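(* Let $d\ge2$, $\mathcal{Y}=\{1,\dots,d\}$, $f:\mathcal{Y}\to(0,\infty)$, $\alpha_1,\dots,\alpha_d>0$ with $\sum_i\alpha_i=1$, $T>0$, and let $\mu$ be a probability measure on $\mathbb{R}$. Put $\lambda_i=f^2(i)$ and assume that $(\lambda_i)_{1\le i\le d}$ satisfies Condition (C). Then the stochastic differential equation $$dX_t=\frac{f(Y)}{\sqrt{\mathbb{E}[f^2(Y)\mid X_t]}}\,dW_t,\qquad X_0\sim\mu,\qquad t\in[0,T],$$ where $Y$ is a (constant in time) random variable with $\mathbb{P}(Y=i)=\alpha_i$ for $i\in\mathcal Y$, $W$ is a Brownian motion, and $X_0$, $Y$, $(W_t)$ are independent, has a weak solution, and this solution has the same one-dimensional time marginals as $(Z+W_t)_{t\in[0,T]}$, where $Z\sim\mu$ is independent of $(W_t)$.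
   Context: Condition (C): there exists a symmetric positive definite real $d\times d$ matrix $\Gamma$ such that for every $1\le k\le d$ the $d\times d$ matrix $\Gamma^{(k)}$ with coefficients $\Gamma^{(k)}_{ij}=\frac{\lambda_i+\lambda_j}{2}\left(\Gamma_{ij}+\Gamma_{kk}-\Gamma_{ik}-\Gamma_{jk}\right)$ is positive definite on $e_k^\perp=\{y\in\mathbb{R}^d: y_k=0\}$. A weak solution is a filtered probability space carrying a Brownian motion $W$, a random variable $Y$ and a continuous adapted process $X$ (with $X_0,Y$ measurable at time $0$) having the prescribed laws and independence and satisfying the equation; the equation is nonlinear in the sense of McKean since the conditional expectation is computed under the law of $(X_t,Y)$. *)

theory Defs
  imports "HOL-Probability.Probability"
begin

section \<open>Condition (C)\<close>

definition positive_definite_on :: "(real ^ 'd) set \<Rightarrow> real ^ 'd ^ 'd \<Rightarrow> bool" where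
  "positive_definite_on S A \<longleftrightarrow> (\<forall>y\<in>S. y \<noteq> 0 \<longrightarrow> 0 < y \<bullet> (A *v y))"

definition Gamma_k :: "('d \<Rightarrow> real) \<Rightarrow> real ^ 'd ^ 'd \<Rightarrow> 'd::finite \<Rightarrow> real ^ 'd ^ 'd" where
  "Gamma_k l G k =
     (\<chi> i j. (l i + l j) / 2 * (G $ i $ j + G $ k $ k - G $ i $ k - G $ j $ k))"

text \<open>The index set \<open>{1, \<dots>, d}\<close> is rendered by a finite type with \<open>d\<close> elements.\<close>

definition condition_C :: "('d::finite \<Rightarrow> real) \<Rightarrow> bool" where
  "condition_C l \<longleftrightarrow>
     (\<exists>G :: real ^ 'd ^ 'd. transpose G = G \<and> positive_definite_on UNIV G \<and>
        (\<forall>k. positive_definite_on {y. y $ k = 0} (Gamma_k l G k)))"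

section \<open>Filtered probability spaces and Brownian motion on \<open>[0, T]\<close>\<close>

text \<open>Filtrations and processes are indexed by all reals, but only times in \<open>[0, T]\<close> matter: a
  filtration on \<open>[0, T]\<close> extends constantly to the left of \<open>0\<close> and to the right of \<open>T\<close>.
  No completeness or right-continuity of the filtration is assumed.\<close>

definition filtered_prob_space :: "'a measure \<Rightarrow> (real \<Rightarrow> 'a measure) \<Rightarrow> bool" where
  "filtered_prob_space M F \<longleftrightarrow>
     prob_space M \<and> filtration (space M) F \<and> (\<forall>t. subalgebra M (F t))"

definition continuous_adapted ::
  "'a measure \<Rightarrow> (real \<Rightarrow> 'a measure) \<Rightarrow> real \<Rightarrow> (real \<Rightarrow> 'a \<Rightarrow> real) \<Rightarrow> bool" where
  "continuous_adapted M F T X \<longleftrightarrow>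
     (\<forall>t\<in>{0..T}. X t \<in> borel_measurable (F t)) \<and>
     (\<forall>\<omega>\<in>space M. continuous_on {0..T} (\<lambda>t. X t \<omega>))"

definition brownian_motion ::
  "'a measure \<Rightarrow> (real \<Rightarrow> 'a measure) \<Rightarrow> real \<Rightarrow> (real \<Rightarrow> 'a \<Rightarrow> real) \<Rightarrow> bool" where
  "brownian_motion M F T W \<longleftrightarrow>
     continuous_adapted M F T W \<and>
     (AE \<omega> in M. W 0 \<omega> = 0) \<and>
     (\<forall>s t. 0 \<le> s \<and> s < t \<and> t \<le> T \<longrightarrow>
        distributed M lborel (\<lambda>\<omega>. W t \<omega> - W s \<omega>) (normal_density 0 (sqrt (t - s))) \<and>
        prob_space.indep_set M (sets (F s))
          (sets (vimage_algebra (space M) (\<lambda>\<omega>. W t \<omega> - W s \<omega>) borel)))"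

definition path_algebra :: "'a measure \<Rightarrow> real \<Rightarrow> (real \<Rightarrow> 'a \<Rightarrow> real) \<Rightarrow> 'a measure" where
  "path_algebra M T W =
     vimage_algebra (space M) (\<lambda>\<omega>. \<lambda>t\<in>{0..T}. W t \<omega>) (PiM {0..T} (\<lambda>_. borel))"

section \<open>The Ito integral\<close>

definition progressively_measurable ::
  "(real \<Rightarrow> 'a measure) \<Rightarrow> real \<Rightarrow> (real \<Rightarrow> 'a \<Rightarrow> real) \<Rightarrow> bool" where
  "progressively_measurable F T H \<longleftrightarrow>
     (\<forall>t\<in>{0..T}. (\<lambda>(s, \<omega>). H s \<omega>)
        \<in> borel_measurable (restrict_space borel {0..t} \<Otimes>\<^sub>M F t))"

text \<open>A list of triples \<open>(a, b, \<xi>)\<close> encodes the elementary process that is the sum of the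
  \<open>\<xi> 1\<^bsub>(a, b]\<^esub>\<close>, with \<open>\<xi>\<close> bounded and \<open>F a\<close>-measurable.\<close>

type_synonym 'a elementary = "(real \<times> real \<times> ('a \<Rightarrow> real)) list"

definition elementary_process ::
  "'a measure \<Rightarrow> (real \<Rightarrow> 'a measure) \<Rightarrow> real \<Rightarrow> 'a elementary \<Rightarrow> bool" where
  "elementary_process M F T S \<longleftrightarrow>
     (\<forall>(a, b, \<xi>)\<in>set S. 0 \<le> a \<and> a \<le> b \<and> b \<le> T \<and>
        \<xi> \<in> borel_measurable (F a) \<and> bounded (\<xi> ` space M))"

definition elementary_value :: "'a elementary \<Rightarrow> real \<Rightarrow> 'a \<Rightarrow> real" where
  "elementary_value S s \<omega> = (\<Sum>(a, b, \<xi>)\<leftarrow>S. \<xi> \<omega> * indicator {a<..b} s)"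

definition elementary_integral ::
  "(real \<Rightarrow> 'a \<Rightarrow> real) \<Rightarrow> 'a elementary \<Rightarrow> real \<Rightarrow> 'a \<Rightarrow> real" where
  "elementary_integral W S t \<omega> =
     (\<Sum>(a, b, \<xi>)\<leftarrow>S. \<xi> \<omega> * (W (min b t) \<omega> - W (min a t) \<omega>))"

text \<open>\<open>I\<close> is the process \<open>(\<integral>\<^sub>0\<^sup>t H dW)\<close>, \<open>t \<in> [0, T]\<close>, for progressively measurable \<open>H\<close> with
  \<open>\<integral>\<^sub>0\<^sup>T H\<^sup>2 ds < \<infinity>\<close> almost surely: the continuous adapted process that is the limit in probability,
  at each time, of the integrals of elementary processes approximating \<open>H\<close> in the sense that
  \<open>\<integral>\<^sub>0\<^sup>T (H\<^sub>n - H)\<^sup>2 ds\<close> tends to \<open>0\<close> in probability. The limit does not depend on the approximating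
  sequence, and continuity determines \<open>I\<close> up to indistinguishability.\<close>

definition has_ito_integral ::
  "'a measure \<Rightarrow> (real \<Rightarrow> 'a measure) \<Rightarrow> real \<Rightarrow> (real \<Rightarrow> 'a \<Rightarrow> real) \<Rightarrow>
   (real \<Rightarrow> 'a \<Rightarrow> real) \<Rightarrow> (real \<Rightarrow> 'a \<Rightarrow> real) \<Rightarrow> bool" where
  "has_ito_integral M F T W H I \<longleftrightarrow>
     progressively_measurable F T H \<and>
     (AE \<omega> in M. (\<integral>\<^sup>+s\<in>{0..T}. ennreal ((H s \<omega>)\<^sup>2) \<partial>lborel) < \<infinity>) \<and>
     continuous_adapted M F T I \<and>
     (\<exists>S :: nat \<Rightarrow> 'a elementary.
        (\<forall>n. elementary_process M F T (S n)) \<and>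
        (\<forall>\<epsilon>>0. (\<lambda>n. measure M {\<omega> \<in> space M. ennreal \<epsilon> <
             (\<integral>\<^sup>+s\<in>{0..T}. ennreal ((elementary_value (S n) s \<omega> - H s \<omega>)\<^sup>2) \<partial>lborel)})
           \<longlonglongrightarrow> 0) \<and>
        (\<forall>t\<in>{0..T}. \<forall>\<epsilon>>0. (\<lambda>n. measure M {\<omega> \<in> space M.
             \<epsilon> < \<bar>elementary_integral W (S n) t \<omega> - I t \<omega>\<bar>}) \<longlonglongrightarrow> 0))"

section \<open>Weak solutions of the calibrated stochastic differential equation\<close>

text \<open>\<open>v\<close> is a jointly measurable choice of the regression functions
  \<open>v t x = E[f\<^sup>2(Y) | X\<^sub>t = x]\<close>: for each \<open>t\<close>, \<open>v t (X\<^sub>t)\<close> is a version of \<open>E[f\<^sup>2(Y) | X\<^sub>t]\<close> under the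
  law of the solution itself. A choice for each \<open>t\<close> separately would leave the integrand
  undetermined as a process. The Ito integral does not depend on the choice of \<open>v\<close>.\<close>

definition regression_function ::
  "('d \<Rightarrow> real) \<Rightarrow> real \<Rightarrow> 'a measure \<Rightarrow> ('a \<Rightarrow> 'd) \<Rightarrow> (real \<Rightarrow> 'a \<Rightarrow> real) \<Rightarrow>
   (real \<Rightarrow> real \<Rightarrow> real) \<Rightarrow> bool" where
  "regression_function f T M Y X v \<longleftrightarrow>
     (\<lambda>(t, x). v t x) \<in> borel_measurable (borel \<Otimes>\<^sub>M borel) \<and>
     (\<forall>t\<in>{0..T}. AE \<omega> in M. v t (X t \<omega>) =
        real_cond_exp M (vimage_algebra (space M) (X t) borel) (\<lambda>\<omega>. (f (Y \<omega>))\<^sup>2) \<omega>)"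

definition weak_solution ::
  "('d::finite \<Rightarrow> real) \<Rightarrow> ('d \<Rightarrow> real) \<Rightarrow> real measure \<Rightarrow> real \<Rightarrow>
   'a measure \<Rightarrow> (real \<Rightarrow> 'a measure) \<Rightarrow> (real \<Rightarrow> 'a \<Rightarrow> real) \<Rightarrow> ('a \<Rightarrow> 'd) \<Rightarrow>
   (real \<Rightarrow> 'a \<Rightarrow> real) \<Rightarrow> bool" where
  "weak_solution f \<alpha> \<mu> T M F W Y X \<longleftrightarrow>
     filtered_prob_space M F \<and>
     brownian_motion M F T W \<and>
     Y \<in> F 0 \<rightarrow>\<^sub>M count_space UNIV \<and>
     continuous_adapted M F T X \<and>
     distr M borel (X 0) = \<mu> \<and>
     (\<forall>i. measure M {\<omega> \<in> space M. Y \<omega> = i} = \<alpha> i) \<and>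
     prob_space.indep_sets M
       (\<lambda>i. sets ([vimage_algebra (space M) (X 0) borel,
                   vimage_algebra (space M) Y (count_space UNIV),
                   path_algebra M T W] ! i)) {..<3} \<and>
     (\<exists>v. regression_function f T M Y X v \<and>
        has_ito_integral M F T W (\<lambda>t \<omega>. f (Y \<omega>) / sqrt (v t (X t \<omega>)))
          (\<lambda>t \<omega>. X t \<omega> - X 0 \<omega>))"

text \<open>\<open>Z + B\<close> with \<open>Z\<close> of law \<open>\<mu>\<close> independent of the Brownian motion \<open>B\<close>; the filtration \<open>G\<close>
  plays no role beyond witnessing that \<open>B\<close> is a Brownian motion.\<close>

definition independent_start_and_bm ::
  "real measure \<Rightarrow> real \<Rightarrow> 'a measure \<Rightarrow> ('a \<Rightarrow> real) \<Rightarrow> (real \<Rightarrow> 'a \<Rightarrow> real) \<Rightarrow> bool" where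
  "independent_start_and_bm \<mu> T M Z B \<longleftrightarrow>
     (\<exists>G. filtered_prob_space M G \<and> brownian_motion M G T B) \<and>
     Z \<in> borel_measurable M \<and>
     distr M borel Z = \<mu> \<and>
     prob_space.indep_set M (sets (vimage_algebra (space M) Z borel)) (sets (path_algebra M T B))"

end

theory Submission
  imports Defs
begin

text \<open>The law of \<open>(X\<^sub>t, Y)\<close> has densities \<open>p\<^sub>i\<close> with \<open>\<partial>\<^sub>t p\<^sub>i = \<partial>\<^sub>x\<^sub>x (\<lambda>\<^sub>i p\<^sub>i S / L) / 2\<close>, where \<open>S = \<Sum> p\<^sub>i\<close>
and \<open>L = \<Sum> \<lambda>\<^sub>i p\<^sub>i\<close>; summing over \<open>i\<close> gives the heat equation for \<open>S\<close>. Condition (C) makes the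
flux strongly monotone for a suitable inner product, so an explicit lattice scheme dissipates an energy
and, by Nash's inequality, its gradients are square summable away from time \<open>0\<close>. The scheme is the law
of a Markov chain whose increments of \<open>X\<close> and \<open>W\<close> are martingale differences; characteristic functions
identify the limits in law, and coding countably many coordinates in one real number yields almost sure
convergence. The gradient bound prevents \<open>E[v\<^sub>n(X)\<^sup>2]\<close>, \<open>v\<^sub>n = L / S\<close>, from exceeding its value for the limit
regression function \<open>v\<close>; hence \<open>v\<^sub>n\<close> is close to every Lipschitz approximation of \<open>v\<close> in \<open>L\<^sup>2\<close>, and
the discrete stochastic integrals converge.\<close>

text \<open>The coefficient depends on the law of the solution, yet no fixed point is sought: the
  scheme computes all laws first, deterministically, and the chain driven by the rates read off from
  them has exactly these laws as marginals. The obstacle is the passage to the limit in the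
  nonlinear term. Convergence in law of \<open>(X_t, Y)\<close> says nothing about convergence of
  \<open>L / S\<close>: convexity of \<open>L^2 / S\<close> gives only a lower bound on the limit of
  the energies, and oscillating densities could keep them strictly above the limit value. The
  gradient estimate excludes such oscillations, and no other quantity needs it: expanding
  \<open>E[(v_n(X) - w(X))^2]\<close> for Lipschitz \<open>w\<close> leaves only expectations of
  Lipschitz functions of \<open>(X, Y)\<close> besides the energy. As \<open>\<mu>\<close> is
  arbitrary, the initial energy has no useful bound; after \<open>K\<close> steps the estimate
  depends on the mass alone, and early times are discarded because their total contribution is
  small. Time step \<open>T / 4^n\<close> and space step proportional to \<open>1 / 2^n\<close> keep
  the parabolic ratio \<open>r\<close> fixed, so one constant serves all lattices and all grids are
  nested.\<close>

abbreviation tends_to (infix "--->" 60) where "X ---> L \<equiv> X \<longlonglongrightarrow> L"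
abbreviation "UC \<equiv> count_space UNIV"
abbreviation "bmeas \<equiv> borel_measurable"
abbreviation (in prob_space) "EE \<equiv> expectation"

section \<open>The flux and Condition (C)\<close>

definition tot :: "real ^ 'd::finite => real" where
 "tot p = (SUM i:UNIV. p $ i)"

definition wtot :: "('d::finite => real) => real ^ 'd => real" where
 "wtot l p = (SUM i:UNIV. l i * p $ i)"

text \<open>The nonlinearity under the second space derivative. Division by zero makes it vanish at
  \<open>p = 0\<close>, which is its continuous extension on the cone of nonnegative
  vectors.\<close>

definition flux :: "('d::finite => real) => real ^ 'd => real ^ 'd" where
 "flux l p = (\<chi> i. l i * p $ i * tot p / wtot l p)"

lemma tot_add: "tot (p + q) = tot p + tot q"
 and tot_diff: "tot (p - q) = tot p - tot q"
 and tot_scaleR: "tot (c *\<^sub>R p) = c * tot p"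
 and tot_uminus: "tot (- p) = - tot p"
 and tot_0 [simp]: "tot 0 = 0"
 by (simp_all add: tot_def sum.distrib sum_subtractf sum_distrib_left sum_negf)

lemma wtot_add: "wtot l (p + q) = wtot l p + wtot l q"
 and wtot_diff: "wtot l (p - q) = wtot l p - wtot l q"
 and wtot_scaleR: "wtot l (c *\<^sub>R p) = c * wtot l p"
 and wtot_uminus: "wtot l (- p) = - wtot l p"
 and wtot_0 [simp]: "wtot l 0 = 0"
 by (simp_all add: wtot_def sum.distrib sum_subtractf sum_distrib_left sum_negf algebra_simps)

lemma flux_0 [simp]: "flux l 0 = 0"
 by (simp add: flux_def vec_eq_iff)

definition nonneg_vec :: "real ^ 'd => bool" where
 "nonneg_vec p \<longleftrightarrow> (ALL i. 0 <= p $ i)"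

text \<open>The quadratic form attains its minimum on the compact set of unit vectors in
  \<open>V\<close>, and homogeneity carries the bound to all of \<open>V\<close>. Sets closed under
  scaling cover both the whole space and the hyperplanes of Condition (C).\<close>

lemma coercive_on_cone:
 fixes A :: "real ^ 'd::finite ^ 'd" and V :: "(real ^ 'd) set"
 assumes "positive_definite_on V A" and "closed V" and cone: "!!c y. y : V ==> c *\<^sub>R y : V"
 shows "EX c>0. ALL y:V. c * (norm y)^2 <= y \<bullet> (A *v y)"
proof (cases "V Int sphere 0 1 = {}")
 case True
 have "y = 0" if "y : V" for y
 proof (rule ccontr)
  assume "y ~= 0"
  then have "(1 / norm y) *\<^sub>R y : V Int sphere 0 1"
  using cone[OF that] by auto
  with True show False by blast
 qed
 then have "ALL y:V. 1 * (norm y)^2 <= y \<bullet> (A *v y)" by force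
 then show ?thesis by (intro exI[of _ 1]) auto
next
 case False
 have "continuous_on (V Int sphere 0 1) (%y. y \<bullet> (A *v y))"
  by (intro continuous_intros)
 moreover have "compact (V Int sphere 0 1)"
  using \<open>closed V\<close> by (simp add: closed_Int_compact)
 ultimately obtain z where z: "z : V Int sphere 0 1"
  and zmin: "!!y. y : V Int sphere 0 1 ==> z \<bullet> (A *v z) <= y \<bullet> (A *v y)"
  using False continuous_attains_inf[of "V Int sphere 0 1" "%y. y \<bullet> (A *v y)"] by metis
 have "0 < z \<bullet> (A *v z)"
  using assms(1) z unfolding positive_definite_on_def by force
 moreover have "z \<bullet> (A *v z) * (norm y)^2 <= y \<bullet> (A *v y)" if "y : V" for y
 proof (cases "y = 0")
  case False
  have "z \<bullet> (A *v z) <= ((1 / norm y) *\<^sub>R y) \<bullet> (A *v ((1 / norm y) *\<^sub>R y))"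
  using False cone[OF that] by (intro zmin) auto
  also have "... = (y \<bullet> (A *v y)) / (norm y)^2"
  by (simp add: matrix_vector_mult_scaleR power2_eq_square)
  finally show ?thesis using False by (simp add: field_simps)
 qed simp
 ultimately show ?thesis by blast
qed

lemma abs_bilinear_le:
 fixes A :: "real ^ 'd::finite ^ 'd"
 shows "EX B>=0. ALL y z. abs (y \<bullet> (A *v z)) <= B * norm y * norm z"
proof -
 obtain B where "B > 0" "!!z. norm (A *v z) <= B * norm z"
  using linear_bounded_pos[OF matrix_vector_mul_linear[of A]] by blast
 then have "abs (y \<bullet> (A *v z)) <= B * norm y * norm z" for y z
  using Cauchy_Schwarz_ineq2[of y "A *v z"]
  mult_left_mono[OF \<open>norm (A *v z) <= B * norm z\<close>, of "norm y"] by (simp add: algebra_simps)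
 with \<open>B > 0\<close> show ?thesis by (intro exI[of _ B]) auto
qed

lemma sum_abs_le_norm:
 fixes y :: "real ^ 'd::finite"
 shows "(SUM i:UNIV. abs (y $ i)) <= CARD('d) * norm y"
 using sum_bounded_above[of UNIV "%i. abs (y $ i)" "norm y"] component_le_norm_cart[of y] by simp

lemma abs_tot_le: "abs (tot y) <= CARD('d) * norm y" for y :: "real ^ 'd::finite"
 unfolding tot_def using sum_abs[of "%i. y $ i" UNIV] sum_abs_le_norm[of y] by linarith

lemma sum_sum_matrix:
 fixes A :: "real ^ 'd::finite ^ 'd"
 shows "y \<bullet> (A *v z) = (SUM i:UNIV. SUM j:UNIV. A $ i $ j * y $ i * z $ j)"
 by (simp add: inner_vec_def matrix_vector_mult_def sum_distrib_left mult_ac)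

section \<open>Secant formula and strong monotonicity of the flux\<close>

locale volatilities =
 fixes l :: "'d::finite => real" and lo hi :: real
 assumes lo_pos: "0 < lo" and lo_le: "lo <= l i" and le_hi: "l i <= hi"
begin

lemma l_pos: "0 < l i"
 using lo_pos lo_le[of i] by linarith

lemma hi_pos: "0 < hi"
 using l_pos le_hi by (meson less_le_trans)

lemma tot_nonneg: "nonneg_vec p ==> 0 <= tot p"
 unfolding tot_def nonneg_vec_def by (simp add: sum_nonneg)

lemma tot_pos: "nonneg_vec p ==> p ~= 0 ==> 0 < tot p"
 unfolding tot_def nonneg_vec_def
 by (smt (verit) UNIV_I finite_code sum_nonneg sum_nonneg_eq_0_iff vec_eq_iff zero_index)

lemma wtot_bounds:
 assumes "nonneg_vec p"
 shows "lo * tot p <= wtot l p" "wtot l p <= hi * tot p"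
 using assms lo_le le_hi unfolding tot_def wtot_def nonneg_vec_def
 by (auto simp: sum_distrib_left intro!: sum_mono mult_right_mono)

lemma wtot_pos: "nonneg_vec p ==> p ~= 0 ==> 0 < wtot l p"
 using wtot_bounds(1)[of p] tot_pos[of p] lo_pos by (smt (verit) mult_pos_pos)

lemma ratio_bounds:
 assumes "nonneg_vec p" "p ~= 0"
 shows "1 / hi <= tot p / wtot l p" "tot p / wtot l p <= 1 / lo"
 using wtot_bounds[OF assms(1)] tot_pos[OF assms] wtot_pos[OF assms] lo_pos hi_pos
 by (auto simp: field_simps)

text \<open>An exact secant formula: the difference of two fluxes is a linear map applied to
  \<open>p - q\<close>, from a family whose parameters \<open>a\<close> and \<open>\<pi>\<close>
  range over a compact set. For nonzero arguments \<open>a = tot p / wtot l p\<close> and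
  \<open>\<pi> i = l i * q $ i / wtot l q\<close>; taking one from \<open>p\<close> and the other
  from \<open>q\<close> makes the formula exact. The dependence on \<open>\<pi>\<close> is affine,
  which later reduces monotonicity to the vertices of the simplex, that is, to Condition
  (C).\<close>

lemma flux_diff:
 assumes p: "nonneg_vec p" and q: "nonneg_vec q"
 shows "EX a \<pi>. 1 / hi <= a & a <= 1 / lo & (ALL i. 0 <= \<pi> i) & sum \<pi> UNIV = 1 &
  (ALL i. (flux l p - flux l q) $ i =
  a * (l i * (p - q) $ i - \<pi> i * wtot l (p - q)) + \<pi> i * tot (p - q))"
proof (cases "q = 0")
 case q0: True
 \<comment> \<open>For \<open>q = 0\<close> the terms in \<open>\<pi>\<close> cancel because
   \<open>a * wtot l p = tot p\<close>, so any probability vector would do.\<close>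
 let ?\<pi> = "%i::'d. 1 / real CARD('d)"
 show ?thesis
 proof (cases "p = 0")
  case True
  then show ?thesis using q0 lo_pos hi_pos lo_le[of undefined] le_hi[of undefined]
  by (intro exI[of _ "1/lo"] exI[of _ ?\<pi>]) (auto intro!: divide_left_mono)
 next
  case False
  have "wtot l p ~= 0"
  using wtot_pos[OF p False] by simp
  then show ?thesis using q0 ratio_bounds[OF p False]
  by (intro exI[of _ "tot p / wtot l p"] exI[of _ ?\<pi>])
  (auto simp: flux_def right_diff_distrib)
 qed
next
 case False
 define \<pi> where "\<pi> i = l i * q $ i / wtot l q" for i
 have Lq: "0 < wtot l q" by (rule wtot_pos[OF q False])
 have \<pi>: "ALL i. 0 <= \<pi> i" "sum \<pi> UNIV = 1"
  using Lq q l_pos by (auto simp: \<pi>_def nonneg_vec_def less_imp_le wtot_def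
  simp flip: sum_divide_distrib)
 show ?thesis
 proof (cases "p = 0")
  case True
  \<comment> \<open>For \<open>p = 0\<close> the bracket vanishes, so \<open>a\<close> may be any
    number in its range.\<close>
  have "(flux l p - flux l q) $ i =
  1/lo * (l i * (p - q) $ i - \<pi> i * wtot l (p - q)) + \<pi> i * tot (p - q)" for i
  using True Lq by (simp add: flux_def \<pi>_def wtot_uminus tot_uminus)
  then show ?thesis using \<pi> lo_pos hi_pos lo_le[of undefined] le_hi[of undefined]
  by (intro exI[of _ "1/lo"] exI[of _ \<pi>]) (auto intro!: divide_left_mono)
 next
  case pn: False
  have Lp: "0 < wtot l p" by (rule wtot_pos[OF p pn])
  have "(flux l p - flux l q) $ i =
  tot p / wtot l p * (l i * (p - q) $ i - \<pi> i * wtot l (p - q)) + \<pi> i * tot (p - q)" for i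
  using Lp Lq by (simp add: flux_def \<pi>_def wtot_diff tot_diff field_simps)
  then show ?thesis using \<pi> ratio_bounds[OF p pn]
  by (intro exI[of _ "tot p / wtot l p"] exI[of _ \<pi>]) auto
 qed
qed

lemma abs_wtot_le: "abs (wtot l y) <= hi * (CARD('d) * norm y)"
proof -
 have "abs (wtot l y) <= (SUM i:UNIV. hi * abs (y $ i))"
  unfolding wtot_def using l_pos le_hi
  by (intro order_trans[OF sum_abs] sum_mono) (auto simp: abs_mult less_imp_le intro!: mult_right_mono)
 also have "... <= hi * (CARD('d) * norm y)"
  using sum_abs_le_norm[of y] hi_pos by (simp flip: sum_distrib_left)
 finally show ?thesis .
qed

text \<open>All coefficients of the secant formula are bounded. The constant will control the
  quadratic error of an explicit time step.\<close>

lemma flux_lipschitz: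
 "EX K>0. ALL p q. nonneg_vec p --> nonneg_vec q --> norm (flux l p - flux l q) <= K * norm (p - q)"
proof -
 define d where "d = real CARD('d)"
 have d: "d >= 1" using d_def by (simp add: Suc_leI)
 define K where "K = d * (1 / lo * (hi + hi * d) + d)"
 have "norm (flux l p - flux l q) <= K * norm (p - q)" if pq: "nonneg_vec p" "nonneg_vec q" for p q
 proof -
  define y where "y = p - q"
  obtain a \<pi> where a: "1 / hi <= a" "a <= 1 / lo" and \<pi>: "!!i. 0 <= \<pi> i" "sum \<pi> UNIV = 1"
  and eq: "!!i. (flux l p - flux l q) $ i = a * (l i * y $ i - \<pi> i * wtot l y) + \<pi> i * tot y"
  using flux_diff[OF pq] unfolding y_def by blast
  have \<pi>1: "\<pi> i <= 1" for i
  using \<pi> by (metis UNIV_I finite_code member_le_sum)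
  have a0: "0 <= a" using a(1) hi_pos by (smt (verit) divide_pos_pos)
  have "abs ((flux l p - flux l q) $ i) <= (1 / lo * (hi + hi * d) + d) * norm y" for i
  proof -
  have "abs (l i * y $ i) <= hi * norm y"
  using component_le_norm_cart[of y i] l_pos[of i] le_hi[of i] by (simp add: abs_mult mult_mono)
  moreover have "abs (\<pi> i * wtot l y) <= 1 * (hi * (d * norm y))"
  unfolding abs_mult using \<pi>1[of i] \<pi>(1)[of i] abs_wtot_le[of y] d_def
  by (intro mult_mono) auto
  ultimately have "abs (l i * y $ i - \<pi> i * wtot l y) <= (hi + hi * d) * norm y"
  by (simp add: algebra_simps)
  then have 1: "abs (a * (l i * y $ i - \<pi> i * wtot l y)) <= 1 / lo * ((hi + hi * d) * norm y)"
  unfolding abs_mult using a a0 lo_pos by (intro mult_mono) auto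
  have 2: "abs (\<pi> i * tot y) <= 1 * (d * norm y)"
  unfolding abs_mult using \<pi>1[of i] \<pi>(1)[of i] abs_tot_le[of y] d_def
  by (intro mult_mono) auto
  show ?thesis unfolding eq using 1 2 by (simp add: algebra_simps)
  qed
  then have "norm (flux l p - flux l q) <= d * ((1 / lo * (hi + hi * d) + d) * norm y)"
  using norm_le_l1_cart[of "flux l p - flux l q"]
  sum_bounded_above[of UNIV "%i. abs ((flux l p - flux l q) $ i)"] d_def
  by (smt (verit, best) of_nat_1 UNIV_I)
  then show ?thesis by (simp add: K_def y_def mult_ac)
 qed
 moreover have "K > 0" using d lo_pos hi_pos by (simp add: K_def add_pos_pos)
 ultimately show ?thesis by blast
qed

text \<open>The origin of the matrices in Condition (C): pairing \<open>y\<close> through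
  \<open>G\<close> with the linearised flux at the vertex \<open>j\<close> of the simplex is the
  quadratic form of \<open>Gamma_k l G j\<close>, up to a term with the factor \<open>tot y\<close>.
  The weight \<open>(l i + l j) / 2\<close> comes from symmetrising the weight
  \<open>l j\<close>.\<close>

lemma Gamma_k_form:
 fixes G :: "real ^ 'd ^ 'd"
 assumes sym: "transpose G = G"
 shows "y \<bullet> (G *v (\<chi> i. l i * y $ i)) - wtot l y * (SUM i:UNIV. G $ i $ j * y $ i)
  = y \<bullet> (Gamma_k l G j *v y) + tot y * (SUM i:UNIV. (G $ i $ j - G $ j $ j) * l i * y $ i)"
proof -
 have s: "G $ a $ b = G $ b $ a" for a b
  using sym by (metis transpose_def vec_lambda_beta)
 define H where "H a b = (G $ a $ b + G $ j $ j - G $ a $ j - G $ b $ j) * y $ a * y $ b" for a b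
 have Hs: "H a b = H b a" for a b unfolding H_def using s[of a b] by simp
 have "y \<bullet> (Gamma_k l G j *v y) = (SUM a:UNIV. SUM b:UNIV. (l a + l b) / 2 * H a b)"
  unfolding sum_sum_matrix Gamma_k_def H_def by (simp add: mult_ac)
 also have "... = (SUM a:UNIV. SUM b:UNIV. l a / 2 * H a b) + (SUM a:UNIV. SUM b:UNIV. l b / 2 * H a b)"
  by (simp add: add_divide_distrib distrib_right sum.distrib)
 also have "(SUM a:UNIV. SUM b:UNIV. l a / 2 * H a b) = (SUM a:UNIV. SUM b:UNIV. l b / 2 * H a b)"
  by (subst sum.swap) (simp add: Hs)
 also have "(SUM a:UNIV. SUM b:UNIV. l b / 2 * H a b) + (SUM a:UNIV. SUM b:UNIV. l b / 2 * H a b)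
  = (SUM a:UNIV. SUM b:UNIV. l b * H a b)"
  by (simp flip: sum.distrib)
 also have "... = (SUM a:UNIV. SUM b:UNIV. G $ a $ b * y $ a * (l b * y $ b))
  - (SUM a:UNIV. SUM b:UNIV. (G $ a $ j * y $ a) * (l b * y $ b))
  - (SUM a:UNIV. SUM b:UNIV. y $ a * ((G $ b $ j - G $ j $ j) * l b * y $ b))"
  unfolding sum_subtractf[symmetric] H_def
  by (intro sum.cong refl) (simp add: algebra_simps)
 also have "(SUM a:UNIV. SUM b:UNIV. (G $ a $ j * y $ a) * (l b * y $ b))
  = wtot l y * (SUM i:UNIV. G $ i $ j * y $ i)"
  unfolding wtot_def sum_product[symmetric] by simp
 also have "(SUM a:UNIV. SUM b:UNIV. y $ a * ((G $ b $ j - G $ j $ j) * l b * y $ b))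
  = tot y * (SUM i:UNIV. (G $ i $ j - G $ j $ j) * l i * y $ i)"
  unfolding tot_def sum_product[symmetric] by simp
 finally show ?thesis by (simp add: sum_sum_matrix)
qed

text \<open>Row and column \<open>k\<close> of the matrix vanish, so its form does not see
  \<open>y $ k\<close>. The missing coordinate is recovered from \<open>tot y\<close> and the other
  coordinates, at the price of the negative multiple of \<open>(tot y)^2\<close>.\<close>

lemma Gamma_k_coercive:
 fixes G :: "real ^ 'd ^ 'd"
 assumes "positive_definite_on {y. y $ k = 0} (Gamma_k l G k)" and sym: "transpose G = G"
 shows "EX c>0. ALL y. c * (norm y)^2 - 2 * c * (tot y)^2 <= y \<bullet> (Gamma_k l G k *v y)"
proof -
 define d where "d = real CARD('d)"
 have d0: "0 <= d" by (simp add: d_def)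
 have s: "G $ a $ b = G $ b $ a" for a b
  using sym by (metis transpose_def vec_lambda_beta)
 have cl: "closed {y :: real ^ 'd. y $ k = 0}"
  by (intro closed_Collect_eq continuous_intros)
 obtain c where c: "c > 0" "!!y. y $ k = 0 ==> c * (norm y)^2 <= y \<bullet> (Gamma_k l G k *v y)"
  using coercive_on_cone[OF assms(1) cl] by auto
 have "c / (1 + 2 * d) * (norm y)^2 - 2 * (c / (1 + 2 * d)) * (tot y)^2 <= y \<bullet> (Gamma_k l G k *v y)" for y
 proof -
  define z where "z = y - axis k (y $ k)"
  have zk: "z $ k = 0" and zi: "i ~= k ==> z $ i = y $ i" for i
  by (auto simp: z_def axis_def)
  have form: "y \<bullet> (Gamma_k l G k *v y) = z \<bullet> (Gamma_k l G k *v z)"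
  unfolding sum_sum_matrix
  proof (intro sum.cong refl)
  fix a b
  show "Gamma_k l G k $ a $ b * y $ a * y $ b = Gamma_k l G k $ a $ b * z $ a * z $ b"
  by (cases "a = k"; cases "b = k") (auto simp: zi Gamma_k_def s)
  qed
  have ny: "(norm y)^2 = (norm z)^2 + (y $ k)^2"
  proof -
  have "y = z + axis k (y $ k)" by (simp add: z_def)
  moreover have "z \<bullet> axis k (y $ k) = 0" by (simp add: inner_axis zk)
  ultimately have "(norm y)^2 = (norm z)^2 + (norm (axis k (y $ k)))^2"
  by (metis norm_add_Pythagorean orthogonal_def)
  moreover have "(norm (axis k (y $ k)))^2 = (y $ k)^2"
  unfolding power2_norm_eq_inner inner_axis_axis by (simp add: power2_eq_square)
  ultimately show ?thesis by simp
  qed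
  have "tot y = tot z + y $ k"
  by (simp add: z_def tot_diff) (simp add: tot_def axis_def)
  moreover have "(tot z)^2 <= d * (norm z)^2"
  using sum_squared_le_sum_of_squares[of "%i. z $ i" "UNIV :: 'd set"]
  by (simp add: tot_def d_def norm_vec_def L2_set_def sum_nonneg mult.commute)
  moreover have "(tot y - tot z)^2 <= 2 * (tot y)^2 + 2 * (tot z)^2"
  using sum_squares_bound[of "tot y" "- tot z"] by (simp add: power2_diff)
  ultimately have "(y $ k)^2 <= 2 * (tot y)^2 + 2 * d * (norm z)^2" by simp
  then have "(norm y)^2 - 2 * (tot y)^2 <= (1 + 2 * d) * (norm z)^2"
  using ny by (simp add: algebra_simps)
  then have "c / (1 + 2 * d) * ((norm y)^2 - 2 * (tot y)^2) <= c / (1 + 2 * d) * ((1 + 2 * d) * (norm z)^2)"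
  using c(1) d0 by (intro mult_left_mono) auto
  also have "... = c * (norm z)^2" using d0 by simp
  also have "... <= z \<bullet> (Gamma_k l G k *v z)" by (rule c(2)[OF zk])
  finally show ?thesis unfolding form by (simp add: algebra_simps)
 qed
 then show ?thesis using c(1) d0 by (intro exI[of _ "c / (1 + 2 * d)"]) auto
qed

text \<open>The secant formula averages the forms of Condition (C) with weights
  \<open>\<pi>\<close>, so coercivity survives up to errors containing \<open>tot y\<close>. Since
  the flux preserves \<open>tot\<close>, adding a large constant matrix to \<open>G\<close>
  contributes \<open>M * (tot y)^2\<close> and absorbs them all.\<close>

lemma flux_monotone:
 assumes "condition_C l"
 shows "EX (G :: real ^ 'd ^ 'd) c. c > 0 & transpose G = G &
  (ALL y. c * (norm y)^2 <= y \<bullet> (G *v y)) &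
  (ALL p q. nonneg_vec p --> nonneg_vec q -->
  c * (norm (p - q))^2 <= (p - q) \<bullet> (G *v (flux l p - flux l q)))"
proof -
 obtain G :: "real ^ 'd ^ 'd" where sym: "transpose G = G" and pd: "positive_definite_on UNIV G"
  and Gk: "!!k. positive_definite_on {y. y $ k = 0} (Gamma_k l G k)"
  using assms unfolding condition_C_def by blast
 obtain c0 where c0: "c0 > 0" "!!y. c0 * (norm y)^2 <= y \<bullet> (G *v y)"
  using coercive_on_cone[OF pd] by auto
 have "EX ck. ALL k. ck k > 0 & (ALL y. ck k * (norm y)^2 - 2 * ck k * (tot y)^2 <= y \<bullet> (Gamma_k l G k *v y))"
  using Gamma_k_coercive[OF Gk sym] by (intro choice) blast
 then obtain ck where ck: "!!k. ck k > 0"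
  "!!k y. ck k * (norm y)^2 - 2 * ck k * (tot y)^2 <= y \<bullet> (Gamma_k l G k *v y)" by blast
 define c1 where "c1 = Min (range ck)"
 define c2 where "c2 = 2 * Max (range ck)"
 have c1: "c1 > 0" "!!k. c1 <= ck k" and c2: "!!k. 2 * ck k <= c2"
  using ck(1) by (auto simp: c1_def c2_def)
 have c2p: "c2 > 0" using c2 ck(1) by (meson less_le_trans mult_pos_pos zero_less_numeral)
 have coer: "c1 * (norm y)^2 - c2 * (tot y)^2 <= y \<bullet> (Gamma_k l G k *v y)" for k y
  using ck(2)[of k y] mult_right_mono[OF c1(2)[of k], of "(norm y)^2"]
  mult_right_mono[OF c2[of k], of "(tot y)^2"] by simp
 obtain b where b: "b >= 0" "!!i j. abs (G $ i $ j) <= b"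
 proof (rule that)
  show "0 <= (SUM i:UNIV. SUM j:UNIV. abs (G $ i $ j))" by (intro sum_nonneg) auto
  show "abs (G $ i $ j) <= (SUM i:UNIV. SUM j:UNIV. abs (G $ i $ j))" for i j
  by (rule order_trans[OF member_le_sum[of j UNIV "%j. abs (G $ i $ j)"]
  member_le_sum[of i UNIV "%i. SUM j:UNIV. abs (G $ i $ j)"]]) (auto intro: sum_nonneg)
 qed
 define d where "d = real CARD('d)"
 define B where "B = 2 * b * (1 + hi) * d"
 have B0: "B >= 0" using b hi_pos by (simp add: B_def d_def)
 have B1: "abs (SUM i:UNIV. g i * y $ i) <= B * norm y" if "!!i. abs (g i) <= 2 * b * (1 + hi)" for g and y :: "real^'d"
 proof -
  have "abs (SUM i:UNIV. g i * y $ i) <= (SUM i:UNIV. 2 * b * (1 + hi) * abs (y $ i))"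
  using that by (intro order_trans[OF sum_abs] sum_mono) (auto simp: abs_mult intro!: mult_right_mono)
  also have "... <= 2 * b * (1 + hi) * (d * norm y)"
  using sum_abs_le_norm[of y] b hi_pos by (auto simp: d_def intro!: mult_left_mono simp flip: sum_distrib_left)
  finally show ?thesis by (simp add: B_def mult_ac)
 qed
 \<comment> \<open>\<open>B'\<close> bounds the mixed terms \<open>abs (tot y) * norm y\<close>. In
   \<open>M\<close>, the first summand pays for the negative squares, the second for what Young's
   inequality leaves after half of \<open>c1 / hi\<close> has been spent.\<close>
 define B' where "B' = B * (1 / lo + 1)"
 define M where "M = c2 / lo + B'^2 * hi / (2 * c1)"
 have M0: "M >= 0" using c1 c2p lo_pos hi_pos by (simp add: M_def)
 define J :: "real ^ 'd ^ 'd" where "J = (\<chi> i j. M)"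
 have J: "y \<bullet> (J *v z) = M * (tot y * tot z)" for y z
  unfolding sum_sum_matrix J_def tot_def sum_product by (simp add: sum_distrib_left mult_ac)
 define c where "c = min c0 (c1 / (2 * hi))"
 have c: "c > 0" "c <= c0" "c <= c1 / (2 * hi)" using c0 c1 hi_pos by (auto simp: c_def)
 have G': "y \<bullet> ((G + J) *v z) = y \<bullet> (G *v z) + M * (tot y * tot z)" for y z
  by (simp add: matrix_vector_mult_add_rdistrib inner_add_right J)
 have "c * (norm y)^2 <= y \<bullet> ((G + J) *v y)" for y
  unfolding G' using c0(2)[of y] mult_right_mono[OF c(2), of "(norm y)^2"] M0
  by (smt (verit) mult_nonneg_nonneg power2_eq_square zero_le_power2)
 moreover have "transpose (G + J) = G + J"
  using sym by (simp add: transpose_def vec_eq_iff J_def)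
 moreover have "c * (norm (p - q))^2 <= (p - q) \<bullet> ((G + J) *v (flux l p - flux l q))"
  if pq: "nonneg_vec p" "nonneg_vec q" for p q
 proof -
  define y where "y = p - q"
  define z where "z = flux l p - flux l q"
  define S where "S = tot y"
  obtain a \<pi> where a: "1 / hi <= a" "a <= 1 / lo" and \<pi>: "!!i. 0 <= \<pi> i" "sum \<pi> UNIV = 1"
  and eq: "!!i. z $ i = a * (l i * y $ i - \<pi> i * wtot l y) + \<pi> i * S"
  using flux_diff[OF pq] unfolding y_def z_def S_def by blast
  have a0: "0 < a" using a(1) hi_pos by (smt (verit) divide_pos_pos)
  have tz: "tot z = S"
  by (simp add: tot_def eq sum.distrib sum_subtractf \<pi> flip: sum_distrib_left sum_distrib_right wtot_def)
  define P where "P = (SUM j:UNIV. \<pi> j * (SUM i:UNIV. G $ i $ j * y $ i))"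
  define Q where "Q = (SUM j:UNIV. \<pi> j * (SUM i:UNIV. (G $ i $ j - G $ j $ j) * l i * y $ i))"
  define R where "R = (SUM j:UNIV. \<pi> j * (y \<bullet> (Gamma_k l G j *v y)))"
  have yp: "y \<bullet> (G *v (\<chi> i. \<pi> i)) = P"
  unfolding P_def sum_sum_matrix by (subst sum.swap) (simp add: sum_distrib_left mult_ac)
  have zv: "z = a *\<^sub>R ((\<chi> i. l i * y $ i) - wtot l y *\<^sub>R (\<chi> i. \<pi> i)) + S *\<^sub>R (\<chi> i. \<pi> i)"
  by (simp add: vec_eq_iff eq mult_ac)
  have "y \<bullet> (G *v z) = a * (y \<bullet> (G *v (\<chi> i. l i * y $ i)) - wtot l y * P) + S * P"
  unfolding zv by (simp add: matrix_vector_right_distrib matrix_vector_mult_diff_distrib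
  matrix_vector_mult_scaleR inner_add_right inner_diff_right yp)
  \<comment> \<open>Writing \<open>1\<close> as the sum of \<open>\<pi>\<close> turns the expression
    into an average over the vertices, where the identity for \<open>Gamma_k\<close>
    applies.\<close>
  also have "y \<bullet> (G *v (\<chi> i. l i * y $ i)) - wtot l y * P =
  (SUM j:UNIV. \<pi> j * (y \<bullet> (G *v (\<chi> i. l i * y $ i)) - wtot l y * (SUM i:UNIV. G $ i $ j * y $ i)))"
  unfolding P_def right_diff_distrib sum_subtractf sum_distrib_right[symmetric]
  by (simp add: \<pi> sum_distrib_left mult_ac)
  also have "... = R + S * Q"
  unfolding Gamma_k_form[OF sym] R_def Q_def S_def
  by (simp add: distrib_left sum.distrib sum_distrib_left mult_ac)
  finally have yGz: "y \<bullet> (G *v z) = a * (R + S * Q) + S * P" .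
  have avg: "abs (SUM j:UNIV. \<pi> j * g j) <= C" if "!!j. abs (g j) <= C" for g C
  proof -
  have "abs (SUM j:UNIV. \<pi> j * g j) <= (SUM j:UNIV. \<pi> j * C)"
  using that \<pi> by (intro order_trans[OF sum_abs] sum_mono) (auto simp: abs_mult intro!: mult_left_mono)
  then show ?thesis using \<pi> by (simp flip: sum_distrib_right)
  qed
  have Pb: "abs P <= B * norm y"
  unfolding P_def
  proof (rule avg, rule B1)
  show "abs (G $ i $ j) <= 2 * b * (1 + hi)" for i j
  using b(2)[of i j] mult_nonneg_nonneg[OF b(1) less_imp_le[OF hi_pos]] b(1)
  unfolding distrib_left by linarith
  qed
  have Qb: "abs Q <= B * norm y"
  unfolding Q_def
  proof (rule avg, rule B1)
  show "abs ((G $ i $ j - G $ j $ j) * l i) <= 2 * b * (1 + hi)" for i j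
  proof -
  have "abs (G $ i $ j - G $ j $ j) <= 2 * b" using b(2)[of i j] b(2)[of j j] by linarith
  then show ?thesis unfolding abs_mult
  using l_pos[of i] le_hi[of i] b(1) by (intro mult_mono) auto
  qed
  qed
  have Rb: "c1 * (norm y)^2 - c2 * S^2 <= R"
  proof -
  have "c1 * (norm y)^2 - c2 * S^2 = (SUM j:UNIV. \<pi> j * (c1 * (norm y)^2 - c2 * S^2))"
  using \<pi> by (simp flip: sum_distrib_right)
  also have "... <= R" unfolding R_def S_def using \<pi> coer by (intro sum_mono mult_left_mono) auto
  finally show ?thesis .
  qed
  have SPb: "abs (S * P) <= abs S * (B * norm y)" "abs (S * Q) <= abs S * (B * norm y)"
  unfolding abs_mult using Pb Qb by (auto intro: mult_left_mono)
  have aSQ: "- (1/lo * (abs S * (B * norm y))) <= a * (S * Q)"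
  proof -
  have "abs (a * (S * Q)) <= 1/lo * (abs S * (B * norm y))"
  unfolding abs_mult[of a] using a a0 SPb(2) lo_pos by (intro mult_mono) auto
  then show ?thesis by linarith
  qed
  have aR: "c1 / hi * (norm y)^2 - c2 / lo * S^2 <= a * R"
  proof -
  have "1/hi * (c1 * (norm y)^2) <= a * (c1 * (norm y)^2)"
  using a c1 by (intro mult_right_mono) auto
  moreover have "a * (c2 * S^2) <= 1/lo * (c2 * S^2)"
  using a c2p by (intro mult_right_mono) auto
  moreover have "a * (c1 * (norm y)^2 - c2 * S^2) <= a * R"
  using a0 Rb by (intro mult_left_mono) auto
  ultimately show ?thesis by (simp add: right_diff_distrib)
  qed
  have young: "B' * abs S * norm y <= c1 / (2 * hi) * (norm y)^2 + B'^2 * hi / (2 * c1) * S^2"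
  proof -
  have "0 <= (c1 * norm y - B' * hi * abs S)^2 / (2 * hi * c1)"
  using c1 hi_pos by simp
  also have "... = c1 / (2 * hi) * (norm y)^2 + B'^2 * hi / (2 * c1) * S^2 - B' * abs S * norm y"
  using c1 hi_pos by (simp add: power2_diff field_simps power2_eq_square)
  finally show ?thesis by simp
  qed
  have "c1 / hi * (norm y)^2 - c2 / lo * S^2 - B' * abs S * norm y <= y \<bullet> (G *v z)"
  unfolding yGz using aR aSQ SPb(1) by (simp add: B'_def algebra_simps abs_le_iff)
  then have "c1 / hi * (norm y)^2 - c1 / (2 * hi) * (norm y)^2 <= y \<bullet> (G *v z) + M * S^2"
  using young by (simp add: M_def algebra_simps)
  moreover have "c1 / hi * (norm y)^2 - c1 / (2 * hi) * (norm y)^2 = c1 / (2 * hi) * (norm y)^2"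
  using hi_pos by (simp add: field_simps)
  ultimately have "c1 / (2 * hi) * (norm y)^2 <= y \<bullet> (G *v z) + M * S^2" by simp
  with mult_right_mono[OF c(3), of "(norm y)^2"]
  have "c * (norm y)^2 <= y \<bullet> ((G + J) *v z)"
  unfolding G' tz S_def[symmetric] by (simp add: power2_eq_square)
  then show ?thesis by (simp add: y_def z_def)
 qed
 ultimately show ?thesis using c(1) by blast
qed

end

section \<open>The lattice scheme and its energy estimate\<close>

definition supp_in :: "int => (int => 'a::zero) => bool" where
 "supp_in M p \<longleftrightarrow> (ALL x. M < abs x --> p x = 0)"

text \<open>Lattice sums run over a finite window. A support strictly inside it gives the
  translation invariance behind summation by parts and conservation of mass.\<close>

lemma window_shift:
 fixes f :: "int => 'a::comm_monoid_add"
 assumes "!!x. L <= abs x ==> f x = 0"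
 shows "(SUM x=-L..L. f (x + 1)) = (SUM x=-L..L. f x)" "(SUM x=-L..L. f (x - 1)) = (SUM x=-L..L. f x)"
proof -
 have "(SUM x=-L..L. f (x + 1)) = sum f {-L+1..L+1}"
  by (rule sum.reindex_bij_witness[of _ "%x. x - 1" "%x. x + 1"]) auto
 also have "... = sum f {-L+1..L-1}"
  using assms by (intro sum.mono_neutral_right) auto
 also have "... = sum f {-L..L}"
  using assms by (intro sum.mono_neutral_left) auto
 finally show "(SUM x=-L..L. f (x + 1)) = (SUM x=-L..L. f x)" .
 have "(SUM x=-L..L. f (x - 1)) = sum f {-L-1..L-1}"
  by (rule sum.reindex_bij_witness[of _ "%x. x + 1" "%x. x - 1"]) auto
 also have "... = sum f {-L+1..L-1}"
  using assms by (intro sum.mono_neutral_right) auto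
 also have "... = sum f {-L..L}"
  using assms by (intro sum.mono_neutral_left) auto
 finally show "(SUM x=-L..L. f (x - 1)) = (SUM x=-L..L. f x)" .
qed

lemma telescope_le:
 fixes g :: "int => real"
 assumes "-L <= x"
 shows "g x - g (-L) <= (SUM y:{-L..<x}. abs (g (y + 1) - g y))"
 using assms
proof (induction x rule: int_ge_induct)
 case (step i)
 have "{-L..<i+1} = insert i {-L..<i}" using step by auto
 then show ?case using step by simp
qed simp



text \<open>Nash's inequality on the line. Telescoping \<open>N^2\<close> and Cauchy-Schwarz bound
  the maximum \<open>m\<close> by \<open>m^4 <= 4 * D * s\<close>, while \<open>s <= m\<close>
  because the mass is at most one.\<close>

lemma nash:
 fixes N :: "int => real"
 assumes nn: "!!x. 0 <= N x" and z: "!!x. L <= abs x ==> N x = 0" and mass: "(SUM x=-L..L. N x) <= 1"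
  and L: "0 < L"
 defines "s \<equiv> SUM x=-L..L. (N x)^2" and "D \<equiv> SUM x=-L..L. (N (x + 1) - N x)^2"
 shows "s ^ 3 <= 4 * D"
proof -
 have s0: "0 <= s" and D0: "0 <= D" unfolding s_def D_def by (auto intro: sum_nonneg)
 have shift: "(SUM x=-L..L. (N (x + 1))^2) = s"
  unfolding s_def using window_shift(1)[of L "%x. (N x)^2"] z by simp
 have Nx: "(N x) ^ 4 <= 4 * D * s" if x: "x : {-L..L}" for x
 proof -
  define A where "A = (SUM y=-L..L. abs (N (y + 1) - N y) * (N (y + 1) + N y))"
  have "(N x)^2 - (N (-L))^2 <= (SUM y:{-L..<x}. abs ((N (y + 1))^2 - (N y)^2))"
  using telescope_le[of L x "%x. (N x)^2"] x by simp
  also have "... <= (SUM y=-L..L. abs ((N (y + 1))^2 - (N y)^2))"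
  using x by (intro sum_mono2) auto
  also have "... = A"
  unfolding A_def
  proof (intro sum.cong refl)
  fix y
  have "(N (y + 1))^2 - (N y)^2 = (N (y + 1) - N y) * (N (y + 1) + N y)"
  by (simp add: power2_eq_square algebra_simps)
  then show "abs ((N (y + 1))^2 - (N y)^2) = abs (N (y + 1) - N y) * (N (y + 1) + N y)"
  using nn[of y] nn[of "y+1"] by (simp add: abs_mult)
  qed
  finally have "(N x)^2 <= A" using z[of "-L"] L by simp
  then have "((N x)^2)^2 <= A^2" by (intro power_mono) auto
  also have "A^2 <= (SUM y=-L..L. abs (N (y + 1) - N y)^2) * (SUM y=-L..L. (N (y + 1) + N y)^2)"
  unfolding A_def by (rule Cauchy_Schwarz_ineq_sum)
  also have "... <= D * (SUM y=-L..L. 2 * (N (y + 1))^2 + 2 * (N y)^2)"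
  proof (intro mult_mono sum_mono)
  fix y show "(N (y + 1) + N y)^2 <= 2 * (N (y + 1))^2 + 2 * (N y)^2"
  using sum_squares_bound[of "N (y+1)" "N y"] by (simp add: power2_sum)
  qed (auto simp: D_def intro!: sum_nonneg)
  also have "(SUM y=-L..L. 2 * (N (y + 1))^2 + 2 * (N y)^2) = 4 * s"
  by (simp add: sum.distrib shift flip: sum_distrib_left) (simp add: s_def)
  finally show ?thesis by (simp add: mult_ac)
 qed
 define m where "m = Max (N ` {-L..L})"
 have ne: "{-L..L} ~= {}" using L by auto
 have "m : N ` {-L..L}" unfolding m_def by (intro Max_in) (use ne in auto)
 then obtain x0 where "x0 : {-L..L}" "m = N x0" by auto
 then have m4: "m ^ 4 <= 4 * D * s" and m0: "0 <= m" using Nx nn by auto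
 have mge: "N x <= m" if "x : {-L..L}" for x using that by (auto simp: m_def)
 have "s <= (SUM x=-L..L. m * N x)"
  unfolding s_def power2_eq_square using mge nn by (intro sum_mono mult_right_mono) auto
 also have "... <= m * 1" unfolding sum_distrib_left[symmetric] using mass m0 by (intro mult_left_mono)
 finally have "s <= m" by simp
 then have "s ^ 4 <= m ^ 4" using s0 by (intro power_mono)
 then have "s * s ^ 3 <= s * (4 * D)" using m4 by (simp add: eval_nat_numeral mult_ac)
 then show ?thesis using s0 D0 by (cases "s = 0") (auto simp: mult_le_cancel_left)
qed

text \<open>Discrete form of \<open>e' = - \<beta> * e^3\<close>, whose solutions stay below
  \<open>1 / sqrt (\<beta> * t)\<close> whatever their initial value. This loss of memory is what
  permits an arbitrary initial law.\<close>

lemma cubic_decay: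
 fixes e :: "nat => real"
 assumes "!!k. k < N ==> e (Suc k) <= e k - \<beta> * e k ^ 3" and e0: "!!k. 0 <= e k" and \<beta>: "0 < \<beta>"
 shows "k <= N ==> k * \<beta> * (e k)^2 <= 1"
proof (induction k)
 case (Suc k)
 define u where "u = \<beta> * (e k)^2"
 have u0: "0 <= u" using \<beta> by (simp add: u_def)
 have IH: "real k * u <= 1" using Suc by (simp add: u_def mult_ac)
 have le: "e (Suc k) <= e k * (1 - u)"
  using assms(1)[of k] Suc.prems by (simp add: u_def algebra_simps power3_eq_cube power2_eq_square)
 show ?case
 proof (cases "e k = 0")
  case True
  then show ?thesis using le e0[of "Suc k"] by simp
 next
  case False
  then have "0 < e k" using e0[of k] by simp
  \<comment> \<open>A larger \<open>u\<close> would make the next energy negative.\<close>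
  then have u1: "u <= 1" using le e0[of "Suc k"] by (smt (verit) mult_pos_neg)
  have "real (Suc k) * \<beta> * (e (Suc k))^2 <= real (Suc k) * \<beta> * (e k * (1 - u))^2"
  using le e0[of "Suc k"] \<beta> by (intro mult_left_mono power_mono) auto
  also have "... = (real k * u + u) * (1 - u)^2"
  unfolding u_def[symmetric] power_mult_distrib by (simp add: u_def distrib_left distrib_right)
  also have "... <= (1 + u) * (1 - u)^2" using IH by (intro mult_right_mono) auto
  also have "... = (1 - u * u) * (1 - u)" by (simp add: power2_eq_square algebra_simps)
  also have "... <= 1 * 1" using u0 u1 by (intro mult_mono) auto
  finally show ?thesis by simp
 qed
qed simp

section \<open>The explicit scheme: positivity, mass and dissipation\<close>

context volatilities
begin

text \<open>Explicit Euler step for the equation with half the second derivative of the flux, in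
  lattice units: \<open>r\<close> is the time step divided by the square of the space step.\<close>

definition scheme_step :: "real => (int => real ^ 'd) => int => real ^ 'd" where
 "scheme_step r p x =
  p x + (r / 2) *\<^sub>R (flux l (p (x + 1)) + flux l (p (x - 1)) - 2 *\<^sub>R flux l (p x))"

primrec scheme :: "real => (int => real ^ 'd) => nat => int => real ^ 'd" where
 "scheme r p 0 = p"
| "scheme r p (Suc k) = scheme_step r (scheme r p k)"

lemma supp_in_scheme_step: "supp_in M p ==> supp_in (M + 1) (scheme_step r p)"
 unfolding supp_in_def scheme_step_def by auto

lemma supp_in_scheme: "supp_in M p ==> supp_in (M + int k) (scheme r p k)"
proof (induction k)
 case (Suc k)
 then show ?case using supp_in_scheme_step[of "M + int k" "scheme r p k"] by (simp add: add_ac)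
qed simp

text \<open>Summed over the labels the nonlinearity disappears. Hence the total density obeys a
  linear discrete heat equation, which is the source both of mass conservation and of the Brownian
  marginals.\<close>

lemma tot_flux: "nonneg_vec p ==> tot (flux l p) = tot p"
proof (cases "p = 0")
 case False
 assume "nonneg_vec p"
 then have "wtot l p ~= 0" using wtot_pos False by force
 have "tot (flux l p) = wtot l p * (tot p / wtot l p)"
  unfolding tot_def flux_def wtot_def[of l p] sum_distrib_right by simp
 then show ?thesis using \<open>wtot l p ~= 0\<close> by simp
qed simp

lemma flux_bounds:
 assumes "nonneg_vec p"
 shows "0 <= flux l p $ i" "flux l p $ i <= hi / lo * p $ i"
proof -
 have "0 <= flux l p $ i & flux l p $ i <= hi / lo * p $ i"
 proof (cases "p = 0")
  case False
  have p: "0 <= p $ i" using assms by (simp add: nonneg_vec_def)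
  have "flux l p $ i = l i * (tot p / wtot l p) * p $ i" by (simp add: flux_def)
  moreover have le: "l i * (tot p / wtot l p) <= hi * (1 / lo)"
  using ratio_bounds[OF assms False] le_hi[of i] l_pos[of i] hi_pos tot_pos[OF assms False]
  wtot_pos[OF assms False] by (intro mult_mono) (auto simp: less_imp_le)
  moreover have ge: "0 <= l i * (tot p / wtot l p)"
  using l_pos[of i] tot_pos[OF assms False] wtot_pos[OF assms False] by (simp add: less_imp_le)
  ultimately show ?thesis using mult_right_mono[OF le p] mult_nonneg_nonneg[OF ge p] by simp
 qed simp
 then show "0 <= flux l p $ i" "flux l p $ i <= hi / lo * p $ i" by auto
qed

text \<open>The flux is at most \<open>hi / lo\<close> times the density, so under this stability
  condition no site sends out more than it holds.\<close>

lemma nonneg_scheme_step: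
 assumes "!!x. nonneg_vec (p x)" and r: "0 <= r" "r * (hi / lo) <= 1"
 shows "nonneg_vec (scheme_step r p x)"
 unfolding nonneg_vec_def
proof
 fix i
 have "r * flux l (p x) $ i <= r * (hi / lo * p x $ i)"
  using flux_bounds(2)[OF assms(1)] r by (intro mult_left_mono) auto
 also have "... = (r * (hi / lo)) * p x $ i" by simp
 also have "... <= 1 * p x $ i"
  using r assms(1)[of x] by (intro mult_right_mono) (auto simp: nonneg_vec_def)
 finally have "0 <= p x $ i - r * flux l (p x) $ i" by simp
 moreover have "0 <= r / 2 * (flux l (p (x+1)) $ i + flux l (p (x-1)) $ i)"
  using flux_bounds(1)[OF assms(1)] r by (simp add: add_nonneg_nonneg)
 ultimately show "0 <= scheme_step r p x $ i" by (simp add: scheme_step_def algebra_simps)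
qed

lemma nonneg_scheme:
 assumes "!!x. nonneg_vec (p x)" and r: "0 <= r" "r * (hi / lo) <= 1"
 shows "nonneg_vec (scheme r p k x)"
 using assms by (induction k arbitrary: x) (auto intro: nonneg_scheme_step)

lemma mass_scheme_step:
 assumes "!!x. nonneg_vec (p x)" and "supp_in M p" "M + 2 <= L"
 shows "(SUM x=-L..L. tot (scheme_step r p x)) = (SUM x=-L..L. tot (p x))"
proof -
 have z: "L <= abs x ==> tot (p x) = 0" for x using assms(2,3) by (auto simp: supp_in_def)
 show ?thesis
  using window_shift[of L "%x. tot (p x)", OF z]
  by (simp add: scheme_step_def tot_add tot_scaleR tot_diff tot_flux assms(1) sum.distrib sum_subtractf
  flip: sum_distrib_left sum_divide_distrib)
qed

text \<open>Summation by parts turns the first-order term into minus the pairing of the gradients of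
  \<open>p\<close> and of its flux, which monotonicity bounds from below. The square of the update
  is the loss of an explicit method; the Lipschitz bound makes it a multiple of \<open>r^2\<close>
  times the same gradient sum.\<close>

lemma energy_step:
 fixes G :: "real ^ 'd ^ 'd"
 assumes sym: "transpose G = G" and gB: "!!y z. abs (y \<bullet> (G *v z)) <= gB * norm y * norm z" "0 < gB"
  and mono: "!!p q. nonneg_vec p ==> nonneg_vec q ==>
  c * (norm (p - q))^2 <= (p - q) \<bullet> (G *v (flux l p - flux l q))"
  and lip: "!!p q. nonneg_vec p ==> nonneg_vec q ==> norm (flux l p - flux l q) <= K * norm (p - q)"
  and r: "0 < r"
  and p: "!!x. nonneg_vec (p x)" "supp_in M p" "M + 2 <= L" and K: "0 < K"
 shows "(SUM x=-L..L. scheme_step r p x \<bullet> (G *v scheme_step r p x))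
  <= (SUM x=-L..L. p x \<bullet> (G *v p x))
  - (r * c - gB * r^2 * K^2) * (SUM x=-L..L. (norm (p (x + 1) - p x))^2)" (is "?E' <= ?E - _")
proof -
 have s: "y \<bullet> (G *v z) = z \<bullet> (G *v y)" for y z
  by (metis dot_lmul_matrix inner_commute sym transpose_matrix_vector)
 define a where "a x = flux l (p x)" for x
 define dl where "dl x = (r / 2) *\<^sub>R (a (x + 1) + a (x - 1) - 2 *\<^sub>R a x)" for x
 define D where "D = (SUM x=-L..L. (norm (p (x + 1) - p x))^2)"
 have pz: "L <= abs x + 1 ==> p x = 0" for x using p(2,3) by (auto simp: supp_in_def)
 have az: "L <= abs x + 1 ==> a x = 0" for x using pz by (simp add: a_def)
 have "?E' = (SUM x=-L..L. p x \<bullet> (G *v p x) + 2 * (p x \<bullet> (G *v dl x)) + dl x \<bullet> (G *v dl x))"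
  unfolding scheme_step_def a_def[symmetric] dl_def[symmetric]
  by (intro sum.cong refl) (simp add: matrix_vector_right_distrib inner_add_left inner_add_right s)
 then have E': "?E' = ?E + 2 * (SUM x=-L..L. p x \<bullet> (G *v dl x)) + (SUM x=-L..L. dl x \<bullet> (G *v dl x))"
  by (simp add: sum.distrib sum_distrib_left)
 have parts: "(SUM x=-L..L. (p (x + 1) - p x) \<bullet> (G *v (a (x + 1) - a x)))
  = - (SUM x=-L..L. p x \<bullet> (G *v (a (x + 1) + a (x - 1) - 2 *\<^sub>R a x)))"
 proof -
  have "(SUM x=-L..L. p (x+1) \<bullet> (G *v a (x+1))) = (SUM x=-L..L. p x \<bullet> (G *v a x))"
  using window_shift(1)[of L "%x. p x \<bullet> (G *v a x)"] pz by simp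
  moreover have "(SUM x=-L..L. p (x+1) \<bullet> (G *v a x)) = (SUM x=-L..L. p x \<bullet> (G *v a (x-1)))"
  using window_shift(1)[of L "%x. p x \<bullet> (G *v a (x - 1))"] pz by simp
  ultimately show ?thesis
  by (simp add: matrix_vector_right_distrib matrix_vector_mult_diff_distrib inner_diff_left
  inner_diff_right inner_add_right sum_subtractf sum.distrib matrix_vector_mult_scaleR
  sum_distrib_left[symmetric])
 qed
 have "2 * (SUM x=-L..L. p x \<bullet> (G *v dl x)) = - (r * (SUM x=-L..L. (p (x + 1) - p x) \<bullet> (G *v (a (x + 1) - a x))))"
  unfolding parts dl_def
  by (simp add: matrix_vector_mult_scaleR flip: sum_distrib_left sum_divide_distrib)
 moreover have "c * D <= (SUM x=-L..L. (p (x + 1) - p x) \<bullet> (G *v (a (x + 1) - a x)))"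
  unfolding D_def sum_distrib_left a_def using mono p(1) by (intro sum_mono) auto
 ultimately have 1: "2 * (SUM x=-L..L. p x \<bullet> (G *v dl x)) <= - (r * (c * D))"
  using r by (simp add: mult_left_mono)
 have "(SUM x=-L..L. dl x \<bullet> (G *v dl x)) <= (SUM x=-L..L. gB * (norm (dl x))^2)"
  using gB by (intro sum_mono) (metis abs_le_iff mult.assoc power2_eq_square)
 also have "... <= (SUM x=-L..L. gB * (r^2 / 2 * ((norm (a (x + 1) - a x))^2 + (norm (a (x - 1 + 1) - a (x - 1)))^2)))"
 proof (intro sum_mono mult_left_mono)
  fix x
  define u where "u = norm (a (x + 1) - a x)"
  define v where "v = norm (a (x - 1 + 1) - a (x - 1))"
  have "dl x = (r / 2) *\<^sub>R ((a (x + 1) - a x) - (a (x - 1 + 1) - a (x - 1)))"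
  unfolding dl_def by (simp add: algebra_simps scaleR_2)
  then have "norm (dl x) <= r / 2 * (u + v)"
  using norm_triangle_ineq4[of "a (x + 1) - a x" "a (x - 1 + 1) - a (x - 1)"] r
  by (simp add: u_def v_def)
  then have "(norm (dl x))^2 <= (r / 2 * (u + v))^2" by (intro power_mono) auto
  also have "... <= r^2 / 2 * (u^2 + v^2)"
  proof -
  have "(u + v)^2 <= 2 * (u^2 + v^2)"
  using sum_squares_bound[of u v] by (simp add: power2_sum)
  then have "r^2 / 4 * (u + v)^2 <= r^2 / 4 * (2 * (u^2 + v^2))"
  by (rule mult_left_mono) simp
  also have "... = r^2 / 2 * (u^2 + v^2)" by simp
  finally show ?thesis unfolding power_mult_distrib power_divide by simp
  qed
  finally show "(norm (dl x))^2 <= r^2 / 2 * ((norm (a (x + 1) - a x))^2 + (norm (a (x - 1 + 1) - a (x - 1)))^2)"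
  by (simp add: u_def v_def)
 qed (use gB in auto)
 also have "... = gB * r^2 * (SUM x=-L..L. (norm (a (x + 1) - a x))^2)"
 proof -
  have "L <= abs x ==> a (x + 1) - a x = 0" for x using az by simp
  then have "(SUM x=-L..L. (norm (a (x - 1 + 1) - a (x - 1)))^2) = (SUM x=-L..L. (norm (a (x + 1) - a x))^2)"
  using window_shift(2)[of L "%x. (norm (a (x + 1) - a x))^2"] by simp
  then show ?thesis by (simp add: sum.distrib flip: sum_distrib_left sum_divide_distrib)
 qed
 also have "... <= gB * r^2 * (SUM x=-L..L. K^2 * (norm (p (x + 1) - p x))^2)"
 proof (intro mult_left_mono sum_mono)
  fix x
  show "(norm (a (x + 1) - a x))^2 <= K^2 * (norm (p (x + 1) - p x))^2"
  unfolding power_mult_distrib[symmetric] a_def using lip p(1) by (intro power_mono) auto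
 qed (use gB in auto)
 finally have 2: "(SUM x=-L..L. dl x \<bullet> (G *v dl x)) <= gB * r^2 * K^2 * D"
  by (simp add: D_def flip: sum_distrib_left)
 have D0: "0 <= D" by (auto simp: D_def intro: sum_nonneg)
 show ?thesis using 1 2 D0 unfolding E' D_def[symmetric]
  by (simp add: algebra_simps power2_eq_square)
qed

lemma norm_le_tot: "nonneg_vec p ==> norm p <= tot p"
 using norm_le_l1_cart[of p] by (simp add: tot_def nonneg_vec_def)

text \<open>The constants depend on the volatilities alone, not on the initial profile. After
  parabolic rescaling this uniformity is a bound on the spatial gradient in \<open>L^2\<close> after
  any positive time, the only compactness in the construction.\<close>

theorem scheme_dissipation:
 assumes "condition_C l"
 shows "EX r C. 0 < r & r * (hi / lo) <= 1 / 2 & 0 < C &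
  (ALL p M N K L. supp_in M p --> (ALL x. nonneg_vec (p x)) --> (SUM x=-M..M. tot (p x)) = 1 --> 1 <= K -->
  (SUM k=K..<N. SUM x=-L..L. (norm (scheme r p k (x + 1) - scheme r p k x))^2) <= C / sqrt (real K))"
proof -
 obtain G :: "real ^ 'd ^ 'd" and c where c: "c > 0" and sym: "transpose G = G"
  and coer: "!!y. c * (norm y)^2 <= y \<bullet> (G *v y)"
  and mono: "!!p q. nonneg_vec p ==> nonneg_vec q ==>
  c * (norm (p - q))^2 <= (p - q) \<bullet> (G *v (flux l p - flux l q))"
  using flux_monotone[OF assms] by blast
 obtain K0 where K0: "0 < K0"
  and lip: "!!p q. nonneg_vec p ==> nonneg_vec q ==> norm (flux l p - flux l q) <= K0 * norm (p - q)"
  using flux_lipschitz by blast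
 obtain gB0 where "gB0 >= 0" "!!y z. abs (y \<bullet> (G *v z)) <= gB0 * norm y * norm z"
  using abs_bilinear_le[of G] by blast
 then have gB: "!!y z. abs (y \<bullet> (G *v z)) <= (gB0 + 1) * norm y * norm z" "0 < gB0 + 1"
  by (auto simp: distrib_right intro!: add_increasing2)
 define gB where "gB = gB0 + 1"
 note gB = gB[folded gB_def]
 \<comment> \<open>The first bound is the positivity condition with a factor two to spare; under the
   second the quadratic loss costs at most half of the dissipation.\<close>
 define r where "r = min (lo / hi / 2) (c / (2 * (gB * K0^2)))"
 have r0: "0 < r" and r1: "r <= lo / hi / 2" and r2: "r <= c / (2 * (gB * K0^2))"
  using lo_pos hi_pos c gB K0 by (auto simp: r_def)
 have r1': "r * (hi / lo) <= 1 / 2"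
  using mult_right_mono[OF r1, of "hi / lo"] lo_pos hi_pos by simp
 have r2': "r * c / 2 <= r * c - gB * r^2 * K0^2"
 proof -
  have "r * (gB * K0^2) <= c / 2"
  using r2 gB(2) K0 by (simp add: field_simps)
  then have "r * (r * (gB * K0^2)) <= r * (c / 2)" using r0 by (intro mult_left_mono) auto
  then show ?thesis by (simp add: power2_eq_square algebra_simps)
 qed
 \<comment> \<open>Nash's inequality for the norm of the profile gives
   \<open>E^3 <= 4 * gB^3 * D\<close>. Inserted in the dissipation \<open>r * c / 2 * D\<close>, it
   yields the cubic decay with this rate.\<close>
 define \<beta> where "\<beta> = r * c / 2 * (1 / (4 * gB ^ 3))"
 have \<beta>: "0 < \<beta>" using r0 c gB by (simp add: \<beta>_def)
 define C where "C = 2 / (r * c) * (1 / sqrt \<beta>)"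
 have C: "0 < C" using r0 c \<beta> by (simp add: C_def)
 have "(SUM k=K..<N. SUM x=-L..L. (norm (scheme r p k (x + 1) - scheme r p k x))^2) <= C / sqrt (real K)"
  if M: "supp_in M p" and nn: "!!x. nonneg_vec (p x)" and mass: "(SUM x=-M..M. tot (p x)) = 1" and K: "1 <= K"
  for p M N K L
 proof -
  have M0: "0 <= M" using mass by (cases "0 <= M") auto
  \<comment> \<open>A window that the mass cannot leave within \<open>N\<close> steps, enlarged to
    contain the given \<open>L\<close>.\<close>
  define W where "W = max L (M + int N + 3)"
  define P where "P = scheme r p"
  have W: "0 < W" "L <= W" "k <= N ==> M + int k + 2 <= W" for k using M0 by (auto simp: W_def)
  have PS: "P (Suc k) = scheme_step r (P k)" for k by (simp add: P_def)
  have supp: "supp_in (M + int k) (P k)" for k unfolding P_def by (rule supp_in_scheme[OF M])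
  have Pnn: "nonneg_vec (P k x)" for k x
  unfolding P_def by (rule nonneg_scheme[OF nn less_imp_le[OF r0]]) (use r1' in linarith)
  have Pmass: "k <= N ==> (SUM x=-W..W. tot (P k x)) = 1" for k
  proof (induction k)
  case 0
  have "(SUM x=-W..W. tot (p x)) = (SUM x=-M..M. tot (p x))"
  using M W(3)[of 0] by (intro sum.mono_neutral_right) (auto simp: supp_in_def)
  then show ?case using mass by (simp add: P_def)
  next
  case (Suc k)
  then show ?case
  unfolding PS by (subst mass_scheme_step[OF Pnn supp W(3)]) auto
  qed
  define E where "E k = (SUM x=-W..W. P k x \<bullet> (G *v P k x))" for k
  define D where "D k = (SUM x=-W..W. (norm (P k (x + 1) - P k x))^2)" for k
  have D0: "0 <= D k" for k unfolding D_def by (auto intro: sum_nonneg)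
  have E0: "0 <= E k" for k
  unfolding E_def using coer c by (intro sum_nonneg) (meson mult_nonneg_nonneg less_imp_le order_trans zero_le_power2)
  have step: "E (Suc k) <= E k - r * c / 2 * D k" if "k < N" for k
  proof -
  have "E (Suc k) <= E k - (r * c - gB * r^2 * K0^2) * D k"
  unfolding E_def D_def PS
  by (rule energy_step[OF sym gB mono lip r0 Pnn supp W(3) K0]) (use that in auto)
  also have "... <= E k - r * c / 2 * D k"
  using mult_right_mono[OF r2' D0[of k]] by simp
  finally show ?thesis .
  qed
  have ED: "E k ^ 3 <= 4 * gB ^ 3 * D k" if "k <= N" for k
  proof -
  define s where "s = (SUM x=-W..W. (norm (P k x))^2)"
  have "E k <= gB * s"
  unfolding E_def s_def sum_distrib_left using gB(1)
  by (intro sum_mono) (metis abs_le_iff mult.assoc power2_eq_square)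
  then have "E k ^ 3 <= (gB * s) ^ 3" using E0 by (intro power_mono)
  also have "... = gB ^ 3 * s ^ 3" by (simp add: power_mult_distrib)
  also have "s ^ 3 <= 4 * (SUM x=-W..W. (norm (P k (x + 1)) - norm (P k x))^2)"
  unfolding s_def
  proof (rule nash)
  show "W <= abs x ==> norm (P k x) = 0" for x
  using supp[of k] W(3)[OF that] by (auto simp: supp_in_def)
  show "(SUM x=-W..W. norm (P k x)) <= 1"
  unfolding Pmass[OF that, symmetric] by (intro sum_mono norm_le_tot Pnn)
  qed (use W in auto)
  also have "(SUM x=-W..W. (norm (P k (x + 1)) - norm (P k x))^2) <= D k"
  unfolding D_def
  proof (intro sum_mono)
  fix x
  have "abs (norm (P k (x + 1)) - norm (P k x)) <= norm (P k (x + 1) - P k x)"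
  by (rule norm_triangle_ineq3)
  then show "(norm (P k (x + 1)) - norm (P k x))^2 <= (norm (P k (x + 1) - P k x))^2"
  by (simp add: abs_le_square_iff[symmetric])
  qed
  finally show ?thesis using gB by simp
  qed
  have dec: "E (Suc k) <= E k - \<beta> * E k ^ 3" if "k < N" for k
  proof -
  have "\<beta> * E k ^ 3 <= \<beta> * (4 * gB ^ 3 * D k)" using ED[of k] that \<beta> by (intro mult_left_mono) auto
  also have "... = r * c / 2 * D k" using gB by (simp add: \<beta>_def field_simps)
  finally show ?thesis using step[OF that] by simp
  qed
  have EK: "E K <= 1 / sqrt \<beta> / sqrt (real K)" if "K <= N"
  proof -
  have "real K * \<beta> * (E K)^2 <= 1" using cubic_decay[of N E \<beta>, OF dec E0 \<beta> that] .
  then have "(E K)^2 <= 1 / (\<beta> * real K)" using K \<beta> by (simp add: field_simps)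
  then have "E K <= sqrt (1 / (\<beta> * real K))" by (rule real_le_rsqrt)
  then show ?thesis by (simp add: real_sqrt_divide real_sqrt_mult)
  qed
  have sumD: "r * c / 2 * (SUM k=K..<n. D k) <= E K - E n" if "K <= n" "n <= N" for n
  using that
  proof (induction n rule: dec_induct)
  case (step n)
  then show ?case using \<open>!!k. k < N ==> E (Suc k) <= E k - r * c / 2 * D k\<close>[of n]
  by (simp add: distrib_left)
  qed simp
  show ?thesis
  proof (cases "K <= N")
  case True
  have "(SUM k=K..<N. SUM x=-L..L. (norm (P k (x + 1) - P k x))^2) <= (SUM k=K..<N. D k)"
  unfolding D_def using W(2) by (intro sum_mono sum_mono2) auto
  also have "... <= 2 / (r * c) * (E K - E N)"
  using sumD[OF True] r0 c by (simp add: field_simps)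
  also have "... <= 2 / (r * c) * (1 / sqrt \<beta> / sqrt (real K))"
  using EK[OF True] E0[of N] r0 c by (intro mult_left_mono) auto
  finally show ?thesis by (simp add: C_def P_def)
  qed (use C in auto)
 qed
 then show ?thesis using r0 r1' C by blast
qed

end

section \<open>Markov chains with symmetric jumps\<close>

definition jump_pmf :: "real => int pmf" where
 "jump_pmf p = bind_pmf (bernoulli_pmf p)
  (%b. if b then map_pmf (%c. if c then 1 else -1) (bernoulli_pmf (1 / 2)) else return_pmf 0)"

lemma finite_set_jump_pmf: "finite (set_pmf (jump_pmf p))"
proof (rule finite_subset)
 show "set_pmf (jump_pmf p) <= {-1, 0, 1}" by (auto simp: jump_pmf_def split: if_splits)
qed simp

lemma expectation_jump_pmf:
 fixes g :: "int => 'b::{banach, second_countable_topology}"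
 assumes "0 <= p" "p <= 1"
 shows "measure_pmf.expectation (jump_pmf p) g = (1 - p) *\<^sub>R g 0 + (p / 2) *\<^sub>R (g 1 + g (-1))"
proof -
 have "measure_pmf.expectation (jump_pmf p) g = (SUM b:UNIV. pmf (bernoulli_pmf p) b *\<^sub>R
  measure_pmf.expectation (if b then map_pmf (%c. if c then 1 else -1) (bernoulli_pmf (1 / 2)) else return_pmf 0) g)"
  unfolding jump_pmf_def by (rule pmf_expectation_bind) (auto intro: finite_subset[OF subset_UNIV])
 moreover have "measure_pmf.expectation (bernoulli_pmf (1 / 2)) (%x. g (if x then 1 else - 1)) = (1 / 2) *\<^sub>R (g 1 + g (-1))"
  by (subst integral_measure_pmf[of UNIV]) (auto simp: UNIV_bool scaleR_right_distrib)
 ultimately show ?thesis using assms by (simp add: UNIV_bool algebra_simps)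
qed

text \<open>The state is a whole path, started as a constant and overwritten one time at a time;
  times not yet reached keep the initial value. A finitely supported start gives finitely supported
  laws, so that every functional is integrable.\<close>

primrec chain :: "(nat => int => 'd => real) => (int \<times> 'd) pmf => nat => ((nat => int) \<times> 'd) pmf" where
 "chain q m 0 = map_pmf (%(x, i). (%_. x, i)) m"
| "chain q m (Suc k) = bind_pmf (chain q m k)
  (%om. map_pmf (%e. ((fst om)(Suc k := fst om k + e), snd om)) (jump_pmf (q k (fst om k) (snd om))))"

text \<open>Measurability with respect to the past, expressed without \<sigma>-algebras, which
  suffices for finitely supported laws.\<close>

definition adapted_at :: "nat => ((nat => int) \<times> 'd => 'b) => bool" where
 "adapted_at k F \<longleftrightarrow> (ALL x y i. (ALL j<=k. x j = y j) --> F (x, i) = F (y, i))"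

lemma adapted_at_mono: "adapted_at k F ==> k <= n ==> adapted_at n F"
 unfolding adapted_at_def by (meson order_trans)

lemma adapted_at_upd: "adapted_at k F ==> F (x(Suc k := z), i) = F (x, i)"
 unfolding adapted_at_def by auto

lemma adapted_at_comp2: "adapted_at k F ==> adapted_at k G ==> adapted_at k (%om. f (F om) (G om))"
 unfolding adapted_at_def by metis

lemma adapted_at_comp: "adapted_at k F ==> adapted_at k (%om. f (F om))"
 unfolding adapted_at_def by metis

lemma adapted_at_const: "adapted_at k (%om. c)"
 unfolding adapted_at_def by simp

lemma adapted_at_coord: "j <= k ==> adapted_at k (%om. f (fst om j) (snd om))"
 unfolding adapted_at_def by simp

lemma adapted_at_sum: "(!!j. j : A ==> adapted_at k (F j)) ==> adapted_at k (%om. SUM j:A. F j om)"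
 unfolding adapted_at_def by (auto intro!: sum.cong)

locale jump_chain =
 fixes q :: "nat => int => 'd => real" and m :: "(int \<times> 'd) pmf"
 assumes fin: "finite (set_pmf m)" and q0: "0 <= q k x i" and q1: "q k x i <= 1"
begin

abbreviation "E n \<equiv> measure_pmf.expectation (chain q m n)"

lemma finite_chain: "finite (set_pmf (chain q m n))"
 by (induction n) (auto simp: fin finite_set_jump_pmf)

lemma int_chain [simp]: "integrable (measure_pmf (chain q m n)) (F :: _ => 'b::{banach, second_countable_topology})"
 by (rule integrable_measure_pmf_finite[OF finite_chain])

lemma chain_stop: "om : set_pmf (chain q m n) ==> n < j ==> fst om j = fst om 0"
proof (induction n arbitrary: om)
 case (Suc n)
 then show ?case by (auto simp: Suc_lessD)
qed auto

lemma E_Suc: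
 fixes F :: "(nat => int) \<times> 'd => 'b::{banach, second_countable_topology}"
 shows "E (Suc k) F = E k (%om. (1 - q k (fst om k) (snd om)) *\<^sub>R F ((fst om)(Suc k := fst om k), snd om)
  + (q k (fst om k) (snd om) / 2) *\<^sub>R (F ((fst om)(Suc k := fst om k + 1), snd om)
  + F ((fst om)(Suc k := fst om k - 1), snd om)))"
proof -
 let ?A = "set_pmf (chain q m k)"
 have "E (Suc k) F = (SUM om:?A. pmf (chain q m k) om *\<^sub>R measure_pmf.expectation
  (map_pmf (%e. ((fst om)(Suc k := fst om k + e), snd om)) (jump_pmf (q k (fst om k) (snd om)))) F)"
  unfolding chain.simps by (rule pmf_expectation_bind) (auto simp: finite_chain finite_set_jump_pmf)
 also have "... = E k (%om. measure_pmf.expectation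
  (map_pmf (%e. ((fst om)(Suc k := fst om k + e), snd om)) (jump_pmf (q k (fst om k) (snd om)))) F)"
  by (rule integral_measure_pmf[symmetric]) (auto simp: finite_chain)
 finally show ?thesis by (simp add: expectation_jump_pmf q0 q1)
qed

text \<open>A further step leaves the past untouched, so the laws for different horizons are
  consistent and every expectation may be taken under the final one.\<close>

lemma E_adapted:
 fixes F :: "(nat => int) \<times> 'd => 'b::{banach, second_countable_topology}"
 assumes "adapted_at k F" "k <= n"
 shows "E n F = E k F"
 using assms(2)
proof (induction n rule: dec_induct)
 case (step n)
 have a: "adapted_at n F" using assms(1) step by (meson adapted_at_mono)
 have "E (Suc n) F = E n F"
  unfolding E_Suc by (rule arg_cong[where f = "E n"])
  (auto simp: adapted_at_upd[OF a] simp flip: scaleR_left_distrib scaleR_2)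
 then show ?case using step by simp
qed simp

definition Qj :: "nat => (nat => int) \<times> 'd => real" where
 "Qj k om = q k (fst om k) (snd om)"

definition jump :: "nat => (nat => int) \<times> 'd => int" where
 "jump k om = fst om (Suc k) - fst om k"

lemma adapted_Qj: "k <= n ==> adapted_at n (Qj k)"
 unfolding Qj_def by (rule adapted_at_coord)

lemma adapted_jump: "k < n ==> adapted_at n (jump k)"
 unfolding jump_def adapted_at_def by simp

lemma Qj_bounds: "0 <= Qj k om" "Qj k om <= 1"
 by (simp_all add: Qj_def q0 q1)

text \<open>Conditioning on the past at time \<open>k\<close>: the jump is replaced by its three
  values with their conditional probabilities. The moment and characteristic function computations
  below rest on this.\<close>

lemma E_jump:
 fixes G :: "(nat => int) \<times> 'd => int => 'b::{banach, second_countable_topology}"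
 assumes G: "!!e. adapted_at k (%om. G om e)" and k: "k < n"
 shows "E n (%om. G om (jump k om)) =
  E n (%om. (1 - Qj k om) *\<^sub>R G om 0 + (Qj k om / 2) *\<^sub>R (G om 1 + G om (-1)))"
proof -
 have "adapted_at (Suc k) (%om. G om (jump k om))"
  using G unfolding adapted_at_def jump_def by (metis (no_types, lifting) le_Suc_eq fst_conv order.refl)
 then have "E n (%om. G om (jump k om)) = E (Suc k) (%om. G om (jump k om))"
  using k by (intro E_adapted) auto
 also have "... = E k (%om. (1 - Qj k om) *\<^sub>R G om 0 + (Qj k om / 2) *\<^sub>R (G om 1 + G om (-1)))"
  unfolding E_Suc by (rule arg_cong[where f = "E k"])
  (auto simp: adapted_at_upd[OF G] jump_def Qj_def)
 also have "... = E n (%om. (1 - Qj k om) *\<^sub>R G om 0 + (Qj k om / 2) *\<^sub>R (G om 1 + G om (-1)))"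
  by (intro E_adapted[symmetric] adapted_at_comp2[of k _ _ "(+)"] adapted_at_comp2[of k _ _ "(*\<^sub>R)"]
  adapted_at_comp[of k _ "%x. 1 - x"] adapted_at_comp[of k _ "%x. x / 2"] G adapted_Qj)
  (use k in auto)
 finally show ?thesis .
qed

section \<open>Martingale transforms of the jumps\<close>

definition mart :: "(nat => (nat => int) \<times> 'd => real) => nat => nat => (nat => int) \<times> 'd => real" where
 "mart c a k om = (SUM j=a..<k. c j om * of_int (jump j om))"

lemma mart_Suc: "a <= k ==> mart c a (Suc k) om = mart c a k om + c k om * of_int (jump k om)"
 by (simp add: mart_def)

lemma adapted_mart:
 assumes "!!j. adapted_at j (c j)"
 shows "adapted_at k (mart c a k)"
 unfolding mart_def
proof (rule adapted_at_sum)
 fix j assume "j : {a..<k}"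
 then have "adapted_at k (c j)" "adapted_at k (jump j)"
  using assms[of j] by (auto intro: adapted_at_mono adapted_jump)
 then show "adapted_at k (%om. c j om * of_int (jump j om))"
  by (intro adapted_at_comp2[of k _ _ "%u v. u * of_int v"])
qed

lemma E_mart_Suc:
 fixes H :: "(nat => int) \<times> 'd => real => 'b::{banach, second_countable_topology}"
 assumes c: "!!j. adapted_at j (c j)" and H: "!!z. adapted_at k (%om. H om z)" and "a <= k" "k < n"
 shows "E n (%om. H om (mart c a (Suc k) om)) =
  E n (%om. (1 - Qj k om) *\<^sub>R H om (mart c a k om) + (Qj k om / 2) *\<^sub>R
  (H om (mart c a k om + c k om) + H om (mart c a k om - c k om)))"
proof -
 have "adapted_at k (%om. H om (mart c a k om + c k om * of_int e))" for e :: int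
  unfolding adapted_at_def
 proof (intro allI impI)
  fix x y :: "nat => int" and i assume xy: "ALL j<=k. x j = y j"
  have "mart c a k (x, i) = mart c a k (y, i)" "c k (x, i) = c k (y, i)" "!!z. H (x, i) z = H (y, i) z"
  using adapted_mart[OF c, of k a] c[of k] H xy unfolding adapted_at_def by blast+
  then show "H (x, i) (mart c a k (x, i) + c k (x, i) * of_int e)
  = H (y, i) (mart c a k (y, i) + c k (y, i) * of_int e)" by simp
 qed
 from E_jump[where G = "%om e. H om (mart c a k om + c k om * of_int e)", OF this \<open>k < n\<close>] show ?thesis using \<open>a <= k\<close> by (simp add: mart_Suc)
qed

text \<open>The two signs of a jump cancel the mixed term: the discrete Ito isometry.\<close>

lemma isometry:
 assumes c: "!!j. adapted_at j (c j)" and "a <= k" "k <= n"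
 shows "E n (%om. (mart c a k om)^2) = (SUM j=a..<k. E n (%om. (c j om)^2 * Qj j om))"
 using assms(2,3)
proof (induction k rule: dec_induct)
 case base
 then show ?case by (simp add: mart_def)
next
 case (step k)
 have "E n (%om. (mart c a (Suc k) om)^2) = E n (%om. (1 - Qj k om) *\<^sub>R (mart c a k om)\<^sup>2 + (Qj k om / 2) *\<^sub>R
  ((mart c a k om + c k om)^2 + (mart c a k om - c k om)^2))"
  by (rule E_mart_Suc[OF c, where H = "%om z. z^2"]) (use step in \<open>auto simp: adapted_at_const\<close>)
 also have "... = E n (%om. (mart c a k om)^2 + (c k om)^2 * Qj k om)"
  by (rule Bochner_Integration.integral_cong) (simp_all add: power2_eq_square field_simps)
 also have "... = E n (%om. (mart c a k om)^2) + E n (%om. (c k om)^2 * Qj k om)"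
  by (rule Bochner_Integration.integral_add) auto
 finally show ?case using step by simp
qed

text \<open>Odd powers cancel in the conditional expectation, leaving
  \<open>6 * mart^2 * c^2 * Q + c^4 * Q\<close>. As the second moment is linear in time, summation
  gives a quadratic bound, the exponent that Kolmogorov's criterion needs.\<close>

lemma fourth_moment:
 assumes c: "!!j. adapted_at j (c j)" and "a <= k" "k <= n"
  and A: "!!j om. (c j om)^2 * Qj j om <= A" and B: "!!j om. (c j om)^2 <= B"
 shows "E n (%om. (mart c a k om) ^ 4) <= 3 * A^2 * (real (k - a))^2 + A * B * real (k - a)"
 using assms(2,3)
proof (induction k rule: dec_induct)
 case base
 then show ?case by (simp add: mart_def)
next
 case (step k)
 have A0: "0 <= A" using A[of 0 undefined] Qj_bounds[of 0 undefined]
  by (meson mult_nonneg_nonneg order_trans zero_le_power2)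
 have S2: "E n (%om. (mart c a k om)^2) <= A * real (k - a)"
 proof -
  have "E n (%om. (c j om)^2 * Qj j om) <= A" for j
  by (rule measure_pmf.integral_le_const) (auto simp: A)
  then have "(SUM j=a..<k. E n (%om. (c j om)^2 * Qj j om)) <= (SUM j=a..<k. A)" by (intro sum_mono)
  then show ?thesis using isometry[OF c, of a k n] step by (simp add: mult.commute)
 qed
 have "E n (%om. (mart c a (Suc k) om) ^ 4) =
  E n (%om. (mart c a k om) ^ 4 + 6 * (mart c a k om)^2 * ((c k om)^2 * Qj k om) + (c k om)^2 * ((c k om)^2 * Qj k om))"
 proof -
  have "E n (%om. (mart c a (Suc k) om) ^ 4) = E n (%om. (1 - Qj k om) *\<^sub>R (mart c a k om) ^ 4 + (Qj k om / 2) *\<^sub>R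
  ((mart c a k om + c k om) ^ 4 + (mart c a k om - c k om) ^ 4))"
  by (rule E_mart_Suc[OF c, where H = "%om z. z ^ 4"]) (use step in \<open>auto simp: adapted_at_const\<close>)
  also have "... = E n (%om. (mart c a k om) ^ 4 + 6 * (mart c a k om)^2 * ((c k om)^2 * Qj k om) + (c k om)^2 * ((c k om)^2 * Qj k om))"
  by (rule Bochner_Integration.integral_cong)
  (simp_all add: power2_eq_square power4_eq_xxxx field_simps)
  finally show ?thesis .
 qed
 also have "... <= E n (%om. (mart c a k om) ^ 4 + 6 * (mart c a k om)^2 * A + B * A)"
 proof (intro integral_mono add_mono mult_left_mono mult_mono A B)
  fix om
  show "0 <= (c k om)^2 * Qj k om" "0 <= B" using Qj_bounds[of k om] B[of k om]
  by (auto intro: order_trans[OF zero_le_power2])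
 qed auto
 also have "... = E n (%om. (mart c a k om) ^ 4) + 6 * A * E n (%om. (mart c a k om)^2) + B * A"
  by (simp add: mult_ac)
 also have "... <= (3 * A^2 * (real (k - a))^2 + A * B * real (k - a)) + 6 * A * (A * real (k - a)) + B * A"
  using step.IH[OF Suc_leD[OF step.prems]] mult_left_mono[OF S2, of "6 * A"] A0 by simp
 also have "... <= 3 * A^2 * (real (Suc k - a))^2 + A * B * real (Suc k - a)"
 proof -
  have "real (Suc k - a) = real (k - a) + 1" using step by simp
  then show ?thesis by (simp add: power2_eq_square algebra_simps)
 qed
 finally show ?case .
qed

lemma cos_taylor: "abs (cos z - 1 + z^2 / 2) <= z ^ 4 / 24" for z :: real
proof -
 have "cmod (iexp z - (SUM k<=3. (\<i> * z)^k / fact k)) <= abs z^(Suc 3) / fact (Suc 3)"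
  by (rule iexp_approx1)
 moreover have "abs (Re (iexp z - (SUM k<=3. (\<i> * z)^k / fact k))) <= cmod (iexp z - (SUM k<=3. (\<i> * z)^k / fact k))"
  by (rule abs_Re_le_cmod)
 moreover have "Re (iexp z - (SUM k<=3. (\<i> * z)^k / fact k)) = cos z - 1 + z^2 / 2"
  by (simp add: numeral_eq_Suc power_mult_distrib flip: cis_conv_exp)
 moreover have "abs z ^ Suc 3 / fact (Suc 3) = z ^ 4 / 24"
  using power_even_abs[of 4 z] by (simp add: fact_numeral numeral_eq_Suc)
 ultimately show ?thesis by linarith
qed

lemma exp_uminus_taylor: "0 <= u ==> abs (1 - u - exp (- u)) <= u^2" for u :: real
proof -
 assume u: "0 <= u"
 have "1 - u <= exp (- u)" using exp_ge_add_one_self[of "-u"] by simp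
 moreover have "exp (- u) <= 1 / (1 + u)"
  using exp_ge_add_one_self[of u] u by (simp add: exp_minus inverse_eq_divide frac_le)
 moreover have "1 / (1 + u) <= 1 - u + u^2"
  using u by (simp add: field_simps power2_eq_square)
 ultimately show ?thesis by linarith
qed

text \<open>When the conditional variance \<open>c^2 * Q\<close> is constant, the conditional
  characteristic function \<open>ps\<close> of one step differs from the Gaussian factor by at most
  \<open>dl\<close>, uniformly in the past, and the errors of the steps add up. The factor
  \<open>Ph\<close> tests the past, so that the limit yields normality and independence of
  increments together.\<close>

lemma characteristic_step:
 fixes Ph :: "(nat => int) \<times> 'd => complex"
 assumes c: "!!j. adapted_at j (c j)" and "a <= k" "k <= n"
  and ta: "!!j om. (c j om)^2 * Qj j om = ta" and B: "!!j om. (c j om)^2 <= B"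
  and Ph: "adapted_at a Ph" "!!om. cmod (Ph om) <= 1"
 shows "cmod (E n (%om. Ph om * iexp (th * mart c a k om)) - E n Ph * exp (- (th^2 * ta / 2) * real (k - a)))
  <= real (k - a) * (th ^ 4 * ta * B + th ^ 4 * ta^2)"
 using assms(2,3)
proof (induction k rule: dec_induct)
 case base
 then show ?case by (simp add: mart_def)
next
 case (step k)
 have ta0: "0 <= ta" using ta[of 0 undefined] Qj_bounds[of 0 undefined]
  by (metis mult_nonneg_nonneg zero_le_power2)
 have B0: "0 <= B" using B order_trans zero_le_power2 by blast
 define dl where "dl = th ^ 4 * ta * B + th ^ 4 * ta^2"
 define \<rho> where "\<rho> = exp (- (th^2 * ta / 2))"
 define ps where "ps om = (1 - Qj k om) + Qj k om * cos (th * c k om)" for om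
 define S where "S = mart c a k"
 have ps\<rho>: "abs (ps om - \<rho>) <= dl" for om
 proof -
  define z where "z = th * c k om"
  have "abs (Qj k om * (cos z - 1 + z^2 / 2)) <= Qj k om * z ^ 4"
  unfolding abs_mult
  proof (rule mult_mono)
  have "0 <= z ^ 4" by simp
  then show "abs (cos z - 1 + z^2 / 2) <= z ^ 4" using cos_taylor[of z] by linarith
  qed (use Qj_bounds[of k om] in auto)
  also have "... = th ^ 4 * ((c k om)^2 * Qj k om) * (c k om)^2"
  by (simp add: z_def power_mult_distrib power2_eq_square power4_eq_xxxx)
  also have "... <= th ^ 4 * ta * B"
  unfolding ta using ta0 B[of k om] by (intro mult_left_mono) auto
  finally have 1: "abs (Qj k om * (cos z - 1 + z^2 / 2)) <= th ^ 4 * ta * B" .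
  have Qz: "Qj k om * z^2 = th^2 * ta"
  unfolding z_def ta[of k om, symmetric] by (simp add: power_mult_distrib)
  have "abs (1 - th^2 * ta / 2 - \<rho>) <= (th^2 * ta / 2)^2"
  unfolding \<rho>_def using ta0 by (intro exp_uminus_taylor) auto
  also have "... <= th ^ 4 * ta^2"
  proof -
  have "(th^2 * ta / 2)^2 = th ^ 4 * ta^2 / 4"
  by (simp add: power_mult_distrib power_divide flip: power_mult)
  moreover have "0 <= th ^ 4 * ta^2" by simp
  ultimately show ?thesis by linarith
  qed
  finally have 2: "abs (1 - th^2 * ta / 2 - \<rho>) <= th ^ 4 * ta^2" .
  have "ps om - \<rho> = Qj k om * (cos z - 1 + z^2 / 2) + (1 - th^2 * ta / 2 - \<rho>)"
  unfolding ps_def z_def[symmetric] by (simp add: algebra_simps Qz)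
  then show ?thesis using 1 2 unfolding dl_def by linarith
 qed
 have "E n (%om. Ph om * iexp (th * mart c a (Suc k) om)) = E n (%om. Ph om * iexp (th * S om) * ps om)"
  unfolding S_def
 proof (subst E_mart_Suc[OF c, where H = "%om z. Ph om * iexp (th * z)"])
  show "adapted_at k (%om. Ph om * iexp (th * z))" for z
  using adapted_at_mono[OF Ph(1)] step by (intro adapted_at_comp[of k Ph "%w. w * iexp (th * z)"]) auto
  have "iexp (th * (s + d)) + iexp (th * (s - d)) = iexp (th * s) * (2 * cos (th * d))" for s d :: real
  proof -
  have "iexp (th * (s + d)) + iexp (th * (s - d)) = iexp (th * s) * (iexp (th * d) + iexp (- (th * d)))"
  proof -
  have "\<i> * complex_of_real (th * (s + d)) = \<i> * of_real (th * s) + \<i> * of_real (th * d)"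
  "\<i> * complex_of_real (th * (s - d)) = \<i> * of_real (th * s) + \<i> * of_real (- (th * d))"
  by (simp_all add: distrib_left right_diff_distrib)
  then show ?thesis by (simp only: exp_add distrib_left)
  qed
  also have "iexp (th * d) + iexp (- (th * d)) = 2 * cos (th * d)"
  unfolding cis_conv_exp[symmetric] by (simp add: complex_eq_iff)
  finally show ?thesis .
  qed
  then have key: "w * iexp (th * (s + d)) + w * iexp (th * (s - d)) = w * (iexp (th * s) * (2 * cos (th * d)))"
  for s d :: real and w by (metis distrib_left)
  show "E n (%om. (1 - Qj k om) *\<^sub>R (Ph om * iexp (th * mart c a k om)) +
  (Qj k om / 2) *\<^sub>R (Ph om * iexp (th * (mart c a k om + c k om)) + Ph om * iexp (th * (mart c a k om - c k om)))) =
  E n (%om. Ph om * iexp (th * mart c a k om) * complex_of_real (ps om))"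
  unfolding key by (simp add: ps_def scaleR_conv_of_real algebra_simps)
 qed (use step in auto)
 moreover have "cmod (E n (%om. Ph om * iexp (th * S om) * ps om) - E n (%om. Ph om * iexp (th * S om)) * \<rho>) <= dl"
 proof -
  have "E n (%om. Ph om * iexp (th * S om) * ps om) - E n (%om. Ph om * iexp (th * S om)) * \<rho>
  = E n (%om. Ph om * iexp (th * S om) * (ps om - \<rho>))"
  proof -
  have "E n (%om. u om * (ps om - \<rho>)) = E n (%om. u om * ps om) - E n u * \<rho>" for u :: "_ => complex"
  proof -
  have "E n (%om. u om * (ps om - \<rho>)) = E n (%om. u om * ps om - u om * \<rho>)"
  by (simp only: right_diff_distrib of_real_diff)
  also have "... = E n (%om. u om * ps om) - E n (%om. u om * \<rho>)"
  by (rule Bochner_Integration.integral_diff) simp_all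
  also have "E n (%om. u om * \<rho>) = E n u * \<rho>" by (rule integral_mult_left_zero)
  finally show ?thesis .
  qed
  from this[of "%om. Ph om * iexp (th * S om)"] show ?thesis by simp
  qed
  also have "cmod ... <= E n (%om. cmod (Ph om * iexp (th * S om) * (ps om - \<rho>)))"
  by (rule integral_norm_bound)
  also have "... <= dl"
  proof (rule measure_pmf.integral_le_const)
  have "cmod (Ph om * iexp (th * S om) * (ps om - \<rho>)) <= dl" for om
  using mult_mono[OF Ph(2)[of om] ps\<rho>[of om]] by (simp add: norm_mult flip: of_real_diff)
  then show "AE om in measure_pmf (chain q m n). cmod (Ph om * iexp (th * S om) * (ps om - \<rho>)) <= dl" by simp
  qed simp
  finally show ?thesis .
 qed
 moreover have "cmod (E n (%om. Ph om * iexp (th * S om)) * \<rho> - E n Ph * exp (- (th^2 * ta / 2) * real (k - a)) * \<rho>)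
  <= real (k - a) * dl * 1"
  unfolding left_diff_distrib[symmetric] norm_mult S_def
 proof (rule mult_mono)
  show "cmod (complex_of_real \<rho>) <= 1" using ta0 by (simp add: \<rho>_def)
  show "0 <= real (k - a) * dl" using ta0 B0 by (simp add: dl_def)
 qed (use step in \<open>auto simp: dl_def\<close>)
 moreover have "exp (- (th^2 * ta / 2) * real (k - a)) * \<rho> = exp (- (th^2 * ta / 2) * real (Suc k - a))"
 proof -
  have "real (Suc k - a) = real (k - a) + 1" using step by simp
  moreover have "exp (- u * v) * exp (- u) = exp (- u * (v + 1))" for u v :: real
  by (simp add: distrib_left flip: exp_add)
  ultimately show ?thesis by (simp only: \<rho>_def)
 qed
 then have "E n Ph * exp (- (th^2 * ta / 2) * real (k - a)) * \<rho> = E n Ph * exp (- (th^2 * ta / 2) * real (Suc k - a))"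
  by (metis mult.assoc of_real_mult)
 moreover have "real (Suc k - a) * dl = real (k - a) * dl + dl"
  using step by (simp add: Suc_diff_le algebra_simps)
 ultimately show ?case unfolding dl_def[symmetric]
  by (smt (verit) norm_triangle_ineq4 norm_diff_triangle_le mult.right_neutral add.commute)
qed

section \<open>One-dimensional marginals of the chain\<close>

definition marg :: "nat => (int \<times> 'd) pmf" where
 "marg k = map_pmf (%om. (fst om k, snd om)) (chain q m k)"

lemma E_marg:
 fixes ph :: "int => 'd => 'b::{banach, second_countable_topology}"
 assumes "k <= n"
 shows "E n (%om. ph (fst om k) (snd om)) = measure_pmf.expectation (marg k) (%(x, i). ph x i)"
 using E_adapted[OF adapted_at_coord[of k k ph] assms] by (simp add: marg_def)

text \<open>The forward equation, in the form in which it is compared with the scheme.\<close>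

lemma pmf_marg_Suc:
 "pmf (marg (Suc k)) (y, i) = (1 - q k y i) * pmf (marg k) (y, i)
  + q k (y - 1) i / 2 * pmf (marg k) (y - 1, i) + q k (y + 1) i / 2 * pmf (marg k) (y + 1, i)"
proof -
 define I :: "int => (nat => int) \<times> 'd => real" where "I z om = indicator {(z, i)} (fst om k, snd om)" for z om
 have pm: "pmf (marg n) z = E n (%om. indicator {z} (fst om n, snd om))" for n z
 proof -
  have "(%om. indicator {z} (fst om n, snd om)) = (indicator ((%om. (fst om n, snd om)) -` {z}) :: _ => real)"
  by (auto split: split_indicator)
  then show ?thesis by (simp add: marg_def pmf_map)
 qed
 have "pmf (marg (Suc k)) (y, i) = E k (%om. (1 - q k y i) * I y om + q k (y - 1) i / 2 * I (y - 1) om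
  + q k (y + 1) i / 2 * I (y + 1) om)"
  unfolding pm E_Suc by (rule arg_cong[where f = "E k"])
  (auto simp: I_def fun_eq_iff split: split_indicator)
 also have "... = (1 - q k y i) * pmf (marg k) (y, i)
  + q k (y - 1) i / 2 * pmf (marg k) (y - 1, i) + q k (y + 1) i / 2 * pmf (marg k) (y + 1, i)"
  unfolding pm by (simp add: I_def)
 finally show ?thesis .
qed

lemma marg_0: "marg 0 = m"
 by (simp add: marg_def map_pmf_comp case_prod_beta)

end

section \<open>Almost sure convergence along a subsequence\<close>

text \<open>Base four with digits zero and one, so the values form a Cantor set: codes that are
  close share their leading digits, which fails for binary expansions.\<close>

definition bcode :: "(nat => bool) => real" where
 "bcode b = (\<Sum>m. of_bool (b m) / 4 ^ Suc m)"

lemma summable_bcode: "summable (%m. of_bool (b m) / (4::real) ^ Suc m)"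
proof (rule summable_comparison_test)
 show "EX N. ALL n>=N. norm (of_bool (b n) / (4::real) ^ Suc n) <= (1/4) ^ n"
  by (auto simp: power_divide field_simps)
qed (auto intro: summable_geometric)

text \<open>The first differing digit contributes \<open>1 / 4 ^ Suc m\<close>, and all later ones
  together can undo at most a third of it.\<close>

lemma bcode_tail:
 assumes "!!k. k < m ==> b k = b' k" "b m" "~ b' m"
 shows "2 / 3 / 4 ^ Suc m <= bcode b - bcode b'"
proof -
 define g where "g k = of_bool (b k) / (4::real) ^ Suc k - of_bool (b' k) / 4 ^ Suc k" for k
 have sg: "summable g" unfolding g_def by (intro summable_diff summable_bcode)
 have "bcode b - bcode b' = (\<Sum>k. g k)"
  unfolding bcode_def g_def by (intro suminf_diff summable_bcode)
 also have "... = (\<Sum>k. g (k + Suc m)) + (SUM k<Suc m. g k)"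
  by (rule suminf_split_initial_segment[OF sg])
 also have "(SUM k<Suc m. g k) = 1 / 4 ^ Suc m"
  using assms by (simp add: g_def)
 also have "(\<Sum>k. g (k + Suc m)) >= (\<Sum>k. - (1 / 4 ^ Suc (Suc m)) * (1 / 4) ^ k)"
 proof (rule suminf_le)
  fix k
  show "- (1 / 4 ^ Suc (Suc m)) * (1 / 4) ^ k <= g (k + Suc m)"
  by (simp add: g_def power_add power_divide field_simps)
 next
  show "summable (%k. - (1 / 4 ^ Suc (Suc m)) * (1 / 4) ^ k :: real)"
  by (intro summable_mult summable_geometric) auto
  show "summable (%k. g (k + Suc m))" using sg by (rule summable_ignore_initial_segment)
 qed
 moreover have "(\<Sum>k. - (1 / 4 ^ Suc (Suc m)) * (1 / 4) ^ k :: real) = - (1 / 4 ^ Suc (Suc m)) * (4/3)"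
  by (subst suminf_mult) (auto simp: suminf_geometric)
 moreover have "- (1 / 4 ^ Suc (Suc m)) * (4/3) + 1 / 4 ^ Suc m = 2 / 3 / (4 ^ Suc m :: real)"
  by (simp add: field_simps)
 ultimately show ?thesis by linarith
qed

lemma bcode_close:
 assumes "abs (bcode b - bcode b') < 2 / 3 / 4 ^ Suc m" "k <= m"
 shows "b k = b' k"
proof (rule ccontr)
 assume "b k ~= b' k"
 define j where "j = (LEAST j. b j ~= b' j)"
 have j: "b j ~= b' j" unfolding j_def by (rule LeastI) fact
 have jk: "j <= k" unfolding j_def by (rule Least_le) fact
 have lt: "i < j ==> b i = b' i" for i unfolding j_def using not_less_Least by blast
 have "2 / 3 / 4 ^ Suc j <= abs (bcode b - bcode b')"
 proof (cases "b j")
  case True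
  then show ?thesis using bcode_tail[of j b b', OF lt] j by simp
 next
  case False
  then show ?thesis using bcode_tail[of j b' b, OF lt[symmetric]] j by simp
 qed
 moreover have "2 / 3 / 4 ^ Suc m <= 2 / 3 / (4 ^ Suc j :: real)"
  using jk assms(2) by (intro divide_left_mono power_increasing) auto
 ultimately show False using assms(1) by linarith
qed

lemma bcode_range: "0 <= bcode b" "bcode b <= 1"
proof -
 show "0 <= bcode b" unfolding bcode_def by (intro suminf_nonneg summable_bcode) auto
 have "bcode b <= (\<Sum>k. (1/4) * (1/4)^k)"
  unfolding bcode_def
  by (intro suminf_le summable_bcode summable_mult summable_geometric) (auto simp: power_divide)
 also have "... = 1/3" by (subst suminf_mult) (auto simp: suminf_geometric)
 finally show "bcode b <= 1" by simp
qed

definition bdig :: "nat => real => bool" where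
 "bdig k y \<longleftrightarrow> odd \<lfloor>2 ^ Suc k * y\<rfloor>"

lemma floor_bits:
 assumes "!!k. k < L ==> bdig k y = bdig k z" "0 <= y" "y < 1" "0 <= z" "z < 1"
 shows "\<lfloor>2 ^ L * y\<rfloor> = \<lfloor>2 ^ L * z\<rfloor>"
 using assms(1)
proof (induction L)
 case 0
 then show ?case using assms floor_unique[of 0 y] floor_unique[of 0 z] by simp
next
 case (Suc L)
 have half: "\<lfloor>2 ^ Suc L * u\<rfloor> div 2 = \<lfloor>2 ^ L * u\<rfloor>" for u :: real
  using floor_divide_real_eq_div[of 2 "2 ^ Suc L * u"] by simp
 have "odd \<lfloor>2 ^ Suc L * y\<rfloor> = odd \<lfloor>2 ^ Suc L * z\<rfloor>" using Suc.prems[of L] by (simp add: bdig_def)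
 then have "\<lfloor>2 ^ Suc L * y\<rfloor> mod 2 = \<lfloor>2 ^ Suc L * z\<rfloor> mod 2" by (simp add: mod2_eq_if)
 moreover have "\<lfloor>2 ^ Suc L * y\<rfloor> div 2 = \<lfloor>2 ^ Suc L * z\<rfloor> div 2"
  unfolding half using Suc by simp
 ultimately show ?case by (metis div_mult_mod_eq)
qed

lemma bits_close:
 assumes "!!k. k < L ==> bdig k y = bdig k z" "0 <= y" "y < 1" "0 <= z" "z < 1"
 shows "abs (y - z) <= 1 / 2 ^ L"
proof -
 have "\<lfloor>2 ^ L * y\<rfloor> = \<lfloor>2 ^ L * z\<rfloor>" using assms by (rule floor_bits)
 then have "abs (2 ^ L * y - 2 ^ L * z) <= 1" by linarith
 then have "2 ^ L * abs (y - z) <= 1" by (simp add: abs_mult flip: right_diff_distrib)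
 then show ?thesis by (simp add: field_simps)
qed

definition squash :: "real => real" where
 "squash x = (x / (1 + abs x) + 1) / 2"

lemma squash_range: "0 <= squash x" "squash x < 1"
 by (auto simp: squash_def field_simps abs_if)

lemma unsquash: "x / (1 + abs x) = w ==> x = w / (1 - abs w)" for x w :: real
proof -
 assume w: "x / (1 + abs x) = w"
 have p: "0 < 1 + abs x" by linarith
 have "1 - abs w = 1 / (1 + abs x)" unfolding w[symmetric] using p by (simp add: abs_divide field_simps)
 then show "x = w / (1 - abs w)" unfolding w[symmetric] using p by simp
qed

text \<open>All binary digits of all squashed coordinates, interleaved by the pairing function. The
  code is not continuous, but its inverse is, and that is the direction used: convergent codes force
  the squashed coordinates to converge.\<close>

definition seq_code :: "(nat => real) => real" where
 "seq_code v = bcode (%m. bdig (snd (prod_decode m)) (squash (v (fst (prod_decode m)))))"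

text \<open>The squashed values converge in the closed unit interval; a limit at an endpoint means
  that the original sequence escapes to infinity.\<close>

lemma squash_LIMSEQ_cases:
 assumes "convergent (%n. squash (x n))"
 shows "convergent x \<or> (ALL B. eventually (%n. B < abs (x n)) sequentially)"
proof -
 define w where "w n = x n / (1 + abs (x n))" for n
 have "a = 2 * ((a + 1) / 2) - 1" for a :: real by (simp add: field_simps)
 then have w: "w n = 2 * squash (x n) - 1" for n unfolding w_def squash_def by blast
 obtain z where "(%n. squash (x n)) ---> z" using assms unfolding convergent_def by blast
 then have wz: "w ---> 2 * z - 1" unfolding w by (intro tendsto_intros)
 have w1: "abs (w n) < 1" for n by (simp add: w_def abs_if field_simps)
 show ?thesis
 proof (cases "abs (2 * z - 1) = 1")
  case False
  have "x n = w n / (1 - abs (w n))" for n by (rule unsquash) (simp add: w_def)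
  moreover have "(%n. w n / (1 - abs (w n))) ---> (2 * z - 1) / (1 - abs (2 * z - 1))"
  using False by (intro tendsto_intros wz) auto
  ultimately have "x ---> (2 * z - 1) / (1 - abs (2 * z - 1))" by (metis (lifting) ext)
  then show ?thesis by (auto simp: convergent_def)
 next
  case True
  have "eventually (%n. B < abs (x n)) sequentially" for B
  proof -
  define C where "C = max B 0"
  have "(%n. abs (w n)) ---> 1" using tendsto_rabs[OF wz] True by simp
  then have "eventually (%n. C / (1 + C) < abs (w n)) sequentially"
  by (rule order_tendstoD) (auto simp: C_def field_simps)
  then show ?thesis
  proof eventually_elim
  case (elim n)
  have "abs (w n) = abs (x n) / (1 + abs (x n))" by (simp add: w_def)
  with elim have "C * (1 + abs (x n)) < abs (x n) * (1 + C)"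
  by (simp add: field_simps C_def)
  then show ?case by (simp add: C_def algebra_simps)
  qed
  qed
  then show ?thesis by blast
 qed
qed

lemma seq_code_convergent:
 assumes "convergent (%n. seq_code (v n))"
 shows "convergent (%n. squash (v n j))"
proof (rule Cauchy_convergent, rule metric_CauchyI)
 fix e :: real assume "0 < e"
 then obtain L where L: "1 / 2 ^ L < e"
  using real_arch_pow_inv[of e "1/2"] by (auto simp: power_divide)
 define m where "m = (SUM k<L. prod_encode (j, k))"
 have m: "prod_encode (j, k) <= m" if "k < L" for k
  unfolding m_def using that by (intro member_le_sum) auto
 have "Cauchy (%n. seq_code (v n))" using assms by (rule convergent_Cauchy)
 then obtain N where N: "!!n n'. n >= N ==> n' >= N ==> dist (seq_code (v n)) (seq_code (v n')) < 2 / 3 / 4 ^ Suc m"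
  using metric_CauchyD[of _ "2 / 3 / 4 ^ Suc m"] by (smt (verit) divide_pos_pos zero_less_power)
 have "dist (squash (v n j)) (squash (v n' j)) < e" if "n >= N" "n' >= N" for n n'
 proof -
  have "abs (squash (v n j) - squash (v n' j)) <= 1 / 2 ^ L"
  proof (rule bits_close)
  fix k assume "k < L"
  have "abs (seq_code (v n) - seq_code (v n')) < 2 / 3 / 4 ^ Suc m"
  using N[OF that] by (simp add: dist_real_def)
  from bcode_close[OF this[unfolded seq_code_def] m[OF \<open>k < L\<close>]]
  show "bdig k (squash (v n j)) = bdig k (squash (v n' j))" by simp
  qed (auto simp: squash_range)
  then show ?thesis using L by (simp add: dist_real_def)
 qed
 then show "EX M. ALL m>=M. ALL n>=M. dist (squash (v m j)) (squash (v n j)) < e" by blast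
qed

lemma seq_code_inj:
 assumes "seq_code v = seq_code v'"
 shows "v j = v' j"
proof -
 have "squash (v j) = squash (v' j)"
 proof (rule ccontr)
  assume "squash (v j) ~= squash (v' j)"
  then obtain L where L: "1 / 2 ^ L < abs (squash (v j) - squash (v' j))"
  using real_arch_pow_inv[of "abs (squash (v j) - squash (v' j))" "1/2"] by (auto simp: power_divide)
  have "bdig k (squash (v j)) = bdig k (squash (v' j))" for k
  proof -
  have "abs (seq_code v - seq_code v') < 2 / 3 / 4 ^ Suc (prod_encode (j, k))" using assms by simp
  from bcode_close[OF this[unfolded seq_code_def] order.refl] show ?thesis by simp
  qed
  then have "abs (squash (v j) - squash (v' j)) <= 1 / 2 ^ L"
  by (intro bits_close) (auto simp: squash_range)
  with L show False by simp
 qed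
 moreover have "a = b" if "(a + 1) / 2 = (b + 1) / 2" for a b :: real using that by simp
 ultimately have "v j / (1 + abs (v j)) = v' j / (1 + abs (v' j))" unfolding squash_def by blast
 then show ?thesis using unsquash by metis
qed

text \<open>Reduces the representation theorem for infinitely many coordinates to the real line.
  Through its code a sample becomes a number in \<open>{0..1}\<close>, so tightness of the codes is
  free; almost surely convergent codes are decoded on the countable supports. Tightness of the
  coordinates enters only to exclude escape to infinity.\<close>

lemma skorokhod_pmf_nat:
 fixes Q :: "nat => 'a pmf" and V :: "nat => nat => 'a => real"
 assumes tight: "!!j eps. eps > 0 ==> EX B. ALL n. measure_pmf.prob (Q n) {om. B < abs (V n j om)} <= eps"
  and inj: "!!n om om'. om : set_pmf (Q n) ==> om' : set_pmf (Q n) ==> (!!j. V n j om = V n j om') ==> om = om'"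
 shows "EX r (M :: real measure) Om. strict_mono r & prob_space M &
  (ALL n. Om n : M \<rightarrow>\<^sub>M UC & distr M (count_space UNIV) (Om n) = measure_pmf (Q (r n))) &
  (AE om in M. ALL j. convergent (%n. V (r n) j (Om n om)))"
proof -
 define R where "R n om = seq_code (%j. V n j om)" for n om
 define \<mu> where "\<mu> n = distr (measure_pmf (Q n)) borel (R n)" for n
 have Rinj: "inj_on (R n) (set_pmf (Q n))" for n
  unfolding inj_on_def R_def using inj seq_code_inj by metis
 have rd: "real_distribution (\<mu> n)" for n
  unfolding \<mu>_def
  by (rule prob_space.real_distribution_distr[OF measure_pmf.prob_space_axioms]) simp
 have "tight \<mu>"
  unfolding tight_def
 proof (intro conjI allI impI)
  fix eps :: real assume "0 < eps"
  have "measure (\<mu> n) {-1<..1} = 1" for n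
  proof -
  have "measure (\<mu> n) {-1<..1} = measure_pmf.prob (Q n) (R n -` {-1<..1})"
  by (simp add: \<mu>_def measure_distr)
  also have "R n -` {-1<..1} = UNIV"
  using bcode_range less_le_trans[OF _ bcode_range(1), of "-1"] by (auto simp: R_def seq_code_def)
  finally show ?thesis by simp
  qed
  then show "EX a b. a < b & (ALL n. 1 - eps < measure (\<mu> n) {a<..b})"
  using \<open>0 < eps\<close> by (intro exI[of _ "-1"] exI[of _ 1]) auto
 qed (rule rd)
 then obtain r L where r: "strict_mono r" and L: "real_distribution L" and wc: "weak_conv_m (\<mu> \<circ> r) L"
  using tight_imp_convergent_subsubsequence[of \<mu> id] by (auto simp: strict_mono_id)
 have "EX (M :: real measure) (U :: nat => real => real) (W :: real => real). prob_space M & (ALL n. U n : measurable M borel) &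
  (ALL n. distr M borel (U n) = \<mu> (r n)) & W : measurable M lborel & distr M borel W = L &
  (ALL x : space M. (%n. U n x) ---> W x)"
  using Skorohod[of "\<mu> \<circ> r" L] rd L wc by (simp add: comp_def)
 then obtain M :: "real measure" and U W where M: "prob_space M" and U[measurable]: "!!n. U n : bmeas M"
  and dU: "!!n. distr M borel (U n) = \<mu> (r n)" and conv: "!!x. x : space M ==> (%n. U n x) ---> W x"
  by blast
 interpret M: prob_space M by fact
 define C where "C n = R n ` set_pmf (Q n)" for n
 define d where "d n y = (if y : C n then inv_into (set_pmf (Q n)) (R n) y else undefined)" for n y
 have Cc: "countable (C n)" for n by (simp add: C_def)
 have dm[measurable]: "d n : borel \<rightarrow>\<^sub>M UC" for n
  by (rule measurable_discrete_difference[of "%_. undefined" borel _ "C n"])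
  (auto simp: Cc d_def)
 have dR: "om : set_pmf (Q n) ==> d n (R n om) = om" for n om
  using Rinj by (simp add: d_def C_def)
 have Rd: "y : C n ==> R n (d n y) = y" for n y
  by (auto simp: d_def C_def f_inv_into_f)
 define Om where "Om n om = d (r n) (U n om)" for n om
 have Omm[measurable]: "Om n : M \<rightarrow>\<^sub>M UC" for n
  unfolding Om_def by measurable
 have dOm: "distr M (count_space UNIV) (Om n) = measure_pmf (Q (r n))" for n
 proof -
  have "distr M (count_space UNIV) (Om n) = distr (distr M borel (U n)) (count_space UNIV) (d (r n))"
  by (subst distr_distr) (auto simp: comp_def Om_def[abs_def])
  also have "... = distr (measure_pmf (Q (r n))) (count_space UNIV) (d (r n) \<circ> R (r n))"
  unfolding dU \<mu>_def by (subst distr_distr) auto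
  also have "... = distr (measure_pmf (Q (r n))) (count_space UNIV) (%om. om)"
  by (rule distr_cong_AE) (auto simp: AE_measure_pmf_iff dR)
  also have "... = measure_pmf (Q (r n))" by (rule distr_id2) simp
  finally show ?thesis .
 qed
 have inC: "AE om in M. ALL n. U n om : C (r n)"
 proof (subst AE_all_countable, rule allI)
  fix n
  have Cb: "C (r n) : sets borel" by (rule sets.countable) (auto simp: Cc)
  then have "AE y in \<mu> (r n). y : C (r n)"
  unfolding \<mu>_def by (subst AE_distr_iff) (auto simp: AE_measure_pmf_iff C_def)
  then show "AE om in M. U n om : C (r n)"
  unfolding dU[symmetric] using Cb by (subst (asm) AE_distr_iff) auto
 qed
 \<comment> \<open>A coordinate escaping to infinity exceeds \<open>B\<close> at all indices from
   some \<open>k\<close> on, and the event at index \<open>k\<close> alone already has probability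
   at most \<open>eps\<close>.\<close>
 have bad: "AE om in M. ~ (ALL B. eventually (%n. B < abs (V (r n) j (Om n om))) sequentially)" for j
 proof -
  define S where "S = {om : space M. ALL B::nat. eventually (%n. real B < abs (V (r n) j (Om n om))) sequentially}"
  have Vm[measurable]: "(%om. V (r n) j (Om n om)) : bmeas M" for n
  by (rule measurable_compose[OF Omm]) simp
  have S[measurable]: "S : sets M" unfolding S_def eventually_sequentially by measurable
  have "measure M S <= eps" if "eps > 0" for eps
  proof -
  obtain B where B: "!!n. measure_pmf.prob (Q n) {om. B < abs (V n j om)} <= eps"
  using tight[OF \<open>eps > 0\<close>, of j] by blast
  define A where "A k = {om : space M. ALL n>=k. real (nat \<lceil>B\<rceil>) < abs (V (r n) j (Om n om))}" for k
  have A[measurable]: "A k : sets M" for k unfolding A_def by measurable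
  have "measure M (A k) <= eps" for k
  proof -
  have "measure M (A k) <= measure M {om : space M. B < abs (V (r k) j (Om k om))}"
  proof (rule M.finite_measure_mono)
  have "B <= real (nat \<lceil>B\<rceil>)" by linarith
  then show "A k <= {om : space M. B < abs (V (r k) j (Om k om))}"
  unfolding A_def using le_less_trans by blast
  qed measurable
  also have "... = measure (distr M (count_space UNIV) (Om k)) {om. B < abs (V (r k) j om)}"
  by (subst measure_distr) (auto simp: vimage_def Int_def conj_commute)
  also have "... <= eps" unfolding dOm by (rule B)
  finally show ?thesis .
  qed
  moreover have "(%k. measure M (A k)) ---> measure M (\<Union>k. A k)"
  by (intro M.finite_Lim_measure_incseq) (auto simp: incseq_def A_def)
  ultimately have "measure M (\<Union>k. A k) <= eps" by (meson LIMSEQ_le_const2)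
  moreover have "S <= (\<Union>k. A k)"
  unfolding S_def A_def eventually_sequentially by blast
  ultimately show ?thesis using M.finite_measure_mono[of S "\<Union>k. A k"] by auto
  qed
  then have "measure M S <= 0" by (rule field_le_epsilon) simp
  then have "emeasure M S = 0" by (simp add: M.emeasure_eq_measure measure_le_0_iff)
  then have "AE om in M. om ~: S" by (intro AE_not_in) auto
  then show ?thesis by (rule AE_mp) (auto simp: S_def)
 qed
 have "AE om in M. ALL j. convergent (%n. V (r n) j (Om n om))"
 proof -
  have "AE om in M. ALL j. ~ (ALL B. eventually (%n. B < abs (V (r n) j (Om n om))) sequentially)"
  using bad by (subst AE_all_countable) auto
  then show ?thesis using inC AE_space
  proof eventually_elim
  case (elim om)
  have "R (r n) (Om n om) = U n om" for n unfolding Om_def using elim(2) by (intro Rd) auto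
  then have "convergent (%n. seq_code (%j. V (r n) j (Om n om)))"
  using conv[OF elim(3)] by (auto simp: R_def convergent_def)
  then have "convergent (%n. squash (V (r n) j (Om n om)))" for j
  by (rule seq_code_convergent)
  then show ?case using squash_LIMSEQ_cases[of "%n. V (r n) j (Om n om)" for j] elim(1) by blast
  qed
 qed
 then show ?thesis using r M Omm dOm by blast
qed

theorem skorokhod_pmf:
 fixes Q :: "nat => 'a pmf" and V :: "nat => 'j::countable => 'a => real"
 assumes tight: "!!j eps. eps > 0 ==> EX B. ALL n. measure_pmf.prob (Q n) {om. B < abs (V n j om)} <= eps"
  and inj: "!!n om om'. om : set_pmf (Q n) ==> om' : set_pmf (Q n) ==> (!!j. V n j om = V n j om') ==> om = om'"
 shows "EX r (M :: real measure) Om. strict_mono r & prob_space M &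
  (ALL n. Om n : M \<rightarrow>\<^sub>M UC & distr M (count_space UNIV) (Om n) = measure_pmf (Q (r n))) &
  (AE om in M. ALL j. convergent (%n. V (r n) j (Om n om)))"
proof -
 have "EX r (M :: real measure) Om. strict_mono r & prob_space M &
  (ALL n. Om n : M \<rightarrow>\<^sub>M UC & distr M (count_space UNIV) (Om n) = measure_pmf (Q (r n))) &
  (AE om in M. ALL k. convergent (%n. V (r n) (from_nat k) (Om n om)))"
 proof (rule skorokhod_pmf_nat[of Q "%n k. V n (from_nat k)"])
  fix n om om' assume "om : set_pmf (Q n)" "om' : set_pmf (Q n)"
  and "!!k. V n (from_nat k) om = V n (from_nat k) om'"
  then show "om = om'" using inj by (metis from_nat_to_nat)
 qed (rule tight)
 moreover have "(ALL k. convergent (%n. V (r n) (from_nat k) (Om n om))) \<longleftrightarrow>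
  (ALL j. convergent (%n. V (r n) j (Om n om)))" for r and Om :: "nat => real => 'a" and om
  by (metis from_nat_to_nat)
 ultimately show ?thesis by simp
qed

section \<open>Continuous versions\<close>

text \<open>Each level divides a time cell into four, matching lattices whose space step is halved
  at each level.\<close>

definition quad :: "real => nat => nat => real" where
 "quad T m k = T * real k / 4 ^ m"

definition quads :: "real => real set" where
 "quads T = {quad T m k | m k. k <= 4 ^ m}"

definition qfloor :: "real => nat => real => real" where
 "qfloor T m t = quad T m (nat \<lfloor>4 ^ m * t / T\<rfloor>)"

lemma quadsI: "k <= 4 ^ m ==> quad T m k : quads T"
 unfolding quads_def by blast

lemma quad_lift: "m <= L ==> quad T m k = quad T L (k * 4 ^ (L - m))"
proof -
 assume "m <= L"
 then have "(4::real) ^ L = 4 ^ m * 4 ^ (L - m)" by (simp flip: power_add)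
 then show ?thesis by (simp add: quad_def)
qed

lemma quads_level:
 assumes "t : quads T"
 shows "EX m. ALL L>=m. EX k<=4 ^ L. t = quad T L k"
proof -
 obtain m k where mk: "t = quad T m k" "k <= 4 ^ m" using assms unfolding quads_def by blast
 have "EX k<=4 ^ L. t = quad T L k" if "m <= L" for L
 proof (intro exI conjI)
  show "t = quad T L (k * 4 ^ (L - m))" using mk quad_lift[OF that] by simp
  have "k * 4 ^ (L - m) <= 4 ^ m * 4 ^ (L - m)" using mk by (intro mult_right_mono) auto
  then show "k * 4 ^ (L - m) <= 4 ^ L" using that by (simp flip: power_add)
 qed
 then show ?thesis by blast
qed

context
 fixes T :: real
 assumes T: "0 < T"
begin

lemma quads_subset: "quads T <= {0..T}"
proof
 fix t assume "t : quads T"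
 then obtain m k where t: "t = quad T m k" "k <= 4 ^ m" unfolding quads_def by blast
 have "real k <= 4 ^ m" using t(2) of_nat_mono[of k "4 ^ m", where 'a = real] by simp
 then have "T * real k <= T * 4 ^ m" using T by simp
 then show "t : {0..T}" using T by (simp add: t(1) quad_def field_simps)
qed

lemma qfloor_index: "t : {0..T} ==> nat \<lfloor>4 ^ m * t / T\<rfloor> <= 4 ^ m"
proof -
 assume t: "t : {0..T}"
 have "4 ^ m * t / T <= 4 ^ m" using t T by (simp add: field_simps)
 then have "\<lfloor>4 ^ m * t / T\<rfloor> <= 4 ^ m" by (metis floor_mono floor_of_int of_int_numeral of_int_power)
 then show ?thesis by (simp add: nat_le_iff)
qed

lemma qfloor_in: "t : {0..T} ==> qfloor T m t : quads T"
 unfolding qfloor_def by (rule quadsI) (rule qfloor_index)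

lemma qfloor_bounds:
 assumes "0 <= t"
 shows "qfloor T m t <= t" "t < qfloor T m t + T / 4 ^ m"
proof -
 define z where "z = 4 ^ m * t / T"
 have t: "t = T * z / 4 ^ m" using T by (simp add: z_def)
 have "0 <= z" using assms T by (simp add: z_def)
 then have e: "real (nat \<lfloor>z\<rfloor>) = of_int \<lfloor>z\<rfloor>" by simp
 have q: "qfloor T m t = T * of_int \<lfloor>z\<rfloor> / 4 ^ m" unfolding qfloor_def quad_def z_def[symmetric] e ..
 have "T * of_int \<lfloor>z\<rfloor> / 4 ^ m <= T * z / 4 ^ m"
  using T by (intro divide_right_mono mult_left_mono) auto
 then show "qfloor T m t <= t" unfolding q t[symmetric] .
 have "T * z / 4 ^ m < T * (of_int \<lfloor>z\<rfloor> + 1) / 4 ^ m"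
  using T by (intro divide_strict_right_mono mult_strict_left_mono) (linarith, auto)
 then show "t < qfloor T m t + T / 4 ^ m"
  unfolding q t[symmetric] by (simp add: distrib_left add_divide_distrib)
qed

lemma qfloor_mono: "s <= t ==> qfloor T m s <= qfloor T m t"
 unfolding qfloor_def quad_def using T
 by (intro divide_right_mono mult_left_mono) (auto intro!: nat_mono floor_mono divide_right_mono)

lemma qfloor_LIMSEQ: "0 <= t ==> (%m. qfloor T m t) ---> t"
proof (rule real_tendsto_sandwich)
 assume t: "0 <= t"
 show "\<forall>\<^sub>F m in sequentially. t - T / 4 ^ m <= qfloor T m t"
  using qfloor_bounds[OF t] by (simp add: field_simps less_imp_le)
 show "\<forall>\<^sub>F m in sequentially. qfloor T m t <= t" using qfloor_bounds[OF t] by simp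
 have "(%m. t - T * (1 / 4) ^ m) ---> t - T * 0"
  by (intro tendsto_intros LIMSEQ_power_zero) auto
 then show "(%m. t - T / 4 ^ m) ---> t" by (simp add: power_divide)
qed simp

lemma qfloor_quad:
 assumes "m <= L"
 shows "qfloor T L (quad T m k) = quad T m k"
proof -
 have "(4::real) ^ L = 4 ^ m * 4 ^ (L - m)" using assms by (simp flip: power_add)
 then have "4 ^ L * quad T m k / T = real (k * 4 ^ (L - m))"
  using T by (simp add: quad_def)
 then have "nat \<lfloor>4 ^ L * quad T m k / T\<rfloor> = k * 4 ^ (L - m)" by (metis floor_of_nat nat_int)
 then show ?thesis unfolding qfloor_def using quad_lift[OF assms] by simp
qed

lemma closure_quads: "closure (quads T) = {0..T}"
proof
 show "closure (quads T) <= {0..T}" using quads_subset by (simp add: closure_minimal)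
 show "{0..T} <= closure (quads T)"
 proof
  fix t assume "t : {0..T}"
  then show "t : closure (quads T)"
  unfolding closure_sequential using qfloor_LIMSEQ[of t] qfloor_in[of t]
  by (intro exI[of _ "%m. qfloor T m t"]) auto
 qed
qed

text \<open>Going up one level crosses at most three increments, so reaching level \<open>m\<close>
  from any finer one costs at most \<open>9 * (3/4) ^ m\<close>. The constant \<open>19\<close> is
  two such passages plus one increment between neighbouring points of level
  \<open>m\<close>.\<close>

lemma chaining:
 fixes g :: "real => real"
 assumes inc: "!!m k. m0 <= m ==> k < 4 ^ m ==> abs (g (quad T m (Suc k)) - g (quad T m k)) <= (3/4) ^ m"
 shows "uniformly_continuous_on (quads T) g"
proof -
 have steps: "abs (g (quad T m (k + j)) - g (quad T m k)) <= real j * (3/4) ^ m"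
  if "m0 <= m" "k + j <= 4 ^ m" for m k j
  using that(2)
 proof (induction j)
  case (Suc j)
  have "abs (g (quad T m (Suc (k + j))) - g (quad T m (k + j))) <= (3/4) ^ m"
  using Suc.prems that(1) by (intro inc) auto
  with Suc show ?case by (simp add: algebra_simps)
 qed simp
 have coarse: "abs (g (quad T L k) - g (quad T m (k div 4 ^ (L - m)))) <= 9 * (3/4) ^ m - 9 * (3/4) ^ L"
  if "m0 <= m" "m <= L" "k <= 4 ^ L" for m L k
  using that(2,3)
 proof (induction L arbitrary: k rule: dec_induct)
  case (step L)
  have k4: "k div 4 <= 4 ^ L" using step.prems by simp
  have "k = 4 * (k div 4) + k mod 4" by simp
  moreover have "quad T (Suc L) (4 * (k div 4)) = quad T L (k div 4)"
  using quad_lift[of L "Suc L" T "k div 4"] by (simp add: mult.commute)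
  ultimately have "abs (g (quad T (Suc L) k) - g (quad T L (k div 4))) <= real (k mod 4) * (3/4) ^ Suc L"
  using steps[of "Suc L" "4 * (k div 4)" "k mod 4"] step that(1) by simp
  also have "... <= 3 * (3/4) ^ Suc L" by (intro mult_right_mono) auto
  finally have 1: "abs (g (quad T (Suc L) k) - g (quad T L (k div 4))) <= 3 * (3/4) ^ Suc L" .
  have "k div 4 div 4 ^ (L - m) = k div 4 ^ (Suc L - m)"
  using step by (simp add: div_mult2_eq Suc_diff_le)
  then have "abs (g (quad T L (k div 4)) - g (quad T m (k div 4 ^ (Suc L - m)))) <= 9 * (3/4) ^ m - 9 * (3/4) ^ L"
  using step.IH[OF k4] by simp
  moreover have "3 * (3/4) ^ Suc L = 9 * (3/4) ^ L - 9 * (3/4 :: real) ^ Suc L" by simp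
  ultimately show ?case using 1 by linarith
 qed simp
 show ?thesis
  unfolding uniformly_continuous_on_def
 proof (intro allI impI)
  fix e :: real assume "0 < e"
  then obtain m1 where m1: "(3/4) ^ m1 < e / 19"
  using real_arch_pow_inv[of "e / 19" "3/4"] by auto
  define m where "m = max m0 m1"
  have m: "m0 <= m" "19 * (3/4) ^ m < e"
  proof -
  have "(3/4) ^ m <= ((3/4) ^ m1 :: real)" by (intro power_decreasing) (auto simp: m_def)
  then have "19 * (3/4) ^ m <= 19 * ((3/4) ^ m1 :: real)" by (rule mult_left_mono) simp
  also have "... < e" using m1 by (simp add: field_simps)
  finally show "19 * (3/4) ^ m < e" .
  qed (simp add: m_def)
  have close: "dist (g s) (g t) < e" if st: "s : quads T" "t : quads T" "s <= t" "t - s < T / 4 ^ m" for s t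
  proof -
  obtain ms where ms: "ALL L>=ms. EX k<=4 ^ L. s = quad T L k" using quads_level[OF st(1)] by blast
  obtain mt where mt: "ALL L>=mt. EX k<=4 ^ L. t = quad T L k" using quads_level[OF st(2)] by blast
  define L where "L = max m (max ms mt)"
  have L: "m <= L" "ms <= L" "mt <= L" by (auto simp: L_def)
  obtain k where k: "k <= 4 ^ L" "s = quad T L k" using ms L by blast
  obtain k' where k': "k' <= 4 ^ L" "t = quad T L k'" using mt L by blast
  have kk: "k <= k'" using st(3) T unfolding k(2) k'(2) quad_def by (simp add: field_simps)
  have "T * (real k' - real k) / 4 ^ L < T / 4 ^ m"
  using st(4) unfolding k(2) k'(2) quad_def by (simp add: right_diff_distrib diff_divide_distrib)
  then have "T * ((real k' - real k) / 4 ^ L) < T * (1 / 4 ^ m)" by simp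
  then have "(real k' - real k) / 4 ^ L < 1 / 4 ^ m" using T by (simp only: mult_less_cancel_left_pos)
  then have "real k' - real k < 4 ^ L / 4 ^ m" by (simp add: field_simps)
  also have "(4::real) ^ L = 4 ^ m * 4 ^ (L - m)" using L by (simp flip: power_add)
  also have "4 ^ m * 4 ^ (L - m) / 4 ^ m = real (4 ^ (L - m))" by simp
  finally have k'k: "k' < k + 4 ^ (L - m)" by linarith
  define c where "c = k div 4 ^ (L - m)"
  define c' where "c' = k' div 4 ^ (L - m)"
  have "c <= c'" using kk by (simp add: c_def c'_def div_le_mono)
  moreover have "c' <= (k + 4 ^ (L - m)) div 4 ^ (L - m)"
  unfolding c'_def using k'k by (intro div_le_mono) simp
  then have "c' <= c + 1" by (simp add: c_def)
  ultimately have cc: "c' = c \<or> c' = c + 1" by linarith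
  have "c' <= 4 ^ L div 4 ^ (L - m)" unfolding c'_def using k' by (intro div_le_mono)
  also have "(4::nat) ^ L div 4 ^ (L - m) = 4 ^ m" using L
  by (metis diff_diff_cancel diff_le_self power_diff zero_neq_numeral)
  finally have c'm: "c' <= 4 ^ m" .
  have "abs (g (quad T m c') - g (quad T m c)) <= (3/4) ^ m"
  using cc steps[OF m(1), of c 1] c'm by auto
  moreover have "abs (g s - g (quad T m c)) <= 9 * (3/4) ^ m"
  using coarse[OF m(1) L(1) k(1)] unfolding k(2) c_def by (smt (verit) zero_le_power zero_le_divide_iff)
  moreover have "abs (g t - g (quad T m c')) <= 9 * (3/4) ^ m"
  using coarse[OF m(1) L(1) k'(1)] unfolding k'(2) c'_def by (smt (verit) zero_le_power zero_le_divide_iff)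
  ultimately have "abs (g s - g t) <= 19 * (3/4) ^ m" by linarith
  then show ?thesis using m by (simp add: dist_real_def)
  qed
  have "dist (g s) (g t) < e" if "s : quads T" "t : quads T" "dist s t < T / 4 ^ m" for s t
  using that close[of s t] close[of t s]
  by (cases "s <= t") (auto simp: dist_real_def abs_minus_commute)
  then show "EX d>0. ALL x:quads T. ALL x':quads T. dist x' x < d --> dist (g x') (g x) < e"
  using T by (intro exI[of _ "T / 4 ^ m"]) auto
 qed
qed

end

text \<open>The threshold \<open>(3/4) ^ m\<close> meets two demands: it is summable, as chaining
  requires, and large enough that Markov's inequality with fourth powers over \<open>4 ^ m\<close>
  increments leaves the summable bound \<open>(64 / 81) ^ m\<close>. Moments are asked for at grid
  times only, since the limit process is at first controlled only there.\<close>

theorem (in prob_space) kolmogorov_continuity: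
 fixes X :: "real => 'a => real"
 assumes T: "0 < T"
  and meas[measurable]: "!!t. X t : bmeas M"
  and int: "!!s t. s : quads T ==> t : quads T ==> integrable M (%om. (X t om - X s om) ^ 4)"
  and mom: "!!s t. s : quads T ==> t : quads T ==> EE (%om. (X t om - X s om) ^ 4) <= C * (t - s)^2"
 shows "EX Z :: real => 'a => real. (ALL t. Z t : bmeas M) & (ALL om:space M. continuous_on {0..T} (%t. Z t om)) &
  (AE om in M. ALL t:quads T. Z t om = X t om)"
proof -
 note chaining = chaining[OF T] and qfloor_in = qfloor_in[OF T] and qfloor_LIMSEQ = qfloor_LIMSEQ[OF T]
  and quads_subset = quads_subset[OF T] and closure_quads = closure_quads[OF T]
 define A where "A m = {om : space M. EX k<4 ^ m. (3/4) ^ m < abs (X (quad T m (Suc k)) om - X (quad T m k) om)}" for m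
 have A[measurable]: "A m : sets M" for m unfolding A_def by measurable
 have C0: "0 <= C"
 proof -
  have "0 : quads T" "T : quads T"
  using quadsI[of 0 0 T] quadsI[of 1 0 T] by (auto simp: quad_def)
  then have "0 <= C * (T - 0)^2"
  using mom[of 0 T] by (intro order_trans[OF integral_nonneg_AE]) auto
  then show ?thesis using T by (simp add: zero_le_mult_iff)
 qed
 have "prob (A m) <= C * T^2 * (64 / 81) ^ m" for m
 proof -
  have 1: "prob {om : space M. (3/4) ^ m < abs (X (quad T m (Suc k)) om - X (quad T m k) om)}
  <= C * (T / 4 ^ m)^2 / ((3/4) ^ m) ^ 4" if k: "k < 4 ^ m" for k
  proof -
  have q: "quad T m (Suc k) : quads T" "quad T m k : quads T" using k by (auto intro: quadsI)
  have d: "quad T m (Suc k) - quad T m k = T / 4 ^ m" by (simp add: quad_def field_simps)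
  have "prob {om : space M. (3/4) ^ m < abs (X (quad T m (Suc k)) om - X (quad T m k) om)}
  <= prob {om : space M. ((3/4) ^ m) ^ 4 <= (X (quad T m (Suc k)) om - X (quad T m k) om) ^ 4}"
  proof (intro finite_measure_mono subsetI)
  fix om assume "om : {om : space M. (3/4) ^ m < abs (X (quad T m (Suc k)) om - X (quad T m k) om)}"
  then have "((3/4) ^ m) ^ 4 <= abs (X (quad T m (Suc k)) om - X (quad T m k) om) ^ 4" "om : space M"
  using power_mono[of "(3/4) ^ m" "abs (X (quad T m (Suc k)) om - X (quad T m k) om)" 4] by simp_all
  then show "om : {om : space M. ((3/4) ^ m) ^ 4 <= (X (quad T m (Suc k)) om - X (quad T m k) om) ^ 4}"
  by (simp add: power_even_abs)
  qed measurable
  also have "... <= EE (%om. (X (quad T m (Suc k)) om - X (quad T m k) om) ^ 4) / ((3/4) ^ m) ^ 4"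
  by (rule integral_Markov_inequality_measure[where A = "{}"]) (use int[OF q(2,1)] in auto)
  also have "... <= C * (T / 4 ^ m)^2 / ((3/4) ^ m) ^ 4"
  using mom[OF q(2,1)] unfolding d by (intro divide_right_mono) auto
  finally show ?thesis .
  qed
  have "A m = (\<Union>k\<in>{..<4 ^ m}. {om : space M. (3/4) ^ m < abs (X (quad T m (Suc k)) om - X (quad T m k) om)})"
  unfolding A_def by auto
  also have "prob ... <= (SUM k<4 ^ m. prob {om : space M. (3/4) ^ m < abs (X (quad T m (Suc k)) om - X (quad T m k) om)})"
  by (intro finite_measure_subadditive_finite) auto
  also have "... <= (SUM k<(4::nat) ^ m. C * (T / 4 ^ m)^2 / ((3/4) ^ m) ^ 4)"
  by (intro sum_mono 1) auto
  also have "... = C * T^2 * (64 / 81) ^ m"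
  proof -
  have "((3/4) ^ m) ^ 4 = ((3/4) ^ 4 :: real) ^ m" "(4 ^ m)^2 = (4^2 :: real) ^ m"
  by (simp_all only: power_mult[symmetric] mult.commute)
  moreover have "(64 / 81 :: real) ^ m = 4 ^ m / (4^2) ^ m / ((3/4) ^ 4) ^ m"
  unfolding power_divide[symmetric] by (simp add: power_divide)
  ultimately show ?thesis by (simp add: power_divide[of T])
  qed
  finally show ?thesis .
 qed
 then have le: "norm (prob (A m)) <= C * T^2 * (64 / 81) ^ m" for m by simp
 have "summable (%m. C * T^2 * (64 / 81 :: real) ^ m)"
  by (intro summable_mult summable_geometric) simp
 then have "summable (%m. prob (A m))"
  by (rule summable_comparison_test') (rule le)
 then have "AE om in M. eventually (%m. om : space M - A m) sequentially"
  by (intro borel_cantelli_AE1) (auto simp: less_top[symmetric])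
 define G where "G = {om : space M. EX m0. ALL m>=m0. om ~: A m}"
 have G[measurable]: "G : sets M" unfolding G_def by measurable
 have AEG: "AE om in M. om : G"
  using \<open>AE om in M. eventually (%m. om : space M - A m) sequentially\<close> AE_space
  by eventually_elim (auto simp: G_def eventually_sequentially)
 have uc: "uniformly_continuous_on (quads T) (%t. X t om)" if "om : G" for om
 proof -
  from that obtain m0 where "ALL m>=m0. om ~: A m" "om : space M" by (auto simp: G_def)
  then show ?thesis by (intro chaining[of m0]) (simp add: A_def, meson not_less)
 qed
 define cl where "cl t = max 0 (min T t)" for t
 have cl: "cl t : {0..T}" "t : {0..T} ==> cl t = t" for t using T by (auto simp: cl_def)
 \<comment> \<open>On the good event this is the continuous extension from the grid times; being a
   pointwise limit it is visibly measurable.\<close>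
 define Z where "Z t om = (if om : G then lim (%m. X (qfloor T m (cl t)) om) else 0)" for t om
 have "Z t : bmeas M" for t
  unfolding Z_def[abs_def] by measurable
 moreover have ZG: "continuous_on {0..T} (%t. Z t om) & (ALL t:quads T. Z t om = X t om)" if "om : G" for om
 proof -
  obtain g where g: "uniformly_continuous_on (closure (quads T)) g" "!!t. t : quads T ==> X t om = g t"
  using uniformly_continuous_on_extension_on_closure[OF uc[OF \<open>om : G\<close>]] by metis
  have gc: "continuous_on {0..T} g"
  using g(1) unfolding closure_quads by (rule uniformly_continuous_imp_continuous)
  have Zg: "Z t om = g t" if t: "t : {0..T}" for t
  proof -
  have "(%m. g (qfloor T m t)) ---> g t"
  proof (rule continuous_on_tendsto_compose[OF gc qfloor_LIMSEQ])
  show "\<forall>\<^sub>F m in sequentially. qfloor T m t : {0..T}"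
  using qfloor_in[OF t] quads_subset by (intro always_eventually) blast
  qed (use t in auto)
  then have "(%m. X (qfloor T m t) om) ---> g t" using g(2)[OF qfloor_in[OF t]] by simp
  then show ?thesis using \<open>om : G\<close> cl(2)[OF t] by (simp add: Z_def limI)
  qed
  show ?thesis
  using gc continuous_on_cong[of "{0..T}" "{0..T}" "%t. Z t om" g] Zg g(2) quads_subset by auto
 qed
 moreover have "continuous_on {0..T} (%t. Z t om)" for om
  using ZG[of om] by (cases "om : G") (auto simp: Z_def)
 moreover have "AE om in M. ALL t:quads T. Z t om = X t om"
  using AEG by eventually_elim (use ZG in auto)
 ultimately show ?thesis by blast
qed

section \<open>Approximation by Lipschitz functions\<close>

text \<open>Inner regularity provides a compact subset of \<open>B\<close> of almost full measure,
  and the indicator of a compact set is the pointwise limit of truncated distance functions, which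
  are Lipschitz.\<close>

lemma indicator_lipschitz_approx:
 fixes \<nu> :: "'a::polish_space measure"
 assumes "finite_measure \<nu>" and sets: "sets \<nu> = sets borel" and B: "B : sets borel" and "0 < eps"
 shows "EX (ph :: 'a => real) L. 0 <= L & (ALL x y. abs (ph x - ph y) <= L * dist x y) & (ALL x. 0 <= ph x & ph x <= 1) &
  (\<integral>x. abs (indicator B x - ph x) \<partial>\<nu>) <= eps"
proof -
 interpret finite_measure \<nu> by fact
 have sp: "space \<nu> = UNIV" using sets_eq_imp_space_eq[OF sets] by simp
 have [measurable_cong]: "sets \<nu> = sets borel" by fact
 note B[measurable]
 have "emeasure \<nu> B = (SUP K\<in>{K. K <= B & compact K}. emeasure \<nu> K)"
  using inner_regular[of \<nu> B] sets B emeasure_finite by auto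
 moreover have "{K. K <= B & compact K} ~= {}" by auto
 moreover have "emeasure \<nu> B ~= \<infinity>" by (simp add: emeasure_eq_measure)
 ultimately have "EX K:{K. K <= B & compact K}. emeasure \<nu> B < emeasure \<nu> K + ennreal (eps / 2)"
  using \<open>0 < eps\<close> by (intro SUP_approx_ennreal) auto
 then obtain K where K: "K <= B" "compact K" "emeasure \<nu> B <= emeasure \<nu> K + ennreal (eps / 2)"
  by (auto simp: less_imp_le)
 have Km[measurable]: "K : sets borel" using K(2) by (simp add: borel_compact)
 have BK: "measure \<nu> B - measure \<nu> K <= eps / 2"
 proof -
  have "ennreal (measure \<nu> B) <= ennreal (measure \<nu> K + eps / 2)"
  using K(3) \<open>0 < eps\<close> by (simp add: emeasure_eq_measure)
  then show ?thesis using \<open>0 < eps\<close> by (subst (asm) ennreal_le_iff) auto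
 qed
 have bk: "(\<integral>x. abs (indicator B x - indicator K x :: real) \<partial>\<nu>) <= eps / 2"
 proof -
  have "(\<integral>x. abs (indicator B x - indicator K x :: real) \<partial>\<nu>) = (\<integral>x. indicator B x - indicator K x \<partial>\<nu>)"
  using K(1) by (intro Bochner_Integration.integral_cong) (auto split: split_indicator)
  also have "... = measure \<nu> B - measure \<nu> K"
  by (subst Bochner_Integration.integral_diff) (auto simp: sets sp emeasure_eq_measure)
  finally show ?thesis using BK by simp
 qed
 show ?thesis
 proof (cases "K = {}")
  case True
  then show ?thesis using bk \<open>0 < eps\<close> by (intro exI[of _ "%_. 0"] exI[of _ 0]) auto
 next
  case False
  define ph where "ph m x = max 0 (1 - real m * infdist x K)" for m and x :: 'a
  have phm[measurable]: "ph m : bmeas borel" for m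
  unfolding ph_def by (intro borel_measurable_continuous_onI continuous_intros)
  have ph01: "0 <= ph m x" "ph m x <= 1" for m x
  by (auto simp: ph_def infdist_nonneg)
  have lim: "(%m. ph m x) ---> indicator K x" for x
  proof (cases "x : K")
  case True
  then show ?thesis by (simp add: ph_def)
  next
  case xK: False
  have d: "0 < infdist x K"
  using xK False K(2) compact_imp_closed in_closed_iff_infdist_zero[of K x] infdist_nonneg[of x K]
  by force
  obtain N :: nat where N: "1 / infdist x K < N" using reals_Archimedean2 by blast
  have "ph m x = 0" if "N <= m" for m
  proof -
  have "1 < real N * infdist x K" using N d by (simp add: field_simps)
  also have "... <= real m * infdist x K" using that d by (intro mult_right_mono) auto
  finally show ?thesis by (simp add: ph_def)
  qed
  then have "eventually (%m. ph m x = 0) sequentially" by (auto simp: eventually_sequentially)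
  then show ?thesis using xK by (simp add: tendsto_eventually)
  qed
  have "(%m. \<integral>x. abs (indicator K x - ph m x) \<partial>\<nu>) ---> (\<integral>x. 0 \<partial>\<nu>)"
  proof (rule integral_dominated_convergence[where w = "%_. 1"])
  show "AE x in \<nu>. (%m. abs (indicator K x - ph m x)) ---> 0"
  proof (intro AE_I2)
  fix x
  have "(%m. abs (indicator K x - ph m x)) ---> abs (indicator K x - indicator K x :: real)"
  by (intro tendsto_intros lim)
  then show "(%m. abs (indicator K x - ph m x)) ---> 0" by simp
  qed
  show "AE x in \<nu>. norm \<bar>indicator K x - ph m x\<bar> <= 1" for m
  using ph01[of m] by (intro AE_I2) (auto split: split_indicator)
  qed auto
  then have "eventually (%m. (\<integral>x. abs (indicator K x - ph m x) \<partial>\<nu>) < eps / 2) sequentially"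
  using \<open>0 < eps\<close> by (intro order_tendstoD) auto
  then obtain m where m: "(\<integral>x. abs (indicator K x - ph m x) \<partial>\<nu>) < eps / 2"
  by (auto simp: eventually_sequentially)
  have i1: "integrable \<nu> (%x. abs (indicator K x - ph m x))" "integrable \<nu> (%x. abs (indicator B x - indicator K x :: real))"
  "integrable \<nu> (%x. abs (indicator B x - ph m x))"
  using ph01[of m] by (auto intro!: integrable_const_bound[where B = 1] split: split_indicator)
  have "(\<integral>x. abs (indicator B x - ph m x) \<partial>\<nu>) <= (\<integral>x. abs (indicator B x - indicator K x) + abs (indicator K x - ph m x) \<partial>\<nu>)"
  using i1 by (intro integral_mono) auto
  also have "... <= eps" using i1 bk m by simp
  finally have "(\<integral>x. abs (indicator B x - ph m x) \<partial>\<nu>) <= eps" .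
  moreover have "abs (ph m x - ph m y) <= real m * dist x y" for x y
  proof -
  have "abs (infdist x K - infdist y K) <= dist x y"
  using infdist_triangle_abs by blast
  then have "abs (real m * infdist x K - real m * infdist y K) <= real m * dist x y"
  by (simp add: abs_mult mult_left_mono flip: right_diff_distrib)
  moreover have "abs (max 0 (1 - a) - max 0 (1 - b)) <= abs (a - b)" for a b :: real by linarith
  ultimately show ?thesis unfolding ph_def using order_trans by blast
  qed
  ultimately show ?thesis using ph01 by (intro exI[of _ "ph m"] exI[of _ "real m"]) auto
 qed
qed

text \<open>Layer-cake decomposition: up to \<open>D / n\<close> the function is a constant plus a
  sum of indicators of level sets, and each of these is replaced by a Lipschitz function with values
  in \<open>{0..1}\<close>. The range \<open>{lo..hi}\<close> is preserved because the quotients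
  formed later are Lipschitz only away from zero.\<close>

theorem lipschitz_dense:
 fixes \<nu> :: "'a::polish_space measure" and v :: "'a => real"
 assumes \<nu>: "finite_measure \<nu>" and sets: "sets \<nu> = sets borel" and v[measurable]: "v : bmeas borel"
  and range: "!!x. lo <= v x" "!!x. v x <= hi" and eps: "0 < eps"
 shows "EX w L. 0 <= L & (ALL x y. abs (w x - w y) <= L * dist x y) & (ALL x. lo <= w x & w x <= hi) &
  (\<integral>x. abs (v x - w x) \<partial>\<nu>) <= eps"
proof (cases "lo < hi")
 case False
 then have "v x = lo" for x using range[of x] by linarith
 then show ?thesis using False eps range by (intro exI[of _ "%_. lo"] exI[of _ 0]) auto
next
 case True
 interpret finite_measure \<nu> by fact
 have [measurable_cong]: "sets \<nu> = sets borel" by fact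
 define R where "R = measure \<nu> (space \<nu>)"
 have R: "0 <= R" by (simp add: R_def)
 define D where "D = hi - lo"
 have D: "0 < D" using True by (simp add: D_def)
 obtain N :: nat where N: "2 * D * R / eps < N" using reals_Archimedean2 by blast
 define n where "n = Suc N"
 have n: "0 < real n" "D / real n * R <= eps / 2"
 proof -
  have "2 * D * R / eps <= real n" using N by (simp add: n_def)
  then show "D / real n * R <= eps / 2" using eps by (simp add: field_simps n_def)
 qed (simp add: n_def)
 define B where "B j = {x. lo + D * real j / real n <= v x}" for j
 have B[measurable]: "B j : sets borel" for j unfolding B_def by measurable
 have "ALL j. EX (ph :: 'a => real) L. 0 <= L & (ALL x y. abs (ph x - ph y) <= L * dist x y) & (ALL x. 0 <= ph x & ph x <= 1) &
  (\<integral>x. abs (indicator (B j) x - ph x) \<partial>\<nu>) <= eps / (2 * D)"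
  using eps D by (intro allI indicator_lipschitz_approx[OF \<nu> sets B]) auto
 from choice[OF this] obtain ph where "ALL j. EX L. 0 <= L & (ALL x y. abs (ph j x - ph j y) <= L * dist x y) &
  (ALL x. 0 <= ph j x & ph j x <= 1) & (\<integral>x. abs (indicator (B j) x - ph j x) \<partial>\<nu>) <= eps / (2 * D)" by blast
 from choice[OF this] obtain L where "ALL j. 0 <= L j & (ALL x y. abs (ph j x - ph j y) <= L j * dist x y) &
  (ALL x. 0 <= ph j x & ph j x <= 1) & (\<integral>x. abs (indicator (B j) x - ph j x) \<partial>\<nu>) <= eps / (2 * D)" by blast
 then have L: "!!j. 0 <= L j" "!!j x y. abs (ph j x - ph j y) <= L j * dist x y"
  and ph: "!!j x. 0 <= ph j x" "!!j x. ph j x <= 1"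
  and app: "!!j. (\<integral>x. abs (indicator (B j) x - ph j x) \<partial>\<nu>) <= eps / (2 * D)" by blast+
 have phm[measurable]: "ph j : bmeas borel" for j
 proof (rule borel_measurable_continuous_onI)
  have "(L j)-lipschitz_on UNIV (ph j)"
  using L by (auto simp: lipschitz_on_def dist_real_def)
  then show "continuous_on UNIV (ph j)" by (rule lipschitz_on_continuous_on)
 qed
 define w where "w x = lo + D / real n * (SUM j=1..n. ph j x)" for x
 define w0 where "w0 x = lo + D / real n * (SUM j=1..n. indicator (B j) x)" for x
 have vw0: "abs (v x - w0 x) <= D / real n" for x
 proof -
  define u where "u = (v x - lo) / D * real n"
  have u: "0 <= u" "u <= real n" using range[of x] D n
  by (auto simp: u_def D_def field_simps intro: mult_right_mono)
  have vu: "v x = lo + D / real n * u" using D n by (simp add: u_def)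
  have "x : B j \<longleftrightarrow> real j <= u" for j using D n by (simp add: B_def u_def field_simps)
  then have "(SUM j=1..n. indicator (B j) x) = (SUM j=1..n. if real j <= u then 1 else 0 :: real)"
  by (intro sum.cong) (auto split: split_indicator)
  also have "... = real (card {j : {1..n}. real j <= u})"
  by (simp add: sum.If_cases Int_def)
  also have "{j : {1..n}. real j <= u} = {1..nat \<lfloor>u\<rfloor>}"
  proof -
  have "real j <= u \<longleftrightarrow> j <= nat \<lfloor>u\<rfloor>" for j
  using u by (simp add: le_nat_iff le_floor_iff)
  moreover have "real j <= u ==> j <= n" for j using u by linarith
  ultimately show ?thesis by auto
  qed
  finally have "(SUM j=1..n. indicator (B j) x) = (of_int \<lfloor>u\<rfloor> :: real)" using u by simp
  then have "v x - w0 x = D / real n * (u - of_int \<lfloor>u\<rfloor>)" by (simp add: vu w0_def right_diff_distrib)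
  moreover have "0 <= u - of_int \<lfloor>u\<rfloor>" "u - of_int \<lfloor>u\<rfloor> <= 1" by linarith+
  ultimately show ?thesis
  using mult_left_mono[of "u - of_int \<lfloor>u\<rfloor>" 1 "D / real n"] D n by (simp add: abs_mult)
 qed
 have int: "integrable \<nu> (%x. abs (indicator (B j) x - ph j x))" for j
  using ph[of j] by (auto intro!: integrable_const_bound[where B = 1] split: split_indicator)
 have w0w: "abs (w0 x - w x) <= D / real n * (SUM j=1..n. abs (indicator (B j) x - ph j x))" for x
 proof -
  have "w0 x - w x = D / real n * (SUM j=1..n. indicator (B j) x - ph j x)"
  by (simp add: w_def w0_def sum_subtractf right_diff_distrib)
  then show ?thesis using D n by (simp add: abs_mult mult_left_mono sum_abs divide_right_mono)
 qed
 have wlo: "lo <= w x" "w x <= hi" for x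
 proof -
  have "0 <= (SUM j=1..n. ph j x)" "(SUM j=1..n. ph j x) <= (SUM j=1..n. 1)"
  using ph by (auto intro!: sum_nonneg sum_mono simp del: sum_constant)
  then have "0 <= D / real n * (SUM j=1..n. ph j x)" "D / real n * (SUM j=1..n. ph j x) <= D / real n * real n"
  using D n by (auto intro!: mult_nonneg_nonneg mult_left_mono simp del: times_divide_eq_left)
  then show "lo <= w x" "w x <= hi" using n by (simp_all add: w_def D_def)
 qed
 have "abs (v x - w x) <= D / real n + D / real n * (SUM j=1..n. abs (indicator (B j) x - ph j x))" for x
  using vw0[of x] w0w[of x] by linarith
 then have "(\<integral>x. abs (v x - w x) \<partial>\<nu>) <= (\<integral>x. D / real n + D / real n * (SUM j=1..n. abs (indicator (B j) x - ph j x)) \<partial>\<nu>)"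
 proof (intro integral_mono)
  show "integrable \<nu> (%x. abs (v x - w x))"
  proof (rule integrable_const_bound[where B = D])
  show "AE x in \<nu>. norm \<bar>v x - w x\<bar> <= D"
  using range wlo by (intro AE_I2) (simp add: D_def abs_le_iff, smt (verit))
  have "w : bmeas borel" unfolding w_def[abs_def] by measurable
  then show "(%x. abs (v x - w x)) : bmeas \<nu>" by measurable
  qed
 qed (use int in auto)
 also have "... = D / real n * R + D / real n * (SUM j=1..n. \<integral>x. abs (indicator (B j) x - ph j x) \<partial>\<nu>)"
  using int by (subst Bochner_Integration.integral_add) (auto simp: R_def)
 also have "... <= eps / 2 + D / real n * (SUM j=1..n. eps / (2 * D))"
  using n D app by (intro add_mono mult_left_mono sum_mono) auto
 also have "... = eps" using n D by simp
 finally have "(\<integral>x. abs (v x - w x) \<partial>\<nu>) <= eps" .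
 moreover have "abs (w x - w y) <= (D / real n * (SUM j=1..n. L j)) * dist x y" for x y
 proof -
  have "w x - w y = D / real n * (SUM j=1..n. ph j x - ph j y)"
  by (simp add: w_def sum_subtractf right_diff_distrib)
  moreover have "abs (SUM j=1..n. ph j x - ph j y) <= (SUM j=1..n. L j * dist x y)"
  using L by (intro order_trans[OF sum_abs] sum_mono) auto
  ultimately have "abs (w x - w y) <= D / real n * (SUM j=1..n. L j * dist x y)"
  using D n by (simp add: abs_mult mult_left_mono divide_right_mono)
  then show ?thesis by (simp add: sum_distrib_right mult.assoc)
 qed
 moreover have "0 <= D / real n * (SUM j=1..n. L j)" using D n L by (simp add: sum_nonneg)
 ultimately show ?thesis using wlo by (intro exI[of _ w] exI[of _ "D / real n * (SUM j=1..n. L j)"]) auto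
qed

section \<open>Jointly measurable regression functions\<close>

text \<open>Step functions with rational values, indexed by a countable type because the measurable
  selection below takes least indices.\<close>

definition stepf :: "nat \<times> rat list => real => real" where
 "stepf q x = (let k = nat \<lfloor>(x + real (fst q)) * real (Suc (fst q))\<rfloor>
  in if 0 <= x + real (fst q) & k < length (snd q) then of_rat (snd q ! k) else 0)"

lemma stepf_measurable [measurable]: "stepf q : bmeas borel"
 unfolding stepf_def[abs_def] Let_def by measurable

text \<open>A Lipschitz approximation is sampled on a fine grid and rounded up to rationals by less
  than the mesh, whence the bound \<open>K + 1\<close>. A uniform bound is kept so that closeness in
  \<open>L^1\<close> controls quadratic risks.\<close>

lemma stepf_dense:
 fixes \<nu> :: "real measure" and ps :: "real => real"
 assumes \<nu>: "finite_measure \<nu>" and sets: "sets \<nu> = sets borel" and ps[measurable]: "ps : bmeas borel"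
  and range: "!!x. abs (ps x) <= K" and eps: "0 < eps"
 shows "EX q. (ALL x. abs (stepf q x) <= K + 1) & (\<integral>x. abs (ps x - stepf q x) \<partial>\<nu>) < eps"
proof -
 interpret finite_measure \<nu> by fact
 have [measurable_cong]: "sets \<nu> = sets borel" by fact
 have K0: "0 <= K" using range[of 0] by linarith
 have "-K <= ps x" "ps x <= K" for x using range[of x] by (auto simp: abs_le_iff)
 moreover have "0 < eps / 2" using eps by simp
 ultimately have "EX w L. 0 <= L & (ALL x y. abs (w x - w y) <= L * dist x y) & (ALL x. -K <= w x & w x <= K) &
  (\<integral>x. abs (ps x - w x) \<partial>\<nu>) <= eps / 2"
  by (rule lipschitz_dense[OF \<nu> sets ps])
 then obtain w L where L: "0 <= L" "!!x y. abs (w x - w y) <= L * dist x y" and wr: "!!x. - K <= w x" "!!x. w x <= K"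
  and app: "(\<integral>x. abs (ps x - w x) \<partial>\<nu>) <= eps / 2" by blast
 have wm[measurable]: "w : bmeas borel"
 proof (rule borel_measurable_continuous_onI)
  have "L-lipschitz_on UNIV w" using L by (auto simp: lipschitz_on_def dist_real_def)
  then show "continuous_on UNIV w" by (rule lipschitz_on_continuous_on)
 qed
 define pt where "pt m k = real k / real (Suc m) - real m" for m k
 have "ALL m k. EX r. w (pt m k) < of_rat r & of_rat r < w (pt m k) + 1 / real (Suc m)"
  by (intro allI of_rat_dense) simp
 then obtain r where r: "!!m k. w (pt m k) < of_rat (r m k)" "!!m k. of_rat (r m k) < w (pt m k) + 1 / real (Suc m)"
  by metis
 define q where "q m = (m, map (r m) [0..<2 * m * Suc m])" for m
 have qb: "abs (stepf (q m) x) <= K + 1" for m x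
 proof -
  have "abs (of_rat (r m k) :: real) <= K + 1" for k
  proof (rule abs_leI)
  have "1 / real (Suc m) <= 1" by simp
  then show "of_rat (r m k) <= K + 1" "- of_rat (r m k) <= K + 1"
  using r[of m k] wr[of "pt m k"] by linarith+
  qed
  then show ?thesis using K0 by (auto simp: stepf_def q_def Let_def)
 qed
 have near: "abs (stepf (q m) x - w x) <= (L + 1) / real (Suc m)" if x: "abs x < real m" for m x
 proof -
  define k where "k = nat \<lfloor>(x + real m) * real (Suc m)\<rfloor>"
  have xm: "0 <= x + real m" "x + real m < 2 * real m" using x by auto
  have z0: "0 <= (x + real m) * real (Suc m)" using xm by simp
  have k: "real k <= (x + real m) * real (Suc m)" "(x + real m) * real (Suc m) < real k + 1"
  using z0 unfolding k_def by (simp_all add: of_nat_floor)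
  have "real k < 2 * real m * real (Suc m)"
  by (rule le_less_trans[OF k(1) mult_strict_right_mono[OF xm(2)]]) simp
  then have "real k < real (2 * m * Suc m)" by (simp add: algebra_simps)
  then have k2: "k < 2 * m * Suc m" by (simp only: of_nat_less_iff)
  have "stepf (q m) x = of_rat (r m k)"
  using k2 xm(1) unfolding stepf_def q_def Let_def k_def by (simp del: mult_Suc_right)
  moreover have "abs (x - pt m k) <= 1 / real (Suc m)"
  proof -
  have "real k / real (Suc m) <= x + real m" "x + real m <= (real k + 1) / real (Suc m)"
  using k by (simp_all add: field_simps)
  then show ?thesis unfolding pt_def by (simp add: add_divide_distrib abs_le_iff)
  qed
  then have "L * abs (pt m k - x) <= L * (1 / real (Suc m))" using L(1) by (intro mult_left_mono) (auto simp: abs_minus_commute)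
  then have "abs (w (pt m k) - w x) <= L / real (Suc m)"
  using L(2)[of "pt m k" x] by (simp add: dist_real_def)
  ultimately show ?thesis using r[of m k] by (simp add: add_divide_distrib abs_le_iff)
 qed
 have lim: "(%m. stepf (q m) x) ---> w x" for x
 proof (rule LIM_zero_cancel, rule Lim_null_comparison)
  obtain m0 :: nat where "abs x < m0" using reals_Archimedean2 by blast
  then show "\<forall>\<^sub>F m in sequentially. norm (stepf (q m) x - w x) <= (L + 1) / real (Suc m)"
  using near unfolding eventually_sequentially by (intro exI[of _ m0]) force
  show "(%m. (L + 1) / real (Suc m)) ---> 0"
  by (rule LIMSEQ_Suc[OF lim_const_over_n])
 qed
 have "(%m. \<integral>x. abs (w x - stepf (q m) x) \<partial>\<nu>) ---> (\<integral>x. 0 \<partial>\<nu>)"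
 proof (rule integral_dominated_convergence[where w = "%_. 2 * K + 1"])
  show "AE x in \<nu>. (%m. abs (w x - stepf (q m) x)) ---> 0"
  proof (intro AE_I2)
  fix x
  have "(%m. abs (w x - stepf (q m) x)) ---> abs (w x - w x)" by (intro tendsto_intros lim)
  then show "(%m. abs (w x - stepf (q m) x)) ---> 0" by simp
  qed
  show "AE x in \<nu>. norm \<bar>w x - stepf (q m) x\<bar> <= 2 * K + 1" for m
  using qb[of m] wr by (intro AE_I2) (simp add: abs_le_iff, smt (verit))
 qed auto
 then have "eventually (%m. (\<integral>x. abs (w x - stepf (q m) x) \<partial>\<nu>) < eps / 2) sequentially"
  using eps by (intro order_tendstoD) auto
 then obtain m where m: "(\<integral>x. abs (w x - stepf (q m) x) \<partial>\<nu>) < eps / 2" by (auto simp: eventually_sequentially)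
 have wK: "abs (w x) <= K" for x using wr[of x] by (simp add: abs_le_iff)
 have "integrable \<nu> (%x. abs (ps x - w x))" "integrable \<nu> (%x. abs (w x - stepf (q m) x))" "integrable \<nu> (%x. abs (ps x - stepf (q m) x))"
  using range wK qb[of m]
  by (auto intro!: integrable_const_bound[where B = "2 * K + 1"] AE_I2 intro: order_trans[OF abs_triangle_ineq4])
  (smt (verit))+
 then have "(\<integral>x. abs (ps x - stepf (q m) x) \<partial>\<nu>) <= (\<integral>x. abs (ps x - w x) \<partial>\<nu>) + (\<integral>x. abs (w x - stepf (q m) x) \<partial>\<nu>)"
 proof -
  assume i: "integrable \<nu> (%x. abs (ps x - w x))" "integrable \<nu> (%x. abs (w x - stepf (q m) x))" "integrable \<nu> (%x. abs (ps x - stepf (q m) x))"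
  have "(\<integral>x. abs (ps x - stepf (q m) x) \<partial>\<nu>) <= (\<integral>x. abs (ps x - w x) + abs (w x - stepf (q m) x) \<partial>\<nu>)"
  by (intro integral_mono i Bochner_Integration.integrable_add) auto
  then show ?thesis using i by simp
 qed
 also have "... < eps" using app m by simp
 finally show ?thesis using qb by blast
qed

lemma square_perturb:
 fixes g a b :: real
 assumes "abs g <= K" "abs a <= K" "abs b <= K + 1"
 shows "(g - b)^2 <= (g - a)^2 + (4 * K + 1) * abs (a - b)"
proof -
 have "(g - b)^2 - (g - a)^2 = (a - b) * (2 * g - a - b)" by (simp add: power2_eq_square algebra_simps)
 also have "... <= abs (a - b) * abs (2 * g - a - b)" unfolding abs_mult[symmetric] by (rule abs_ge_self)
 also have "... <= abs (a - b) * (4 * K + 1)"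
 proof (rule mult_left_mono)
  show "abs (2 * g - a - b) <= 4 * K + 1" using assms by linarith
 qed simp
 finally show ?thesis by (simp add: mult.commute)
qed

text \<open>For each time the regression function is the limit of near-minimisers of the quadratic risk
 over one countable family; taking least indices keeps the choice measurable in time.\<close>

theorem (in prob_space) jointly_measurable_regression:
 fixes X :: "real => 'a => real" and g :: "'a => real"
 assumes X[measurable]: "(%(t, om). X t om) : bmeas (borel \<Otimes>\<^sub>M M)"
  and g[measurable]: "g : bmeas M" and lo: "!!om. lo <= g om" and hi: "!!om. g om <= hi"
 shows "EX v. (%(t, x). v t x) : bmeas (borel \<Otimes>\<^sub>M borel) & (ALL t x. lo <= v t x & v t x <= hi) &
  (ALL t. ALL ps:bmeas borel. (ALL x. abs (ps x) <= (1::real)) -->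
  EE (%om. v t (X t om) * ps (X t om)) = EE (%om. g om * ps (X t om)))"
proof -
 have Xt[measurable]: "X t : bmeas M" for t
  using measurable_compose[OF measurable_Pair1'[of t borel M] X] by simp
 define K where "K = abs lo + abs hi"
 have gK: "abs (g om) <= K" for om using lo[of om] hi[of om] by (auto simp: K_def abs_le_iff)
 have K0: "0 <= K" by (simp add: K_def)
 define ph where "ph n = stepf (from_nat n)" for n
 have phm[measurable]: "ph n : bmeas borel" for n by (simp add: ph_def)
 define good where "good n \<longleftrightarrow> (ALL x. abs (ph n x) <= K + 1)" for n
 define Ph where "Ph n = (if good n then ph n else (%_. 0))" for n
 have Phm[measurable]: "Ph n : bmeas borel" for n by (simp add: Ph_def)
 have PhK: "abs (Ph n x) <= K + 1" for n x using K0 by (auto simp: Ph_def good_def)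
 define J where "J t n = EE (%om. (g om - Ph n (X t om))^2)" for t n
 have Jm[measurable]: "(%t. J t n) : bmeas borel" for n
 proof -
  have "(%(t, om). (g om - Ph n (X t om))^2) : bmeas (borel \<Otimes>\<^sub>M M)"
  by measurable
  then show ?thesis unfolding J_def by (intro borel_measurable_lebesgue_integral) simp
 qed
 have J0: "0 <= J t n" for t n unfolding J_def by simp
 define I where "I t = (INF n. J t n)" for t
 have bdd: "bdd_below (range (J t))" for t using J0 by (intro bdd_belowI[of _ 0]) auto
 have Im[measurable]: "I : bmeas borel"
  unfolding I_def by (intro borel_measurable_cINF) (use bdd in auto)
 have IJ: "I t <= J t n" for t n unfolding I_def using bdd by (intro cINF_lower) auto
 have intb: "integrable M h" if "h : bmeas M" "!!om. abs (h om) <= B" for h :: "'a => real" and B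
  using that by (intro integrable_const_bound[where B = B]) auto
 \<comment> \<open>The infimum over the countable family bounds the risk of every bounded Borel
   function from below. Truncating \<open>ps\<close> to an interval containing the values of
   \<open>g\<close> can only lower its risk.\<close>
 have opt: "I t <= EE (%om. (g om - ps (X t om))^2)"
  if [measurable]: "ps : bmeas borel" and psK: "!!x. abs (ps x) <= K'" for t ps K'
 proof -
  define a where "a x = max (-K) (min K (ps x))" for x
  have am[measurable]: "a : bmeas borel" unfolding a_def by measurable
  have aK: "abs (a x) <= K" for x using K0 by (auto simp: a_def)
  have "I t <= EE (%om. (g om - a (X t om))^2) + dl" if "dl > 0" for dl
  proof -
  have dl': "0 < dl / (4 * K + 1)" using that K0 by simp
  have fm: "finite_measure (distr M borel (X t))" by (rule finite_measure_distr) simp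
  obtain q where q: "!!x. abs (stepf q x) <= K + 1"
  and app: "(\<integral>x. abs (a x - stepf q x) \<partial>distr M borel (X t)) < dl / (4 * K + 1)"
  using stepf_dense[OF fm _ am aK dl'] by auto
  obtain n where n: "from_nat n = q" by (metis from_nat_to_nat)
  have Phn: "Ph n = stepf q" using q by (simp add: Ph_def good_def ph_def n)
  have app': "EE (%om. abs (a (X t om) - Ph n (X t om))) < dl / (4 * K + 1)"
  using app by (subst (asm) integral_distr) (auto simp: Phn)
  have i1: "integrable M (%om. (g om - a (X t om))^2)" "integrable M (%om. abs (a (X t om) - Ph n (X t om)))"
  "integrable M (%om. (g om - Ph n (X t om))^2)"
  proof -
  show "integrable M (%om. (g om - a (X t om))^2)"
  proof (rule intb[of _ "(2 * K)^2"])
  fix om have "abs (g om - a (X t om)) <= 2 * K" using gK[of om] aK[of "X t om"] by linarith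
  then have "abs (g om - a (X t om))^2 <= (2 * K)^2" by (rule power_mono) simp
  then show "abs ((g om - a (X t om))^2) <= (2 * K)^2" by simp
  qed measurable
  show "integrable M (%om. abs (a (X t om) - Ph n (X t om)))"
  proof (rule intb[of _ "2 * K + 1"])
  fix om show "\<bar>\<bar>a (X t om) - Ph n (X t om)\<bar>\<bar> <= 2 * K + 1" using aK[of "X t om"] PhK[of n "X t om"] by linarith
  qed measurable
  show "integrable M (%om. (g om - Ph n (X t om))^2)"
  proof (rule intb[of _ "(2 * K + 1)^2"])
  fix om have "abs (g om - Ph n (X t om)) <= 2 * K + 1" using gK[of om] PhK[of n "X t om"] by linarith
  then have "abs (g om - Ph n (X t om))^2 <= (2 * K + 1)^2" by (rule power_mono) simp
  then show "abs ((g om - Ph n (X t om))^2) <= (2 * K + 1)^2" by simp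
  qed measurable
  qed
  have "I t <= J t n" by (rule IJ)
  also have "... <= EE (%om. (g om - a (X t om))^2 + (4 * K + 1) * abs (a (X t om) - Ph n (X t om)))"
  unfolding J_def using i1 by (intro integral_mono square_perturb gK aK PhK) auto
  also have "... = EE (%om. (g om - a (X t om))^2) + (4 * K + 1) * EE (%om. abs (a (X t om) - Ph n (X t om)))"
  using i1 by simp
  also have "(4 * K + 1) * EE (%om. abs (a (X t om) - Ph n (X t om))) <= dl"
  using app' K0 by (simp add: field_simps)
  finally show ?thesis by simp
  qed
  then have "I t <= EE (%om. (g om - a (X t om))^2)" by (rule field_le_epsilon)
  also have "... <= EE (%om. (g om - ps (X t om))^2)"
  proof (rule integral_mono)
  show "integrable M (%om. (g om - a (X t om))^2)"
  proof (rule intb[of _ "(2 * K)^2"])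
  fix om have "abs (g om - a (X t om)) <= 2 * K" using gK[of om] aK[of "X t om"] by linarith
  then have "abs (g om - a (X t om))^2 <= (2 * K)^2" by (rule power_mono) simp
  then show "abs ((g om - a (X t om))^2) <= (2 * K)^2" by simp
  qed measurable
  show "integrable M (%om. (g om - ps (X t om))^2)"
  proof (rule intb[of _ "(K + K')^2"])
  fix om have "abs (g om - ps (X t om)) <= K + K'" using gK[of om] psK[of "X t om"] by linarith
  then have "abs (g om - ps (X t om))^2 <= (K + K')^2" by (rule power_mono) simp
  then show "abs ((g om - ps (X t om))^2) <= (K + K')^2" by simp
  qed measurable
  fix om
  have "abs (g om - a (X t om)) <= abs (g om - ps (X t om))" using gK[of om] by (auto simp: a_def max_def min_def)
  then show "(g om - a (X t om))^2 <= (g om - ps (X t om))^2" by (simp add: abs_le_square_iff)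
  qed
  finally show ?thesis .
 qed
 define sel where "sel k t = (LEAST n. J t n < I t + (1/4) ^ k)" for k t
 have selm[measurable]: "sel k : borel \<rightarrow>\<^sub>M UC" for k unfolding sel_def by measurable
 have sel: "J t (sel k t) < I t + (1/4) ^ k" for k t
 proof -
  have "(INF n. J t n) < I t + (1/4) ^ k" by (simp add: I_def)
  then have "EX n. J t n < I t + (1/4) ^ k" using cINF_less_iff[of UNIV "J t"] bdd by auto
  then show ?thesis unfolding sel_def by (rule LeastI_ex)
 qed
 define u where "u k t x = Ph (sel k t) x" for k t x
 have um[measurable]: "(%(t, x). u k t x) : bmeas (borel \<Otimes>\<^sub>M borel)" for k
  unfolding u_def split_beta
  by (rule measurable_compose_countable[where f = "%n z. Ph n (snd z)" and g = "%z. sel k (fst z)"]) measurable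
 have utm[measurable]: "u k t : bmeas borel" for k t by (simp add: u_def[abs_def])
 have uK: "abs (u k t x) <= K + 1" for k t x by (simp add: u_def PhK)
 \<comment> \<open>Clamping does not increase the risk, since \<open>g\<close> takes values in the
   same interval.\<close>
 define v where "v t x = max lo (min hi (lim (%k. u k t x)))" for t x
 have vm: "(%(t, x). v t x) : bmeas (borel \<Otimes>\<^sub>M borel)"
  unfolding v_def split_beta by measurable
 have vtm[measurable]: "v t : bmeas borel" for t unfolding v_def[abs_def] by measurable
 have lohi: "lo <= hi" using lo[of undefined] hi[of undefined] by linarith
 have vr: "lo <= v t x" "v t x <= hi" for t x using lohi by (auto simp: v_def)
 have ui: "integrable M (%om. (u k t (X t om) - u l t (X t om))^2)" "integrable M (%om. (g om - u k t (X t om))^2)"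
  "integrable M (%om. (g om - (u k t (X t om) + u l t (X t om)) / 2)^2)" for k l t
 proof -
  show "integrable M (%om. (u k t (X t om) - u l t (X t om))^2)"
  proof (rule intb[of _ "(2 * K + 2)^2"])
  fix om have "abs (u k t (X t om) - u l t (X t om)) <= 2 * K + 2" using uK[of k t "X t om"] uK[of l t "X t om"] by linarith
  then have "abs (u k t (X t om) - u l t (X t om))^2 <= (2 * K + 2)^2" by (rule power_mono) simp
  then show "abs ((u k t (X t om) - u l t (X t om))^2) <= (2 * K + 2)^2" by simp
  qed measurable
  show "integrable M (%om. (g om - u k t (X t om))^2)"
  proof (rule intb[of _ "(2 * K + 1)^2"])
  fix om have "abs (g om - u k t (X t om)) <= 2 * K + 1" using gK[of om] uK[of k t "X t om"] by linarith
  then have "abs (g om - u k t (X t om))^2 <= (2 * K + 1)^2" by (rule power_mono) simp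
  then show "abs ((g om - u k t (X t om))^2) <= (2 * K + 1)^2" by simp
  qed measurable
  show "integrable M (%om. (g om - (u k t (X t om) + u l t (X t om)) / 2)^2)"
  proof (rule intb[of _ "(2 * K + 1)^2"])
  fix om have "abs (g om - (u k t (X t om) + u l t (X t om)) / 2) <= 2 * K + 1"
  using gK[of om] uK[of k t "X t om"] uK[of l t "X t om"] by (simp add: abs_le_iff field_simps)
  then have "abs (g om - (u k t (X t om) + u l t (X t om)) / 2)^2 <= (2 * K + 1)^2" by (rule power_mono) simp
  then show "abs ((g om - (u k t (X t om) + u l t (X t om)) / 2)^2) <= (2 * K + 1)^2" by simp
  qed measurable
 qed
 \<comment> \<open>Parallelogram identity: two near-minimisers whose midpoint cannot beat the
   infimum are close in \<open>L^2\<close>. The tolerance \<open>(1/4) ^ k\<close> then makes the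
   successive differences summable in \<open>L^1\<close>.\<close>
 have cauchy: "EE (%om. (u (Suc k) t (X t om) - u k t (X t om))^2) <= 4 * (1/4) ^ k" for k t
 proof -
  have "(a - b)^2 = 2 * (c - a)^2 + 2 * (c - b)^2 - 4 * (c - (a + b) / 2)^2" for a b c :: real
  by (simp add: power2_eq_square field_simps)
  then have "EE (%om. (u (Suc k) t (X t om) - u k t (X t om))^2) =
  EE (%om. 2 * (g om - u (Suc k) t (X t om))^2 + 2 * (g om - u k t (X t om))^2
  - 4 * (g om - (u (Suc k) t (X t om) + u k t (X t om)) / 2)^2)" by presburger
  also have "... = 2 * J t (sel (Suc k) t) + 2 * J t (sel k t)
  - 4 * EE (%om. (g om - (u (Suc k) t (X t om) + u k t (X t om)) / 2)^2)"
  using ui(2)[of "Suc k" t] ui(2)[of k t] ui(3)[of "Suc k" t k] by (simp add: J_def u_def)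
  also have "... <= 2 * (I t + (1/4) ^ Suc k) + 2 * (I t + (1/4) ^ k) - 4 * I t"
  proof -
  have "I t <= EE (%om. (g om - (u (Suc k) t (X t om) + u k t (X t om)) / 2)^2)"
  proof (rule opt[of "%x. (u (Suc k) t x + u k t x) / 2" "K + 1"])
  show "abs ((u (Suc k) t x + u k t x) / 2) <= K + 1" for x
  using uK[of k t x] uK[of "Suc k" t x] by (simp add: abs_le_iff)
  qed measurable
  moreover have "2 * a + 2 * b - 4 * c <= 2 * (i + x) + 2 * (i + y) - 4 * i"
  if "i <= c" "b < i + y" "a < i + x" for a b c i x y :: real using that by (simp add: distrib_left)
  ultimately show ?thesis using sel[of t k] sel[of t "Suc k"] by blast
  qed
  also have "... <= 4 * (1/4) ^ k" by simp
  finally show ?thesis .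
 qed
 have conv: "AE om in M. convergent (%k. u k t (X t om))" for t
 proof -
  define d where "d k om = abs (u (Suc k) t (X t om) - u k t (X t om))" for k om
  have dm[measurable]: "d k : bmeas M" for k unfolding d_def by measurable
  have d0: "0 <= d k om" for k om by (simp add: d_def)
  have "(\<integral>\<^sup>+om. ennreal (d k om) \<partial>M) <= ennreal (3 * (1/2) ^ k)" for k
  proof -
  have AM: "d k om <= (1/2) ^ k + 2 ^ k / 2 * (d k om)^2" for om
  proof -
  have "0 <= (d k om * 2 ^ k - 1)^2 / 2 ^ k" by simp
  also have "... = 2 ^ k * (d k om)^2 - 2 * d k om + (1/2) ^ k"
  by (simp add: power2_diff field_simps power2_eq_square power_divide)
  finally have "2 * d k om <= 2 ^ k * (d k om)^2 + (1/2) ^ k" by simp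
  moreover have "0 <= (1/2 :: real) ^ k" by simp
  ultimately show ?thesis by linarith
  qed
  have i: "integrable M (%om. (d k om)^2)" unfolding d_def using ui(1)[of "Suc k" t k] by simp
  have i': "integrable M (d k)"
  proof (rule intb[of _ "2 * K + 2"])
  show "abs (d k om) <= 2 * K + 2" for om
  using uK[of k t "X t om"] uK[of "Suc k" t "X t om"] unfolding d_def by linarith
  qed measurable
  have "EE (d k) <= EE (%om. (1/2) ^ k + 2 ^ k / 2 * (d k om)^2)"
  using i i' AM by (intro integral_mono) auto
  also have "... = (1/2) ^ k + 2 ^ k / 2 * EE (%om. (d k om)^2)" using i by (simp add: prob_space)
  also have "... <= (1/2) ^ k + 2 ^ k / 2 * (4 * (1/4) ^ k)"
  using cauchy[of k t] by (intro add_left_mono mult_left_mono) (auto simp: d_def)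
  also have "... = 3 * (1/2) ^ k"
  proof -
  have "(2::real) ^ k * (1/4) ^ k = (1/2) ^ k" by (simp flip: power_mult_distrib)
  then show ?thesis by simp
  qed
  finally have "EE (d k) <= 3 * (1/2) ^ k" .
  then show ?thesis using i' d0 by (simp add: nn_integral_eq_integral ennreal_leI)
  qed
  then have "(\<integral>\<^sup>+om. (\<Sum>k. ennreal (d k om)) \<partial>M) <= (\<Sum>k. ennreal (3 * (1/2) ^ k))"
  by (subst nn_integral_suminf) (auto intro!: suminf_le)
  also have "... < \<infinity>"
  proof -
  have "(\<Sum>k. ennreal (3 * (1/2) ^ k)) = ennreal (\<Sum>k. 3 * (1/2) ^ k)"
  by (rule suminf_ennreal2) (auto intro!: summable_mult summable_geometric)
  then show ?thesis by (simp add: less_top[symmetric])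
  qed
  finally have "AE om in M. (\<Sum>k. ennreal (d k om)) ~= \<infinity>"
  by (intro nn_integral_PInf_AE) (auto simp: less_top[symmetric])
  then show ?thesis
  proof eventually_elim
  case (elim om)
  then have "summable (%k. d k om)" using d0 by (intro summable_suminf_not_top) auto
  then have "summable (%k. u (Suc k) t (X t om) - u k t (X t om))"
  unfolding d_def by (rule summable_rabs_cancel)
  then have "convergent (%n. SUM k<n. u (Suc k) t (X t om) - u k t (X t om))"
  by (simp add: summable_iff_convergent)
  then have "convergent (%n. (u n t (X t om) - u 0 t (X t om)) + u 0 t (X t om))"
  unfolding sum_lessThan_telescope[of "%k. u k t (X t om)"] by (intro convergent_add convergent_const)
  then show ?case by simp
  qed
 qed
 have limE: "EE (%om. (g om - v t (X t om))^2) <= I t" for t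
 proof -
  have "(%k. EE (%om. (g om - u k t (X t om))^2)) ---> EE (%om. (g om - lim (%k. u k t (X t om)))^2)"
  proof (rule integral_dominated_convergence[where w = "%_. (2 * K + 1)^2"])
  show "AE om in M. (%k. (g om - u k t (X t om))^2) ---> (g om - lim (%k. u k t (X t om)))^2"
  using conv[of t] by eventually_elim (intro tendsto_intros, simp add: convergent_LIMSEQ_iff)
  show "AE om in M. norm ((g om - u k t (X t om))^2) <= (2 * K + 1)^2" for k
  proof (intro AE_I2)
  fix om have "abs (g om - u k t (X t om)) <= 2 * K + 1" using gK[of om] uK[of k t "X t om"] by linarith
  then have "abs (g om - u k t (X t om))^2 <= (2 * K + 1)^2" by (rule power_mono) simp
  then show "norm ((g om - u k t (X t om))^2) <= (2 * K + 1)^2" by simp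
  qed
  qed auto
  moreover have "(%k. I t + (1/4) ^ k) ---> I t + 0" by (intro tendsto_intros LIMSEQ_power_zero) auto
  moreover have "EE (%om. (g om - u k t (X t om))^2) <= I t + (1/4) ^ k" for k
  using sel[of t k] by (simp add: J_def u_def)
  ultimately have 1: "EE (%om. (g om - lim (%k. u k t (X t om)))^2) <= I t"
  by (intro LIMSEQ_le[of "%k. EE (%om. (g om - u k t (X t om))^2)" _ "%k. I t + (1/4) ^ k"]) auto
  have limb: "AE om in M. abs (lim (%k. u k t (X t om))) <= K + 1"
  using conv[of t]
  proof eventually_elim
  case (elim om)
  then have "(%k. abs (u k t (X t om))) ---> abs (lim (%k. u k t (X t om)))"
  by (intro tendsto_rabs) (simp add: convergent_LIMSEQ_iff)
  then show ?case by (rule LIMSEQ_le_const2) (use uK in auto)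
  qed
  have "EE (%om. (g om - v t (X t om))^2) <= EE (%om. (g om - lim (%k. u k t (X t om)))^2)"
  proof (rule integral_mono_AE)
  show "integrable M (%om. (g om - lim (%k. u k t (X t om)))^2)"
  proof (rule integrable_const_bound[where B = "(2 * K + 1)^2"])
  show "AE om in M. norm ((g om - lim (%k. u k t (X t om)))^2) <= (2 * K + 1)^2"
  using limb
  proof eventually_elim
  case (elim om)
  then have "abs (g om - lim (%k. u k t (X t om))) <= 2 * K + 1" using gK[of om] by linarith
  then have "abs (g om - lim (%k. u k t (X t om)))^2 <= (2 * K + 1)^2" by (rule power_mono) simp
  then show ?case by simp
  qed
  qed measurable
  have "(g om - v t x)^2 <= (g om - lim (%k. u k t x))^2" for om x
  proof -
  have "abs (g om - v t x) <= abs (g om - lim (%k. u k t x))"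
  unfolding v_def using lo[of om] hi[of om] by linarith
  then show ?thesis by (simp add: abs_le_square_iff)
  qed
  then show "AE om in M. (g om - v t (X t om))^2 <= (g om - lim (%k. u k t (X t om)))^2" by simp
  show "integrable M (%om. (g om - v t (X t om))^2)"
  proof (rule intb[of _ "(hi - lo)^2"])
  fix om have "abs (g om - v t (X t om)) <= hi - lo" using lo[of om] hi[of om] vr[of t "X t om"] by linarith
  then have "abs (g om - v t (X t om))^2 <= (hi - lo)^2" by (rule power_mono) simp
  then show "abs ((g om - v t (X t om))^2) <= (hi - lo)^2" by simp
  qed measurable
  qed
  with 1 show ?thesis by simp
 qed
 have orth: "EE (%om. v t (X t om) * ps (X t om)) = EE (%om. g om * ps (X t om))"
  if [measurable]: "ps : bmeas borel" and ps1: "!!x. abs (ps x) <= 1" for t ps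
 proof -
  define e where "e om = g om - v t (X t om)" for om
  define p where "p om = ps (X t om)" for om
  have [measurable]: "e : bmeas M" "p : bmeas M" unfolding e_def p_def by measurable
  have eb: "abs (e om) <= hi - lo" for om using lo[of om] hi[of om] vr[of t "X t om"] unfolding e_def by linarith
  have pb: "abs (p om) <= 1" for om by (simp add: p_def ps1)
  have i: "integrable M (%om. (e om)^2)" "integrable M (%om. e om * p om)" "integrable M (%om. (p om)^2)"
  proof -
  show "integrable M (%om. (e om)^2)"
  using power_mono[OF eb, where n = 2] by (intro intb[of _ "(hi - lo)^2"]) auto
  show "integrable M (%om. (p om)^2)"
  using power_mono[OF pb, where n = 2] by (intro intb[of _ "1"]) auto
  show "integrable M (%om. e om * p om)"
  using mult_mono[OF eb pb] lohi by (intro intb[of _ "hi - lo"]) (auto simp: abs_mult)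
  qed
  define c where "c = EE (%om. e om * p om)"
  \<comment> \<open>First variation: moving the minimiser by \<open>s\<close> in the direction
    \<open>ps\<close> cannot lower the risk. At \<open>s = c\<close> this forces
    \<open>c = 0\<close>.\<close>
  have key: "2 * s * c <= s^2" for s
  proof -
  have "EE (%om. (e om)^2) <= I t" using limE[of t] by (simp add: e_def)
  also have "I t <= EE (%om. (g om - (v t (X t om) + s * ps (X t om)))^2)"
  proof (rule opt[of "%x. v t x + s * ps x" "K + abs s"])
  fix x
  have "abs (v t x) <= K" using vr[of t x] by (auto simp: K_def abs_le_iff)
  moreover have "abs (s * ps x) <= abs s" using mult_left_mono[OF ps1[of x], of "abs s"] by (simp add: abs_mult)
  ultimately show "abs (v t x + s * ps x) <= K + abs s" by linarith
  qed measurable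
  also have "... = EE (%om. (e om)^2 - 2 * s * (e om * p om) + s^2 * (p om)^2)"
  by (rule Bochner_Integration.integral_cong) (simp_all add: e_def p_def power2_eq_square algebra_simps)
  also have "... = EE (%om. (e om)^2) - 2 * s * c + s^2 * EE (%om. (p om)^2)"
  unfolding c_def using i by simp
  also have "s^2 * EE (%om. (p om)^2) <= s^2 * 1"
  proof (rule mult_left_mono)
  show "EE (%om. (p om)^2) <= 1"
  using power_mono[OF pb, where n = 2] i(3) by (intro integral_le_const) auto
  qed simp
  finally show ?thesis by simp
  qed
  have "c = 0" using key[of c] by (simp add: power2_eq_square) (smt (verit) not_sum_squares_lt_zero mult_nonneg_nonneg zero_le_square mult_eq_0_iff)
  moreover have "c = EE (%om. g om * ps (X t om)) - EE (%om. v t (X t om) * ps (X t om))"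
  proof -
  have "integrable M (%om. g om * ps (X t om))"
  using mult_mono[OF gK pb] K0 by (intro intb[of _ "K"]) (auto simp: abs_mult p_def)
  moreover have "integrable M (%om. v t (X t om) * ps (X t om))"
  proof (rule intb[of _ "K"])
  fix om
  have "abs (v t (X t om)) <= K" using vr[of t "X t om"] by (auto simp: K_def abs_le_iff)
  from mult_mono[OF this ps1[of "X t om"]] show "abs (v t (X t om) * ps (X t om)) <= K"
  using K0 by (simp add: abs_mult)
  qed measurable
  ultimately show ?thesis unfolding c_def e_def p_def
  by (simp add: left_diff_distrib)
  qed
  ultimately show ?thesis by simp
 qed
 show ?thesis using vm vr orth by (intro exI[of _ v]) auto
qed

section \<open>Independence from characteristic functions\<close>

text \<open>A continuous upper approximation of the indicator of \<open>{..a}\<close>; limits in law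
  are available for continuous test functions only.\<close>

definition ramp :: "nat => real => real => real" where
 "ramp k a x = max 0 (min 1 (1 - real k * (x - a)))"

lemma ramp_bounds: "0 <= ramp k a x" "ramp k a x <= 1"
 by (auto simp: ramp_def)

lemma ramp_measurable [measurable]: "ramp k a : bmeas borel"
 unfolding ramp_def[abs_def] by measurable

lemma continuous_ramp: "continuous_on UNIV (ramp k a)"
 unfolding ramp_def[abs_def] by (intro continuous_intros)

lemma ramp_LIMSEQ: "(%k. ramp k a x) ---> indicator {..a} x"
proof (cases "x <= a")
 case True
 then have "real k * (x - a) <= 0" for k by (simp add: mult_nonneg_nonpos)
 then have "ramp k a x = 1" for k by (simp add: ramp_def max_def min_def)
 then show ?thesis using True by simp
next
 case False
 obtain N :: nat where N: "1 / (x - a) < N" using reals_Archimedean2 by blast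
 have "ramp k a x = 0" if "N <= k" for k
 proof -
  have "1 < real N * (x - a)" using N False by (simp add: field_simps)
  also have "... <= real k * (x - a)" using that False by (intro mult_right_mono) auto
  finally show ?thesis by (simp add: ramp_def)
 qed
 then have "eventually (%k. ramp k a x = 0) sequentially" by (auto simp: eventually_sequentially)
 then show ?thesis using False by (simp add: tendsto_eventually)
qed

lemma (in prob_space) char_eq_imp_distr_eq:
 fixes D D' :: "'a => real"
 assumes "prob_space N" "prob_space N'" "sets N = sets borel" "sets N' = sets borel" "char N = char N'"
 shows "N = N'"
proof -
 have "real_distribution N" "real_distribution N'"
  using assms by (auto simp: real_distribution_def real_distribution_axioms_def)
 then show ?thesis using assms(5) by (rule Levy_uniqueness)
qed

lemma char_normal:
 assumes "0 < sg"
 shows "char (density lborel (normal_density 0 sg)) th = exp (- (th^2 * sg^2 / 2))"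
proof -
 interpret N: prob_space "density lborel (normal_density 0 sg)"
  using assms by (rule prob_space_normal_density)
 have "distributed (density lborel (normal_density 0 sg)) lborel (%x. x) (normal_density 0 sg)"
  unfolding distributed_def by (auto intro!: distr_id2[symmetric] simp: distr_id2)
 then have "distributed (density lborel (normal_density 0 sg)) lborel (%x. (x - 0) / sg) std_normal_density"
  using N.normal_standard_normal_convert[OF assms, of "%x. x" 0] by simp
 then have d: "distr (density lborel (normal_density 0 sg)) lborel (%x. x / sg) = std_normal_distribution"
  by (simp add: distributed_def)
 have "char (density lborel (normal_density 0 sg)) th = (CLINT x|density lborel (normal_density 0 sg). iexp (th * sg * (x / sg)))"
  unfolding char_def using assms by simp
 also have "... = (CLINT y|distr (density lborel (normal_density 0 sg)) lborel (%x. x / sg). iexp (th * sg * y))"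
  by (subst integral_distr) auto
 also have "... = char std_normal_distribution (th * sg)"
  unfolding d char_def ..
 also have "... = exp (- (th^2 * sg^2 / 2))"
  by (simp add: char_std_normal_distribution power_mult_distrib)
 finally show ?thesis .
qed

lemma (in prob_space) distributed_normalI:
 assumes [measurable]: "D : bmeas M" and sg: "0 < sg"
  and char: "!!th. (CLINT om|M. iexp (th * D om)) = exp (- (th^2 * sg^2 / 2))"
 shows "distributed M lborel D (normal_density 0 sg)"
proof -
 have "distr M borel D = density lborel (normal_density 0 sg)"
 proof (rule char_eq_imp_distr_eq)
  show "char (distr M borel D) = char (density lborel (normal_density 0 sg))"
  proof
  fix th
  have "char (distr M borel D) th = (CLINT om|M. iexp (th * D om))"
  unfolding char_def by (subst integral_distr) auto
  then show "char (distr M borel D) th = char (density lborel (normal_density 0 sg)) th"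
  using char[of th] char_normal[OF sg] by simp
  qed
 qed (auto intro: prob_space_distr prob_space_normal_density sg)
 moreover have "distr M lborel D = distr M borel D" by (rule distr_cong) auto
 ultimately show ?thesis unfolding distributed_def by simp
qed

text \<open>Conditioning on \<open>A\<close> leaves the characteristic function of \<open>D\<close>,
  hence its law, unchanged, and this is independence of \<open>A\<close> and
  \<open>D\<close>.\<close>

lemma (in prob_space) indep_prob_of_char:
 assumes [measurable]: "D : bmeas M" "A : events"
  and char: "!!th. (CLINT om|M. indicator A om *\<^sub>R iexp (th * D om)) = prob A *\<^sub>R (CLINT om|M. iexp (th * D om))"
  and B[measurable]: "B : sets borel"
 shows "prob (A Int (D -` B Int space M)) = prob A * prob (D -` B Int space M)"
proof (cases "prob A = 0")
 case True
 then have "prob (A Int (D -` B Int space M)) <= 0"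
  using finite_measure_mono[of "A Int (D -` B Int space M)" A] by simp
 then show ?thesis using True by (simp add: measure_le_0_iff)
next
 case False
 then have pA: "0 < prob A" using measure_nonneg[of M A] by linarith
 define N where "N = density M (%om. ennreal (indicator A om / prob A))"
 have N: "prob_space N"
 proof
  have "emeasure N (space N) = (\<integral>\<^sup>+om. ennreal (1 / prob A) * indicator A om \<partial>M)"
  unfolding N_def by (subst emeasure_density) (auto intro!: nn_integral_cong split: split_indicator)
  also have "... = ennreal (1 / prob A) * emeasure M A" by (simp add: nn_integral_cmult_indicator)
  also have "... = 1" using pA by (simp add: emeasure_eq_measure ennreal_mult[symmetric])
  finally show "emeasure N (space N) = 1" .
 qed
 interpret N: prob_space N by (rule N)
 have [measurable_cong]: "sets N = sets M" by (simp add: N_def)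
 have "distr N borel D = distr M borel D"
 proof (rule char_eq_imp_distr_eq)
  show "char (distr N borel D) = char (distr M borel D)"
  proof
  fix th
  have "char (distr N borel D) th = (CLINT om|N. iexp (th * D om))"
  unfolding char_def by (subst integral_distr) auto
  also have "... = (CLINT om|M. (indicator A om / prob A) *\<^sub>R iexp (th * D om))"
  unfolding N_def using pA by (subst integral_density) auto
  also have "... = (CLINT om|M. (1 / prob A) *\<^sub>R (indicator A om *\<^sub>R iexp (th * D om)))"
  by (rule Bochner_Integration.integral_cong) simp_all
  also have "... = (1 / prob A) *\<^sub>R (CLINT om|M. indicator A om *\<^sub>R iexp (th * D om))"
  by (rule integral_scaleR_right)
  also have "... = (CLINT om|M. iexp (th * D om))" unfolding char using pA by simp
  also have "... = char (distr M borel D) th"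
  unfolding char_def by (subst integral_distr) auto
  finally show "char (distr N borel D) th = char (distr M borel D) th" .
  qed
 qed (auto intro: prob_space_distr N.prob_space_distr)
 then have "measure (distr N borel D) B = measure (distr M borel D) B" by simp
 then have "measure N (D -` B Int space M) = prob (D -` B Int space M)"
  by (simp add: measure_distr sets_eq_imp_space_eq[OF \<open>sets N = sets M\<close>])
 moreover have "measure N (D -` B Int space M) = prob (A Int (D -` B Int space M)) / prob A"
 proof -
  have "emeasure N (D -` B Int space M) = (\<integral>\<^sup>+om. ennreal (1 / prob A) * indicator (A Int (D -` B Int space M)) om \<partial>M)"
  unfolding N_def by (subst emeasure_density) (auto intro!: nn_integral_cong split: split_indicator)
  also have "... = ennreal (1 / prob A) * emeasure M (A Int (D -` B Int space M))"
  by (simp add: nn_integral_cmult_indicator)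
  also have "... = ennreal (prob (A Int (D -` B Int space M)) / prob A)"
  using pA by (simp add: emeasure_eq_measure ennreal_mult[symmetric])
  finally show ?thesis by (simp add: measure_def)
 qed
 ultimately show ?thesis using pA by (simp add: field_simps)
qed

section \<open>Generated filtrations and independence of increments\<close>

definition half_space_events :: "'a measure => ('j => 'a => real) => 'j set => 'a set set" where
 "half_space_events M Z J = {{om : space M. ALL j:F. Z j om <= a j} | F a. finite F & F <= J}"

definition generated_by :: "'a measure => ('j => 'a => real) => 'j set => 'a measure" where
 "generated_by M Z J = sigma (space M) (half_space_events M Z J)"

lemma space_generated_by [simp]: "space (generated_by M Z J) = space M"
 and sets_generated_by: "sets (generated_by M Z J) = sigma_sets (space M) (half_space_events M Z J)"
 unfolding generated_by_def by (auto simp: half_space_events_def intro!: space_measure_of sets_measure_of)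

lemma Int_stable_half_space_events: "Int_stable (half_space_events M Z J)"
proof (rule Int_stableI)
 fix A B assume "A : half_space_events M Z J" "B : half_space_events M Z J"
 then obtain F a G b where F: "finite F" "F <= J" "A = {om : space M. ALL j:F. Z j om <= a j}"
  and G: "finite G" "G <= J" "B = {om : space M. ALL j:G. Z j om <= b j}"
  unfolding half_space_events_def by blast
 define c where "c j = (if j : F then if j : G then min (a j) (b j) else a j else b j)" for j
 have "A Int B = {om : space M. ALL j:F Un G. Z j om <= c j}"
  unfolding F G c_def by auto
 then show "A Int B : half_space_events M Z J"
  unfolding half_space_events_def using F G by (intro CollectI exI[of _ "F Un G"] exI[of _ c]) auto
qed

lemma half_space_events_subset:
 assumes "!!j. j : J ==> Z j : bmeas M"
 shows "half_space_events M Z J <= sets M"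
proof
 fix A assume "A : half_space_events M Z J"
 then obtain F a where F: "finite F" "F <= J" "A = {om : space M. ALL j:F. Z j om <= a j}"
  unfolding half_space_events_def by blast
 have "Measurable.pred M (%om. Z j om <= a j)" if "j : F" for j
 proof -
  have [measurable]: "Z j : bmeas M" using assms F that by auto
  show ?thesis by measurable
 qed
 then show "A : sets M" unfolding F(3) pred_def[symmetric] using F(1) by (intro pred_intros_finite) auto
qed

lemma sets_generated_by_subset:
 assumes "!!j. j : J ==> Z j : bmeas M"
 shows "sets (generated_by M Z J) <= sets M"
 unfolding sets_generated_by by (rule sets.sigma_sets_subset[OF half_space_events_subset[OF assms]])

lemma sets_generated_by_mono: "J <= J' ==> sets (generated_by M Z J) <= sets (generated_by M Z J')"
 unfolding sets_generated_by
 by (intro sigma_sets_mono') (auto simp: half_space_events_def)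

lemma measurable_generated_by:
 assumes "j : J"
 shows "Z j : bmeas (generated_by M Z J)"
proof (subst borel_measurable_iff_le, rule allI)
 fix c
 have "{om : space M. Z j om <= c} : half_space_events M Z J"
  unfolding half_space_events_def using assms by (intro CollectI exI[of _ "{j}"] exI[of _ "%_. c"]) auto
 then show "{om : space (generated_by M Z J). Z j om <= c} : sets (generated_by M Z J)"
  by (simp add: sets_generated_by)
qed

text \<open>The assumption is what convergence in law delivers: characters test the increment,
  finitely many continuous functions test the past. Steepening the ramps reaches the half-space
  events, which are stable under intersection and generate the past.\<close>

theorem (in prob_space) increment_independent_of_past:
 fixes Z :: "'j => 'a => real"
 assumes Z: "!!j. j : J ==> Z j : bmeas M" and D[measurable]: "D : bmeas M" and sg: "0 < sg"
  and char: "!!F a k th. finite F ==> F <= J ==>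
  (CLINT om|M. complex_of_real (\<Prod>j\<in>F. ramp k (a j) (Z j om)) * iexp (th * D om)) =
  complex_of_real (EE (%om. \<Prod>j\<in>F. ramp k (a j) (Z j om))) * complex_of_real (exp (- (th^2 * sg^2 / 2)))"
 shows "distributed M lborel D (normal_density 0 sg) &
  indep_set (sets (generated_by M Z J)) (sets (vimage_algebra (space M) D borel))"
proof -
 have charD: "(CLINT om|M. iexp (th * D om)) = exp (- (th^2 * sg^2 / 2))" for th
  using char[of "{}" 0 "%_. 0" th] by (simp add: prob_space)
 have "distributed M lborel D (normal_density 0 sg)"
  by (rule distributed_normalI[OF D sg charD])
 moreover have "indep_set (half_space_events M Z J) {D -` B Int space M |B. B : sets borel}"
 proof (rule indep_setI)
  show "half_space_events M Z J <= events" by (rule half_space_events_subset[OF Z])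
  show "{D -` B Int space M |B. B : sets borel} <= events" by auto
  fix A E assume A: "A : half_space_events M Z J" and "E : {D -` B Int space M |B. B : sets borel}"
  then obtain B where B: "B : sets borel" "E = D -` B Int space M" by blast
  have Am[measurable]: "A : events" by (rule subsetD[OF half_space_events_subset[OF Z] A])
  obtain F a where F: "finite F" "F <= J" "A = {om : space M. ALL j:F. Z j om <= a j}"
  using A unfolding half_space_events_def by blast
  have FZ: "j : F ==> Z j : bmeas M" for j using F Z by auto
  have meas: "(%om. \<Prod>j\<in>F. ramp k (a j) (Z j om)) : bmeas M" for k
  by (intro borel_measurable_prod measurable_compose[OF FZ ramp_measurable])
  have lim: "(%k. \<Prod>j\<in>F. ramp k (a j) (Z j om)) ---> indicator A om" if "om : space M" for om
  proof -
  have "(%k. \<Prod>j\<in>F. ramp k (a j) (Z j om)) ---> (\<Prod>j\<in>F. indicator {..a j} (Z j om))"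
  by (intro tendsto_prod ramp_LIMSEQ)
  moreover have "(\<Prod>j\<in>F. indicator {..a j} (Z j om)) = (indicator A om :: real)"
  using F(1) that unfolding F(3) by (auto simp: indicator_def prod_zero_iff)
  ultimately show ?thesis by simp
  qed
  have b01: "abs (\<Prod>j\<in>F. ramp k (a j) (Z j om)) <= 1" for k om
  unfolding abs_prod using ramp_bounds by (intro prod_le_1) auto
  have l1: "(%k. EE (%om. \<Prod>j\<in>F. ramp k (a j) (Z j om))) ---> EE (indicator A)"
  by (rule integral_dominated_convergence[where w = "%_. 1"])
  (auto simp: meas b01 intro!: AE_I2 lim)
  have "(CLINT om|M. indicator A om *\<^sub>R iexp (th * D om)) = prob A *\<^sub>R (CLINT om|M. iexp (th * D om))" for th
  proof -
  have "(%k. CLINT om|M. of_real (\<Prod>j\<in>F. ramp k (a j) (Z j om)) * iexp (th * D om)) --->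
  (CLINT om|M. of_real (indicator A om) * iexp (th * D om))"
  proof (rule integral_dominated_convergence[where w = "%_. 1"])
  show "AE om in M. (%k. of_real (\<Prod>j\<in>F. ramp k (a j) (Z j om)) * iexp (th * D om)) ---> of_real (indicator A om) * iexp (th * D om)"
  by (intro AE_I2 tendsto_mult tendsto_of_real lim tendsto_const)
  show "AE om in M. norm (complex_of_real (\<Prod>j\<in>F. ramp k (a j) (Z j om)) * iexp (th * D om)) <= 1" for k
  using b01[of k] by (intro AE_I2) (simp add: norm_mult del: of_real_prod)
  show "(%om. complex_of_real (\<Prod>j\<in>F. ramp k (a j) (Z j om)) * iexp (th * D om)) : bmeas M" for k
  using meas[of k] by measurable
  qed auto
  moreover have "(%k. complex_of_real (EE (%om. \<Prod>j\<in>F. ramp k (a j) (Z j om))) * exp (- (th^2 * sg^2 / 2))) --->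
  complex_of_real (EE (indicator A)) * exp (- (th^2 * sg^2 / 2))"
  by (intro tendsto_intros tendsto_of_real l1)
  ultimately have "(CLINT om|M. of_real (indicator A om) * iexp (th * D om)) =
  complex_of_real (EE (indicator A)) * exp (- (th^2 * sg^2 / 2))"
  unfolding char[OF F(1,2)] by (rule LIMSEQ_unique)
  then show ?thesis unfolding charD by (simp add: scaleR_conv_of_real)
  qed
  from indep_prob_of_char[OF D Am this B(1)] show "prob (A Int E) = prob A * prob E"
  unfolding B(2) .
 qed
 then have "indep_set (sigma_sets (space M) (half_space_events M Z J))
  (sigma_sets (space M) {D -` B Int space M |B. B : sets borel})"
 proof (rule indep_set_sigma_sets)
  show "Int_stable {D -` B Int space M |B. B : sets borel}"
  proof (rule Int_stableI)
  fix A E assume "A : {D -` B Int space M |B. B : sets borel}" "E : {D -` B Int space M |B. B : sets borel}"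
  then obtain B C where "A = D -` B Int space M" "E = D -` C Int space M" "B : sets borel" "C : sets borel" by blast
  then have "A Int E = D -` (B Int C) Int space M" "B Int C : sets borel" by auto
  then show "A Int E : {D -` B Int space M |B. B : sets borel}" by blast
  qed
 qed (rule Int_stable_half_space_events)
 ultimately show ?thesis by (simp add: sets_generated_by sets_vimage_algebra)
qed

text \<open>A family with independent increments, started at \<open>0\<close>, is independent of the initial
 \<open>\<sigma>\<close>-algebra: on a finite grid the joint law with \<open>A\<close> factorises one increment at a time.\<close>

theorem (in prob_space) path_independent_of_start:
 fixes W :: "real => 'a => real" and F :: "real => 'a measure"
 assumes F: "!!t. sets (F t) <= events" "!!t. space (F t) = space M"
  "!!s t. s <= t ==> sets (F s) <= sets (F t)"
  and W: "!!t. t : {0..T} ==> W t : bmeas (F t)"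
  and W0: "AE om in M. W 0 om = 0"
  and indep: "!!s t. 0 <= s ==> s < t ==> t <= T ==>
  indep_set (sets (F s)) (sets (vimage_algebra (space M) (%om. W t om - W s om) borel))"
 shows "indep_set (sets (F 0)) (sets (vimage_algebra (space M) (%om. \<lambda>t\<in>{0..T}. W t om) (PiM {0..T} (%_. borel))))"
proof -
 have WM[measurable]: "W t : bmeas M" if "t : {0..T}" for t
  using W[OF that] F(1,2)[of t] unfolding measurable_def by auto
 have WF: "W s : bmeas (F t)" if "s : {0..T}" "s <= t" for s t
  using W[OF that(1)] F(2)[of s] F(2)[of t] F(3)[OF that(2)] unfolding measurable_def by auto
 define cyl where "cyl = {{om : space M. ALL t:J. W t om : B t} | J B. finite J & J <= {0..T} & (ALL t. B t : sets borel)}"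
 have cylM: "cyl <= events"
 proof
  fix E assume "E : cyl"
  then obtain J B where J: "finite J" "J <= {0..T}" "ALL t. B t : sets borel" "E = {om : space M. ALL t:J. W t om : B t}"
  unfolding cyl_def by blast
  have "Measurable.pred M (%om. W t om : B t)" if "t : J" for t
  by (rule pred_sets2[where N = borel]) (use J that WM[of t] in auto)
  then show "E : events" unfolding J(4) pred_def[symmetric] using J(1) by (intro pred_intros_finite) auto
 qed
 have key: "prob (A Int {om : space M. ALL t:J. W t om : B t}) = prob A * prob {om : space M. ALL t:J. W t om : B t}"
  if A: "A : sets (F 0)" and J: "finite J" "J <= {0..T}" and B: "!!t. B t : sets borel" for A J B
 proof -
  \<comment> \<open>Time \<open>0\<close> is added so that the values on the grid are partial sums
    of increments beginning with \<open>W 0\<close>.\<close>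
  define J' where "J' = insert 0 J"
  define n where "n = card J'"
  define ts where "ts = sorted_list_of_set J'"
  have fJ': "finite J'" and T0: "0 <= T \<or> J = {}" using J by (auto simp: J'_def)
  show ?thesis
  proof (cases "J = {}")
  case True
  then show ?thesis using A F(1)[of 0] sets.Int_space_eq2[of A M] prob_space by (auto simp: Int_absorb2 subset_eq)
  next
  case False
  then have T0: "0 <= T" using J by auto
  have J'T: "J' <= {0..T}" using J T0 by (auto simp: J'_def)
  have ts: "set ts = J'" "sorted_wrt (<) ts" "length ts = n"
  using fJ' by (auto simp: ts_def n_def)
  have n0: "0 < n" using fJ' by (auto simp: n_def J'_def card_gt_0_iff)
  have tsT: "ts ! k : {0..T}" if "k < n" for k using that ts J'T by (metis nth_mem subsetD)
  have ts0: "ts ! 0 = 0"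
  proof -
  have "0 : set ts" by (simp add: ts J'_def)
  then obtain k where k: "k < n" "ts ! k = 0" using ts by (metis in_set_conv_nth)
  have "ts ! 0 <= ts ! k"
  proof (cases "k = 0")
  case False
  then have "ts ! 0 < ts ! k" using ts(2,3) k(1) unfolding sorted_wrt_iff_nth_less by blast
  then show ?thesis by simp
  qed simp
  with tsT[OF n0] k show ?thesis by auto
  qed
  have tsmono: "j < k ==> k < n ==> ts ! j < ts ! k" for j k
  using ts by (auto simp: sorted_wrt_iff_nth_less)
  define D where "D k om = (if k = 0 then W 0 om else W (ts ! k) om - W (ts ! (k - 1)) om)" for k om
  have Wts: "W (ts ! k) om = (SUM j<=k. D j om)" for k om
  by (induction k) (auto simp: D_def ts0)
  have DF: "D k : bmeas (F (ts ! k))" if "k < n" for k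
  unfolding D_def using that tsT tsmono ts0 T0
  by (cases k) (auto intro!: borel_measurable_diff WF simp: less_imp_le)
  define \<D> where "\<D> = {{om : space M. ALL k<n. D k om : C k} | C. ALL k. C k : sets borel}"
  have predF: "{om : space M. ALL k<m. D k om : C k} : sets (F (ts ! (m - 1)))" if C: "ALL k. C k : sets borel" and m: "0 < m" "m <= n" for C m
  proof -
  have "Measurable.pred (F (ts ! (m - 1))) (%om. D k om : C k)" if "k < m" for k
  proof -
  have "ts ! k <= ts ! (m - 1)"
  proof (cases "k = m - 1")
  case False
  then have "k < m - 1" using that by linarith
  then show ?thesis using tsmono[of k "m - 1"] m by (simp add: less_imp_le)
  qed simp
  then have "D k : bmeas (F (ts ! (m - 1)))"
  using DF[of k] that m F(2)[of "ts ! k"] F(2)[of "ts ! (m - 1)"] F(3)[of "ts ! k" "ts ! (m - 1)"]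
  unfolding measurable_def by auto
  then show ?thesis using C by (intro pred_sets2[where N = borel]) auto
  qed
  then have "Measurable.pred (F (ts ! (m - 1))) (%om. ALL k:{..<m}. D k om : C k)"
  by (intro pred_intros_finite) auto
  then show ?thesis unfolding pred_def F(2) Ball_def lessThan_iff .
  qed
  have fact: "prob (A Int {om : space M. ALL k<m. D k om : C k}) = prob A * prob {om : space M. ALL k<m. D k om : C k}"
  if C: "ALL k. C k : sets borel" and m: "m <= n" and A: "A : sets (F 0)" for C m A
  using m
  proof (induction m)
  case 0
  then show ?case using A F(1)[of 0] sets.Int_space_eq2[of A M] prob_space by (auto simp: Int_absorb2 subset_eq)
  next
  case (Suc m)
  have AM: "A : events" using A F(1) by blast
  show ?case
  proof (cases "m = 0")
  case True
  \<comment> \<open>The first term is \<open>W 0\<close>, almost surely zero, so its events have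
    probability zero or one and factorise with any \<open>A\<close>.\<close>
  have W0': "AE om in M. D 0 om = 0" using W0 by (simp add: D_def)
  have m0: "{om : space M. ALL k<1. D k om : C k} : events"
  using predF[OF C, of 1] n0 F(1) by auto
  show ?thesis
  proof (cases "0 : C 0")
  case True
  have "AE om in M. om : {om : space M. ALL k<1. D k om : C k}"
  using W0' AE_space by eventually_elim (use True in auto)
  then have "prob {om : space M. ALL k<1. D k om : C k} = 1" using m0 by (simp add: prob_eq_1)
  moreover have "prob (A Int {om : space M. ALL k<1. D k om : C k}) = prob A"
  using \<open>AE om in M. om : {om : space M. ALL k<1. D k om : C k}\<close>
  by (intro finite_measure_eq_AE) (use AM m0 in auto)
  ultimately show ?thesis using \<open>m = 0\<close> by simp
  next
  case False
  have "AE om in M. om ~: {om : space M. ALL k<1. D k om : C k}"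
  using W0' by eventually_elim (use False in auto)
  then have "prob {om : space M. ALL k<1. D k om : C k} = 0" using m0 by (simp add: prob_eq_0)
  moreover have "prob (A Int {om : space M. ALL k<1. D k om : C k}) <= prob {om : space M. ALL k<1. D k om : C k}"
  using m0 by (intro finite_measure_mono) auto
  ultimately show ?thesis using \<open>m = 0\<close> by (simp add: measure_le_0_iff)
  qed
  next
  case False
  define P where "P = {om : space M. ALL k<m. D k om : C k}"
  define s where "s = ts ! (m - 1)"
  define t where "t = ts ! m"
  have st: "0 <= s" "s < t" "t <= T" using False Suc.prems tsT[of "m - 1"] tsT[of m] tsmono[of "m - 1" m]
  by (auto simp: s_def t_def)
  have PF: "P : sets (F s)" unfolding P_def s_def by (rule predF[OF C]) (use False Suc.prems in auto)
  have AF: "A : sets (F s)" using A F(3)[OF st(1)] by blast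
  define Q where "Q = (%om. W t om - W s om) -` C m Int space M"
  have Q: "Q : sets (vimage_algebra (space M) (%om. W t om - W s om) borel)"
  unfolding Q_def using C by (intro in_vimage_algebra) auto
  have split: "{om : space M. ALL k<Suc m. D k om : C k} = P Int Q"
  using False by (auto simp: P_def Q_def D_def s_def t_def less_Suc_eq)
  have "prob (A Int P Int Q) = prob (A Int P) * prob Q"
  by (rule indep_setD[OF indep[OF st] sets.Int[OF AF PF] Q])
  moreover have "prob (P Int Q) = prob P * prob Q"
  using indep_setD[OF indep[OF st] PF Q] .
  moreover have "prob (A Int P) = prob A * prob P" unfolding P_def by (rule Suc.IH) (use Suc.prems in simp)
  ultimately show ?thesis unfolding split by (simp add: Int_assoc)
  qed
  qed
  have "indep_set (sets (F 0)) (sigma_sets (space M) \<D>)"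
  proof -
  have "indep_set (sets (F 0)) \<D>"
  proof (rule indep_setI)
  show "\<D> <= events" unfolding \<D>_def using predF[of _ n] n0 F(1) by blast
  fix A E assume "A : sets (F 0)" "E : \<D>"
  then show "prob (A Int E) = prob A * prob E" unfolding \<D>_def using fact[of _ n] by auto
  qed (rule F(1))
  then have "indep_set (sigma_sets (space M) (sets (F 0))) (sigma_sets (space M) \<D>)"
  proof (rule indep_set_sigma_sets)
  show "Int_stable (sets (F 0))" by (rule sets.Int_stable)
  show "Int_stable \<D>"
  proof (rule Int_stableI)
  fix E E' assume "E : \<D>" "E' : \<D>"
  then obtain C C' where "ALL k. C k : sets borel" "ALL k. C' k : sets borel"
  "E = {om : space M. ALL k<n. D k om : C k}" "E' = {om : space M. ALL k<n. D k om : C' k}"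
  unfolding \<D>_def by blast
  then show "E Int E' : \<D>"
  unfolding \<D>_def by (intro CollectI exI[of _ "%k. C k Int C' k"]) auto
  qed
  qed
  then show ?thesis using F(2)[of 0] sets.sigma_sets_eq[of "F 0"] by simp
  qed
  moreover have "{om : space M. ALL t:J. W t om : B t} : sigma_sets (space M) \<D>"
  proof -
  define N where "N = sigma (space M) \<D>"
  have N: "space N = space M" "sets N = sigma_sets (space M) \<D>"
  unfolding N_def \<D>_def by (auto intro!: space_measure_of sets_measure_of)
  have DN: "D k : bmeas N" if "k < n" for k
  proof (rule measurableI)
  fix C :: "real set" assume C: "C : sets borel"
  have "D k -` C Int space N = {om : space M. ALL j<n. D j om : (if j = k then C else UNIV)}"
  using that by (auto simp: N)
  then show "D k -` C Int space N : sets N"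
  unfolding N(2) \<D>_def using C
  by (intro sigma_sets.Basic CollectI exI[of _ "%j. if j = k then C else UNIV"]) auto
  qed simp
  have "Measurable.pred N (%om. W t om : B t)" if "t : J" for t
  proof -
  have "t : set ts" using that by (simp add: ts J'_def)
  then obtain k where k: "k < n" "t = ts ! k" using ts by (metis in_set_conv_nth)
  have "(%om. SUM j<=k. D j om) : bmeas N" using DN k by (intro borel_measurable_sum) auto
  then have "W t : bmeas N" unfolding k(2) Wts[symmetric] by simp
  then show ?thesis using B by (intro pred_sets2[where N = borel]) auto
  qed
  then have "Measurable.pred N (%om. ALL t:J. W t om : B t)" using J by (intro pred_intros_finite) auto
  then show ?thesis by (simp add: pred_def N)
  qed
  ultimately show ?thesis using indep_setD A by blast
  qed
 qed
 have "indep_set (sets (F 0)) cyl"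
 proof (rule indep_setI)
  fix A E assume "A : sets (F 0)" "E : cyl"
  then show "prob (A Int E) = prob A * prob E" unfolding cyl_def using key by blast
 qed (use F(1) cylM in auto)
 then have "indep_set (sigma_sets (space M) (sets (F 0))) (sigma_sets (space M) cyl)"
 proof (rule indep_set_sigma_sets)
  show "Int_stable (sets (F 0))" by (rule sets.Int_stable)
  show "Int_stable cyl"
  proof (rule Int_stableI)
  fix E E' assume "E : cyl" "E' : cyl"
  then obtain J B J' B' where J: "finite J" "J <= {0..T}" "ALL t. B t : sets borel" "E = {om : space M. ALL t:J. W t om : B t}"
  and J': "finite J'" "J' <= {0..T}" "ALL t. B' t : sets borel" "E' = {om : space M. ALL t:J'. W t om : B' t}"
  unfolding cyl_def by blast
  define C where "C t = (if t : J then B t else UNIV) Int (if t : J' then B' t else UNIV)" for t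
  have "E Int E' = {om : space M. ALL t:J Un J'. W t om : C t}" unfolding J J' C_def by auto
  moreover have "ALL t. C t : sets borel" using J J' by (auto simp: C_def)
  ultimately show "E Int E' : cyl"
  unfolding cyl_def using J J' by (intro CollectI exI[of _ "J Un J'"] exI[of _ C]) auto
  qed
 qed
 then have i: "indep_set (sets (F 0)) (sigma_sets (space M) cyl)"
  using F(2)[of 0] sets.sigma_sets_eq[of "F 0"] by simp
 define N where "N = sigma (space M) cyl"
 have N: "space N = space M" "sets N = sigma_sets (space M) cyl"
  unfolding N_def cyl_def by (auto intro!: space_measure_of sets_measure_of)
 have "(%om. \<lambda>t\<in>{0..T}. W t om) : N \<rightarrow>\<^sub>M PiM {0..T} (%_. borel)"
 proof (rule measurable_restrict)
  fix t assume t: "t : {0..T}"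
  show "W t : bmeas N"
  proof (rule measurableI)
  fix C :: "real set" assume C: "C : sets borel"
  have "W t -` C Int space N = {om : space M. ALL s:{t}. W s om : C}" by (auto simp: N)
  then show "W t -` C Int space N : sets N"
  unfolding N(2) cyl_def using C t
  by (intro sigma_sets.Basic CollectI exI[of _ "{t}"] exI[of _ "%_. C"]) auto
  qed simp
 qed
 then have "sets (vimage_algebra (space M) (%om. \<lambda>t\<in>{0..T}. W t om) (PiM {0..T} (%_. borel))) <= sigma_sets (space M) cyl"
  using sets_image_in_sets[OF N(1)] N(2) by metis
 with i show ?thesis unfolding indep_set_def
  by (elim indep_sets_mono_sets) (auto split: bool.split)
qed

text \<open>The path is sampled at the left ends of the cells of a grid on \<open>{0..t}\<close>, so
  that only values up to \<open>t\<close> enter. Countably many cells give joint measurability,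
  continuity the limit. The grid may depend on \<open>t\<close>, since the claim is made for each
  \<open>t\<close> separately.\<close>

lemma progressive_of_continuous:
 fixes X :: "real => 'a => real" and F :: "real => 'a measure"
 assumes F: "!!t. space (F t) = Om" "!!s t. s <= t ==> sets (F s) <= sets (F t)"
  and X: "!!t. t : {0..T} ==> X t : bmeas (F t)"
  and cont: "!!om. om : Om ==> continuous_on {0..T} (%t. X t om)" and t: "t : {0..T}"
 shows "(%(s, om). X s om) : bmeas (restrict_space borel {0..t} \<Otimes>\<^sub>M F t)"
proof (rule borel_measurable_LIMSEQ_real)
 define p where "p m s = t * real (min (4 ^ m) (nat \<lfloor>4 ^ m * s / t\<rfloor>)) / 4 ^ m" for m :: nat and s
 have pt: "p m s : {0..t}" for m s
 proof -
  have "real (min (4 ^ m) (nat \<lfloor>4 ^ m * s / t\<rfloor>)) <= 4 ^ m"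
  by (metis min.cobounded1 of_nat_le_iff of_nat_numeral of_nat_power)
  then have "t * real (min (4 ^ m) (nat \<lfloor>4 ^ m * s / t\<rfloor>)) <= t * 4 ^ m" using t by (intro mult_left_mono) auto
  then show ?thesis using t unfolding p_def by (auto simp: divide_le_eq)
 qed
 show "(%(s, om). X (p m s) om) : bmeas (restrict_space borel {0..t} \<Otimes>\<^sub>M F t)" for m
 proof -
  have X': "X (p m s) : bmeas (F t)" for s
  proof -
  have "p m s : {0..T}" "p m s <= t" using pt[of m s] t by auto
  then show ?thesis using X[of "p m s"] F(1)[of "p m s"] F(1)[of t] F(2)[of "p m s" t]
  unfolding measurable_def by auto
  qed
  define G where "G k z = X (t * real (min (4 ^ m) k) / 4 ^ m) (snd z)" for k :: nat and z :: "real \<times> 'a"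
  have "G k : bmeas (restrict_space borel {0..t} \<Otimes>\<^sub>M F t)" for k
  proof (cases "t = 0")
  case True
  then show ?thesis unfolding G_def using X'[of 0] by (intro measurable_compose[OF measurable_snd]) (simp add: p_def)
  next
  case False
  define s where "s = t * real k / 4 ^ m"
  have "nat \<lfloor>4 ^ m * s / t\<rfloor> = k" using False by (simp add: s_def)
  then have "t * real (min (4 ^ m) k) / 4 ^ m = p m s" by (simp add: p_def)
  then show ?thesis unfolding G_def using X'[of s] by (intro measurable_compose[OF measurable_snd]) simp
  qed
  moreover have "(%z. nat \<lfloor>4 ^ m * fst z / t\<rfloor>) : restrict_space borel {0..t} \<Otimes>\<^sub>M F t \<rightarrow>\<^sub>M UC"
  proof (rule measurable_compose[OF measurable_fst])
  show "(%s. nat \<lfloor>4 ^ m * s / t\<rfloor>) : restrict_space borel {0..t} \<rightarrow>\<^sub>M UC"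
  by (rule measurable_restrict_space1) measurable
  qed
  ultimately have "(%z. G (nat \<lfloor>4 ^ m * fst z / t\<rfloor>) z) : bmeas (restrict_space borel {0..t} \<Otimes>\<^sub>M F t)"
  by (rule measurable_compose_countable)
  then show ?thesis by (simp add: G_def p_def split_beta)
 qed
 fix z assume "z : space (restrict_space borel {0..t} \<Otimes>\<^sub>M F t)"
 then obtain s om where z: "z = (s, om)" "s : {0..t}" "om : Om"
  by (auto simp: space_pair_measure space_restrict_space F)
 have "(%m. p m s) ---> s"
 proof (cases "t = 0")
  case False
  then have t0: "0 < t" using t by simp
  have "abs (p m s - s) <= t * (1 / 4) ^ m" for m
  proof -
  define y where "y = 4 ^ m * s / t"
  have y: "0 <= y" "y <= 4 ^ m" using z(2) t0 by (auto simp: y_def field_simps)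
  have s: "s = t * y / 4 ^ m" using t0 by (simp add: y_def)
  have fl: "of_int \<lfloor>y\<rfloor> <= y" "y <= of_int \<lfloor>y\<rfloor> + 1" by linarith+
  have rn: "real (nat \<lfloor>y\<rfloor>) = of_int \<lfloor>y\<rfloor>" using y by simp
  moreover have "nat \<lfloor>y\<rfloor> <= 4 ^ m"
  proof -
  have "real (nat \<lfloor>y\<rfloor>) <= 4 ^ m" unfolding rn using y fl by linarith
  then show ?thesis by (metis of_nat_le_iff of_nat_numeral of_nat_power)
  qed
  ultimately have "p m s = t * of_int \<lfloor>y\<rfloor> / 4 ^ m" unfolding p_def y_def[symmetric] by (simp add: min_def)
  then have "p m s - s = t * (of_int \<lfloor>y\<rfloor> - y) * (1 / 4) ^ m"
  by (subst s) (simp add: field_simps power_divide)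
  moreover have "abs (of_int \<lfloor>y\<rfloor> - y) <= 1" using fl by linarith
  ultimately show ?thesis using t0 by (simp add: abs_mult mult_left_le)
  qed
  then have b: "\<forall>\<^sub>F m in sequentially. norm (p m s - s) <= t * (1 / 4) ^ m" by simp
  have "(%m. (1 / 4 :: real) ^ m) ---> 0" by (rule LIMSEQ_power_zero) simp
  then have l0: "(%m. t * (1 / 4) ^ m) ---> 0" by (rule tendsto_mult_right_zero)
  have "(%m. p m s - s) ---> 0" by (rule Lim_null_comparison[OF b l0])
  then show ?thesis by (rule LIM_zero_cancel)
 qed (use z in \<open>simp add: p_def\<close>)
 then have "(%m. X (p m s) om) ---> X s om"
 proof (rule continuous_on_tendsto_compose[OF cont[OF z(3)]])
  have "p m s : {0..T}" for m using pt[of m s] t by auto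
  then show "\<forall>\<^sub>F m in sequentially. p m s : {0..T}" by simp
 qed (use t z in auto)
 then show "(%m. (case z of (s, om) => X (p m s) om)) ---> (case z of (s, om) => X s om)"
  by (simp add: z)
qed

section \<open>The approximating chains\<close>

lemma finite_range_pmf:
 assumes "prob_space M" and X[measurable]: "X : M \<rightarrow>\<^sub>M UC" and fin: "finite (range X)"
 shows "EX p. measure_pmf p = distr M (count_space UNIV) X"
proof -
 interpret prob_space M by fact
 define N where "N = distr M (count_space UNIV) X"
 have N: "prob_space N" unfolding N_def by (rule prob_space_distr) simp
 interpret N: prob_space N by fact
 have "AE x in N. measure N {x} ~= 0"
 proof -
  have "AE x in N. x : range X" unfolding N_def by (subst AE_distr_iff) auto
  moreover have "AE x in N. ALL y:{y : range X. measure N {y} = 0}. x ~= y"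
  proof (rule AE_finite_allI)
  fix y assume "y : {y : range X. measure N {y} = 0}"
  then have "emeasure N {y} = 0" by (simp add: N.emeasure_eq_measure)
  then have "{y} : null_sets N" by (simp add: null_sets_def) (simp add: N_def)
  then show "AE x in N. x ~= y" by (rule AE_I') auto
  qed (use fin in auto)
  ultimately show ?thesis by eventually_elim auto
 qed
 moreover have "sets N = UNIV" by (simp add: N_def)
 ultimately have "measure_pmf (Abs_pmf N) = N" using N by (intro Abs_pmf_inverse CollectI conjI)
 then show ?thesis unfolding N_def by blast
qed

locale approx = volatilities l lo hi for l :: "'d::finite => real" and lo hi +
 fixes al :: "'d => real" and \<mu> :: "real measure" and T r C0 :: real
 assumes al_pos: "!!i. 0 < al i" and al_sum: "(SUM i:UNIV. al i) = 1"
  and \<mu>: "prob_space \<mu>" "sets \<mu> = sets borel" and T_pos: "0 < T"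
  and r_pos: "0 < r" and r_le: "r * (hi / lo) <= 1 / 2" and C0_pos: "0 < C0"
  and dissipation: "!!p M N K L. supp_in M p ==> (!!x. nonneg_vec (p x)) ==> (SUM x=-M..M. tot (p x)) = 1 ==> 1 <= K ==>
  (SUM k=K..<N. SUM x=-L..L. (norm (scheme r p k (x + 1) - scheme r p k x))^2) <= C0 / sqrt (real K)"
begin

definition ta :: "nat => real" where "ta n = T / 4 ^ n"
text \<open>Chosen so that \<open>(h n)^2 = ta n / r\<close>: the parabolic ratio of the scheme is
  \<open>r\<close> at every level.\<close>

definition h :: "nat => real" where "h n = sqrt (T / r) / 2 ^ n"
text \<open>Truncation at \<open>4 ^ n\<close> sites keeps the support finite. In real units the cut
  lies at a height proportional to \<open>2 ^ n\<close> and disappears in the limit.\<close>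

definition rnd :: "nat => real => int" where "rnd n xi = max (- (4 ^ n)) (min (4 ^ n) \<lfloor>xi / h n\<rfloor>)"
definition m0 :: "nat => int pmf" where "m0 n = (SOME p. measure_pmf p = distr \<mu> (count_space UNIV) (rnd n))"
definition ini :: "nat => (int \<times> 'd) pmf" where "ini n = pair_pmf (m0 n) (embed_pmf al)"
definition p0 :: "nat => int => real ^ 'd" where "p0 n x = (\<chi> i. pmf (m0 n) x * al i)"
definition P :: "nat => nat => int => real ^ 'd" where "P n = scheme r (p0 n)"
text \<open>The squared coefficient of the equation, \<open>l i\<close> divided by the conditional
  mean of \<open>l(Y)\<close> at the lattice point. Where the law has no mass the value
  \<open>1\<close> is used, which respects the bounds \<open>lo / hi\<close> and
  \<open>hi / lo\<close>.\<close>

definition rate :: "nat => nat => int => 'd => real" where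
 "rate n k x i = (if P n k x = 0 then 1 else l i * tot (P n k x) / wtot l (P n k x))"
definition q :: "nat => nat => int => 'd => real" where "q n k x i = r * rate n k x i"

lemma ta_pos: "0 < ta n" using T_pos by (simp add: ta_def)
lemma h_pos: "0 < h n" using T_pos r_pos by (simp add: h_def)
lemma h2: "(h n)^2 = ta n / r"
 using T_pos r_pos by (simp add: h_def ta_def power_divide power2_eq_square) (simp add: power_mult_distrib[symmetric])

lemma h2r: "(h n)^2 * r = ta n" using h2[of n] r_pos by simp

lemma rnd_measurable [measurable]: "rnd n : borel \<rightarrow>\<^sub>M UC"
 unfolding rnd_def[abs_def] by measurable

lemma m0: "measure_pmf (m0 n) = distr \<mu> (count_space UNIV) (rnd n)"
proof -
 have "rnd n ` UNIV <= {- (4 ^ n)..4 ^ n}" by (auto simp: rnd_def)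
 then have "finite (range (rnd n))" by (rule finite_subset) simp
 moreover have "rnd n : \<mu> \<rightarrow>\<^sub>M UC" using rnd_measurable \<mu>(2) by (simp add: measurable_cong_sets)
 ultimately have "EX p. measure_pmf p = distr \<mu> (count_space UNIV) (rnd n)"
  using \<mu>(1) by (intro finite_range_pmf)
 then show ?thesis unfolding m0_def by (rule someI_ex)
qed

lemma set_m0: "set_pmf (m0 n) <= {- (4 ^ n)..4 ^ n}"
proof
 fix x assume "x : set_pmf (m0 n)"
 then have "measure (measure_pmf (m0 n)) {x} ~= 0" by (simp add: set_pmf.rep_eq)
 then have "measure \<mu> (rnd n -` {x} Int space \<mu>) ~= 0"
  unfolding m0 using rnd_measurable \<mu>(2) by (subst (asm) measure_distr) (auto simp: measurable_cong_sets)
 then have "rnd n -` {x} ~= {}" by (cases "rnd n -` {x} = {}") auto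
 then show "x : {- (4 ^ n)..4 ^ n}" by (auto simp: rnd_def)
qed

lemma pmf_al: "pmf (embed_pmf al) i = al i"
proof (rule pmf_embed_pmf)
 show "0 <= al x" for x using al_pos[of x] by simp
 have "(\<integral>\<^sup>+x. ennreal (al x) \<partial>count_space UNIV) = (SUM x:UNIV. ennreal (al x))"
  by (rule nn_integral_count_space_finite) simp
 also have "... = 1" using al_sum al_pos by (subst sum_ennreal) (auto simp: less_imp_le)
 finally show "(\<integral>\<^sup>+x. ennreal (al x) \<partial>count_space UNIV) = 1" .
qed

lemma pmf_m: "pmf (ini n) (x, i) = pmf (m0 n) x * al i"
 by (simp add: ini_def pmf_pair pmf_al)

lemma finite_m: "finite (set_pmf (ini n))"
 unfolding ini_def using finite_subset[OF set_m0] by (auto intro: finite_subset[OF subset_UNIV])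

lemma lo_le_hi: "lo <= hi"
 using lo_le le_hi by (meson order_trans)

lemma hilo: "1 <= hi / lo" "lo / hi <= 1" "0 < hi / lo" "0 < lo / hi"
 using lo_le_hi lo_pos hi_pos by auto

lemma nonneg_p0: "nonneg_vec (p0 n x)"
 using al_pos by (auto simp: nonneg_vec_def p0_def less_imp_le)

lemma supp_p0: "supp_in (4 ^ n) (p0 n)"
 unfolding supp_in_def
proof (intro allI impI)
 fix x :: int assume "4 ^ n < abs x"
 then have "x ~: {- (4 ^ n)..4 ^ n}" by auto
 then have "x ~: set_pmf (m0 n)" using set_m0[of n] by blast
 then show "p0 n x = 0" by (simp add: p0_def vec_eq_iff set_pmf_iff)
qed

lemma tot_p0: "tot (p0 n x) = pmf (m0 n) x"
 unfolding tot_def p0_def using al_sum by (simp flip: sum_distrib_left)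

lemma mass_p0: "(SUM x=-(4^n)..4^n. tot (p0 n x)) = 1"
 unfolding tot_p0 by (rule sum_pmf_eq_1) (use set_m0 in auto)

lemma nonneg_P: "nonneg_vec (P n k x)"
 unfolding P_def
proof (rule nonneg_scheme[OF nonneg_p0])
 show "r * (hi / lo) <= 1" using r_le by linarith
qed (use r_pos in simp)

lemma supp_P: "supp_in (4 ^ n + int k) (P n k)"
 unfolding P_def by (rule supp_in_scheme[OF supp_p0])

lemma rate_bounds: "lo / hi <= rate n k x i" "rate n k x i <= hi / lo"
proof -
 have "lo / hi <= rate n k x i & rate n k x i <= hi / lo"
 proof (cases "P n k x = 0")
  case True
  then show ?thesis using hilo by (simp add: rate_def)
 next
  case False
  note b = ratio_bounds[OF nonneg_P False]
  have e: "rate n k x i = l i * (tot (P n k x) / wtot l (P n k x))" using False by (simp add: rate_def)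
  have "lo * (1 / hi) <= rate n k x i"
  unfolding e using b(1) lo_le[of i] l_pos[of i] hi_pos by (intro mult_mono) auto
  moreover have "rate n k x i <= hi * (1 / lo)"
  unfolding e using b le_hi[of i] l_pos[of i] hi_pos lo_pos by (intro mult_mono) (auto intro: order_trans[OF _ b(1)])
  ultimately show ?thesis by simp
 qed
 then show "lo / hi <= rate n k x i" "rate n k x i <= hi / lo" by auto
qed

lemma rate_pos: "0 < rate n k x i"
 using rate_bounds(1)[of n k x i] hilo(4) by linarith

lemma rate_flux: "rate n k x i * P n k x $ i = flux l (P n k x) $ i"
 by (simp add: rate_def flux_def)

lemma q_bounds: "0 <= q n k x i" "q n k x i <= 1"
proof -
 show "0 <= q n k x i" using r_pos rate_pos by (simp add: q_def less_imp_le)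
 have "q n k x i <= r * (hi / lo)"
  unfolding q_def using r_pos rate_bounds(2) by (intro mult_left_mono) auto
 then show "q n k x i <= 1" using r_le by linarith
qed

sublocale ch: jump_chain "q n" "ini n" for n
 by standard (auto simp: finite_m q_bounds)

abbreviation "plaw n \<equiv> chain (q n) (ini n) (4 ^ n)"
abbreviation "EP n \<equiv> measure_pmf.expectation (plaw n)"

text \<open>The dependence on the own law closes here: since \<open>q * P = r * flux\<close>, the
  forward equation of the chain with rates taken from the scheme is the scheme itself.\<close>

lemma pmf_marg: "pmf (ch.marg n k) (x, i) = P n k x $ i"
proof (induction k arbitrary: x)
 case 0
 then show ?case by (simp add: ch.marg_0 pmf_m P_def p0_def)
next
 case (Suc k)
 have qf: "q n k y i * P n k y $ i = r * flux l (P n k y) $ i" for y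
  unfolding q_def using rate_flux[of n k y i] by simp
 have "pmf (ch.marg n (Suc k)) (x, i) = P n k x $ i - q n k x i * P n k x $ i
  + (q n k (x - 1) i * P n k (x - 1) $ i) / 2 + (q n k (x + 1) i * P n k (x + 1) $ i) / 2"
  unfolding ch.pmf_marg_Suc Suc by (simp add: algebra_simps)
 also have "... = P n (Suc k) x $ i"
  unfolding qf by (simp add: P_def scheme_step_def algebra_simps)
 finally show ?case .
qed

section \<open>The discrete solution and its driving martingale\<close>

definition Xd :: "nat => nat => (nat => int) \<times> 'd => real" where
 "Xd n k om = h n * of_int (fst om k)"

definition sgd :: "nat => nat => (nat => int) \<times> 'd => real" where
 "sgd n k om = sqrt (rate n k (fst om k) (snd om))"

text \<open>The driving martingale is obtained from \<open>X\<close> by dividing each jump by its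
  volatility. Thus an increment of \<open>X\<close> is exactly \<open>sgd\<close> times the one of
  \<open>W\<close>, and the conditional variance of the latter is exactly
  \<open>ta n\<close>.\<close>

definition wc :: "nat => nat => (nat => int) \<times> 'd => real" where
 "wc n k om = h n / sgd n k om"

definition Wd :: "nat => nat => (nat => int) \<times> 'd => real" where
 "Wd n k om = ch.mart (wc n) 0 k om"

lemma sgd_pos: "0 < sgd n k om" by (simp add: sgd_def rate_pos)

lemma sgd_sq: "(sgd n k om)^2 = rate n k (fst om k) (snd om)"
 using rate_pos[of n k "fst om k" "snd om"] by (simp add: sgd_def)

lemma Qj_eq: "ch.Qj n k om = r * (sgd n k om)^2"
 unfolding ch.Qj_def q_def sgd_sq ..

lemma adapted_sgd: "adapted_at k (sgd n k)"
 unfolding sgd_def by (rule adapted_at_coord) simp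

lemma adapted_wc: "adapted_at k (wc n k)"
 unfolding wc_def by (rule adapted_at_comp[OF adapted_sgd])

lemma Xd_diff:
 assumes "a <= k" shows "Xd n k om - Xd n a om = ch.mart (%_ _. h n) a k om"
 using assms
proof (induction k rule: dec_induct)
 case (step k)
 then show ?case by (simp add: ch.mart_Suc ch.jump_def Xd_def algebra_simps)
qed (simp add: ch.mart_def)

lemma Wd_diff: "a <= k ==> Wd n k om - Wd n a om = ch.mart (wc n) a k om"
 unfolding Wd_def ch.mart_def using sum_diff_nat_ivl[of 0 a k] by simp

lemma Wd_0 [simp]: "Wd n 0 om = 0" by (simp add: Wd_def ch.mart_def)

lemma adapted_Xd: "j <= k ==> adapted_at k (Xd n j)"
 unfolding Xd_def adapted_at_def by simp

lemma adapted_Wd: "j <= k ==> adapted_at k (Wd n j)"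
 unfolding Wd_def using ch.adapted_mart[OF adapted_wc] by (rule adapted_at_mono)

lemma wc_Q: "(wc n j om)^2 * ch.Qj n j om = ta n"
 using sgd_pos[of n j om] h2r[of n] by (simp add: wc_def Qj_eq power_divide)

lemma wc_sq_le: "(wc n j om)^2 <= ta n / r * (hi / lo)"
proof -
 have "(wc n j om)^2 = (h n)^2 / (sgd n j om)^2" by (simp add: wc_def power_divide)
 also have "... <= (h n)^2 / (lo / hi)"
  unfolding sgd_sq using rate_bounds(1) hilo rate_pos by (intro divide_left_mono mult_pos_pos) auto
 also have "... = ta n / r * (hi / lo)" unfolding h2 using lo_pos hi_pos by simp
 finally show ?thesis .
qed

text \<open>The constant \<open>3 * A^2 + A * B\<close> of the fourth moment estimate with
  \<open>A = ta n * (hi / lo)\<close> and \<open>B = ta n / r\<close>, stripped of the factor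
  \<open>(ta n)^2\<close>; it serves both processes.\<close>

definition C4 :: real where "C4 = 3 * (hi / lo)^2 + hi / lo / r"

lemma C4_pos: "0 < C4" unfolding C4_def using hilo r_pos lo_pos hi_pos by (intro add_pos_pos) auto

lemma fourth_X:
 assumes "a <= k" "k <= 4 ^ n"
 shows "EP n (%om. (Xd n k om - Xd n a om) ^ 4) <= C4 * (ta n * real (k - a))^2"
proof -
 have A: "(h n)^2 * ch.Qj n j om <= ta n * (hi / lo)" for j om
 proof -
  have "(h n)^2 * ch.Qj n j om = ta n * rate n j (fst om j) (snd om)"
  unfolding Qj_eq sgd_sq using h2r[of n] by (simp add: mult_ac)
  also have "... <= ta n * (hi / lo)" using ta_pos[of n] rate_bounds(2) by (intro mult_left_mono) auto
  finally show ?thesis .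
 qed
 have B: "(h n)^2 <= ta n / r" by (simp add: h2)
 have "EP n (%om. (Xd n k om - Xd n a om) ^ 4) <=
  3 * (ta n * (hi / lo))^2 * (real (k - a))^2 + (ta n * (hi / lo)) * (ta n / r) * real (k - a)"
  unfolding Xd_diff[OF assms(1)] by (rule ch.fourth_moment[OF adapted_at_const assms A B])
 also have "... <= 3 * (ta n * (hi / lo))^2 * (real (k - a))^2 + (ta n * (hi / lo)) * (ta n / r) * (real (k - a))^2"
 proof (intro add_left_mono mult_left_mono)
  show "real (k - a) <= (real (k - a))^2" by (cases "k - a") (auto simp: power2_eq_square)
 qed (use ta_pos[of n] hilo r_pos lo_pos hi_pos in auto)
 also have "... = C4 * (ta n * real (k - a))^2" by (simp add: C4_def power2_eq_square algebra_simps)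
 finally show ?thesis .
qed

lemma fourth_W:
 assumes "a <= k" "k <= 4 ^ n"
 shows "EP n (%om. (Wd n k om - Wd n a om) ^ 4) <= C4 * (ta n * real (k - a))^2"
proof -
 have A: "(wc n j om)^2 * ch.Qj n j om <= ta n" for j om by (simp add: wc_Q)
 have "EP n (%om. (Wd n k om - Wd n a om) ^ 4) <=
  3 * (ta n)^2 * (real (k - a))^2 + ta n * (ta n / r * (hi / lo)) * real (k - a)"
  unfolding Wd_diff[OF assms(1)] by (rule ch.fourth_moment[OF adapted_wc assms A wc_sq_le])
 also have "... <= 3 * (ta n * (hi / lo))^2 * (real (k - a))^2 + (ta n * (hi / lo)) * (ta n / r) * (real (k - a))^2"
 proof (intro add_mono)
  have "(ta n * 1)^2 <= (ta n * (hi / lo))^2" using ta_pos[of n] hilo by (intro power_mono mult_left_mono) auto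
  then show "3 * (ta n)^2 * (real (k - a))^2 <= 3 * (ta n * (hi / lo))^2 * (real (k - a))^2"
  by (intro mult_right_mono) auto
  have "real (k - a) <= (real (k - a))^2" by (cases "k - a") (auto simp: power2_eq_square)
  then have "(ta n * (hi / lo)) * (ta n / r) * real (k - a) <= (ta n * (hi / lo)) * (ta n / r) * (real (k - a))^2"
  using ta_pos[of n] hilo r_pos lo_pos hi_pos by (intro mult_left_mono) auto
  then show "ta n * (ta n / r * (hi / lo)) * real (k - a) <= (ta n * (hi / lo)) * (ta n / r) * (real (k - a))^2"
  by (simp add: mult_ac)
 qed
 also have "... = C4 * (ta n * real (k - a))^2" by (simp add: C4_def power2_eq_square algebra_simps)
 finally show ?thesis .
qed

lemma second_X:
 assumes "a <= k" "k <= 4 ^ n"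
 shows "EP n (%om. (Xd n k om - Xd n a om)^2) <= hi / lo * (ta n * real (k - a))"
proof -
 have "EP n (%om. (h n)^2 * ch.Qj n j om) <= ta n * (hi / lo)" for j
 proof (rule measure_pmf.integral_le_const)
  have "(h n)^2 * ch.Qj n j om <= ta n * (hi / lo)" for om
  proof -
  have "(h n)^2 * ch.Qj n j om = ta n * rate n j (fst om j) (snd om)"
  unfolding Qj_eq sgd_sq using h2r[of n] by (simp add: mult_ac)
  also have "... <= ta n * (hi / lo)" using ta_pos[of n] rate_bounds(2) by (intro mult_left_mono) auto
  finally show ?thesis .
  qed
  then show "AE om in measure_pmf (plaw n). (h n)^2 * ch.Qj n j om <= ta n * (hi / lo)" by simp
 qed simp
 then have "(SUM j=a..<k. EP n (%om. (h n)^2 * ch.Qj n j om)) <= (SUM j=a..<k. ta n * (hi / lo))" by (intro sum_mono)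
 then show ?thesis
  unfolding Xd_diff[OF assms(1)] ch.isometry[OF adapted_at_const assms] by (simp add: mult_ac)
qed

lemma char_W:
 fixes Ph :: "(nat => int) \<times> 'd => complex"
 assumes "a <= k" "k <= 4 ^ n" and Ph: "adapted_at a Ph" "!!om. cmod (Ph om) <= 1"
 shows "cmod (EP n (%om. Ph om * iexp (th * (Wd n k om - Wd n a om))) - EP n Ph * exp (- (th^2 / 2) * (ta n * real (k - a))))
  <= th ^ 4 * T * (hi / lo / r + 1) * ta n"
proof -
 have "cmod (EP n (%om. Ph om * iexp (th * ch.mart (wc n) a k om)) - EP n Ph * exp (- (th^2 * ta n / 2) * real (k - a)))
  <= real (k - a) * (th ^ 4 * ta n * (ta n / r * (hi / lo)) + th ^ 4 * (ta n)^2)"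
  by (rule ch.characteristic_step[OF adapted_wc assms(1,2) wc_Q wc_sq_le Ph])
 also have "... = (real (k - a) * ta n) * (th ^ 4 * (hi / lo / r + 1) * ta n)"
  by (simp add: power2_eq_square algebra_simps)
 also have "... <= T * (th ^ 4 * (hi / lo / r + 1) * ta n)"
 proof (rule mult_right_mono)
  have "k - a <= 4 ^ n" using assms(2) by linarith
  then have "real (k - a) <= real (4 ^ n)" by (simp only: of_nat_le_iff)
  then have "real (k - a) * ta n <= 4 ^ n * ta n" using ta_pos[of n] by (intro mult_right_mono) auto
  then show "real (k - a) * ta n <= T" by (simp add: ta_def)
  show "0 <= th ^ 4 * (hi / lo / r + 1) * ta n"
  using ta_pos[of n] hilo r_pos lo_pos hi_pos by (intro mult_nonneg_nonneg add_nonneg_nonneg) auto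
 qed
 finally have "cmod (EP n (%om. Ph om * iexp (th * ch.mart (wc n) a k om)) - EP n Ph * exp (- (th^2 * ta n / 2) * real (k - a)))
  <= T * (th ^ 4 * (hi / lo / r + 1) * ta n)" .
 moreover have "- (th^2 * ta n / 2) * real (k - a) = - (th^2 / 2) * (ta n * real (k - a))" by simp
 ultimately show ?thesis unfolding Wd_diff[OF assms(1)] by (simp add: mult_ac)
qed

text \<open>Since \<open>X\<close> moves by \<open>sgd\<close> times the increment of
  \<open>W\<close>, the difference is the martingale transform of \<open>G - sgd\<close>:
  approximating \<open>X\<close> by stochastic sums reduces to approximating its volatility in
  \<open>L^2\<close>.\<close>

lemma isometry_X:
 assumes "a <= k" "k <= 4 ^ n" and G: "!!j. adapted_at j (G j)"
 shows "EP n (%om. ((SUM j=a..<k. G j om * (Wd n (Suc j) om - Wd n j om)) - (Xd n k om - Xd n a om))^2)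
  = (SUM j=a..<k. ta n * EP n (%om. (G j om - sgd n j om)^2))"
proof -
 define c where "c j om = (G j om - sgd n j om) * wc n j om" for j om
 have c: "adapted_at j (c j)" for j
  unfolding c_def by (intro adapted_at_comp2[of j _ _ "(*)"] adapted_at_comp2[of j _ _ "(-)"] G adapted_sgd adapted_wc)
 have "(SUM j=a..<k. G j om * (Wd n (Suc j) om - Wd n j om)) - (Xd n k om - Xd n a om) = ch.mart c a k om" for om
 proof -
  have e1: "Wd n (Suc j) om - Wd n j om = wc n j om * of_int (ch.jump j om)" for j
  by (simp add: Wd_def ch.mart_Suc)
  have "sgd n j om * wc n j om = h n" for j using sgd_pos[of n j om] by (simp add: wc_def)
  then have e2: "h n * of_int (ch.jump j om) = sgd n j om * (wc n j om * of_int (ch.jump j om))" for j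
  by (metis mult.assoc)
  show ?thesis
  unfolding Xd_diff[OF assms(1)] ch.mart_def c_def sum_subtractf[symmetric] e1 e2
  by (intro sum.cong refl) (simp only: left_diff_distrib mult.assoc)
 qed
 then have "EP n (%om. ((SUM j=a..<k. G j om * (Wd n (Suc j) om - Wd n j om)) - (Xd n k om - Xd n a om))^2)
  = EP n (%om. (ch.mart c a k om)^2)" by simp
 also have "... = (SUM j=a..<k. EP n (%om. (c j om)^2 * ch.Qj n j om))" by (rule ch.isometry[OF c assms(1,2)])
 also have "... = (SUM j=a..<k. ta n * EP n (%om. (G j om - sgd n j om)^2))"
 proof (intro sum.cong refl)
  fix j
  have "(c j om)^2 * ch.Qj n j om = ta n * (G j om - sgd n j om)^2" for om
  using wc_Q[of n j om] by (simp add: c_def power_mult_distrib mult_ac)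
  then show "EP n (%om. (c j om)^2 * ch.Qj n j om) = ta n * EP n (%om. (G j om - sgd n j om)^2)" by simp
 qed
 finally show ?thesis .
qed

lemma E_marg_sum:
 fixes ph :: "int => 'd => 'b::{banach, second_countable_topology}"
 assumes "k <= 4 ^ n" and L: "4 ^ n + int k <= L"
 shows "EP n (%om. ph (fst om k) (snd om)) = (SUM x=-L..L. SUM i:UNIV. P n k x $ i *\<^sub>R ph x i)"
proof -
 have "EP n (%om. ph (fst om k) (snd om)) = measure_pmf.expectation (ch.marg n k) (%(x, i). ph x i)"
  by (rule ch.E_marg[OF assms(1)])
 also have "... = (SUM z:{-L..L} \<times> UNIV. pmf (ch.marg n k) z *\<^sub>R (case z of (x, i) => ph x i))"
 proof (rule integral_measure_pmf)
  fix z assume z: "z : set_pmf (ch.marg n k)"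
  obtain x i where xi: "z = (x, i)" by (cases z)
  have "P n k x $ i ~= 0" using z pmf_marg[of n k x i] by (simp add: xi set_pmf_iff)
  then have "P n k x ~= 0" by auto
  then have "abs x <= L" using supp_P[of n k] L unfolding supp_in_def by (meson le_less_trans not_le order_trans)
  then show "z : {-L..L} \<times> UNIV" by (auto simp: xi)
 qed auto
 also have "... = (SUM x=-L..L. SUM i:UNIV. P n k x $ i *\<^sub>R ph x i)"
  unfolding sum.cartesian_product by (intro sum.cong refl) (auto simp: pmf_marg)
 finally show ?thesis .
qed

lemma E_initial:
 fixes ph :: "real => 'd => 'b::{banach, second_countable_topology}"
 shows "EP n (%om. ph (Xd n 0 om) (snd om)) = (SUM i:UNIV. al i *\<^sub>R (LINT xi|\<mu>. ph (h n * of_int (rnd n xi)) i))"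
proof -
 have "EP n (%om. ph (h n * of_int (fst om 0)) (snd om)) = (SUM x=-(4^n)..4^n. SUM i:UNIV. P n 0 x $ i *\<^sub>R ph (h n * of_int x) i)"
  by (rule E_marg_sum) auto
 also have "... = (SUM i:UNIV. al i *\<^sub>R (SUM x=-(4^n)..4^n. pmf (m0 n) x *\<^sub>R ph (h n * of_int x) i))"
  by (subst sum.swap) (simp add: P_def p0_def scaleR_sum_right mult_ac)
 finally have E: "EP n (%om. ph (h n * of_int (fst om 0)) (snd om)) =
  (SUM i:UNIV. al i *\<^sub>R (SUM x=-(4^n)..4^n. pmf (m0 n) x *\<^sub>R ph (h n * of_int x) i))" .
 have "(SUM x=-(4^n)..4^n. pmf (m0 n) x *\<^sub>R ph (h n * of_int x) i) = (LINT xi|\<mu>. ph (h n * of_int (rnd n xi)) i)" for i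
 proof -
  have "(SUM x=-(4^n)..4^n. pmf (m0 n) x *\<^sub>R ph (h n * of_int x) i) = measure_pmf.expectation (m0 n) (%x. ph (h n * of_int x) i)"
  by (rule integral_measure_pmf[symmetric]) (use subsetD[OF set_m0[of n]] in auto)
  also have "... = (LINT xi|\<mu>. ph (h n * of_int (rnd n xi)) i)"
  unfolding m0 using rnd_measurable \<mu>(2) by (subst integral_distr) (auto simp: measurable_cong_sets)
  finally show ?thesis .
 qed
 with E show ?thesis by (simp add: Xd_def)
qed

text \<open>Exact at every level: averaged over the label the jump probability is \<open>r\<close>,
  because the flux preserves \<open>tot\<close>. So \<open>X\<close> has the marginals of a lazy
  random walk, whatever the volatilities.\<close>

lemma E_char_X:
 assumes "k <= 4 ^ n"
 shows "EP n (%om. iexp (th * Xd n k om)) = (LINT xi|\<mu>. iexp (th * (h n * of_int (rnd n xi)))) * of_real (1 - r * (1 - cos (th * h n))) ^ k"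
 using assms
proof (induction k)
 case 0
 have "EP n (%om. iexp (th * Xd n 0 om)) = (SUM i:UNIV. al i *\<^sub>R (LINT xi|\<mu>. iexp (th * (h n * of_int (rnd n xi)))))"
  by (rule E_initial[where ph = "%x i. iexp (th * x)"])
 then show ?case using al_sum by (simp add: scaleR_sum_left[symmetric])
next
 case (Suc k)
 define c where "c = 1 - cos (th * h n)"
 define u where "u x = iexp (th * (h n * of_int x))" for x :: int
 have trig: "u (x + 1) + u (x - 1) = u x * of_real (2 * cos (th * h n))" for x
 proof -
  have "\<i> * complex_of_real (th * (h n * of_int (x + 1))) = \<i> * of_real (th * (h n * of_int x)) + \<i> * of_real (th * h n)"
  "\<i> * complex_of_real (th * (h n * of_int (x - 1))) = \<i> * of_real (th * (h n * of_int x)) + \<i> * of_real (- (th * h n))"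
  by (simp_all add: algebra_simps)
  then have "u (x + 1) + u (x - 1) = u x * (iexp (th * h n) + iexp (- (th * h n)))"
  unfolding u_def by (simp only: exp_add distrib_left)
  also have "iexp (th * h n) + iexp (- (th * h n)) = of_real (2 * cos (th * h n))"
  unfolding cis_conv_exp[symmetric] by (simp add: complex_eq_iff)
  finally show ?thesis .
 qed
 have "EP n (%om. iexp (th * Xd n (Suc k) om)) = EP n (%om. u (fst om k + ch.jump k om))"
  by (simp add: Xd_def u_def ch.jump_def)
 also have "... = EP n (%om. (1 - ch.Qj n k om) *\<^sub>R u (fst om k + 0) + (ch.Qj n k om / 2) *\<^sub>R
  (u (fst om k + 1) + u (fst om k + (-1))))"
  by (rule ch.E_jump[where G = "%om e. u (fst om k + e)"]) (use Suc in \<open>auto simp: adapted_at_def\<close>)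
 also have "... = EP n (%om. (1 - q n k (fst om k) (snd om) * c) *\<^sub>R u (fst om k))"
 proof (rule Bochner_Integration.integral_cong)
  fix om
  have "(1 - Q) *\<^sub>R z + (Q / 2) *\<^sub>R (z * of_real (2 * (1 - c))) = (1 - Q * c) *\<^sub>R z" for Q :: real and z :: complex
  proof -
  have "z * of_real (2 * (1 - c)) = (2 * (1 - c)) *\<^sub>R z" by (simp only: scaleR_conv_of_real mult.commute)
  then have "(1 - Q) *\<^sub>R z + (Q / 2) *\<^sub>R (z * of_real (2 * (1 - c))) = (1 - Q + Q / 2 * (2 * (1 - c))) *\<^sub>R z"
  by (simp only: scaleR_scaleR scaleR_left_distrib)
  moreover have "1 - Q + Q / 2 * (2 * (1 - c)) = 1 - Q * c" by (simp add: algebra_simps)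
  ultimately show ?thesis by simp
  qed
  moreover have "cos (th * h n) = 1 - c" by (simp add: c_def)
  ultimately show "(1 - ch.Qj n k om) *\<^sub>R u (fst om k + 0) + (ch.Qj n k om / 2) *\<^sub>R (u (fst om k + 1) + u (fst om k + (-1)))
  = (1 - q n k (fst om k) (snd om) * c) *\<^sub>R u (fst om k)"
  using trig[of "fst om k"] by (simp add: ch.Qj_def)
 qed simp
 also have "... = (SUM x=-(4^n + int k)..4^n + int k. SUM i:UNIV. P n k x $ i *\<^sub>R ((1 - q n k x i * c) *\<^sub>R u x))"
  by (rule E_marg_sum[where ph = "%x i. (1 - q n k x i * c) *\<^sub>R u x"]) (use Suc in auto)
 also have "... = (SUM x=-(4^n + int k)..4^n + int k. SUM i:UNIV. P n k x $ i *\<^sub>R u x) * of_real (1 - r * c)"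
 proof (subst sum_distrib_right, intro sum.cong refl)
  fix x
  have "(SUM i:UNIV. P n k x $ i *\<^sub>R ((1 - q n k x i * c) *\<^sub>R u x)) = (SUM i:UNIV. P n k x $ i - r * c * flux l (P n k x) $ i) *\<^sub>R u x"
  unfolding scaleR_sum_left q_def rate_flux[symmetric] by (intro sum.cong refl) (simp add: algebra_simps)
  also have "(SUM i:UNIV. P n k x $ i - r * c * flux l (P n k x) $ i) = tot (P n k x) - r * c * tot (flux l (P n k x))"
  unfolding tot_def by (simp add: sum_subtractf sum_distrib_left)
  also have "... = tot (P n k x) * (1 - r * c)" by (simp add: tot_flux[OF nonneg_P] algebra_simps)
  finally show "(SUM i:UNIV. P n k x $ i *\<^sub>R ((1 - q n k x i * c) *\<^sub>R u x)) = (SUM i:UNIV. P n k x $ i *\<^sub>R u x) * of_real (1 - r * c)"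
  unfolding scaleR_sum_left[symmetric] tot_def[symmetric] by (simp add: scaleR_conv_of_real)
 qed
 also have "(SUM x=-(4^n + int k)..4^n + int k. SUM i:UNIV. P n k x $ i *\<^sub>R u x) = EP n (%om. u (fst om k))"
  by (rule E_marg_sum[symmetric, where ph = "%x i. u x"]) (use Suc in auto)
 also have "EP n (%om. u (fst om k)) = EP n (%om. iexp (th * Xd n k om))" by (simp add: u_def Xd_def)
 finally show ?case using Suc by (simp add: c_def mult_ac)
qed

end

section \<open>Mollified energy\<close>

text \<open>Its integer translates form a partition of unity in which each point meets at most two
  of them.\<close>

definition hat :: "real => real" where "hat z = max 0 (1 - abs z)"

lemma hat_bounds: "0 <= hat z" "hat z <= 1" by (auto simp: hat_def)

lemma hat_lipschitz: "abs (hat y - hat z) <= abs (y - z)"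
 by (auto simp: hat_def max_def abs_if)

lemma hat_sum_eq:
 assumes "\<lfloor>z\<rfloor> : A" "\<lfloor>z\<rfloor> + 1 : A" "finite A"
 shows "(SUM j:A. hat (z - of_int j)) = 1"
proof -
 have "(SUM j:A. hat (z - of_int j)) = (SUM j:{\<lfloor>z\<rfloor>, \<lfloor>z\<rfloor> + 1}. hat (z - of_int j))"
 proof (rule sum.mono_neutral_right)
  show "ALL j:A - {\<lfloor>z\<rfloor>, \<lfloor>z\<rfloor> + 1}. hat (z - of_int j) = 0"
  proof
  fix j assume "j : A - {\<lfloor>z\<rfloor>, \<lfloor>z\<rfloor> + 1}"
  then have "j <= \<lfloor>z\<rfloor> - 1 \<or> \<lfloor>z\<rfloor> + 2 <= j" by auto
  then have "1 <= abs (z - of_int j)" by linarith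
  then show "hat (z - of_int j) = 0" by (simp add: hat_def)
  qed
 qed (use assms in auto)
 also have "... = hat (z - of_int \<lfloor>z\<rfloor>) + hat (z - of_int (\<lfloor>z\<rfloor> + 1))" by simp
 also have "hat (z - of_int \<lfloor>z\<rfloor>) = 1 - (z - of_int \<lfloor>z\<rfloor>)"
  unfolding hat_def by linarith
 also have "hat (z - of_int (\<lfloor>z\<rfloor> + 1)) = z - of_int \<lfloor>z\<rfloor>"
  unfolding hat_def of_int_add of_int_1 by linarith
 finally show ?thesis by simp
qed

lemma hat_sum_le: "finite A ==> (SUM j:A. hat (z - of_int j)) <= 1"
proof -
 assume "finite A"
 have "(SUM j:A. hat (z - of_int j)) <= (SUM j:A Un {\<lfloor>z\<rfloor>, \<lfloor>z\<rfloor> + 1}. hat (z - of_int j))"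
  using \<open>finite A\<close> hat_bounds by (intro sum_mono2) auto
 also have "... = 1" by (rule hat_sum_eq) (use \<open>finite A\<close> in auto)
 finally show ?thesis .
qed

lemma hat_sum_window:
 assumes "abs z <= of_int J"
 shows "(SUM j=-J..J. hat (z - of_int j)) = 1"
proof -
 have "\<lfloor>z\<rfloor> : {-J..J}" using assms by (auto simp: le_floor_iff floor_le_iff abs_le_iff)
 have "(SUM j=-J..J. hat (z - of_int j)) = (SUM j:{-J..J+1}. hat (z - of_int j))"
 proof (rule sum.mono_neutral_left)
  show "ALL j:{-J..J+1} - {-J..J}. hat (z - of_int j) = 0"
  proof
  fix j assume "j : {-J..J+1} - {-J..J}"
  then have "j = J + 1" by auto
  then have "z - of_int j <= -1" using assms by (simp add: abs_le_iff)
  then show "hat (z - of_int j) = 0" by (simp add: hat_def)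
  qed
 qed auto
 also have "... = 1" using \<open>\<lfloor>z\<rfloor> : {-J..J}\<close> by (intro hat_sum_eq) auto
 finally show ?thesis .
qed

lemma norm_telescope:
 fixes p :: "int => 'b::real_normed_vector"
 assumes "a <= x" "x <= y" "y <= b"
 shows "norm (p y - p x) <= (SUM z:{a..<b}. norm (p (z + 1) - p z))"
proof -
 have "norm (p y - p x) <= (SUM z:{x..<y}. norm (p (z + 1) - p z))"
  using assms(2)
 proof (induction y rule: int_ge_induct)
  case (step i)
  have "{x..<i+1} = insert i {x..<i}" using step by auto
  then show ?case using step norm_triangle_ineq[of "p (i + 1) - p i" "p i - p x"] by simp
 qed simp
 also have "... <= (SUM z:{a..<b}. norm (p (z + 1) - p z))"
  using assms by (intro sum_mono2) auto
 finally show ?thesis .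
qed

context volatilities
begin

text \<open>The energy density: its sum over the lattice is \<open>E[v_n(X)^2]\<close>. It is convex
  and homogeneous of degree one, so averaging over blocks can only decrease the energy; the task of
  this section is to bound that decrease.\<close>

definition Th :: "real ^ 'd => real" where "Th p = (wtot l p)^2 / tot p"

text \<open>The sum of \<open>2 * hi * (hi * d)\<close> from the term in \<open>wtot\<close> and
  \<open>hi^2 * d\<close> from the term in \<open>tot\<close>, with
  \<open>d = CARD('d)\<close>.\<close>

definition KTh :: real where "KTh = 3 * hi^2 * real CARD('d)"

lemma KTh_pos: "0 < KTh" using hi_pos by (simp add: KTh_def)

lemma Th_0 [simp]: "Th 0 = 0" by (simp add: Th_def)

lemma wtot_nonneg: "nonneg_vec p ==> 0 <= wtot l p"
 using wtot_bounds(1)[of p] tot_nonneg[of p] lo_pos by (meson mult_nonneg_nonneg less_imp_le order_trans)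

lemma Th_nonneg: "nonneg_vec p ==> 0 <= Th p"
 using tot_nonneg[of p] by (simp add: Th_def)

text \<open>\<open>Th\<close> is a supremum of linear functions, attained at
  \<open>c = wtot l p / tot p\<close> for nonzero \<open>p\<close>. This \<open>c\<close> is at most
  \<open>hi\<close>, so a Lipschitz bound for \<open>Th\<close> follows even though the quotient is
  singular at zero.\<close>

lemma Th_variational:
 assumes "nonneg_vec p"
 shows "2 * c * wtot l p - c^2 * tot p <= Th p"
proof (cases "p = 0")
 case False
 have t: "0 < tot p" by (rule tot_pos[OF assms False])
 have "0 <= (wtot l p - c * tot p)^2 / tot p" using t by simp
 also have "... = Th p - (2 * c * wtot l p - c^2 * tot p)"
  using t by (simp add: Th_def power2_diff power_mult_distrib field_simps power2_eq_square)
 finally show ?thesis by simp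
qed simp

lemma Th_le: "nonneg_vec p ==> Th p <= hi^2 * tot p"
proof (cases "p = 0")
 case False
 assume p: "nonneg_vec p"
 have t: "0 < tot p" by (rule tot_pos[OF p False])
 have "(wtot l p)^2 <= (hi * tot p)^2" using wtot_bounds(2)[OF p] wtot_nonneg[OF p] by (intro power_mono)
 then show ?thesis using t by (simp add: Th_def divide_le_eq power_mult_distrib power2_eq_square mult_ac)
qed simp

lemma Th_diff_le:
 assumes p: "nonneg_vec p" and q: "nonneg_vec q"
 shows "Th p - Th q <= KTh * norm (p - q)"
proof (cases "p = 0")
 case True
 then show ?thesis
  using Th_nonneg[OF q] mult_nonneg_nonneg[OF less_imp_le[OF KTh_pos] norm_ge_zero[of "p - q"]]
  by (simp only: Th_0)
next
 case False
 have t: "0 < tot p" by (rule tot_pos[OF p False])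
 define c where "c = wtot l p / tot p"
 have c: "0 <= c" "c <= hi" using wtot_bounds(2)[OF p] wtot_nonneg[OF p] t by (auto simp: c_def divide_le_eq)
 have "Th p = 2 * c * wtot l p - c^2 * tot p"
  using t by (simp add: Th_def c_def power_divide power2_eq_square)
 then have "Th p - Th q <= 2 * c * wtot l (p - q) - c^2 * tot (p - q)"
  using Th_variational[OF q, of c] by (simp add: wtot_diff tot_diff right_diff_distrib)
 also have "... <= 2 * c * abs (wtot l (p - q)) + c^2 * abs (tot (p - q))"
 proof -
  have "2 * c * wtot l (p - q) <= 2 * c * abs (wtot l (p - q))" using c by (intro mult_left_mono) auto
  moreover have "c^2 * - tot (p - q) <= c^2 * abs (tot (p - q))" by (intro mult_left_mono) auto
  ultimately show ?thesis by simp
 qed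
 also have "... <= 2 * hi * (hi * (real CARD('d) * norm (p - q))) + hi^2 * (real CARD('d) * norm (p - q))"
  using c abs_wtot_le[of "p - q"] abs_tot_le[of "p - q"] hi_pos
  by (intro add_mono mult_mono power_mono) auto
 also have "... = KTh * norm (p - q)" by (simp add: KTh_def power2_eq_square algebra_simps)
 finally show ?thesis .
qed

lemma Th_scaleR: "Th (c *\<^sub>R p) = c * Th p"
 by (simp add: Th_def wtot_scaleR tot_scaleR power2_eq_square)

lemma nonneg_vec_sum: "(!!x. x : S ==> 0 <= c x) ==> (!!x. nonneg_vec (p x)) ==> nonneg_vec (SUM x:S. c x *\<^sub>R p x)"
 unfolding nonneg_vec_def by (auto intro!: sum_nonneg)

lemma nonneg_vec_scaleR: "0 <= c ==> nonneg_vec p ==> nonneg_vec (c *\<^sub>R p)"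
 unfolding nonneg_vec_def by auto

text \<open>A converse of Jensen's inequality. Within a block every value differs from the weighted
  mean by at most the total variation \<open>V\<close>; the Lipschitz bound for \<open>Th\<close> is
  then summed over weights of total at most \<open>2 * B\<close>.\<close>

lemma block_estimate:
 fixes p :: "int => real ^ 'd" and B :: nat and j :: int
 assumes p: "!!x. nonneg_vec (p x)" and B: "0 < B" and S: "finite S"
 defines "ct \<equiv> %x. hat (of_int x / real B - of_int j)"
 defines "V \<equiv> SUM z:{(j - 1) * int B..<(j + 1) * int B}. norm (p (z + 1) - p z)"
 shows "(SUM x:S. ct x * Th (p x)) <= Th (SUM x:S. ct x *\<^sub>R p x) + KTh * (2 * real B) * V"
proof -
 define M where "M = (SUM x:S. ct x)"
 have ct: "0 <= ct x" "ct x <= 1" for x by (simp_all add: ct_def hat_bounds)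
 have V0: "0 <= V" unfolding V_def by (intro sum_nonneg) simp
 have supp: "x : {(j - 1) * int B<..<(j + 1) * int B}" if "ct x ~= 0" for x
 proof -
  have "abs (of_int x / real B - of_int j) < 1" using that by (auto simp: ct_def hat_def max_def split: if_splits)
  then have "(of_int j - 1) * real B < of_int x" "of_int x < (of_int j + 1) * real B"
  using B by (auto simp: abs_less_iff field_simps)
  then have "real_of_int ((j - 1) * int B) < of_int x" "real_of_int x < of_int ((j + 1) * int B)"
  by simp_all
  then show ?thesis by (simp only: of_int_less_iff greaterThanLessThan_iff)
 qed
 have M0: "0 <= M" unfolding M_def using ct by (simp add: sum_nonneg)
 have M2: "M <= 2 * real B"
 proof -
  have "M = (SUM x:S Int {(j - 1) * int B<..<(j + 1) * int B}. ct x)"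
  unfolding M_def using supp S by (intro sum.mono_neutral_right) auto
  also have "... <= real (card (S Int {(j - 1) * int B<..<(j + 1) * int B})) * 1"
  using ct by (intro sum_bounded_above) auto
  also have "card (S Int {(j - 1) * int B<..<(j + 1) * int B}) <= card {(j - 1) * int B<..<(j + 1) * int B}"
  by (intro card_mono) auto
  also have "card {(j - 1) * int B<..<(j + 1) * int B} <= 2 * B" by (simp add: algebra_simps)
  finally show ?thesis by simp
 qed
 show ?thesis
 proof (cases "M = 0")
  case True
  then have "ct x = 0" if "x : S" for x using that S ct unfolding M_def by (simp add: sum_nonneg_eq_0_iff)
  then have "(SUM x:S. ct x * Th (p x)) = 0" "(SUM x:S. ct x *\<^sub>R p x) = 0" by simp_all
  then show ?thesis using KTh_pos V0 by simp
 next
  case False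
  then have Mp: "0 < M" using M0 by simp
  define s where "s = (1 / M) *\<^sub>R (SUM x:S. ct x *\<^sub>R p x)"
  have snn: "nonneg_vec s" unfolding s_def using Mp ct p by (intro nonneg_vec_scaleR nonneg_vec_sum) auto
  have "Th (SUM x:S. ct x *\<^sub>R p x) = M * Th s" unfolding s_def Th_scaleR using Mp by simp
  moreover have "ct x * Th (p x) <= ct x * (Th s + KTh * V)" if "x : S" for x
  proof (cases "ct x = 0")
  case False
  have "p x - s = (1 / M) *\<^sub>R (SUM y:S. ct y *\<^sub>R (p x - p y))"
  unfolding s_def using Mp
  by (simp add: scaleR_right_diff_distrib sum_subtractf M_def flip: scaleR_sum_left)
  also have "norm ... <= (1 / M) * (SUM y:S. ct y * V)"
  proof -
  have "norm (ct y *\<^sub>R (p x - p y)) <= ct y * V" for y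
  proof (cases "ct y = 0")
  case y: False
  have "norm (p x - p y) <= V"
  proof (cases "x <= y")
  case True
  have "norm (p y - p x) <= V"
  unfolding V_def using supp[OF False] supp[OF y] True by (intro norm_telescope) auto
  then show ?thesis by (simp add: norm_minus_commute)
  next
  case nle: False
  show ?thesis
  unfolding V_def using supp[OF False] supp[OF y] nle by (intro norm_telescope) auto
  qed
  then show ?thesis using ct(1)[of y] by (simp add: mult_left_mono)
  qed simp
  then show ?thesis using Mp by (auto intro!: divide_right_mono order_trans[OF norm_sum] sum_mono)
  qed
  also have "... = V" using Mp by (simp add: M_def flip: sum_distrib_right)
  finally have "Th (p x) - Th s <= KTh * V"
  using Th_diff_le[OF p[of x] snn] KTh_pos by (meson mult_left_mono less_imp_le order_trans)
  then show ?thesis using ct(1)[of x] by (intro mult_left_mono) auto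
  qed simp
  then have "(SUM x:S. ct x * Th (p x)) <= M * (Th s + KTh * V)"
  unfolding M_def sum_distrib_right by (intro sum_mono)
  moreover have "M * (KTh * V) <= 2 * real B * (KTh * V)"
  using M2 KTh_pos V0 by (intro mult_right_mono) auto
  ultimately show ?thesis by (simp add: distrib_left mult_ac)
 qed
qed

end

context approx
begin

definition tent :: "nat => int => real => real" where
 "tent a j y = hat (y / h a - of_int j)"

lemma tent_lattice:
 assumes "a <= n"
 shows "tent a j (h n * of_int x) = hat (of_int x / real (2 ^ (n - a)) - of_int j)"
proof -
 have "(2::real) ^ n = 2 ^ a * 2 ^ (n - a)" using assms by (simp flip: power_add)
 moreover have "0 < sqrt (T / r)" using T_pos r_pos by simp
 ultimately have "h n * of_int x / h a = of_int x / real (2 ^ (n - a))"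
  unfolding h_def using T_pos r_pos by (simp add: field_simps)
 then show ?thesis by (simp add: tent_def)
qed

abbreviation win :: "nat => int set" where "win n \<equiv> {-(2 * 4 ^ n)..2 * 4 ^ n}"

lemma E_win:
 fixes ph :: "int => 'd => real"
 assumes "k <= 4 ^ n"
 shows "EP n (%om. ph (fst om k) (snd om)) = (SUM x:win n. SUM i:UNIV. P n k x $ i * ph x i)"
proof -
 have "int k <= 4 ^ n" using assms by (metis of_nat_le_iff of_nat_numeral of_nat_power)
 then show ?thesis using E_marg_sum[of k n "2 * 4 ^ n" ph] assms by simp
qed

text \<open>Neighbouring blocks overlap, but each bond belongs to at most two of them.\<close>

lemma sum_grad_le:
 fixes B :: nat and J :: nat and g :: "int => real"
 assumes "0 < B" and g: "!!z. 0 <= g z"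
 shows "(SUM j=-int J..int J. SUM z:{(j - 1) * int B..<(j + 1) * int B}. g z) <=
  2 * (SUM z:{-(int J + 1) * int B..<(int J + 1) * int B}. g z)"
proof -
 let ?W = "{-(int J + 1) * int B..<(int J + 1) * int B}"
 have "(SUM j=-int J..int J. SUM z:{(j - 1) * int B..<(j + 1) * int B}. g z)
  <= (SUM j=-int J..int J. SUM z:?W. if j = z div int B \<or> j = z div int B + 1 then g z else 0)"
 proof (rule sum_mono)
  fix j assume j: "j : {-int J..int J}"
  have sub: "{(j - 1) * int B..<(j + 1) * int B} <= ?W"
  proof
  fix z assume "z : {(j - 1) * int B..<(j + 1) * int B}"
  moreover have "(-(int J + 1)) * int B <= (j - 1) * int B" using j by (intro mult_right_mono) auto
  moreover have "(j + 1) * int B <= (int J + 1) * int B" using j by (intro mult_right_mono) auto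
  ultimately show "z : ?W" by auto
  qed
  have ind: "j = z div int B \<or> j = z div int B + 1" if "z : {(j - 1) * int B..<(j + 1) * int B}" for z
  proof -
  have "(j - 1) * int B div int B <= z div int B" using that assms by (intro zdiv_mono1) auto
  then have 1: "j - 1 <= z div int B" using assms by simp
  have "z div int B * int B <= z" using assms by (simp add: minus_mod_eq_div_mult[symmetric])
  also have "z < (j + 1) * int B" using that by simp
  finally have "z div int B < j + 1" using assms by (simp add: mult_less_cancel_right)
  then show ?thesis using 1 by linarith
  qed
  have "(SUM z:{(j - 1) * int B..<(j + 1) * int B}. g z) = (SUM z:{(j - 1) * int B..<(j + 1) * int B}. if j = z div int B \<or> j = z div int B + 1 then g z else 0)"
  using ind by (intro sum.cong) auto
  also have "... <= (SUM z:?W. if j = z div int B \<or> j = z div int B + 1 then g z else 0)"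
  using sub g by (intro sum_mono2) auto
  finally show "(SUM z:{(j - 1) * int B..<(j + 1) * int B}. g z) <= (SUM z:?W. if j = z div int B \<or> j = z div int B + 1 then g z else 0)" .
 qed
 also have "... = (SUM z:?W. SUM j=-int J..int J. if j = z div int B \<or> j = z div int B + 1 then g z else 0)"
  by (rule sum.swap)
 also have "... <= (SUM z:?W. 2 * g z)"
 proof (rule sum_mono)
  fix z
  have "(SUM j=-int J..int J. if j = z div int B \<or> j = z div int B + 1 then g z else 0)
  = (SUM j:{-int J..int J} Int {z div int B, z div int B + 1}. g z)"
  by (subst sum.inter_restrict) auto
  also have "... = real (card ({-int J..int J} Int {z div int B, z div int B + 1})) * g z" by simp
  also have "... <= 2 * g z"
  proof (rule mult_right_mono)
  have "card ({-int J..int J} Int {z div int B, z div int B + 1}) <= card {z div int B, z div int B + 1}"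
  by (intro card_mono) auto
  also have "... <= 2" by (simp add: card_insert_if)
  finally show "real (card ({-int J..int J} Int {z div int B, z div int B + 1})) <= 2" by simp
  qed (rule g)
  finally show "(SUM j=-int J..int J. if j = z div int B \<or> j = z div int B + 1 then g z else 0) <= 2 * g z" .
 qed
 finally show ?thesis by (simp add: sum_distrib_left)
qed

text \<open>The scales are fixed independently of \<open>n\<close>: tents of half-width
  \<open>h a\<close>, times from \<open>T / 4 ^ e\<close> on, and positions up to
  \<open>\<rho> * sqrt (T / r)\<close> in real units. The error vanishes as \<open>a\<close> grows,
  uniformly in \<open>n\<close>, because after Cauchy-Schwarz and the dissipation bound all powers
  of \<open>2 ^ n\<close> cancel.\<close>

theorem mollified_energy:
 fixes \<rho> :: nat
 assumes "a <= n" "e <= n"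
 defines "J \<equiv> int (\<rho> * 2 ^ a)"
 shows "(SUM k=4 ^ (n - e)..<4 ^ n. ta n * (SUM x:{x : win n. abs x <= J * 2 ^ (n - a)}. Th (P n k x))) <=
  (SUM k=4 ^ (n - e)..<4 ^ n. ta n * (SUM j=-J..J. Th (SUM x:win n. tent a j (h n * of_int x) *\<^sub>R P n k x)))
  + KTh * 4 * T * sqrt (2 * (real \<rho> + 1) * C0 * 2 ^ e) / 2 ^ a"
proof -
 define B :: nat where "B = 2 ^ (n - a)"
 have B: "0 < B" by (simp add: B_def)
 define I where "I = {4 ^ (n - e)..<4 ^ n :: nat}"
 define Z where "Z = {-(J + 1) * int B..<(J + 1) * int B}"
 define g where "g k z = norm (P n k (z + 1) - P n k z)" for k z
 have BJ: "J * 2 ^ (n - a) = J * int B" by (simp add: B_def)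
 have one: "(SUM x:{x : win n. abs x <= J * 2 ^ (n - a)}. Th (P n k x)) <=
  (SUM j=-J..J. Th (SUM x:win n. tent a j (h n * of_int x) *\<^sub>R P n k x)) + KTh * (2 * real B) * (2 * (SUM z:Z. g k z))" for k
 proof -
  have ps: "(SUM j=-J..J. tent a j (h n * of_int x)) = 1" if "abs x <= J * 2 ^ (n - a)" for x
  proof -
  have "abs (real_of_int x) <= of_int J * real B" using that unfolding BJ
  by (metis of_int_abs of_int_le_iff of_int_mult of_int_of_nat_eq)
  then have "abs (of_int x / real (2 ^ (n - a))) <= of_int J" using B unfolding B_def by (simp add: abs_divide divide_le_eq)
  then show ?thesis unfolding tent_lattice[OF assms(1)] by (rule hat_sum_window)
  qed
  have "(SUM x:{x : win n. abs x <= J * 2 ^ (n - a)}. Th (P n k x)) =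
  (SUM x:{x : win n. abs x <= J * 2 ^ (n - a)}. (SUM j=-J..J. tent a j (h n * of_int x)) * Th (P n k x))"
  using ps by (intro sum.cong) auto
  also have "... <= (SUM x:win n. (SUM j=-J..J. tent a j (h n * of_int x)) * Th (P n k x))"
  by (intro sum_mono2) (auto intro!: mult_nonneg_nonneg sum_nonneg Th_nonneg nonneg_P simp: tent_def hat_bounds)
  also have "... = (SUM j=-J..J. SUM x:win n. tent a j (h n * of_int x) * Th (P n k x))"
  by (simp only: sum_distrib_right) (rule sum.swap)
  also have "... <= (SUM j=-J..J. Th (SUM x:win n. tent a j (h n * of_int x) *\<^sub>R P n k x) +
  KTh * (2 * real B) * (SUM z:{(j - 1) * int B..<(j + 1) * int B}. g k z))"
  unfolding tent_lattice[OF assms(1)] g_def B_def[symmetric]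
  by (intro sum_mono block_estimate nonneg_P B) auto
  also have "... = (SUM j=-J..J. Th (SUM x:win n. tent a j (h n * of_int x) *\<^sub>R P n k x)) +
  KTh * (2 * real B) * (SUM j=-J..J. SUM z:{(j - 1) * int B..<(j + 1) * int B}. g k z)"
  by (simp only: sum.distrib sum_distrib_left)
  also have "... <= (SUM j=-J..J. Th (SUM x:win n. tent a j (h n * of_int x) *\<^sub>R P n k x)) +
  KTh * (2 * real B) * (2 * (SUM z:Z. g k z))"
  proof (intro add_left_mono mult_left_mono)
  show "(SUM j=-J..J. SUM z:{(j - 1) * int B..<(j + 1) * int B}. g k z) <= 2 * (SUM z:Z. g k z)"
  unfolding Z_def J_def by (rule sum_grad_le[OF B]) (simp add: g_def)
  qed (use KTh_pos in auto)
  finally show ?thesis .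
 qed
 \<comment> \<open>Cauchy-Schwarz over at most \<open>4 ^ n\<close> times and a multiple of
   \<open>2 ^ n\<close> sites, while the dissipation after \<open>4 ^ (n - e)\<close> steps is of
   order \<open>2 ^ e / 2 ^ n\<close>.\<close>
 have G: "(SUM k:I. SUM z:Z. g k z) <= 2 ^ n * sqrt (2 * (real \<rho> + 1) * C0 * 2 ^ e)"
 proof -
  have D: "(SUM k:I. SUM z:Z. (g k z)^2) <= C0 * 2 ^ e / 2 ^ n"
  proof -
  have "(SUM k:I. SUM z:Z. (g k z)^2) <= (SUM k:I. SUM z=-((J + 1) * int B)..(J + 1) * int B. (g k z)^2)"
  unfolding Z_def by (intro sum_mono sum_mono2) (auto simp: algebra_simps)
  also have "... <= C0 / sqrt (real (4 ^ (n - e)))"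
  unfolding I_def g_def P_def by (rule dissipation[OF supp_p0 nonneg_p0 mass_p0]) simp
  also have "sqrt (real (4 ^ (n - e))) = 2 ^ (n - e)"
  by (rule real_sqrt_unique) (simp_all add: power_mult[symmetric] mult.commute[of _ 2] power_mult)
  also have "C0 / 2 ^ (n - e) = C0 * 2 ^ e / 2 ^ n" using assms(2) by (simp add: power_diff)
  finally show ?thesis .
  qed
  have "(SUM k:I. SUM z:Z. g k z) = (SUM y:I \<times> Z. g (fst y) (snd y) * 1)"
  unfolding sum.cartesian_product by (simp add: split_beta)
  then have "(SUM k:I. SUM z:Z. g k z)^2 <= (SUM y:I \<times> Z. (g (fst y) (snd y))^2) * (SUM y:I \<times> Z. 1^2)"
  using Cauchy_Schwarz_ineq_sum[of "%y. g (fst y) (snd y)" "%_. 1" "I \<times> Z"] by simp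
  also have "(SUM y:I \<times> Z. (g (fst y) (snd y))^2) = (SUM k:I. SUM z:Z. (g k z)^2)"
  unfolding sum.cartesian_product by (simp add: split_beta)
  also have "(SUM y:I \<times> Z. 1^2) = real (card I) * real (card Z)" by (simp add: card_cartesian_product)
  also have "(SUM k:I. SUM z:Z. (g k z)^2) * (real (card I) * real (card Z)) <= (C0 * 2 ^ e / 2 ^ n) * (4 ^ n * (2 * (real \<rho> + 1) * 2 ^ n))"
  proof (intro mult_mono D)
  have "card I <= 4 ^ n" by (simp add: I_def)
  then show "real (card I) <= 4 ^ n" by (metis of_nat_le_iff of_nat_numeral of_nat_power)
  have "card Z = 2 * (\<rho> * 2 ^ a + 1) * B"
  unfolding Z_def J_def by (simp add: algebra_simps nat_add_distrib nat_mult_distrib)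
  then have "real (card Z) = 2 * (real \<rho> * (2 ^ a * 2 ^ (n - a)) + 2 ^ (n - a))"
  by (simp add: B_def algebra_simps)
  also have "(2::real) ^ a * 2 ^ (n - a) = 2 ^ n" using assms(1) by (simp flip: power_add)
  also have "(2::real) ^ (n - a) <= 2 ^ n" by (rule power_increasing) auto
  finally show "real (card Z) <= 2 * (real \<rho> + 1) * 2 ^ n" by (simp add: algebra_simps)
  qed (use C0_pos in \<open>auto intro!: sum_nonneg mult_nonneg_nonneg\<close>)
  also have "... = (2 ^ n)^2 * (2 * (real \<rho> + 1) * C0 * 2 ^ e)"
  proof -
  have "(4::real) ^ n = (2 ^ n)^2" by (simp add: power_mult[symmetric] mult.commute[of n] power_mult)
  then show ?thesis by simp
  qed
  finally have "(SUM k:I. SUM z:Z. g k z) <= sqrt ((2 ^ n)^2 * (2 * (real \<rho> + 1) * C0 * 2 ^ e))"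
  by (rule real_le_rsqrt)
  then show ?thesis by (simp add: real_sqrt_mult)
 qed
 have "(SUM k:I. ta n * (SUM x:{x : win n. abs x <= J * 2 ^ (n - a)}. Th (P n k x))) <=
  (SUM k:I. ta n * ((SUM j=-J..J. Th (SUM x:win n. tent a j (h n * of_int x) *\<^sub>R P n k x)) + KTh * (2 * real B) * (2 * (SUM z:Z. g k z))))"
  using ta_pos[of n] by (intro sum_mono mult_left_mono one) auto
 also have "... = (SUM k:I. ta n * (SUM j=-J..J. Th (SUM x:win n. tent a j (h n * of_int x) *\<^sub>R P n k x)))
  + ta n * (4 * KTh * real B) * (SUM k:I. SUM z:Z. g k z)"
 proof -
  have "(SUM k:I. ta n * (A k + KTh * (2 * real B) * (2 * G' k))) = (SUM k:I. ta n * A k) + ta n * (4 * KTh * real B) * (SUM k:I. G' k)"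
  for A G' :: "nat => real"
  by (simp add: distrib_left sum.distrib sum_distrib_left sum_distrib_right mult_ac)
  then show ?thesis .
 qed
 also have "ta n * (4 * KTh * real B) * (SUM k:I. SUM z:Z. g k z) <= ta n * (4 * KTh * real B) * (2 ^ n * sqrt (2 * (real \<rho> + 1) * C0 * 2 ^ e))"
  using G ta_pos[of n] KTh_pos by (intro mult_left_mono) auto
 also have "ta n * (4 * KTh * real B) * (2 ^ n * sqrt (2 * (real \<rho> + 1) * C0 * 2 ^ e))
  = KTh * 4 * T * sqrt (2 * (real \<rho> + 1) * C0 * 2 ^ e) / 2 ^ a"
 proof -
  have "ta n * real B * 2 ^ n = T / 2 ^ a"
  proof -
  have "(4::real) ^ n = 2 ^ n * 2 ^ n" by (simp flip: power_mult_distrib)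
  moreover have "(2::real) ^ n = 2 ^ a * 2 ^ (n - a)" using assms(1) by (simp flip: power_add)
  ultimately show ?thesis by (simp add: ta_def B_def field_simps)
  qed
  then have "ta n * (4 * KTh * real B) * (2 ^ n * s) = KTh * 4 * (T / 2 ^ a) * s" for s
  by (metis (no_types, lifting) mult.assoc mult.commute)
  then show ?thesis by simp
 qed
 finally show ?thesis unfolding I_def by simp
qed

text \<open>A version of \<open>E[l(Y) | X]\<close> for the chain at step \<open>k\<close>; the
  default \<open>lo\<close> keeps it within \<open>{lo..hi}\<close>.\<close>

definition vd :: "nat => nat => int => real" where
 "vd n k x = (if P n k x = 0 then lo else wtot l (P n k x) / tot (P n k x))"

lemma vd_bounds: "lo <= vd n k x" "vd n k x <= hi"
 using wtot_bounds[OF nonneg_P, of n k x] tot_pos[OF nonneg_P, of n k x] lo_le_hi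
 by (auto simp: vd_def field_simps)

text \<open>In the mixed term \<open>vd\<close> may be replaced by \<open>l(Y)\<close>, being its
  regression on the position. The energy is thereby the only term that is not the expectation of a
  given function of position and label.\<close>

lemma E_vd:
 fixes w :: "int => real"
 assumes "k <= 4 ^ n"
 shows "EP n (%om. (vd n k (fst om k) - w (fst om k))^2) =
  (SUM x:win n. Th (P n k x)) - 2 * EP n (%om. l (snd om) * w (fst om k)) + EP n (%om. (w (fst om k))^2)"
proof -
 have "(SUM i:UNIV. P n k x $ i * (vd n k x - w x)^2) =
  Th (P n k x) - 2 * (SUM i:UNIV. P n k x $ i * (l i * w x)) + (SUM i:UNIV. P n k x $ i * (w x)^2)" for x
 proof (cases "P n k x = 0")
  case False
  have t: "0 < tot (P n k x)" by (rule tot_pos[OF nonneg_P False])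
  have "(SUM i:UNIV. P n k x $ i * (vd n k x - w x)^2) = tot (P n k x) * (vd n k x - w x)^2"
  by (simp add: tot_def sum_distrib_right)
  also have "... = Th (P n k x) - 2 * (wtot l (P n k x) * w x) + tot (P n k x) * (w x)^2"
  using t False by (simp add: vd_def Th_def power2_diff field_simps power2_eq_square)
  finally show ?thesis by (simp add: tot_def wtot_def sum_distrib_left sum_distrib_right mult_ac)
 qed simp
 then show ?thesis
  using E_win[OF assms, of "%x i. (vd n k x - w x)^2"] E_win[OF assms, of "%x i. l i * w x"]
  E_win[OF assms, of "%x i. (w x)^2"]
  by (simp add: sum.distrib sum_subtractf sum_distrib_left)
qed

text \<open>Restricted to the support, where neither of the two default values occurs.\<close>

lemma sgd_vd:
 assumes "om : set_pmf (plaw n)" "k <= 4 ^ n"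
 shows "sgd n k om = sqrt (l (snd om) / vd n k (fst om k))"
proof -
 have "(fst om k, snd om) : set_pmf (ch.marg n k)"
 proof -
  have "AE om in measure_pmf (plaw n). (fst om k, snd om) : set_pmf (ch.marg n k)"
  proof -
  define I where "I x i = (if (x, i) : set_pmf (ch.marg n k) then 0 else 1 :: real)" for x i
  have "EP n (%om. I (fst om k) (snd om)) = measure_pmf.expectation (ch.marg n k) (%(x, i). I x i)"
  by (rule ch.E_marg[OF assms(2)])
  also have "... = measure_pmf.expectation (ch.marg n k) (%_. 0)"
  by (rule integral_cong_AE) (auto simp: AE_measure_pmf_iff I_def)
  finally have "EP n (%om. I (fst om k) (snd om)) = 0" by simp
  then have "AE om in measure_pmf (plaw n). I (fst om k) (snd om) = 0"
  by (subst (asm) integral_nonneg_eq_0_iff_AE) (auto simp: I_def)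
  then show ?thesis by eventually_elim (auto simp: I_def split: if_splits)
  qed
  then show ?thesis using assms(1) by (simp add: AE_measure_pmf_iff)
 qed
 then have "P n k (fst om k) $ snd om ~= 0" using pmf_marg[of n k "fst om k" "snd om"] by (simp add: set_pmf_iff)
 then have "P n k (fst om k) ~= 0" by auto
 then show ?thesis by (simp add: sgd_def rate_def vd_def)
qed

end

lemma tail_small:
 fixes \<mu> :: "real measure"
 assumes "prob_space \<mu>" "sets \<mu> = sets borel" "0 < eps"
 shows "EX B::real. measure \<mu> {x. B < abs x} <= eps"
proof -
 interpret prob_space \<mu> by fact
 have [measurable_cong]: "sets \<mu> = sets borel" by fact
 have sp: "space \<mu> = UNIV" using sets_eq_imp_space_eq[OF assms(2)] by simp
 define A where "A k = {x. real k < abs x}" for k :: nat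
 have "A k : events" for k unfolding A_def assms(2) by measurable
 then have "range A <= events" by blast
 moreover have "decseq A" unfolding A_def decseq_def by auto
 ultimately have "(%k. prob (A k)) ---> prob (\<Inter>k. A k)" by (rule finite_Lim_measure_decseq)
 moreover have "(\<Inter>k. A k) = {}"
 proof -
  have "x ~: (\<Inter>k. A k)" for x
  proof -
  obtain k :: nat where "abs x < real k" using reals_Archimedean2 by blast
  then have "x ~: A k" by (simp add: A_def)
  then show ?thesis by blast
  qed
  then show ?thesis by blast
 qed
 ultimately have "eventually (%k. prob (A k) < eps) sequentially"
  using \<open>0 < eps\<close> by (intro order_tendstoD) auto
 then obtain k where "prob (A k) < eps" by (auto simp: eventually_sequentially)
 then show ?thesis by (intro exI[of _ "real k"]) (simp add: A_def)
qed

text \<open>Carries moment bounds over to almost sure limits, with integrability of the limit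
  included.\<close>

lemma (in prob_space) fatou_bound:
 fixes f :: "nat => 'a => real"
 assumes f[measurable]: "!!n. integrable M (f n)" and nn: "!!n om. 0 <= f n om" and g[measurable]: "g : bmeas M"
  and lim: "AE om in M. (%n. f n om) ---> g om" and bound: "eventually (%n. EE (f n) <= C) sequentially"
 shows "integrable M g" "EE g <= C"
proof -
 have C: "0 <= C"
 proof -
  obtain n where "EE (f n) <= C" using bound by (auto simp: eventually_sequentially)
  moreover have "0 <= EE (f n)" by (rule integral_nonneg_AE) (simp add: nn)
  ultimately show ?thesis by simp
 qed
 have g0: "AE om in M. 0 <= g om" using lim by eventually_elim (rule LIMSEQ_le_const, auto simp: nn)
 have "(\<integral>\<^sup>+om. ennreal (g om) \<partial>M) = (\<integral>\<^sup>+om. liminf (%n. ennreal (f n om)) \<partial>M)"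
 proof (rule nn_integral_cong_AE)
  show "AE om in M. ennreal (g om) = liminf (%n. ennreal (f n om))"
  using lim by eventually_elim (metis lim_imp_Liminf sequentially_bot tendsto_ennrealI)
 qed
 also have "... <= liminf (%n. \<integral>\<^sup>+om. ennreal (f n om) \<partial>M)"
  using f by (intro nn_integral_liminf) auto
 also have "... <= ennreal C"
 proof (rule Liminf_le)
  show "\<forall>\<^sub>F n in sequentially. (\<integral>\<^sup>+om. ennreal (f n om) \<partial>M) <= ennreal C"
  using bound by eventually_elim (simp add: nn_integral_eq_integral f nn ennreal_leI)
 qed simp
 finally have le: "(\<integral>\<^sup>+om. ennreal (g om) \<partial>M) <= ennreal C" .
 show i: "integrable M g"
  using le g0 by (intro integrableI_nonneg) (auto simp: le_less_trans)
 show "EE g <= C"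
  using le g0 C by (simp add: nn_integral_eq_integral[OF i g0])
qed

context approx
begin

section \<open>Time indices, coordinates and tightness\<close>

definition kk :: "nat => real => nat" where "kk n t = nat \<lfloor>4 ^ n * t / T\<rfloor>"

lemma kk_le: "t : {0..T} ==> kk n t <= 4 ^ n"
 unfolding kk_def by (rule qfloor_index[OF T_pos])

lemma kk_quad: "m <= n ==> kk n (quad T m k) = k * 4 ^ (n - m)"
proof -
 assume "m <= n"
 then have "(4::real) ^ n = 4 ^ m * 4 ^ (n - m)" by (simp flip: power_add)
 then have "4 ^ n * quad T m k / T = real (k * 4 ^ (n - m))"
  using T_pos by (simp add: quad_def)
 then show ?thesis unfolding kk_def by (metis floor_of_nat nat_int)
qed

lemma ta_kk: "ta n * real (kk n t) = qfloor T n t"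
 by (simp add: kk_def qfloor_def quad_def ta_def)

lemma kk_mono: "u <= t ==> kk n u <= kk n t"
 unfolding kk_def using T_pos by (intro nat_mono floor_mono divide_right_mono mult_left_mono) auto

lemma qfloor_eventually:
 assumes "t : quads T"
 shows "EX m. ALL n>=m. qfloor T n t = t"
proof -
 obtain m k where "t = quad T m k" using assms unfolding quads_def by blast
 then show ?thesis using qfloor_quad[OF T_pos] by blast
qed

text \<open>The countably many quantities made convergent: both processes at all grid times, and the
  label. The cap by \<open>min\<close> makes sense of triples beyond the horizon, so that all
  triples can serve as indices.\<close>

definition coord :: "nat => nat \<times> nat \<times> nat => (nat => int) \<times> 'd => real" where
 "coord n j om = (case j of (c, m, k) =>
  if c = 0 then Xd n (min (4 ^ n) (kk n (quad T m k))) om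
  else if c = 1 then Wd n (min (4 ^ n) (kk n (quad T m k))) om
  else real (to_nat (snd om)))"

text \<open>The grid of level \<open>n\<close> contains every time of the chain up to its horizon,
  and later entries of a path in the support repeat the initial value; so positions and label
  determine the sample.\<close>

lemma coord_inj:
 assumes om: "om : set_pmf (plaw n)" "om' : set_pmf (plaw n)" and eq: "!!j. coord n j om = coord n j om'"
 shows "om = om'"
proof (rule prod_eqI)
 have le: "fst om k = fst om' k" if "k <= 4 ^ n" for k
 proof -
  have "kk n (quad T n k) = k" using kk_quad[of n n k] by simp
  then have "Xd n k om = Xd n k om'" using eq[of "(0, n, k)"] that by (simp add: coord_def min_absorb2)
  then show ?thesis using h_pos[of n] by (simp add: Xd_def)
 qed
 show "fst om = fst om'"
 proof
  fix k show "fst om k = fst om' k"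
  using le[of k] le[of 0] ch.chain_stop[OF om(1), of k] ch.chain_stop[OF om(2), of k] by (cases "k <= 4 ^ n") auto
 qed
 show "snd om = snd om'" using eq[of "(2, 0, 0)"] by (simp add: coord_def)
qed

lemma prob_increment_le:
 assumes "0 < B" and E: "EP n (%om. (f om) ^ 4) <= C4 * T^2"
 shows "measure_pmf.prob (plaw n) {om. B < abs (f om)} <= C4 * T^2 / B ^ 4"
proof -
 have "measure_pmf.prob (plaw n) {om. B < abs (f om)} <= measure_pmf.prob (plaw n) {om : space (measure_pmf (plaw n)). B ^ 4 <= (f om) ^ 4}"
 proof (rule measure_pmf.finite_measure_mono)
  have "B ^ 4 <= (f om) ^ 4" if "B < abs (f om)" for om
  using power_mono[of B "abs (f om)" 4] that assms(1) by simp
  then show "{om. B < abs (f om)} <= {om : space (measure_pmf (plaw n)). B ^ 4 <= (f om) ^ 4}" by auto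
 qed simp
 also have "... <= EP n (%om. (f om) ^ 4) / B ^ 4"
  using assms(1) by (intro integral_Markov_inequality_measure[where A = "{}"]) auto
 also have "... <= C4 * T^2 / B ^ 4" using E assms(1) by (intro divide_right_mono) auto
 finally show ?thesis .
qed

lemma ta_times_le: "k <= 4 ^ n ==> ta n * real k <= T"
proof -
 assume "k <= 4 ^ n"
 then have "real k <= 4 ^ n" by (metis of_nat_le_iff of_nat_numeral of_nat_power)
 then have "ta n * real k <= ta n * 4 ^ n" using ta_pos[of n] by (intro mult_left_mono) auto
 then show ?thesis by (simp add: ta_def)
qed

lemma rnd_close: "abs (h n * of_int (rnd n xi)) <= abs xi + h 0"
proof -
 have hn: "h n <= h 0"
  unfolding h_def using T_pos r_pos by (intro divide_left_mono) auto
 have "abs (of_int (rnd n xi)) <= abs (of_int \<lfloor>xi / h n\<rfloor> :: real)"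
 proof -
  have "abs (rnd n xi) <= abs (\<lfloor>xi / h n\<rfloor>)" unfolding rnd_def by (auto simp: max_def min_def)
  then show ?thesis by linarith
 qed
 also have "... <= abs (xi / h n) + 1" by linarith
 finally have "h n * abs (of_int (rnd n xi)) <= h n * (abs (xi / h n) + 1)" using h_pos[of n] by (intro mult_left_mono) auto
 also have "... = abs xi + h n" using h_pos[of n] by (simp add: distrib_left abs_divide)
 finally show ?thesis using hn h_pos[of n] by (simp add: abs_mult)
qed

lemma start_tail:
 "measure_pmf.prob (plaw n) {om. B < abs (Xd n 0 om)} <= measure \<mu> {x. B - h 0 < abs x}"
proof -
 interpret \<mu>: prob_space \<mu> by (rule \<mu>)
 have [measurable_cong]: "sets \<mu> = sets borel" by (rule \<mu>)
 have sp: "space \<mu> = UNIV" using sets_eq_imp_space_eq[OF \<mu>(2)] by simp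
 have "measure_pmf.prob (plaw n) {om. B < abs (Xd n 0 om)} = EP n (%om. indicator {x. B < abs x} (Xd n 0 om))"
 proof -
  have "(%om. indicator {x. B < abs x} (Xd n 0 om)) = (indicator {om. B < abs (Xd n 0 om)} :: _ => real)"
  by (auto split: split_indicator)
  then show ?thesis by simp
 qed
 also have "... = (LINT xi|\<mu>. indicator {x. B < abs x} (h n * of_int (rnd n xi)))"
  using E_initial[of n "%x i. indicator {x. B < abs x} x :: real"] al_sum by (simp add: sum_distrib_right[symmetric])
 also have "... <= (LINT xi|\<mu>. indicator {x. B - h 0 < abs x} xi)"
 proof (rule integral_mono)
  show "integrable \<mu> (%xi. indicator {x. B < abs x} (h n * of_int (rnd n xi)) :: real)"
  by (rule \<mu>.integrable_const_bound[where B = 1]) (auto split: split_indicator)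
  show "integrable \<mu> (indicator {x. B - h 0 < abs x} :: real => real)"
  by (rule \<mu>.integrable_const_bound[where B = 1]) (auto split: split_indicator)
  show "indicator {x. B < abs x} (h n * of_int (rnd n xi)) <= (indicator {x. B - h 0 < abs x} xi :: real)" for xi
  using rnd_close[of n xi] by (auto split: split_indicator)
 qed
 also have "... = measure \<mu> {x. B - h 0 < abs x}" by (simp add: sp)
 finally show ?thesis .
qed

text \<open>No moment of \<open>\<mu>\<close> is available, so the start is controlled through its
  tail and only the increment through its fourth moment.\<close>

lemma tight_X:
 assumes "0 < eps"
 shows "EX B>0. ALL n. ALL k<=4 ^ n. measure_pmf.prob (plaw n) {om. B < abs (Xd n k om)} <= eps"
proof -
 obtain B0 where B0: "measure \<mu> {x. B0 < abs x} <= eps / 2" using tail_small[OF \<mu>, of "eps / 2"] assms by auto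
 have sp: "space \<mu> = UNIV" using sets_eq_imp_space_eq[OF \<mu>(2)] by simp
 interpret \<mu>: prob_space \<mu> by (rule \<mu>)
 have [measurable_cong]: "sets \<mu> = sets borel" by (rule \<mu>)
 define B1 where "B1 = abs B0 + h 0"
 define B2 where "B2 = max 1 (2 * C4 * T^2 / eps)"
 have B2: "1 <= B2" "2 * C4 * T^2 / eps <= B2" by (auto simp: B2_def)
 have "measure_pmf.prob (plaw n) {om. B1 + B2 < abs (Xd n k om)} <= eps" if k: "k <= 4 ^ n" for n k
 proof -
  have "measure_pmf.prob (plaw n) {om. B1 + B2 < abs (Xd n k om)} <=
  measure_pmf.prob (plaw n) ({om. B1 < abs (Xd n 0 om)} Un {om. B2 < abs (Xd n k om - Xd n 0 om)})"
  proof (rule measure_pmf.finite_measure_mono)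
  show "{om. B1 + B2 < abs (Xd n k om)} <= {om. B1 < abs (Xd n 0 om)} Un {om. B2 < abs (Xd n k om - Xd n 0 om)}"
  proof
  fix om assume "om : {om. B1 + B2 < abs (Xd n k om)}"
  then have "B1 + B2 < abs (Xd n k om)" by simp
  then have "B1 < abs (Xd n 0 om) \<or> B2 < abs (Xd n k om - Xd n 0 om)" by linarith
  then show "om : {om. B1 < abs (Xd n 0 om)} Un {om. B2 < abs (Xd n k om - Xd n 0 om)}" by simp
  qed
  qed simp
  also have "... <= measure_pmf.prob (plaw n) {om. B1 < abs (Xd n 0 om)} + measure_pmf.prob (plaw n) {om. B2 < abs (Xd n k om - Xd n 0 om)}"
  by (rule measure_Un_le) auto
  also have "measure_pmf.prob (plaw n) {om. B1 < abs (Xd n 0 om)} <= eps / 2"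
  proof -
  have "measure_pmf.prob (plaw n) {om. B1 < abs (Xd n 0 om)} <= measure \<mu> {x. B1 - h 0 < abs x}" by (rule start_tail)
  also have "... <= measure \<mu> {x. B0 < abs x}"
  by (intro \<mu>.finite_measure_mono) (auto simp: B1_def \<mu>(2))
  finally show ?thesis using B0 by simp
  qed
  also have "measure_pmf.prob (plaw n) {om. B2 < abs (Xd n k om - Xd n 0 om)} <= eps / 2"
  proof -
  have "EP n (%om. (Xd n k om - Xd n 0 om) ^ 4) <= C4 * (ta n * real (k - 0))^2" by (rule fourth_X) (use k in auto)
  also have "... <= C4 * T^2"
  using ta_times_le[OF k] ta_pos[of n] C4_pos by (intro mult_left_mono power_mono) auto
  finally have "measure_pmf.prob (plaw n) {om. B2 < abs (Xd n k om - Xd n 0 om)} <= C4 * T^2 / B2 ^ 4"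
  using B2 by (intro prob_increment_le) auto
  also have "... <= C4 * T^2 / B2"
  proof (rule divide_left_mono)
  show "B2 <= B2 ^ 4" using power_increasing[of 1 4 B2] B2 by simp
  qed (use B2 C4_pos in auto)
  also have "... <= eps / 2"
  proof -
  have "2 * C4 * T^2 <= B2 * eps" using B2(2) assms by (simp add: divide_le_eq)
  then show ?thesis using B2(1) by (simp add: field_simps)
  qed
  finally show ?thesis .
  qed
  finally show ?thesis by simp
 qed
 moreover have "0 < B1 + B2" using B2 h_pos[of 0] by (simp add: B1_def)
 ultimately show ?thesis by blast
qed

lemma tight_coord:
 assumes "0 < eps"
 shows "EX B. ALL n. measure_pmf.prob (plaw n) {om. B < abs (coord n j om)} <= eps"
proof -
 obtain c m k where j: "j = (c, m, k)" by (cases j)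
 consider "c = 0" | "c = 1" | "c ~= 0 & c ~= 1" by blast
 then show ?thesis
 proof cases
  case 1
  then show ?thesis using tight_X[OF assms] by (auto simp: j coord_def intro: min.cobounded1)
 next
  case 2
  define B where "B = max 1 (C4 * T^2 / eps)"
  have B: "1 <= B" "C4 * T^2 / eps <= B" by (auto simp: B_def)
  have "measure_pmf.prob (plaw n) {om. B < abs (coord n j om)} <= eps" for n
  proof -
  define i where "i = min (4 ^ n) (kk n (quad T m k))"
  have i: "i <= 4 ^ n" by (simp add: i_def)
  have "EP n (%om. (Wd n i om - Wd n 0 om) ^ 4) <= C4 * (ta n * real (i - 0))^2" by (rule fourth_W) (use i in auto)
  also have "... <= C4 * T^2"
  using ta_times_le[OF i] ta_pos[of n] C4_pos by (intro mult_left_mono power_mono) auto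
  finally have "measure_pmf.prob (plaw n) {om. B < abs (Wd n i om)} <= C4 * T^2 / B ^ 4"
  using B by (intro prob_increment_le) auto
  also have "... <= C4 * T^2 / B"
  proof (rule divide_left_mono)
  show "B <= B ^ 4" using power_increasing[of 1 4 B] B by simp
  qed (use B C4_pos in auto)
  also have "... <= eps"
  proof -
  have "C4 * T^2 <= B * eps" using B(2) assms by (simp add: divide_le_eq)
  then show ?thesis using B(1) by (simp add: field_simps)
  qed
  finally show ?thesis using 2 by (simp add: j coord_def i_def)
  qed
  then show ?thesis by blast
 next
  case 3
  define B where "B = real (Max (range (to_nat :: 'd => nat)))"
  have e0: "{om. B < abs (coord n j om)} = {}" for n
  proof -
  have "real (to_nat i) <= B" for i :: 'd unfolding B_def by (simp add: Max_ge)
  then show ?thesis using 3 by (auto simp: j coord_def not_less)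
  qed
  show ?thesis using assms by (intro exI[of _ B] allI) (simp only: e0 measure_empty less_imp_le)
 qed
qed

text \<open>The one-dimensional construction lives on the reals; \<open>\<iota>\<close> and its left
  inverse \<open>pr\<close> carry it to any type containing a copy of them, since the type of the
  sample space is prescribed.\<close>

theorem limit_space_exists:
 fixes \<iota> :: "real => 'b" and pr :: "'b => real"
 assumes pr: "!!y. pr (\<iota> y) = y"
 shows "EX (M :: 'b measure) s Om. prob_space M & strict_mono s &
  (ALL n. Om n : M \<rightarrow>\<^sub>M UC & distr M (count_space UNIV) (Om n) = measure_pmf (plaw (s n))) &
  (AE om in M. ALL j. convergent (%n. coord (s n) j (Om n om)))"
proof -
 have "EX s (M0 :: real measure) Om. strict_mono s & prob_space M0 &
  (ALL n. Om n : M0 \<rightarrow>\<^sub>M UC & distr M0 (count_space UNIV) (Om n) = measure_pmf (plaw (s n))) &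
  (AE om in M0. ALL j. convergent (%n. coord (s n) j (Om n om)))"
 proof (rule skorokhod_pmf)
  show "EX B. ALL n. measure_pmf.prob (plaw n) {om. B < abs (coord n j om)} <= eps" if "0 < eps" for j eps
  using that by (rule tight_coord)
  show "om = om'" if "om : set_pmf (plaw n)" "om' : set_pmf (plaw n)" "!!j. coord n j om = coord n j om'" for n om om'
  using that by (rule coord_inj)
 qed
 then obtain s and M0 :: "real measure" and Om where s: "strict_mono s" and M0: "prob_space M0"
  and Om: "!!n. Om n : M0 \<rightarrow>\<^sub>M UC" "!!n. distr M0 (count_space UNIV) (Om n) = measure_pmf (plaw (s n))"
  and conv: "AE om in M0. ALL j. convergent (%n. coord (s n) j (Om n om))"
  by blast
 define N where "N = vimage_algebra (\<iota> ` space M0) pr M0"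
 have prsp: "pr : \<iota> ` space M0 \<rightarrow> space M0" using pr by auto
 have prm[measurable]: "pr : N \<rightarrow>\<^sub>M M0" unfolding N_def by (rule measurable_vimage_algebra1[OF prsp])
 have \<iota>m[measurable]: "\<iota> : M0 \<rightarrow>\<^sub>M N" unfolding N_def by (rule measurable_vimage_algebra2) (auto simp: pr)
 define M where "M = distr M0 N \<iota>"
 have "prob_space M" unfolding M_def by (rule prob_space.prob_space_distr[OF M0 \<iota>m])
 moreover have Om'[measurable]: "(%om. Om n (pr om)) : M \<rightarrow>\<^sub>M UC" for n
  unfolding M_def using measurable_compose[OF prm Om(1)[of n]] by simp
 moreover have "distr M (count_space UNIV) (%om. Om n (pr om)) = measure_pmf (plaw (s n))" for n
 proof -
  have "distr M (count_space UNIV) (%om. Om n (pr om)) = distr M0 (count_space UNIV) (Om n)"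
  unfolding M_def using measurable_compose[OF prm Om(1)[of n]] by (subst distr_distr) (auto simp: comp_def pr)
  then show ?thesis using Om(2) by simp
 qed
 moreover have "AE om in M. ALL j. convergent (%n. coord (s n) j (Om n (pr om)))"
 proof -
  from conv obtain A where A: "{y : space M0. ~ (ALL j. convergent (%n. coord (s n) j (Om n y)))} <= A"
  "A : sets M0" "emeasure M0 A = 0" by (rule AE_E)
  have A'[measurable]: "pr -` A Int space N : sets N" using A(2) by measurable
  have "emeasure M (pr -` A Int space N) = emeasure M0 (\<iota> -` (pr -` A Int space N) Int space M0)"
  unfolding M_def by (rule emeasure_distr) measurable
  also have "\<iota> -` (pr -` A Int space N) Int space M0 = A"
  using sets.sets_into_space[OF A(2)] by (auto simp: pr N_def) (metis pr)
  finally have "emeasure M (pr -` A Int space N) = 0" using A(3) by simp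
  moreover have "{om : space M. ~ (ALL j. convergent (%n. coord (s n) j (Om n (pr om))))} <= pr -` A Int space N"
  proof
  fix om assume om: "om : {om : space M. ~ (ALL j. convergent (%n. coord (s n) j (Om n (pr om))))}"
  then have "om : space N" by (simp add: M_def)
  then have "pr om : {y : space M0. ~ (ALL j. convergent (%n. coord (s n) j (Om n y)))}"
  using om measurable_space[OF prm] by blast
  then show "om : pr -` A Int space N" using subsetD[OF A(1)] \<open>om : space N\<close> by blast
  qed
  ultimately show ?thesis by (intro AE_I[of _ _ "pr -` A Int space N"]) (auto simp: M_def)
 qed
 ultimately show ?thesis using s by (intro exI[of _ M] exI[of _ s] exI[of _ "%n om. Om n (pr om)"]) auto
qed

end

section \<open>The limit process\<close>

text \<open>Exchange of limits, where \<open>m\<close> will be a level of time discretisation and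
  \<open>e m\<close> its error, uniform in \<open>n\<close>.\<close>

lemma diagonal_limit:
 fixes A :: "nat => 'c::real_normed_vector"
 assumes B: "!!m. (%n. B m n) ---> B' m" and B': "B' ---> A'"
  and close: "!!m n. m <= n ==> norm (A n - B m n) <= e m" and e: "e ---> 0"
 shows "A ---> A'"
proof (rule LIMSEQ_I)
 fix eps :: real assume "0 < eps"
 then have eps: "0 < eps / 3" by simp
 have "eventually (%m. e m < eps / 3) sequentially" using e eps by (rule order_tendstoD)
 moreover have "eventually (%m. dist (B' m) A' < eps / 3) sequentially" using B' eps by (rule tendstoD)
 ultimately have "eventually (%m. e m < eps / 3 & dist (B' m) A' < eps / 3) sequentially" by (rule eventually_conj)
 then obtain m where m: "e m < eps / 3" "dist (B' m) A' < eps / 3" by (auto simp: eventually_sequentially)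
 obtain N where N: "!!n. N <= n ==> dist (B m n) (B' m) < eps / 3"
  using tendstoD[OF B eps, of m] by (auto simp: eventually_sequentially)
 have "norm (A n - A') < eps" if "max N m <= n" for n
 proof -
  have "A n - A' = (A n - B m n) + (B m n - B' m) + (B' m - A')" by simp
  then have "norm (A n - A') <= norm (A n - B m n) + norm (B m n - B' m) + norm (B' m - A')"
  by (metis norm_triangle_le norm_triangle_ineq add_mono order_refl)
  also have "... < eps / 3 + eps / 3 + eps / 3"
  using close[of m n] N[of n] m that by (intro add_strict_mono) (auto simp: dist_norm)
  finally show ?thesis by simp
 qed
 then show "EX N. ALL n>=N. norm (A n - A') < eps" by blast
qed

locale scaling = approx l lo hi al \<mu> T r C0 + prob_space M
 for l :: "'d::finite => real" and lo hi al \<mu> T r C0 and M :: "'b measure" +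
 fixes s :: "nat => nat" and Om :: "nat => 'b => (nat => int) \<times> 'd"
 assumes s_mono: "strict_mono s"
  and Om_meas [measurable]: "!!n. Om n : M \<rightarrow>\<^sub>M UC"
  and Om_law: "!!n. distr M (count_space UNIV) (Om n) = measure_pmf (plaw (s n))"
  and Om_conv: "AE om in M. ALL j. convergent (%n. coord (s n) j (Om n om))"
begin

lemma s_ge: "n <= s n" by (rule seq_suble[OF s_mono])

lemma measurable_Om [measurable]: "(%om. F (Om n om)) : bmeas M"
 by (rule measurable_compose[OF Om_meas]) simp

lemma E_Om: "EE (%om. F (Om n om)) = EP (s n) F"
 for F :: "_ => 'c::{banach, second_countable_topology}"
 unfolding Om_law[symmetric] by (subst integral_distr) auto

lemma int_Om [simp]: "integrable M (%om. F (Om n om))"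
 for F :: "_ => 'c::{banach, second_countable_topology}"
proof -
 have "integrable (distr M (count_space UNIV) (Om n)) F" unfolding Om_law by simp
 then show ?thesis by (subst (asm) integrable_distr_eq) auto
qed

lemma ta_s_LIMSEQ: "(%n. ta (s n)) ---> 0"
proof -
 have "(%n. T * (1 / 4) ^ n) ---> T * 0" by (intro tendsto_intros LIMSEQ_power_zero) auto
 then have "(%n. ta n) ---> 0" by (simp add: ta_def[abs_def] power_divide)
 then show ?thesis using LIMSEQ_subseq_LIMSEQ[OF _ s_mono, of ta 0] by (simp add: comp_def)
qed

lemma qfloor_s_LIMSEQ: "0 <= t ==> (%n. qfloor T (s n) t) ---> t"
 using LIMSEQ_subseq_LIMSEQ[OF qfloor_LIMSEQ[OF T_pos] s_mono] by (simp add: comp_def)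

definition Xn :: "nat => real => 'b => real" where "Xn n t om = Xd (s n) (kk (s n) t) (Om n om)"
definition Wn :: "nat => real => 'b => real" where "Wn n t om = Wd (s n) (kk (s n) t) (Om n om)"
definition Yn :: "nat => 'b => 'd" where "Yn n om = snd (Om n om)"

lemma measurable_n [measurable]: "Xn n t : bmeas M" "Wn n t : bmeas M"
 unfolding Xn_def Wn_def by measurable

definition Xl :: "real => 'b => real" where "Xl t om = lim (%n. Xn n t om)"
definition Wl :: "real => 'b => real" where "Wl t om = lim (%n. Wn n t om)"
text \<open>Encoded labels converge as integers and are eventually constant; adding one half before
  the floor reads off the limit away from the jumps of the floor function.\<close>

definition Yl :: "'b => 'd" where "Yl om = from_nat (nat \<lfloor>lim (%n. real (to_nat (Yn n om))) + 1 / 2\<rfloor>)"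

lemma measurable_l [measurable]: "Xl t : bmeas M" "Wl t : bmeas M"
 "Yl : M \<rightarrow>\<^sub>M UC"
proof -
 show "Xl t : bmeas M" "Wl t : bmeas M" unfolding Xl_def[abs_def] Wl_def[abs_def] by measurable
 have [measurable]: "(%om. real (to_nat (Yn n om))) : bmeas M" for n
  unfolding Yn_def by measurable
 have "(%om. nat \<lfloor>lim (%n. real (to_nat (Yn n om))) + 1 / 2\<rfloor>) : M \<rightarrow>\<^sub>M UC" by measurable
 then show "Yl : M \<rightarrow>\<^sub>M UC" unfolding Yl_def[abs_def]
  by (rule measurable_compose) simp
qed

lemma AE_conv:
 "AE om in M. (ALL t:quads T. (%n. Xn n t om) ---> Xl t om & (%n. Wn n t om) ---> Wl t om) & eventually (%n. Yn n om = Yl om) sequentially"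
 using Om_conv
proof eventually_elim
 case (elim om)
 have "convergent (%n. Xn n t om) & convergent (%n. Wn n t om)" if "t : quads T" for t
 proof -
  from that obtain a k where t: "t = quad T a k" "k <= 4 ^ a" unfolding quads_def by blast
  have "t : {0..T}" using quads_subset[OF T_pos] that by blast
  then have "min (4 ^ n) (kk n (quad T a k)) = kk n t" for n using kk_le[of t n] t by simp
  then have "coord (s n) (0, a, k) (Om n om) = Xn n t om" "coord (s n) (1, a, k) (Om n om) = Wn n t om" for n
  by (simp_all add: coord_def Xn_def Wn_def)
  then show ?thesis using elim[rule_format, of "(0, a, k)"] elim[rule_format, of "(1, a, k)"] by simp
 qed
 moreover have "eventually (%n. Yn n om = Yl om) sequentially"
 proof -
  have "convergent (%n. real (to_nat (Yn n om)))"
  using elim[rule_format, of "(2, 0, 0)"] by (simp add: coord_def Yn_def)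
  then obtain L where L: "(%n. real (to_nat (Yn n om))) ---> L" unfolding convergent_def by blast
  obtain N where N: "!!n. N <= n ==> dist (real (to_nat (Yn n om))) L < 1 / 4"
  using tendstoD[OF L, of "1 / 4"] by (auto simp: eventually_sequentially)
  define K where "K = to_nat (Yn N om)"
  have eqK: "to_nat (Yn n om) = K" if "N <= n" for n
  using N[OF that] N[OF order_refl] unfolding K_def dist_real_def by linarith
  then have "eventually (%n. real (to_nat (Yn n om)) = real K) sequentially"
  by (auto simp: eventually_sequentially)
  then have "(%n. real (to_nat (Yn n om))) ---> real K" by (rule tendsto_eventually)
  then have "lim (%n. real (to_nat (Yn n om))) = real K" by (rule limI)
  moreover have "nat \<lfloor>real K + 1 / 2\<rfloor> = K" by linarith
  ultimately have "Yl om = from_nat K" by (simp add: Yl_def)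
  then have "Yn n om = Yl om" if "N <= n" for n using eqK[OF that] by (metis from_nat_to_nat)
  then show ?thesis by (auto simp: eventually_sequentially)
 qed
 ultimately show ?case by (auto simp: Xl_def Wl_def convergent_LIMSEQ_iff)
qed

lemma fourth_l:
 assumes "u : quads T" "t : quads T"
 shows "integrable M (%om. (Xl t om - Xl u om) ^ 4)" "EE (%om. (Xl t om - Xl u om) ^ 4) <= C4 * (t - u)^2"
  "integrable M (%om. (Wl t om - Wl u om) ^ 4)" "EE (%om. (Wl t om - Wl u om) ^ 4) <= C4 * (t - u)^2"
proof -
 obtain mu where mu: "!!n. mu <= n ==> qfloor T n u = u" using qfloor_eventually[OF assms(1)] by blast
 obtain mt where mt: "!!n. mt <= n ==> qfloor T n t = t" using qfloor_eventually[OF assms(2)] by blast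
 have T: "u : {0..T}" "t : {0..T}" using quads_subset[OF T_pos] assms by auto
 \<comment> \<open>Valid once the level is fine enough for \<open>u\<close> and \<open>t\<close> to
   be grid points, which is why the bounds below are only eventual.\<close>
 have key: "EP (s n) (%om. (Z (kk (s n) t) om - Z (kk (s n) u) om) ^ 4) <= C4 * (t - u)^2"
  if Z: "!!a k. a <= k ==> k <= 4 ^ s n ==> EP (s n) (%om. (Z k om - Z a om) ^ 4) <= C4 * (ta (s n) * real (k - a))^2"
  and n: "max mu mt <= n" for Z :: "nat => _ => real" and n
 proof -
  have mm: "mu <= s n" "mt <= s n" using n s_ge[of n] by auto
  have tu: "ta (s n) * real (kk (s n) u) = u" "ta (s n) * real (kk (s n) t) = t"
  using mu[OF mm(1)] mt[OF mm(2)] by (auto simp: ta_kk)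
  consider "u <= t" | "t <= u" by linarith
  then show ?thesis
  proof cases
  case 1
  have "ta (s n) * real (kk (s n) t - kk (s n) u) = t - u"
  using tu kk_mono[OF 1, of "s n"] by (simp add: of_nat_diff right_diff_distrib)
  then show ?thesis using Z[OF kk_mono[OF 1] kk_le[OF T(2)]] by simp
  next
  case 2
  have "ta (s n) * real (kk (s n) u - kk (s n) t) = u - t"
  using tu kk_mono[OF 2, of "s n"] by (simp add: of_nat_diff right_diff_distrib)
  moreover have "(Z (kk (s n) t) om - Z (kk (s n) u) om) ^ 4 = (Z (kk (s n) u) om - Z (kk (s n) t) om) ^ 4" for om
  using power_even_abs[of 4 "Z (kk (s n) t) om - Z (kk (s n) u) om"]
  power_even_abs[of 4 "Z (kk (s n) u) om - Z (kk (s n) t) om"] by (simp add: abs_minus_commute)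
  ultimately show ?thesis using Z[OF kk_mono[OF 2] kk_le[OF T(1)]] by (simp add: power2_commute)
  qed
 qed
 have X: "AE om in M. (%n. (Xn n t om - Xn n u om) ^ 4) ---> (Xl t om - Xl u om) ^ 4"
  using AE_conv by eventually_elim (intro tendsto_intros, use assms in auto)
 have W: "AE om in M. (%n. (Wn n t om - Wn n u om) ^ 4) ---> (Wl t om - Wl u om) ^ 4"
  using AE_conv by eventually_elim (intro tendsto_intros, use assms in auto)
 have bX: "eventually (%n. EE (%om. (Xn n t om - Xn n u om) ^ 4) <= C4 * (t - u)^2) sequentially"
  unfolding eventually_sequentially
 proof (intro exI[of _ "max mu mt"] allI impI)
  fix n assume n: "max mu mt <= n"
  have "EE (%om. (Xn n t om - Xn n u om) ^ 4) = EP (s n) (%om. (Xd (s n) (kk (s n) t) om - Xd (s n) (kk (s n) u) om) ^ 4)"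
  unfolding Xn_def by (rule E_Om)
  also have "... <= C4 * (t - u)^2" by (rule key[OF fourth_X n])
  finally show "EE (%om. (Xn n t om - Xn n u om) ^ 4) <= C4 * (t - u)^2" .
 qed
 have bW: "eventually (%n. EE (%om. (Wn n t om - Wn n u om) ^ 4) <= C4 * (t - u)^2) sequentially"
  unfolding eventually_sequentially
 proof (intro exI[of _ "max mu mt"] allI impI)
  fix n assume n: "max mu mt <= n"
  have "EE (%om. (Wn n t om - Wn n u om) ^ 4) = EP (s n) (%om. (Wd (s n) (kk (s n) t) om - Wd (s n) (kk (s n) u) om) ^ 4)"
  unfolding Wn_def by (rule E_Om)
  also have "... <= C4 * (t - u)^2" by (rule key[OF fourth_W n])
  finally show "EE (%om. (Wn n t om - Wn n u om) ^ 4) <= C4 * (t - u)^2" .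
 qed
 have iX: "integrable M (%om. (Xn n t om - Xn n u om) ^ 4)" and iW: "integrable M (%om. (Wn n t om - Wn n u om) ^ 4)" for n
  unfolding Xn_def Wn_def by (rule int_Om)+
 show "integrable M (%om. (Xl t om - Xl u om) ^ 4)" "EE (%om. (Xl t om - Xl u om) ^ 4) <= C4 * (t - u)^2"
  by (rule fatou_bound[OF iX _ _ X bX]; simp)+
 show "integrable M (%om. (Wl t om - Wl u om) ^ 4)" "EE (%om. (Wl t om - Wl u om) ^ 4) <= C4 * (t - u)^2"
  by (rule fatou_bound[OF iW _ _ W bW]; simp)+
qed

definition continuous_version :: "(real => 'b => real) => real => 'b => real" where
 "continuous_version X = (SOME Z. (ALL t. Z t : bmeas M) &
  (ALL om:space M. continuous_on {0..T} (%t. Z t om)) & (AE om in M. ALL t:quads T. Z t om = X t om))"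

definition Xc where "Xc = continuous_version Xl"
definition Wc where "Wc = continuous_version Wl"

lemma Xc: "(ALL t. Xc t : bmeas M) &
  (ALL om:space M. continuous_on {0..T} (%t. Xc t om)) & (AE om in M. ALL t:quads T. Xc t om = Xl t om)"
proof -
 have "EX Z. (ALL t. Z t : bmeas M) & (ALL om:space M. continuous_on {0..T} (%t. Z t om)) &
  (AE om in M. ALL t:quads T. Z t om = Xl t om)"
  by (rule kolmogorov_continuity[OF T_pos _ fourth_l(1,2)]) auto
 from someI_ex[OF this] show ?thesis unfolding Xc_def continuous_version_def .
qed

lemma Wc: "(ALL t. Wc t : bmeas M) &
  (ALL om:space M. continuous_on {0..T} (%t. Wc t om)) & (AE om in M. ALL t:quads T. Wc t om = Wl t om)"
proof -
 have "EX Z. (ALL t. Z t : bmeas M) & (ALL om:space M. continuous_on {0..T} (%t. Z t om)) &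
  (AE om in M. ALL t:quads T. Z t om = Wl t om)"
  by (rule kolmogorov_continuity[OF T_pos _ fourth_l(3,4)]) auto
 from someI_ex[OF this] show ?thesis unfolding Wc_def continuous_version_def .
qed

lemma measurable_c [measurable]: "Xc t : bmeas M" "Wc t : bmeas M"
 using Xc Wc by auto

lemma continuous_c: "om : space M ==> continuous_on {0..T} (%t. Xc t om)" "om : space M ==> continuous_on {0..T} (%t. Wc t om)"
 using Xc Wc by auto

lemma AE_conv_c:
 "AE om in M. (ALL t:quads T. (%n. Xn n t om) ---> Xc t om & (%n. Wn n t om) ---> Wc t om) & eventually (%n. Yn n om = Yl om) sequentially"
proof -
 have "AE om in M. ALL t:quads T. Xc t om = Xl t om" "AE om in M. ALL t:quads T. Wc t om = Wl t om" using Xc Wc by auto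
 with AE_conv show ?thesis by eventually_elim auto
qed

lemma qfloor_c:
 assumes "om : space M" "t : {0..T}"
 shows "(%n. Xc (qfloor T n t) om) ---> Xc t om" "(%n. Wc (qfloor T n t) om) ---> Wc t om"
proof -
 have e: "\<forall>\<^sub>F n in sequentially. qfloor T n t : {0..T}"
  using qfloor_in[OF T_pos assms(2)] quads_subset[OF T_pos] by (intro always_eventually) blast
 have "(%n. qfloor T n t) ---> t" by (rule qfloor_LIMSEQ[OF T_pos]) (use assms in auto)
 then show "(%n. Xc (qfloor T n t) om) ---> Xc t om" "(%n. Wc (qfloor T n t) om) ---> Wc t om"
  by (auto intro: continuous_on_tendsto_compose[OF continuous_c(1)[OF assms(1)] _ assms(2) e]
  continuous_on_tendsto_compose[OF continuous_c(2)[OF assms(1)] _ assms(2) e])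
qed

text \<open>From \<open>abs f <= 1 / 2 ^ a + 2 ^ a * f^2\<close> and the second moment; the two
  terms balance because the time mesh of level \<open>a\<close> is \<open>T / 4 ^ a\<close>.\<close>

lemma first_increment:
 assumes t: "t : {0..T}" and "a <= s n"
 shows "EP (s n) (%om. abs (Xd (s n) (kk (s n) t) om - Xd (s n) (kk (s n) (qfloor T a t)) om)) <= (1 + hi / lo * T) / 2 ^ a"
proof -
 define N where "N = s n"
 define u where "u = qfloor T a t"
 have ut: "u <= t" "t < u + T / 4 ^ a" unfolding u_def using qfloor_bounds[OF T_pos, of t a] t by auto
 have kut: "kk N u <= kk N t" by (rule kk_mono[OF ut(1)])
 have uq: "qfloor T N u = u" unfolding u_def using assms(2) qfloor_quad[OF T_pos, of a N] by (simp add: N_def qfloor_def)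
 have tN: "qfloor T N t <= t" using qfloor_bounds(1)[OF T_pos, of t N] t by auto
 have dt: "ta N * real (kk N t - kk N u) <= T / 4 ^ a"
  using kut uq ut tN by (simp add: of_nat_diff right_diff_distrib ta_kk)
 define f where "f om = Xd N (kk N t) om - Xd N (kk N u) om" for om
 have sec: "EP N (%om. (f om)^2) <= hi / lo * (T / 4 ^ a)"
 proof -
  have "EP N (%om. (f om)^2) <= hi / lo * (ta N * real (kk N t - kk N u))"
  unfolding f_def by (rule second_X[OF kut kk_le[OF t]])
  also have "... <= hi / lo * (T / 4 ^ a)" using dt hilo by (intro mult_left_mono) auto
  finally show ?thesis .
 qed
 have "abs (f om) <= 1 / 2 ^ a + 2 ^ a * (f om)^2" for om
 proof (cases "abs (f om) <= 1 / 2 ^ a")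
  case True
  then show ?thesis by (simp add: add_increasing2)
 next
  case False
  then have "1 <= 2 ^ a * abs (f om)" by (simp add: field_simps)
  then have "abs (f om) * 1 <= abs (f om) * (2 ^ a * abs (f om))" by (intro mult_left_mono) auto
  also have "... = 2 ^ a * (f om)^2" by (simp add: power2_eq_square mult.left_commute)
  finally show ?thesis by (simp add: add_increasing)
 qed
 then have "EP N (%om. abs (f om)) <= EP N (%om. 1 / 2 ^ a + 2 ^ a * (f om)^2)" by (intro integral_mono) auto
 also have "... = 1 / 2 ^ a + 2 ^ a * EP N (%om. (f om)^2)" by simp
 also have "... <= 1 / 2 ^ a + 2 ^ a * (hi / lo * (T / 4 ^ a))" using sec by (intro add_left_mono mult_left_mono) auto
 also have "... = (1 + hi / lo * T) / 2 ^ a"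
 proof -
  have "(4::real) ^ a = 2 ^ a * 2 ^ a" by (simp flip: power_mult_distrib)
  then show ?thesis by (simp add: field_simps)
 qed
 finally show ?thesis by (simp add: f_def N_def u_def)
qed

text \<open>Almost sure convergence is known at grid times only. A general \<open>t\<close> is
  rounded down to level \<open>a\<close>; this costs a multiple of \<open>1 / 2 ^ a\<close>
  uniformly in \<open>n\<close>, and vanishes in the limit process by continuity of its
  paths.\<close>

theorem weak_convergence:
 fixes ph :: "real => 'd => 'c::{banach, second_countable_topology}"
 assumes b: "!!x i. norm (ph x i) <= B" and L: "!!x y i. norm (ph x i - ph y i) <= L * abs (x - y)" and t: "t : {0..T}"
 shows "(%n. EP (s n) (%om. ph (Xd (s n) (kk (s n) t) om) (snd om))) ---> EE (%om. ph (Xc t om) (Yl om))"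
proof (rule diagonal_limit)
 have L0: "0 <= L" using order_trans[OF norm_ge_zero L[of 0 undefined 1]] by simp
 have cont: "continuous_on UNIV (%x. ph x i)" for i
 proof -
  have "L-lipschitz_on UNIV (%x. ph x i)" using L L0 by (auto simp: lipschitz_on_def dist_norm)
  then show ?thesis by (rule lipschitz_on_continuous_on)
 qed
 have phm[measurable]: "(%x. ph x i) : bmeas borel" for i
  by (rule borel_measurable_continuous_onI[OF cont])
 have phX[measurable]: "(%om. ph (Z om) (V om)) : bmeas M"
  if [measurable]: "Z : bmeas M" "V : M \<rightarrow>\<^sub>M UC" for Z V
  by (rule measurable_compose_countable[where f = "%i om. ph (Z om) i"]) measurable
 have Yn[measurable]: "Yn n : M \<rightarrow>\<^sub>M UC" for n
  unfolding Yn_def[abs_def] by (rule measurable_compose[OF Om_meas]) simp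
 show "(%n. EE (%om. ph (Xn n (qfloor T a t) om) (Yn n om))) ---> EE (%om. ph (Xc (qfloor T a t) om) (Yl om))" for a
 proof (rule integral_dominated_convergence[where w = "%_. B"])
  show "AE om in M. (%n. ph (Xn n (qfloor T a t) om) (Yn n om)) ---> ph (Xc (qfloor T a t) om) (Yl om)"
  using AE_conv_c
  proof eventually_elim
  case (elim om)
  then have "(%n. Xn n (qfloor T a t) om) ---> Xc (qfloor T a t) om" using qfloor_in[OF T_pos t] by blast
  then have "(%n. ph (Xn n (qfloor T a t) om) (Yl om)) ---> ph (Xc (qfloor T a t) om) (Yl om)"
  by (intro continuous_on_tendsto_compose[OF cont]) auto
  moreover have "eventually (%n. ph (Xn n (qfloor T a t) om) (Yl om) = ph (Xn n (qfloor T a t) om) (Yn n om)) sequentially"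
  using elim by (auto elim: eventually_mono)
  ultimately show ?case by (rule Lim_transform_eventually)
  qed
 qed (use b in auto)
 show "(%a. EE (%om. ph (Xc (qfloor T a t) om) (Yl om))) ---> EE (%om. ph (Xc t om) (Yl om))"
 proof (rule integral_dominated_convergence[where w = "%_. B"])
  show "AE om in M. (%a. ph (Xc (qfloor T a t) om) (Yl om)) ---> ph (Xc t om) (Yl om)"
  by (intro AE_I2 continuous_on_tendsto_compose[OF cont] qfloor_c t) auto
 qed (use b in auto)
 show "norm (EP (s n) (%om. ph (Xd (s n) (kk (s n) t) om) (snd om)) - EE (%om. ph (Xn n (qfloor T a t) om) (Yn n om)))
  <= L * ((1 + hi / lo * T) / 2 ^ a)" if "a <= n" for a n
 proof -
  define D where "D om = abs (Xd (s n) (kk (s n) t) om - Xd (s n) (kk (s n) (qfloor T a t)) om)" for om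
  define G1 where "G1 om = ph (Xd (s n) (kk (s n) t) om) (snd om)" for om
  define G2 where "G2 om = ph (Xd (s n) (kk (s n) (qfloor T a t)) om) (snd om)" for om
  have e2: "EE (%om. ph (Xn n (qfloor T a t) om) (Yn n om)) = EP (s n) G2"
  unfolding Xn_def Yn_def G2_def by (rule E_Om)
  have "norm (EP (s n) G1 - EP (s n) G2) = norm (EP (s n) (%om. G1 om - G2 om))"
  by (subst Bochner_Integration.integral_diff) auto
  also have "norm (EP (s n) (%om. G1 om - G2 om)) <= EP (s n) (%om. norm (G1 om - G2 om))"
  by (rule integral_norm_bound)
  also have "EP (s n) (%om. norm (G1 om - G2 om)) <= EP (s n) (%om. L * D om)"
  using L unfolding G1_def G2_def D_def by (intro integral_mono) auto
  also have "EP (s n) (%om. L * D om) = L * EP (s n) D" by simp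
  also have "L * EP (s n) D <= L * ((1 + hi / lo * T) / 2 ^ a)"
  using L0 that s_ge[of n] unfolding D_def by (intro mult_left_mono first_increment[OF t]) auto
  finally show ?thesis unfolding e2 G1_def .
 qed
 have "(%a. L * (1 + hi / lo * T) * (1 / 2) ^ a) ---> L * (1 + hi / lo * T) * 0"
  by (intro tendsto_intros LIMSEQ_power_zero) auto
 then show "(%a. L * ((1 + hi / lo * T) / 2 ^ a)) ---> 0" by (simp add: power_divide)
qed

end

lemma power_exp_LIMSEQ:
 fixes c :: "nat => real" and u :: "nat => real" and k :: "nat => nat"
 assumes "!!n. abs (c n) <= 1" "!!n. 0 <= u n" and close: "!!n. abs (c n - exp (- u n)) <= e n"
  and ke: "(%n. real (k n) * e n) ---> 0" and ku: "(%n. real (k n) * u n) ---> v"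
 shows "(%n. c n ^ k n) ---> exp (- v)"
proof -
 have "norm (c n ^ k n - exp (- u n) ^ k n) <= real (k n) * e n" for n
 proof -
  have "norm (c n ^ k n - exp (- u n) ^ k n) <= real (k n) * norm (c n - exp (- u n))"
  using assms(1,2) by (intro norm_power_diff) auto
  also have "... <= real (k n) * e n" using close[of n] by (intro mult_left_mono) auto
  finally show ?thesis .
 qed
 then have b: "\<forall>\<^sub>F n in sequentially. norm (c n ^ k n - exp (- u n) ^ k n) <= real (k n) * e n" by simp
 have d: "(%n. c n ^ k n - exp (- u n) ^ k n) ---> 0" by (rule Lim_null_comparison[OF b ke])
 have "(%n. exp (- (real (k n) * u n))) ---> exp (- v)" by (intro tendsto_intros ku)
 moreover have "exp (- (real (k n) * u n)) = exp (- u n) ^ k n" for n by (simp flip: exp_of_nat_mult)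
 ultimately have "(%n. exp (- u n) ^ k n) ---> exp (- v)" by simp
 from tendsto_add[OF d this] show ?thesis by simp
qed

lemma norm_iexp_diff: "cmod (iexp x - iexp y) <= abs (x - y)"
proof -
 have "iexp x - iexp y = iexp y * (iexp (x - y) - 1)"
  by (simp add: right_diff_distrib flip: exp_add)
 then have "cmod (iexp x - iexp y) = cmod (iexp (x - y) - 1)" by (simp add: norm_mult)
 also have "... <= abs (x - y)" using iexp_approx1[of "x - y" 0] by simp
 finally show ?thesis .
qed

context scaling
begin

lemma rnd_LIMSEQ: "(%n. h (s n) * of_int (rnd (s n) xi)) ---> xi"
proof -
 have h0: "(%n. h n) ---> 0"
 proof -
  have "(%n. sqrt (T / r) * (1 / 2) ^ n) ---> sqrt (T / r) * 0" by (intro tendsto_intros LIMSEQ_power_zero) auto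
  then show ?thesis by (simp add: h_def[abs_def] power_divide)
 qed
 have bound: "eventually (%n. abs (h n * of_int (rnd n xi) - xi) <= h n) sequentially"
 proof -
  define c where "c = sqrt (T / r)"
  have c: "0 < c" using T_pos r_pos by (simp add: c_def)
  \<comment> \<open>From \<open>N\<close> on the truncation is inactive, since
    \<open>xi / h n\<close> grows like \<open>2 ^ n\<close> and the cut like
    \<open>4 ^ n\<close>.\<close>
  obtain N :: nat where N: "(abs xi / c + 1) < N" using reals_Archimedean2 by blast
  have "abs (h n * of_int (rnd n xi) - xi) <= h n" if n: "N <= n" for n
  proof -
  have hn: "h n = c / 2 ^ n" by (simp add: h_def c_def)
  have "abs (xi / h n) + 1 <= 4 ^ n"
  proof -
  have n2: "real n <= 2 ^ n" by (simp add: less_imp_le of_nat_less_two_power)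
  have "abs (xi / h n) = abs xi / c * 2 ^ n" using c by (simp add: hn abs_divide abs_mult)
  also have "... + 1 <= (abs xi / c + 1) * 2 ^ n" by (simp add: distrib_right)
  also have "... <= real n * 2 ^ n" using N n by (intro mult_right_mono) auto
  also have "... <= 2 ^ n * 2 ^ n" using n2 by (intro mult_right_mono) auto
  finally show ?thesis by (simp flip: power_mult_distrib)
  qed
  then have "abs (xi / h n) + 1 <= real_of_int (4 ^ n)" by (simp only: of_int_power of_int_numeral)
  then have "\<lfloor>xi / h n\<rfloor> <= 4 ^ n" "- (4 ^ n) <= \<lfloor>xi / h n\<rfloor>" by linarith+
  then have "rnd n xi = \<lfloor>xi / h n\<rfloor>" by (simp add: rnd_def)
  moreover have "abs (of_int \<lfloor>xi / h n\<rfloor> - xi / h n) <= 1" by linarith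
  then have "h n * abs (of_int \<lfloor>xi / h n\<rfloor> - xi / h n) <= h n * 1" using h_pos[of n] by (intro mult_left_mono) auto
  then have "abs (h n * (of_int \<lfloor>xi / h n\<rfloor> - xi / h n)) <= h n" using h_pos[of n] by (simp add: abs_mult)
  then have "abs (h n * of_int \<lfloor>xi / h n\<rfloor> - xi) <= h n" using h_pos[of n] by (simp add: right_diff_distrib)
  ultimately show ?thesis by simp
  qed
  then show ?thesis by (auto simp: eventually_sequentially)
 qed
 have "(%n. h n * of_int (rnd n xi) - xi) ---> 0"
  by (rule Lim_null_comparison[OF _ h0]) (use bound in simp)
 then have "(%n. h n * of_int (rnd n xi)) ---> xi" by (rule LIM_zero_cancel)
 from LIMSEQ_subseq_LIMSEQ[OF this s_mono] show ?thesis by (simp add: comp_def)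
qed

lemma measurable_rnd: "(%xi. ph (h n * of_int (rnd n xi))) : bmeas \<mu>"
proof -
 have "rnd n : \<mu> \<rightarrow>\<^sub>M UC" using rnd_measurable by (simp add: measurable_cong_sets[OF \<mu>(2) refl])
 then show ?thesis by (rule measurable_compose[where g = "%k. ph (h n * of_int k)"]) simp
qed

lemma initial_law:
 fixes ph :: "real => 'd => 'c::{banach, second_countable_topology}"
 assumes b: "!!x i. norm (ph x i) <= B" and L: "!!x y i. norm (ph x i - ph y i) <= L * abs (x - y)"
 shows "EE (%om. ph (Xc 0 om) (Yl om)) = (SUM i:UNIV. al i *\<^sub>R (LINT xi|\<mu>. ph xi i))"
proof (rule LIMSEQ_unique)
 interpret \<mu>: prob_space \<mu> by (rule \<mu>)
 have "(%n. EP (s n) (%om. ph (Xd (s n) (kk (s n) 0) om) (snd om))) ---> EE (%om. ph (Xc 0 om) (Yl om))"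
  by (rule weak_convergence[OF b L]) (use T_pos in auto)
 then show "(%n. SUM i:UNIV. al i *\<^sub>R (LINT xi|\<mu>. ph (h (s n) * of_int (rnd (s n) xi)) i)) ---> EE (%om. ph (Xc 0 om) (Yl om))"
  by (simp add: kk_def E_initial)
 have L0: "0 <= L" using order_trans[OF norm_ge_zero L[of 0 undefined 1]] by simp
 have cont: "continuous_on UNIV (%x. ph x i)" for i
 proof -
  have "L-lipschitz_on UNIV (%x. ph x i)" using L L0 by (auto simp: lipschitz_on_def dist_norm)
  then show ?thesis by (rule lipschitz_on_continuous_on)
 qed
 have ph\<mu>: "(%x. ph x i) : bmeas \<mu>" for i
  using borel_measurable_continuous_onI[OF cont[of i]] by (simp add: measurable_cong_sets[OF \<mu>(2) refl])
 show "(%n. SUM i:UNIV. al i *\<^sub>R (LINT xi|\<mu>. ph (h (s n) * of_int (rnd (s n) xi)) i)) ---> (SUM i:UNIV. al i *\<^sub>R (LINT xi|\<mu>. ph xi i))"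
 proof (intro tendsto_sum tendsto_scaleR tendsto_const)
  fix i
  show "(%n. LINT xi|\<mu>. ph (h (s n) * of_int (rnd (s n) xi)) i) ---> (LINT xi|\<mu>. ph xi i)"
  proof (rule integral_dominated_convergence[where w = "%_. B"])
  show "AE xi in \<mu>. (%n. ph (h (s n) * of_int (rnd (s n) xi)) i) ---> ph xi i"
  by (intro AE_I2 continuous_on_tendsto_compose[OF cont] rnd_LIMSEQ) auto
  qed (use b ph\<mu> measurable_rnd[of "%x. ph x i"] in auto)
 qed
qed

text \<open>Limit of the exact formula for the lazy walk: because \<open>r * (h n)^2 = ta n\<close>,
  each factor agrees with \<open>exp (- (th^2 / 2 * ta n))\<close> up to order
  \<open>(ta n)^2\<close>, and the number of factors is at most of order
  \<open>1 / ta n\<close>.\<close>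

lemma char_Xc:
 assumes t: "t : {0..T}"
 shows "EE (%om. iexp (th * Xc t om)) = char \<mu> th * exp (- (th^2 / 2 * t))"
proof (rule LIMSEQ_unique)
 interpret \<mu>: prob_space \<mu> by (rule \<mu>)
 show "(%n. EP (s n) (%om. iexp (th * Xd (s n) (kk (s n) t) om))) ---> EE (%om. iexp (th * Xc t om))"
 proof (rule weak_convergence[where ph = "%x i. iexp (th * x)" and B = 1, OF _ _ t])
  show "cmod (iexp (th * x) - iexp (th * y)) <= abs th * abs (x - y)" for x y
  using norm_iexp_diff[of "th * x" "th * y"] by (simp add: abs_mult flip: right_diff_distrib)
 qed simp
 have "(%n. (LINT xi|\<mu>. iexp (th * (h (s n) * of_int (rnd (s n) xi))))) ---> (LINT xi|\<mu>. iexp (th * xi))"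
 proof (rule integral_dominated_convergence[where w = "%_. 1"])
  show "AE xi in \<mu>. (%n. iexp (th * (h (s n) * of_int (rnd (s n) xi)))) ---> iexp (th * xi)"
  by (intro AE_I2 tendsto_intros rnd_LIMSEQ)
  show "(%xi. iexp (th * xi)) : bmeas \<mu>" by (simp add: measurable_cong_sets[OF \<mu>(2) refl])
  show "(%xi. iexp (th * (h (s n) * of_int (rnd (s n) xi)))) : bmeas \<mu>" for n
  by (rule measurable_rnd)
  show "AE xi in \<mu>. cmod (iexp (th * (h (s n) * of_int (rnd (s n) xi)))) <= 1" for n
  by (intro AE_I2) (simp only: norm_exp_i_times order_refl)
 qed simp
 moreover have "(%n. (1 - r * (1 - cos (th * h (s n)))) ^ kk (s n) t) ---> exp (- (th^2 / 2 * t))"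
 proof (rule power_exp_LIMSEQ)
  fix n
  define z where "z = th * h (s n)"
  define u where "u = th^2 / 2 * ta (s n)"
  have ta0: "0 < ta (s n)" by (rule ta_pos)
  have r1: "r <= 1 / 2"
  proof -
  have "r * 1 <= r * (hi / lo)" using hilo(1) r_pos by (intro mult_left_mono) auto
  with r_le show ?thesis by linarith
  qed
  show "abs (1 - r * (1 - cos (th * h (s n)))) <= 1"
  proof -
  have "0 <= 1 - cos z" "1 - cos z <= 2" using cos_le_one[of z] cos_ge_minus_one[of z] by linarith+
  moreover from this have "0 <= r * (1 - cos z)" "r * (1 - cos z) <= 1 / 2 * 2"
  using r_pos r1 by (simp, intro mult_mono) auto
  then show ?thesis by (simp add: z_def)
  qed
  show "0 <= th^2 / 2 * ta (s n)" using ta0 by simp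
  show "abs (1 - r * (1 - cos (th * h (s n))) - exp (- (th^2 / 2 * ta (s n)))) <= (th ^ 4 / r + th ^ 4) * (ta (s n))^2"
  proof -
  have rz: "r * z^2 = th^2 * ta (s n)" using h2r[of "s n"] by (simp add: z_def power_mult_distrib mult_ac)
  have "abs (r * (cos z - 1 + z^2 / 2)) <= r * z ^ 4"
  proof -
  have "0 <= z ^ 4" by simp
  then have "abs (cos z - 1 + z^2 / 2) <= z ^ 4" using ch.cos_taylor[of z] by linarith
  then show ?thesis using r_pos by (simp add: abs_mult)
  qed
  also have "r * z ^ 4 = th ^ 4 / r * (ta (s n))^2"
  proof -
  have "r * z ^ 4 = (r * z^2)^2 / r" using r_pos by (simp add: power2_eq_square power4_eq_xxxx)
  also have "... = th ^ 4 / r * (ta (s n))^2" unfolding rz by (simp add: power2_eq_square power4_eq_xxxx)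
  finally show ?thesis .
  qed
  finally have 1: "abs (r * (cos z - 1 + z^2 / 2)) <= th ^ 4 / r * (ta (s n))^2" .
  have "abs (1 - u - exp (- u)) <= u^2" using ta0 by (intro ch.exp_uminus_taylor) (simp add: u_def)
  also have "u^2 <= th ^ 4 * (ta (s n))^2"
  proof -
  have "u^2 = th ^ 4 * (ta (s n))^2 / 4" by (simp add: u_def power_mult_distrib power_divide flip: power_mult)
  moreover have "0 <= th ^ 4 * (ta (s n))^2" by simp
  ultimately show ?thesis by linarith
  qed
  finally have 2: "abs (1 - u - exp (- u)) <= th ^ 4 * (ta (s n))^2" .
  have "1 - r * (1 - cos z) - exp (- u) = r * (cos z - 1 + z^2 / 2) + (1 - u - exp (- u))"
  using rz by (simp add: u_def algebra_simps)
  then show ?thesis using 1 2 unfolding z_def u_def by (simp add: distrib_right)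
  qed
 next
  have k: "real (kk (s n) t) * ta (s n) = qfloor T (s n) t" for n by (metis ta_kk mult.commute)
  have "(%n. (th ^ 4 / r + th ^ 4) * (qfloor T (s n) t * ta (s n))) ---> (th ^ 4 / r + th ^ 4) * (t * 0)"
  by (intro tendsto_intros qfloor_s_LIMSEQ ta_s_LIMSEQ) (use t in auto)
  then show "(%n. real (kk (s n) t) * ((th ^ 4 / r + th ^ 4) * (ta (s n))^2)) ---> 0"
  by (simp add: k[symmetric] power2_eq_square mult_ac)
  have "(%n. th^2 / 2 * qfloor T (s n) t) ---> th^2 / 2 * t"
  by (intro tendsto_intros qfloor_s_LIMSEQ) (use t in auto)
  then show "(%n. real (kk (s n) t) * (th^2 / 2 * ta (s n))) ---> th^2 / 2 * t"
  by (simp add: k[symmetric] mult_ac)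
 qed
 ultimately have "(%n. (LINT xi|\<mu>. iexp (th * (h (s n) * of_int (rnd (s n) xi)))) * of_real ((1 - r * (1 - cos (th * h (s n)))) ^ kk (s n) t))
  ---> (LINT xi|\<mu>. iexp (th * xi)) * of_real (exp (- (th^2 / 2 * t)))"
  by (intro tendsto_mult tendsto_of_real)
 then show "(%n. EP (s n) (%om. iexp (th * Xd (s n) (kk (s n) t) om))) ---> char \<mu> th * exp (- (th^2 / 2 * t))"
  unfolding E_char_X[OF kk_le[OF t]] by (simp add: char_def)
qed

section \<open>Gaussian increments given the past\<close>

definition Zc :: "nat \<times> real => 'b => real" where
 "Zc j om = (if fst j = 0 then Xc (snd j) om else if fst j = 1 then Wc (snd j) om else real (to_nat (Yl om)))"

definition Zd :: "nat => nat \<times> real => (nat => int) \<times> 'd => real" where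
 "Zd n j om = (if fst j = 0 then Xd n (kk n (snd j)) om else if fst j = 1 then Wd n (kk n (snd j)) om else real (to_nat (snd om)))"

lemma measurable_Zc [measurable]: "Zc j : bmeas M"
 unfolding Zc_def[abs_def] by (cases j) simp

text \<open>The ramps of past coordinates are adapted in the chain up to the index of
  \<open>u\<close>, so the discrete estimate applies with them as test function. Its Gaussian factor
  is exact as soon as \<open>u\<close> and \<open>t\<close> belong to the grid.\<close>

lemma increment_char_quads:
 assumes F: "finite F" "!!j. j : F ==> snd (g j) : quads T & snd (g j) <= u" and u: "u : quads T" "t : quads T" "u <= t"
 shows "(CLINT om|M. complex_of_real (\<Prod>j\<in>F. ramp k (a j) (Zc (g j) om)) * iexp (th * (Wc t om - Wc u om))) =
  complex_of_real (EE (%om. \<Prod>j\<in>F. ramp k (a j) (Zc (g j) om))) * complex_of_real (exp (- (th^2 / 2 * (t - u))))"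
proof -
 define Ph where "Ph n om = complex_of_real (\<Prod>j\<in>F. ramp k (a j) (Zd n (g j) om))" for n om
 have T: "u : {0..T}" "t : {0..T}" using quads_subset[OF T_pos] u by auto
 have p1: "abs (\<Prod>j\<in>F. ramp k (a j) (z j)) <= 1" for z
  unfolding abs_prod using ramp_bounds by (intro prod_le_1) auto
 have Ph1: "cmod (Ph n om) <= 1" for n om unfolding Ph_def norm_of_real by (rule p1)
 have Pha: "adapted_at (kk n u) (Ph n)" for n
 proof -
  have "adapted_at (kk n u) (Zd n (g j))" if "j : F" for j
  proof -
  have "kk n (snd (g j)) <= kk n u" using F(2)[OF that] by (intro kk_mono) auto
  then have "adapted_at (kk n u) (Xd n (kk n (snd (g j))))" "adapted_at (kk n u) (Wd n (kk n (snd (g j))))"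
  by (auto intro: adapted_Xd adapted_Wd)
  then show ?thesis unfolding Zd_def adapted_at_def by auto
  qed
  then have "Zd n (g j) (x, i) = Zd n (g j) (y, i)" if "j : F" "ALL j<=kk n u. x j = y j" for j x y i
  using that unfolding adapted_at_def by blast
  then have "(\<Prod>j\<in>F. ramp k (a j) (Zd n (g j) (x, i))) = (\<Prod>j\<in>F. ramp k (a j) (Zd n (g j) (y, i)))"
  if "ALL j<=kk n u. x j = y j" for x y i
  using that by (intro prod.cong refl arg_cong[where f = "ramp k _"])
  then show ?thesis unfolding Ph_def adapted_at_def by (intro allI impI arg_cong[where f = complex_of_real])
 qed
 have limZ: "AE om in M. (ALL j:F. (%n. Zd (s n) (g j) (Om n om)) ---> Zc (g j) om) & (%n. Wn n t om - Wn n u om) ---> Wc t om - Wc u om"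
  using AE_conv_c
 proof eventually_elim
  case (elim om)
  have "(%n. Zd (s n) (g j) (Om n om)) ---> Zc (g j) om" if "j : F" for j
  proof -
  have j: "snd (g j) : quads T" using F(2)[OF that] by simp
  have "eventually (%n. real (to_nat (snd (Om n om))) = real (to_nat (Yl om))) sequentially"
  using elim by (auto simp: Yn_def elim: eventually_mono)
  then have "(%n. real (to_nat (snd (Om n om)))) ---> real (to_nat (Yl om))" by (rule tendsto_eventually)
  then show ?thesis using elim j unfolding Zd_def Zc_def by (auto simp: Xn_def Wn_def)
  qed
  then show ?case using elim u by (auto intro: tendsto_diff)
 qed
 have ramp_lim: "(%n. ramp k c (z n)) ---> ramp k c z'" if "z ---> z'" for c z z'
  using that by (intro continuous_on_tendsto_compose[OF continuous_ramp]) auto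
 have L1: "(%n. CLINT om|M. Ph (s n) (Om n om) * iexp (th * (Wn n t om - Wn n u om))) --->
  (CLINT om|M. complex_of_real (\<Prod>j\<in>F. ramp k (a j) (Zc (g j) om)) * iexp (th * (Wc t om - Wc u om)))"
 proof (rule integral_dominated_convergence[where w = "%_. 1"])
  show "AE om in M. (%n. Ph (s n) (Om n om) * iexp (th * (Wn n t om - Wn n u om))) --->
  complex_of_real (\<Prod>j\<in>F. ramp k (a j) (Zc (g j) om)) * iexp (th * (Wc t om - Wc u om))"
  using limZ unfolding Ph_def
  by eventually_elim (intro tendsto_mult tendsto_of_real tendsto_prod ramp_lim tendsto_exp tendsto_const, auto)
  show "AE om in M. cmod (Ph (s n) (Om n om) * iexp (th * (Wn n t om - Wn n u om))) <= 1" for n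
  using Ph1 by (intro AE_I2) (simp add: norm_mult)
 qed (unfold Wn_def, auto)
 have L2: "(%n. CLINT om|M. Ph (s n) (Om n om)) ---> (CLINT om|M. complex_of_real (\<Prod>j\<in>F. ramp k (a j) (Zc (g j) om)))"
 proof (rule integral_dominated_convergence[where w = "%_. 1"])
  show "AE om in M. (%n. Ph (s n) (Om n om)) ---> complex_of_real (\<Prod>j\<in>F. ramp k (a j) (Zc (g j) om))"
  using limZ unfolding Ph_def by eventually_elim (intro tendsto_of_real tendsto_prod ramp_lim, auto)
  show "AE om in M. cmod (Ph (s n) (Om n om)) <= 1" for n using Ph1 by simp
 qed auto
 obtain mu where mu: "!!n. mu <= n ==> qfloor T n u = u" using qfloor_eventually[OF u(1)] by blast
 obtain mt where mt: "!!n. mt <= n ==> qfloor T n t = t" using qfloor_eventually[OF u(2)] by blast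
 have "(%n. (CLINT om|M. Ph (s n) (Om n om) * iexp (th * (Wn n t om - Wn n u om))) -
  (CLINT om|M. Ph (s n) (Om n om)) * exp (- (th^2 / 2 * (t - u)))) ---> 0"
 proof (rule Lim_null_comparison)
  show "\<forall>\<^sub>F n in sequentially. norm ((CLINT om|M. Ph (s n) (Om n om) * iexp (th * (Wn n t om - Wn n u om))) -
  (CLINT om|M. Ph (s n) (Om n om)) * exp (- (th^2 / 2 * (t - u)))) <= th ^ 4 * T * (hi / lo / r + 1) * ta (s n)"
  unfolding eventually_sequentially
  proof (intro exI[of _ "max mu mt"] allI impI)
  fix n assume n: "max mu mt <= n"
  have mm: "mu <= s n" "mt <= s n" using n s_ge[of n] by auto
  have tu: "ta (s n) * real (kk (s n) t - kk (s n) u) = t - u"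
  using mu[OF mm(1)] mt[OF mm(2)] kk_mono[OF u(3), of "s n"] by (simp add: of_nat_diff right_diff_distrib ta_kk)
  have "cmod (EP (s n) (%om. Ph (s n) om * iexp (th * (Wd (s n) (kk (s n) t) om - Wd (s n) (kk (s n) u) om)))
  - EP (s n) (Ph (s n)) * exp (- (th^2 / 2) * (ta (s n) * real (kk (s n) t - kk (s n) u))))
  <= th ^ 4 * T * (hi / lo / r + 1) * ta (s n)"
  by (rule char_W[OF kk_mono[OF u(3)] kk_le[OF T(2)] Pha Ph1])
  moreover have "(CLINT om|M. Ph (s n) (Om n om) * iexp (th * (Wn n t om - Wn n u om))) =
  EP (s n) (%om. Ph (s n) om * iexp (th * (Wd (s n) (kk (s n) t) om - Wd (s n) (kk (s n) u) om)))"
  unfolding Wn_def by (rule E_Om)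
  moreover have "(CLINT om|M. Ph (s n) (Om n om)) = EP (s n) (Ph (s n))" by (rule E_Om)
  ultimately show "norm ((CLINT om|M. Ph (s n) (Om n om) * iexp (th * (Wn n t om - Wn n u om))) -
  (CLINT om|M. Ph (s n) (Om n om)) * exp (- (th^2 / 2 * (t - u)))) <= th ^ 4 * T * (hi / lo / r + 1) * ta (s n)"
  unfolding tu by simp
  qed
  show "(%n. th ^ 4 * T * (hi / lo / r + 1) * ta (s n)) ---> 0"
  using tendsto_mult_left[OF ta_s_LIMSEQ, of "th ^ 4 * T * (hi / lo / r + 1)"] by simp
 qed
 moreover have "(%n. (CLINT om|M. Ph (s n) (Om n om) * iexp (th * (Wn n t om - Wn n u om))) -
  (CLINT om|M. Ph (s n) (Om n om)) * exp (- (th^2 / 2 * (t - u)))) --->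
  (CLINT om|M. complex_of_real (\<Prod>j\<in>F. ramp k (a j) (Zc (g j) om)) * iexp (th * (Wc t om - Wc u om))) -
  (CLINT om|M. complex_of_real (\<Prod>j\<in>F. ramp k (a j) (Zc (g j) om))) * exp (- (th^2 / 2 * (t - u)))"
  by (intro tendsto_diff tendsto_mult L1 L2 tendsto_const)
 ultimately have "(CLINT om|M. complex_of_real (\<Prod>j\<in>F. ramp k (a j) (Zc (g j) om)) * iexp (th * (Wc t om - Wc u om))) -
  (CLINT om|M. complex_of_real (\<Prod>j\<in>F. ramp k (a j) (Zc (g j) om))) * exp (- (th^2 / 2 * (t - u))) = 0"
  by (rule LIMSEQ_unique[symmetric])
 then show ?thesis by (simp add: integral_complex_of_real del: of_real_prod)
qed

text \<open>All times are rounded down together. Rounding is monotone, so the past stays before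
  \<open>u\<close>, and continuity of the paths gives the limit.\<close>

lemma increment_char:
 assumes F: "finite F" "!!j. j : F ==> snd j : {0..u}" and u: "0 <= u" "u <= t" "t <= T"
 shows "(CLINT om|M. complex_of_real (\<Prod>j\<in>F. ramp k (a j) (Zc j om)) * iexp (th * (Wc t om - Wc u om))) =
  complex_of_real (EE (%om. \<Prod>j\<in>F. ramp k (a j) (Zc j om))) * complex_of_real (exp (- (th^2 / 2 * (t - u))))"
proof -
 define \<pi> where "\<pi> n j = (fst j, qfloor T n (snd j))" for n and j :: "nat \<times> real"
 define R where "R n om = (\<Prod>j\<in>F. ramp k (a j) (Zc (\<pi> n j) om))" for n om
 have p1: "abs (\<Prod>j\<in>F. ramp k (a j) (z j)) <= 1" for z :: "nat \<times> real => real"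
  unfolding abs_prod using ramp_bounds by (intro prod_le_1) auto
 have T: "t : {0..T}" "u : {0..T}" using u by auto
 have FT: "snd j : {0..T}" if "j : F" for j using F(2)[OF that] u by auto
 have ramp_lim: "(%n. ramp k c (z n)) ---> ramp k c z'" if "z ---> z'" for c z z'
  using that by (intro continuous_on_tendsto_compose[OF continuous_ramp]) auto
 have limZ: "(%n. Zc (\<pi> n j) om) ---> Zc j om" if "om : space M" "j : F" for om j
  using qfloor_c[OF that(1) FT[OF that(2)]] by (auto simp: Zc_def \<pi>_def)
 have limR: "(%n. R n om) ---> (\<Prod>j\<in>F. ramp k (a j) (Zc j om))" if "om : space M" for om
  unfolding R_def by (intro tendsto_prod ramp_lim limZ that)
 have eq: "(CLINT om|M. complex_of_real (R n om) * iexp (th * (Wc (qfloor T n t) om - Wc (qfloor T n u) om))) =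
  complex_of_real (EE (R n)) * complex_of_real (exp (- (th^2 / 2 * (qfloor T n t - qfloor T n u))))" for n
  unfolding R_def[abs_def]
 proof (rule increment_char_quads[OF F(1), where g = "\<pi> n"])
  fix j assume j: "j : F"
  show "snd (\<pi> n j) : quads T & snd (\<pi> n j) <= qfloor T n u"
  using F(2)[OF j] u FT[OF j] qfloor_in[OF T_pos FT[OF j]] qfloor_mono[OF T_pos] by (auto simp: \<pi>_def)
 qed (use T u in \<open>auto intro: qfloor_in[OF T_pos] qfloor_mono[OF T_pos]\<close>)
 have R1: "abs (R n om) <= 1" for n om unfolding R_def by (rule p1)
 have Rm[measurable]: "R n : bmeas M" for n unfolding R_def[abs_def] by simp
 have Q: "qfloor T n t : {0..T}" "qfloor T n u : {0..T}" for n
  using quads_subset[OF T_pos] qfloor_in[OF T_pos] T by blast+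
 have L1: "(%n. CLINT om|M. complex_of_real (R n om) * iexp (th * (Wc (qfloor T n t) om - Wc (qfloor T n u) om))) --->
  (CLINT om|M. complex_of_real (\<Prod>j\<in>F. ramp k (a j) (Zc j om)) * iexp (th * (Wc t om - Wc u om)))"
 proof (rule integral_dominated_convergence[where w = "%_. 1"])
  show "AE om in M. (%n. complex_of_real (R n om) * iexp (th * (Wc (qfloor T n t) om - Wc (qfloor T n u) om))) --->
  complex_of_real (\<Prod>j\<in>F. ramp k (a j) (Zc j om)) * iexp (th * (Wc t om - Wc u om))"
  by (intro AE_I2 tendsto_mult tendsto_of_real limR tendsto_exp tendsto_const tendsto_diff qfloor_c T)
  show "AE om in M. cmod (complex_of_real (R n om) * iexp (th * (Wc (qfloor T n t) om - Wc (qfloor T n u) om))) <= 1" for n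
  using R1 by (intro AE_I2) (simp add: norm_mult)
 qed auto
 have L2: "(%n. EE (R n)) ---> EE (%om. \<Prod>j\<in>F. ramp k (a j) (Zc j om))"
  by (rule integral_dominated_convergence[where w = "%_. 1"]) (use R1 limR in auto)
 have L3: "(%n. complex_of_real (EE (R n)) * complex_of_real (exp (- (th^2 / 2 * (qfloor T n t - qfloor T n u)))))
  ---> complex_of_real (EE (%om. \<Prod>j\<in>F. ramp k (a j) (Zc j om))) * complex_of_real (exp (- (th^2 / 2 * (t - u))))"
  by (intro tendsto_mult tendsto_of_real L2 tendsto_exp tendsto_minus tendsto_const tendsto_diff qfloor_LIMSEQ[OF T_pos]) (use u in auto)
 show ?thesis by (rule LIMSEQ_unique[OF L1 L3[folded eq]])
qed

end

lemma ramp_lipschitz: "abs (ramp k a x - ramp k a y) <= real k * abs (x - y)"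
proof -
 have "abs (ramp k a x - ramp k a y) <= abs (real k * (x - a) - real k * (y - a))"
  unfolding ramp_def by (auto simp: max_def min_def)
 also have "real k * (x - a) - real k * (y - a) = real k * (x - y)" by (simp add: algebra_simps)
 finally show ?thesis by (simp add: abs_mult)
qed

section \<open>Filtration, Brownian motion and initial law of the limit\<close>

context scaling
begin

definition clip :: "real => real" where "clip t = max 0 (min T t)"

lemma clip: "clip t : {0..T}" "t : {0..T} ==> clip t = t" "u <= t ==> clip u <= clip t"
 using T_pos by (auto simp: clip_def)

text \<open>Generated by both processes up to time \<open>t\<close> and by the label, which is
  present from time \<open>0\<close>; \<open>clip\<close> makes the filtration constant outside
  \<open>{0..T}\<close>.\<close>

definition Fc :: "real => 'b measure" where
 "Fc t = generated_by M Zc {j. fst j <= 2 & snd j : {0..clip t}}"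

lemma space_Fc [simp]: "space (Fc t) = space M" by (simp add: Fc_def)

lemma sets_Fc: "sets (Fc t) <= sets M"
 unfolding Fc_def by (rule sets_generated_by_subset) simp

lemma sets_Fc_mono: "u <= t ==> sets (Fc u) <= sets (Fc t)"
 unfolding Fc_def by (rule sets_generated_by_mono) (auto dest: clip(3))

lemma filtered_Fc: "filtered_prob_space M Fc"
 unfolding filtered_prob_space_def
proof (intro conjI allI)
 show "filtration (space M) Fc" by standard (auto dest: sets_Fc_mono)
 show "subalgebra M (Fc t)" for t using sets_Fc by (simp add: subalgebra_def)
qed (rule prob_space_axioms)

lemma measurable_Fc:
 assumes "u : {0..T}" "u <= t"
 shows "Xc u : bmeas (Fc t)" "Wc u : bmeas (Fc t)"
proof -
 have "u <= clip t" using assms by (auto simp: clip_def)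
 then have "Zc (0, u) : bmeas (Fc t)" "Zc (1, u) : bmeas (Fc t)"
  unfolding Fc_def using assms by (auto intro!: measurable_generated_by)
 then show "Xc u : bmeas (Fc t)" "Wc u : bmeas (Fc t)" by (simp_all add: Zc_def[abs_def])
qed

lemma measurable_Y: "Yl : Fc t \<rightarrow>\<^sub>M UC"
proof -
 have "Zc (2, 0) : bmeas (Fc t)"
  unfolding Fc_def using clip(1)[of t] by (intro measurable_generated_by) auto
 then have "(%om. from_nat (nat \<lfloor>Zc (2, 0) om\<rfloor>) :: 'd) : Fc t \<rightarrow>\<^sub>M UC"
  by measurable
 then show ?thesis by (simp add: Zc_def[abs_def])
qed

lemma Wc_0: "AE om in M. Wc 0 om = 0"
 using AE_conv_c
proof eventually_elim
 case (elim om)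
 have "quad T 0 0 : quads T" by (rule quadsI) simp
 then have "(%n. Wn n 0 om) ---> Wc 0 om" using elim by (simp add: quad_def)
 moreover have "(%n. Wn n 0 om) = (%n. 0)" by (simp add: Wn_def kk_def)
 ultimately show ?case by (simp add: LIMSEQ_const_iff)
qed

lemma increments:
 assumes "0 <= u" "u < t" "t <= T"
 shows "distributed M lborel (%om. Wc t om - Wc u om) (normal_density 0 (sqrt (t - u))) &
  indep_set (sets (Fc u)) (sets (vimage_algebra (space M) (%om. Wc t om - Wc u om) borel))"
 unfolding Fc_def
proof (rule increment_independent_of_past)
 fix F :: "(nat \<times> real) set" and a :: "nat \<times> real => real" and k th
 assume F: "finite F" "F <= {j. fst j <= 2 & snd j : {0..clip u}}"
 have "clip u = u" using assms by (intro clip(2)) auto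
 then have "snd j : {0..u}" if "j : F" for j using F(2) that by auto
 from increment_char[OF F(1) this, of t k a th]
 show "(CLINT om|M. complex_of_real (\<Prod>j\<in>F. ramp k (a j) (Zc j om)) * iexp (th * (Wc t om - Wc u om))) =
  complex_of_real (EE (%om. \<Prod>j\<in>F. ramp k (a j) (Zc j om))) * complex_of_real (exp (- (th^2 * (sqrt (t - u))^2 / 2)))"
  using assms by simp
qed (use assms in auto)

lemma brownian_Wc: "brownian_motion M Fc T Wc"
 unfolding brownian_motion_def continuous_adapted_def
 using measurable_Fc continuous_c Wc_0 increments by auto

lemma continuous_adapted_Xc: "continuous_adapted M Fc T Xc"
 unfolding continuous_adapted_def using measurable_Fc continuous_c by auto

lemma path_independent: "indep_set (sets (Fc 0)) (sets (path_algebra M T Wc))"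
 unfolding path_algebra_def
proof (rule path_independent_of_start[where F = Fc])
 show "Wc t : bmeas (Fc t)" if "t : {0..T}" for t using measurable_Fc that by auto
qed (use sets_Fc sets_Fc_mono Wc_0 increments in auto)

text \<open>Ramps are Lipschitz, so the product law of the discrete start passes to the limit for
  them; steepening the ramps gives half-lines.\<close>

lemma initial_joint:
 "prob {om : space M. Xc 0 om <= a & Yl om = i} = al i * measure \<mu> {..a}"
proof (rule LIMSEQ_unique)
 interpret \<mu>: prob_space \<mu> by (rule \<mu>)
 have [measurable]: "ramp k a : bmeas \<mu>" for k by (simp add: measurable_cong_sets[OF \<mu>(2) refl])
 have sp: "space \<mu> = UNIV" using sets_eq_imp_space_eq[OF \<mu>(2)] by simp
 have eq: "EE (%om. ramp k a (Xc 0 om) * indicator {i} (Yl om)) = al i * (LINT xi|\<mu>. ramp k a xi)" for k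
 proof -
  have "EE (%om. ramp k a (Xc 0 om) * indicator {i} (Yl om)) = (SUM j:UNIV. al j *\<^sub>R (LINT xi|\<mu>. ramp k a xi * indicator {i} j))"
  proof (rule initial_law[where ph = "%x j. ramp k a x * indicator {i} j" and B = 1 and L = "real k"])
  show "norm (ramp k a x * indicator {i} j) <= 1" for x j
  using ramp_bounds[of k a x] by (simp add: indicator_def)
  show "norm (ramp k a x * indicator {i} j - ramp k a y * indicator {i} j) <= real k * abs (x - y)" for x y j
  using ramp_lipschitz[of k a x y] by (simp add: indicator_def)
  qed
  also have "... = (SUM j:UNIV. if j = i then al i * (LINT xi|\<mu>. ramp k a xi) else 0)"
  by (intro sum.cong) auto
  finally show ?thesis by simp
 qed
 have Y[measurable]: "Yl : M \<rightarrow>\<^sub>M UC" by simp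
 have Yi[measurable]: "(%om. indicator {i} (Yl om) :: real) : bmeas M"
  by (rule measurable_compose[OF Y]) simp
 have "(%k. EE (%om. ramp k a (Xc 0 om) * indicator {i} (Yl om))) ---> EE (%om. indicator {..a} (Xc 0 om) * indicator {i} (Yl om) :: real)"
 proof (rule integral_dominated_convergence[where w = "%_. 1"])
  show "AE om in M. (%k. ramp k a (Xc 0 om) * indicator {i} (Yl om)) ---> indicator {..a} (Xc 0 om) * (indicator {i} (Yl om) :: real)"
  by (intro AE_I2 tendsto_intros ramp_LIMSEQ)
  show "AE om in M. norm (ramp k a (Xc 0 om) * indicator {i} (Yl om)) <= 1" for k
  using ramp_bounds by (auto simp: indicator_def)
 qed auto
 also have "EE (%om. indicator {..a} (Xc 0 om) * indicator {i} (Yl om) :: real) =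
  EE (indicator {om : space M. Xc 0 om <= a & Yl om = i})"
  by (intro Bochner_Integration.integral_cong) (auto simp: indicator_def)
 also have "... = prob {om : space M. Xc 0 om <= a & Yl om = i}" by simp
 finally show "(%k. al i * (LINT xi|\<mu>. ramp k a xi)) ---> prob {om : space M. Xc 0 om <= a & Yl om = i}" unfolding eq .
 have "(%k. LINT xi|\<mu>. ramp k a xi) ---> (LINT xi|\<mu>. indicator {..a} xi)"
 proof (rule integral_dominated_convergence[where w = "%_. 1"])
  show "indicator {..a} : bmeas \<mu>" by (simp add: measurable_cong_sets[OF \<mu>(2) refl])
  show "AE xi in \<mu>. norm (ramp k a xi) <= 1" for k using ramp_bounds by auto
 qed (use ramp_LIMSEQ in auto)
 then show "(%k. al i * (LINT xi|\<mu>. ramp k a xi)) ---> al i * measure \<mu> {..a}"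
  using sp by (intro tendsto_mult tendsto_const) simp
qed

lemma initial_Y: "prob {om : space M. Yl om = i} = al i"
proof -
 interpret \<mu>: prob_space \<mu> by (rule \<mu>)
 have [measurable]: "Yl : M \<rightarrow>\<^sub>M UC" by simp
 have "EE (%om. indicator {i} (Yl om) :: real) = (SUM j:UNIV. al j *\<^sub>R (LINT xi|\<mu>. (indicator {i} j :: real)))"
  by (rule initial_law[where ph = "%x j. indicator {i} j" and B = 1 and L = 0]) (auto simp: indicator_def)
 also have "... = (SUM j:UNIV. if j = i then al i else 0)"
  by (intro sum.cong) (auto simp: \<mu>.prob_space)
 also have "EE (%om. indicator {i} (Yl om) :: real) = EE (indicator {om : space M. Yl om = i})"
  by (intro Bochner_Integration.integral_cong) (auto simp: indicator_def)
 finally show ?thesis by simp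
qed

lemma initial_X: "prob {om : space M. Xc 0 om <= a} = measure \<mu> {..a}"
proof -
 have [measurable]: "Yl : M \<rightarrow>\<^sub>M UC" by simp
 have "{om : space M. Xc 0 om <= a} = (\<Union>i\<in>UNIV. {om : space M. Xc 0 om <= a & Yl om = i})" by auto
 also have "prob ... = (SUM i:UNIV. prob {om : space M. Xc 0 om <= a & Yl om = i})"
  by (rule finite_measure_finite_Union) (auto simp: disjoint_family_on_def)
 finally show ?thesis by (simp add: initial_joint al_sum flip: sum_distrib_right)
qed

lemma distr_X0: "distr M borel (Xc 0) = \<mu>"
proof (rule cdf_unique)
 show "real_distribution (distr M borel (Xc 0))" by (rule real_distribution_distr) simp
 show "real_distribution \<mu>" unfolding real_distribution_def real_distribution_axioms_def using \<mu> sets_eq_imp_space_eq[OF \<mu>(2)] by auto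
 have "cdf (distr M borel (Xc 0)) a = prob {om : space M. Xc 0 om <= a}" for a
  unfolding cdf_def by (subst measure_distr) (auto intro!: arg_cong[where f = prob])
 then show "cdf (distr M borel (Xc 0)) = cdf \<mu>" by (simp add: fun_eq_iff initial_X cdf_def)
qed

lemma indep_X0_Y:
 "indep_set (sets (vimage_algebra (space M) (Xc 0) borel)) (sets (vimage_algebra (space M) Yl (count_space UNIV)))"
proof -
 define A where "A = {Xc 0 -` B Int space M |B. B : range (%a::real. {..a})}"
 define C where "C = {Yl -` B Int space M |B. B : UNIV}"
 have Y[measurable]: "Yl : M \<rightarrow>\<^sub>M UC" by simp
 have X[measurable]: "Xc 0 : bmeas M" by simp
 have sA: "sets (vimage_algebra (space M) (Xc 0) borel) = sigma_sets (space M) A"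
 proof -
  have "vimage_algebra (space M) (Xc 0) borel = sigma (space M) A"
  unfolding borel_eq_atMost A_def by (rule vimage_algebra_sigma) auto
  moreover have "A <= Pow (space M)" unfolding A_def by blast
  ultimately show ?thesis by (simp add: sets_measure_of)
 qed
 have sC: "sets (vimage_algebra (space M) Yl (count_space UNIV)) <= sigma_sets (space M) C"
  unfolding C_def by (subst sets_vimage_algebra) auto
 have AE': "A <= events"
 proof
  fix E assume "E : A"
  then obtain a where "E = Xc 0 -` {..a} Int space M" unfolding A_def by blast
  then show "E : events" by simp
 qed
 have CE: "C <= events"
 proof
  fix E assume "E : C"
  then obtain B where "E = Yl -` B Int space M" unfolding C_def by blast
  then show "E : events" using measurable_sets[OF Y, of B] by simp
 qed
 have "indep_set A C"
 proof (rule indep_setI[OF AE' CE])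
  fix E G assume "E : A" "G : C"
  then obtain a B where E: "E = Xc 0 -` {..a} Int space M" and G: "G = Yl -` B Int space M" unfolding A_def C_def by blast
  have "E Int G = (\<Union>i\<in>B. {om : space M. Xc 0 om <= a & Yl om = i})" by (auto simp: E G)
  also have "prob ... = (SUM i:B. prob {om : space M. Xc 0 om <= a & Yl om = i})"
  by (rule finite_measure_finite_Union) (auto simp: disjoint_family_on_def)
  finally have 1: "prob (E Int G) = (SUM i:B. al i) * measure \<mu> {..a}" by (simp add: initial_joint sum_distrib_right)
  have "G = (\<Union>i\<in>B. {om : space M. Yl om = i})" by (auto simp: G)
  also have "prob ... = (SUM i:B. prob {om : space M. Yl om = i})"
  by (rule finite_measure_finite_Union) (auto simp: disjoint_family_on_def)
  finally have 2: "prob G = (SUM i:B. al i)" by (simp add: initial_Y)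
  have "E = {om : space M. Xc 0 om <= a}" by (auto simp: E)
  then have 3: "prob E = measure \<mu> {..a}" by (simp add: initial_X)
  show "prob (E Int G) = prob E * prob G" by (simp add: 1 2 3)
 qed
 moreover have "Int_stable A" unfolding Int_stable_def
 proof (intro ballI)
  fix E G assume "E : A" "G : A"
  then obtain a b where E: "E = Xc 0 -` {..a} Int space M" and G: "G = Xc 0 -` {..b} Int space M" unfolding A_def by blast
  have "E Int G = Xc 0 -` {..min a b} Int space M" by (auto simp: E G)
  then show "E Int G : A" unfolding A_def by blast
 qed
 moreover have "Int_stable C" unfolding Int_stable_def
 proof (intro ballI)
  fix E G assume "E : C" "G : C"
  then obtain a b where E: "E = Yl -` a Int space M" and G: "G = Yl -` b Int space M" unfolding C_def by blast
  have "E Int G = Yl -` (a Int b) Int space M" by (auto simp: E G)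
  then show "E Int G : C" unfolding C_def by blast
 qed
 ultimately have i: "indep_set (sigma_sets (space M) A) (sigma_sets (space M) C)" by (rule indep_set_sigma_sets)
 show ?thesis
 proof (rule indep_setI)
  show "sets (vimage_algebra (space M) (Xc 0) borel) <= events"
  unfolding sA by (rule sets.sigma_sets_subset[OF AE'])
  show "sets (vimage_algebra (space M) Yl (count_space UNIV)) <= events"
  using sC sets.sigma_sets_subset[OF CE] by blast
  show "prob (a Int b) = prob a * prob b" if "a : sets (vimage_algebra (space M) (Xc 0) borel)" "b : sets (vimage_algebra (space M) Yl (count_space UNIV))" for a b
  using indep_setD[OF i] that sC unfolding sA by blast
 qed
qed

text \<open>The start and the label are known at time \<open>0\<close>, hence jointly independent of
  the path of \<open>W\<close>; with their mutual independence this gives the product formula for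
  all three.\<close>

lemma independence:
 "indep_sets (%i. sets ([vimage_algebra (space M) (Xc 0) borel, vimage_algebra (space M) Yl (count_space UNIV),
  path_algebra M T Wc] ! i)) {..<3}"
proof -
 let ?A = "vimage_algebra (space M) (Xc 0) borel" and ?B = "vimage_algebra (space M) Yl (count_space UNIV)"
 let ?C = "path_algebra M T Wc"
 have AF: "sets ?A <= sets (Fc 0)"
  using measurable_sets[OF measurable_Fc(1)[of 0 0]] T_pos by (auto simp: sets_vimage_algebra2)
 have BF: "sets ?B <= sets (Fc 0)"
  using measurable_sets[OF measurable_Y[of 0]] by (auto simp: sets_vimage_algebra2)
 have C: "sets ?C <= events" using path_independent unfolding indep_set_def indep_sets_def by (auto split: bool.splits)
 have three: "{..<3} = {0, 1, 2::nat}" by auto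
 have sp: "space ?A = space M" "space ?B = space M" "space ?C = space M" by (simp_all add: path_algebra_def)
 show ?thesis
 proof (subst indep_sets_finite)
  fix i :: nat assume "i : {..<3}"
  then have i: "i = 0 \<or> i = 1 \<or> i = 2" by auto
  show "sets ([?A, ?B, ?C] ! i) <= events" using i AF BF C sets_Fc[of 0] by auto
  show "space M : sets ([?A, ?B, ?C] ! i)"
  using i sets.top[of ?A] sets.top[of ?B] sets.top[of ?C] sp by auto
 next
  show "ALL E:Pi {..<3} (%i. sets ([?A, ?B, ?C] ! i)). prob (\<Inter>j\<in>{..<3}. E j) = (\<Prod>j<3. prob (E j))"
  proof
  fix E :: "nat => 'b set" assume E: "E : Pi {..<3} (%i. sets ([?A, ?B, ?C] ! i))"
  have e: "E 0 : sets ?A" "E 1 : sets ?B" "E 2 : sets ?C"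
  using Pi_mem[OF E, of 0] Pi_mem[OF E, of 1] Pi_mem[OF E, of 2] by auto
  have "prob ((E 0 Int E 1) Int E 2) = prob (E 0 Int E 1) * prob (E 2)"
  using e AF BF by (intro indep_setD[OF path_independent] sets.Int) auto
  also have "prob (E 0 Int E 1) = prob (E 0) * prob (E 1)" by (rule indep_setD[OF indep_X0_Y e(1,2)])
  finally show "prob (\<Inter>j\<in>{..<3}. E j) = (\<Prod>j<3. prob (E j))"
  unfolding three by (simp add: Int_assoc mult.assoc)
  qed
 qed (use three in auto)
qed

end

section \<open>Convergence of the conditional expectations\<close>

context volatilities
begin

text \<open>Continuity holds at every point of the cone, including zero, thanks to the Lipschitz
  bound.\<close>

lemma Th_tendsto:
 assumes "!!n. nonneg_vec (p n)" "nonneg_vec q" "p ---> q"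
 shows "(%n. Th (p n)) ---> Th q"
proof -
 have b: "abs (Th (p n) - Th q) <= KTh * norm (p n - q)" for n
  using Th_diff_le[OF assms(1,2), of n] Th_diff_le[OF assms(2,1), of n] by (simp add: abs_le_iff norm_minus_commute)
 have "(%n. KTh * norm (p n - q)) ---> KTh * norm (q - q)" by (intro tendsto_intros assms(3))
 then have lim: "(%n. KTh * norm (p n - q)) ---> 0" by simp
 have "\<forall>\<^sub>F n in sequentially. norm (Th (p n) - Th q) <= KTh * norm (p n - q)"
  unfolding real_norm_def by (rule always_eventually) (use b in blast)
 from Lim_null_comparison[OF this lim] have "(%n. Th (p n) - Th q) ---> 0" .
 then show ?thesis by (rule LIM_zero_cancel)
qed

end

section \<open>Time averages and block averages of the scheme\<close>

context approx
begin

lemma cell_iff: "0 <= t ==> t : {ta n * real k..<ta n * real (Suc k)} \<longleftrightarrow> kk n t = k"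
proof -
 assume t: "0 <= t"
 define z where "z = 4 ^ n * t / T"
 have z: "0 <= z" "t = ta n * z" using t T_pos by (auto simp: z_def ta_def)
 have "t : {ta n * real k..<ta n * real (Suc k)} \<longleftrightarrow> real k <= z & z < real (Suc k)"
  unfolding z(2) using ta_pos[of n] by (simp only: atLeastLessThan_iff mult_le_cancel_left_pos mult_less_cancel_left_pos)
 also have "... \<longleftrightarrow> \<lfloor>z\<rfloor> = int k" by (simp add: floor_eq_iff add.commute)
 also have "... \<longleftrightarrow> nat \<lfloor>z\<rfloor> = k" using z(1) by auto
 finally show ?thesis by (simp add: kk_def z_def)
qed

lemma kk_less: "t : {0..<T} ==> kk n t < 4 ^ n"
proof -
 assume t: "t : {0..<T}"
 have "real (kk n t) * ta n <= t" using ta_kk[of n t] qfloor_bounds(1)[OF T_pos, of t n] t by (simp add: mult.commute)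
 also have "t < T" using t by simp
 also have "T = 4 ^ n * ta n" by (simp add: ta_def)
 finally have "real (kk n t) < real (4 ^ n)" using ta_pos[of n] by simp
 then show ?thesis by (simp only: of_nat_less_iff)
qed

text \<open>Sums over time steps become integrals of step functions, to which dominated convergence
  in time applies.\<close>

lemma step_integral:
 fixes f :: "nat => real"
 shows "integrable lborel (%t. indicator {0..<T} t * f (kk n t))"
  and "(LINT t|lborel. indicator {0..<T} t * f (kk n t)) = (SUM k<4 ^ n. ta n * f k)"
proof -
 define I where "I k = {ta n * real k..<ta n * real (Suc k)}" for k
 have T4: "T = ta n * real (4 ^ n)" by (simp add: ta_def)
 have eq: "indicator {0..<T} t * f (kk n t) = (SUM k<4 ^ n. f k * indicator (I k) t)" for t
 proof (cases "t : {0..<T}")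
  case True
  have "(SUM k<4 ^ n. f k * indicator (I k) t) = (SUM k<4 ^ n. if k = kk n t then f (kk n t) else 0)"
  using True cell_iff[of t n] unfolding I_def by (intro sum.cong) (auto simp: indicator_def)
  then show ?thesis using True kk_less[OF True, of n] by simp
 next
  case False
  have "t ~: I k" if "k < 4 ^ n" for k
  proof
  assume t: "t : I k"
  have "0 <= ta n * real k" using ta_pos[of n] by simp
  moreover have "ta n * real (Suc k) <= ta n * real (4 ^ n)"
  using that ta_pos[of n] by (intro mult_left_mono of_nat_mono) auto
  then have "ta n * real (Suc k) <= T" using T4 by linarith
  ultimately show False using t False unfolding I_def by auto
  qed
  then show ?thesis using False by simp
 qed
 have mI: "measure lborel (I k) = ta n" for k
  using ta_pos[of n] by (simp add: I_def measure_lborel_Ico distrib_left mult_left_mono)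
 have iI: "integrable lborel (%t. f k * indicator (I k) t :: real)" for k
  using ta_pos[of n] by (intro integrable_mult_right integrable_real_indicator) (auto simp: I_def emeasure_lborel_Ico)
 have fe: "(%t. indicator {0..<T} t * f (kk n t)) = (%t. SUM k<4 ^ n. f k * indicator (I k) t)" by (rule ext) (rule eq)
 show "integrable lborel (%t. indicator {0..<T} t * f (kk n t))"
  unfolding fe by (rule Bochner_Integration.integrable_sum) (rule iI)
 show "(LINT t|lborel. indicator {0..<T} t * f (kk n t)) = (SUM k<4 ^ n. ta n * f k)"
  unfolding fe using iI by (subst Bochner_Integration.integral_sum) (auto simp: mI mult.commute)
qed

lemma measurable_kk [measurable]: "kk n : borel \<rightarrow>\<^sub>M UC"
 unfolding kk_def[abs_def] by measurable

text \<open>The mass seen by one tent, label by label. It is an expectation of Lipschitz functions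
  of position and label and therefore converges, unlike the densities themselves.\<close>

definition blk :: "nat => int => nat => nat => real ^ 'd" where
 "blk a j n k = (SUM x:win n. tent a j (h n * of_int x) *\<^sub>R P n k x)"

lemma tent_bounds: "0 <= tent a j y" "tent a j y <= 1" unfolding tent_def by (rule hat_bounds)+

lemma tent_lipschitz: "abs (tent a j x - tent a j y) <= (1 / h a) * abs (x - y)"
proof -
 have "abs (tent a j x - tent a j y) <= abs ((x / h a - of_int j) - (y / h a - of_int j))" unfolding tent_def by (rule hat_lipschitz)
 also have "(x / h a - of_int j) - (y / h a - of_int j) = (1 / h a) * (x - y)" by (simp add: diff_divide_distrib)
 finally show ?thesis using h_pos[of a] by (simp add: abs_mult)
qed

lemma nonneg_blk: "nonneg_vec (blk a j n k)"
 unfolding blk_def using tent_bounds nonneg_P by (intro nonneg_vec_sum) auto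

lemma blk_E:
 assumes "k <= 4 ^ n"
 shows "blk a j n k $ i = EP n (%om. tent a j (Xd n k om) * indicator {i} (snd om))"
proof -
 have "EP n (%om. tent a j (h n * of_int (fst om k)) * indicator {i} (snd om)) =
  (SUM x:win n. SUM i':UNIV. P n k x $ i' * (tent a j (h n * of_int x) * indicator {i} i'))"
  by (rule E_win[OF assms])
 also have "... = (SUM x:win n. SUM i':UNIV. if i' = i then P n k x $ i * tent a j (h n * of_int x) else 0)"
  by (intro sum.cong refl) (auto simp: indicator_def)
 also have "... = blk a j n k $ i" by (simp add: blk_def mult.commute)
 finally show ?thesis by (simp add: Xd_def)
qed

lemma tot_win: "k <= 4 ^ n ==> (SUM x:win n. tot (P n k x)) = 1"
 using E_win[of k n "%_ _. 1"] by (simp add: tot_def)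

lemma sum_Th_blk_le:
 assumes "k <= 4 ^ n" "finite A"
 shows "(SUM j:A. Th (blk a j n k)) <= hi^2"
proof -
 have "(SUM j:A. Th (blk a j n k)) <= (SUM j:A. hi^2 * tot (blk a j n k))"
  by (intro sum_mono Th_le nonneg_blk)
 also have "... = hi^2 * (SUM x:win n. (SUM j:A. tent a j (h n * of_int x)) * tot (P n k x))"
  unfolding blk_def tot_def by (simp add: sum_distrib_left sum_distrib_right sum.swap[of _ A] sum.swap[of _ A "win n"] sum.swap[of _ UNIV "win n"])
 also have "... <= hi^2 * (SUM x:win n. 1 * tot (P n k x))"
  using assms(2) hat_sum_le[OF assms(2)] tot_nonneg[OF nonneg_P]
  by (intro mult_left_mono sum_mono mult_right_mono) (auto simp: tent_def)
 also have "... = hi^2" using tot_win[OF assms(1)] by simp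
 finally show ?thesis .
qed

lemma sum_Th_le:
 assumes "k <= 4 ^ n" "A <= win n"
 shows "(SUM x:A. Th (P n k x)) <= hi^2 * (SUM x:A. tot (P n k x))"
 unfolding sum_distrib_left by (intro sum_mono Th_le nonneg_P)

lemma tail_tot:
 assumes "k <= 4 ^ n"
 shows "(SUM x:{x : win n. b < abs x}. tot (P n k x)) = measure_pmf.prob (plaw n) {om. b < abs (fst om k)}"
proof -
 have "EP n (%om. indicator {x. b < abs x} (fst om k) :: real) = (SUM x:win n. SUM i:UNIV. P n k x $ i * indicator {x. b < abs x} x)"
  by (rule E_win[OF assms, of "%x i. indicator {x. b < abs x} x"])
 also have "... = (SUM x:win n. if b < abs x then tot (P n k x) else 0)"
  by (intro sum.cong refl) (auto simp: tot_def)
 also have "... = (SUM x:{x : win n. b < abs x}. tot (P n k x))" by (rule sum.inter_filter[symmetric]) simp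
 also have "EP n (%om. indicator {x. b < abs x} (fst om k) :: real) = EP n (indicator {om. b < abs (fst om k)})"
  by (intro Bochner_Integration.integral_cong) (auto simp: indicator_def)
 finally show ?thesis by simp
qed

end

section \<open>The regression function of the limit and its energy\<close>

context scaling
begin

lemma joint_Xc [measurable]: "(%(t, om). Xc (clip t) om) : bmeas (borel \<Otimes>\<^sub>M M)"
proof -
 have 1: "(%(u, om). Xc u om) : bmeas (restrict_space borel {0..T} \<Otimes>\<^sub>M M)"
  by (rule progressive_of_continuous[where F = "%_. M" and T = T and Om = "space M" and t = T])
  (use continuous_c T_pos in auto)
 have [measurable]: "clip : bmeas borel" unfolding clip_def[abs_def] by measurable
 have [measurable]: "clip : borel \<rightarrow>\<^sub>M restrict_space borel {0..T}"
  using clip(1) by (intro measurable_restrict_space2) auto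
 have "(%p. (clip (fst p), snd p)) : borel \<Otimes>\<^sub>M M \<rightarrow>\<^sub>M restrict_space borel {0..T} \<Otimes>\<^sub>M M" by measurable
 from measurable_compose[OF this 1] show ?thesis by (simp add: case_prod_beta)
qed

text \<open>Clipping time extends the process to all real times, as a regression function is
  required to be measurable on the whole plane.\<close>

definition vr :: "real => real => real" where
 "vr = (SOME v. (%(t, x). v t x) : bmeas (borel \<Otimes>\<^sub>M borel) & (ALL t x. lo <= v t x & v t x <= hi) &
  (ALL t. ALL ps:bmeas borel. (ALL x. abs (ps x) <= (1::real)) -->
  EE (%om. v t (Xc (clip t) om) * ps (Xc (clip t) om)) = EE (%om. l (Yl om) * ps (Xc (clip t) om))))"

lemma vr: "(%(t, x). vr t x) : bmeas (borel \<Otimes>\<^sub>M borel) & (ALL t x. lo <= vr t x & vr t x <= hi) &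
  (ALL t. ALL ps:bmeas borel. (ALL x. abs (ps x) <= (1::real)) -->
  EE (%om. vr t (Xc (clip t) om) * ps (Xc (clip t) om)) = EE (%om. l (Yl om) * ps (Xc (clip t) om)))"
proof -
 have Y[measurable]: "Yl : M \<rightarrow>\<^sub>M UC" by simp
 have "(%om. l (Yl om)) : bmeas M" by (rule measurable_compose[OF Y]) simp
 from jointly_measurable_regression[OF joint_Xc this lo_le le_hi] show ?thesis
  unfolding vr_def by (rule someI_ex)
qed

lemma measurable_vr [measurable]: "(%(t, x). vr t x) : bmeas (borel \<Otimes>\<^sub>M borel)" using vr by blast

lemma vr_bounds: "lo <= vr t x" "vr t x <= hi" "abs (vr t x) <= hi" "(vr t x)^2 <= hi^2"
proof -
 show 1: "lo <= vr t x" "vr t x <= hi" using vr by blast+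
 then show 2: "abs (vr t x) <= hi" using lo_pos by linarith
 then show "(vr t x)^2 <= hi^2" by (rule power2_le_iff_abs_le[THEN iffD2, rotated]) (use hi_pos in simp)
qed

lemma vr_at [measurable]: "vr t : bmeas borel"
 using measurable_compose[OF measurable_Pair1'[of t borel borel] measurable_vr] by simp

lemma joint_vr [measurable]: "(%(t, om). vr t (Xc (clip t) om)) : bmeas (borel \<Otimes>\<^sub>M M)"
proof -
 have "(%p. (fst p, Xc (clip (fst p)) (snd p))) : borel \<Otimes>\<^sub>M M \<rightarrow>\<^sub>M borel \<Otimes>\<^sub>M borel"
  using joint_Xc by (simp add: case_prod_beta)
 from measurable_compose[OF this measurable_vr] show ?thesis by (simp add: case_prod_beta)
qed

lemma vr_orth:
 assumes "ps : bmeas borel" "!!x. abs (ps x) <= B"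
 shows "EE (%om. vr t (Xc (clip t) om) * ps (Xc (clip t) om)) = EE (%om. l (Yl om) * ps (Xc (clip t) om))"
proof -
 have B: "0 < abs B + 1" by simp
 have [measurable]: "ps : bmeas borel" by fact
 have "abs (ps x) <= abs B + 1" for x using assms(2)[of x] by linarith
 then have "\<bar>ps x / (\<bar>B\<bar> + 1)\<bar> <= 1" for x using B by (simp add: abs_divide)
 then have "EE (%om. vr t (Xc (clip t) om) * (ps (Xc (clip t) om) / (abs B + 1))) =
  EE (%om. l (Yl om) * (ps (Xc (clip t) om) / (abs B + 1)))"
  using vr by (elim conjE allE[of _ t] ballE[of _ _ "%x. ps x / (abs B + 1)"]) auto
 then show ?thesis using B by (simp only: times_divide_eq_right Bochner_Integration.integral_divide_zero divide_cancel_right) auto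
qed

definition Vt :: "real => real" where "Vt t = EE (%om. (vr t (Xc (clip t) om))^2)"

lemma Vt_bounds: "0 <= Vt t" "Vt t <= hi^2"
proof -
 show "0 <= Vt t" unfolding Vt_def by (rule integral_nonneg_AE) simp
 have "Vt t <= EE (%om. hi^2)" unfolding Vt_def
  using vr_bounds(4) by (intro integral_mono integrable_const_bound[where B = "hi^2"]) auto
 then show "Vt t <= hi^2" by (simp add: prob_space)
qed

lemma measurable_Vt [measurable]: "Vt : bmeas borel"
 unfolding Vt_def[abs_def] by (rule borel_measurable_lebesgue_integral) (use joint_vr in \<open>simp add: case_prod_beta\<close>)

abbreviation verr :: "(real \<times> real => real) => real => real" where
 "verr w t \<equiv> EE (%om. (vr t (Xc (clip t) om) - w (t, Xc (clip t) om))^2 )"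

lemma integrable_window: "f : bmeas borel ==> (!!t. abs (f t) <= B) ==> integrable lborel (%t. indicator {0..<T} t * f t :: real)"
proof -
 assume f[measurable]: "f : bmeas borel" and b: "!!t. abs (f t) <= B"
 have "integrable lborel (%t. indicator {0..<T} t * B :: real)" using T_pos by (intro integrable_mult_left integrable_real_indicator) (auto simp: emeasure_lborel_Ico)
 then show ?thesis
 proof (rule Bochner_Integration.integrable_bound)
  have "B >= 0" using b[of 0] by linarith
  then show "AE t in lborel. norm (indicator {0..<T} t * f t) <= norm (indicator {0..<T} t * B)"
  using b by (auto simp: abs_mult indicator_def)
 qed simp
qed

definition mblk :: "nat => int => real => real ^ 'd" where
 "mblk a j t = (\<chi> i. EE (%om. tent a j (Xc t om) * indicator {i} (Yl om)))"

lemma nonneg_mblk: "nonneg_vec (mblk a j t)"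
 unfolding nonneg_vec_def mblk_def using tent_bounds by (auto intro!: integral_nonneg_AE)

lemma blk_LIMSEQ:
 assumes t: "t : {0..T}"
 shows "(%n. blk a j (s n) (kk (s n) t)) ---> mblk a j t"
proof (rule vec_tendstoI)
 fix i
 have "(%n. EP (s n) (%om. tent a j (Xd (s n) (kk (s n) t) om) * indicator {i} (snd om)))
  ---> EE (%om. tent a j (Xc t om) * indicator {i} (Yl om))"
 proof (rule weak_convergence[where ph = "%x i'. tent a j x * indicator {i} i'" and B = 1 and L = "1 / h a", OF _ _ t])
  show "norm (tent a j x * indicator {i} i') <= 1" for x i' using tent_bounds[of a j x] by (simp add: indicator_def)
  show "norm (tent a j x * indicator {i} i' - tent a j y * indicator {i} i') <= 1 / h a * abs (x - y)" for x y i'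
  using tent_lipschitz[of a j x y] h_pos[of a] by (simp add: indicator_def)
 qed
 then show "(%n. blk a j (s n) (kk (s n) t) $ i) ---> mblk a j t $ i"
  by (simp add: blk_E[OF kk_le[OF t]] mblk_def)
qed

text \<open>Cauchy--Schwarz: each block of the mollified law carries at most its share of \<open>E[v^2]\<close>.\<close>

lemma Th_mblk_le:
 assumes t: "t : {0..T}"
 shows "Th (mblk a j t) <= EE (%om. (vr t (Xc t om))^2 * tent a j (Xc t om))"
proof -
 define ps where "ps = tent a j"
 have psm[measurable]: "ps : bmeas borel" unfolding ps_def tent_def[abs_def] hat_def by measurable
 have ps: "0 <= ps x" "ps x <= 1" "abs (ps x) <= 1" for x using tent_bounds[of a j x] by (auto simp: ps_def)
 define V where "V om = vr t (Xc t om)" for om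
 define U where "U om = ps (Xc t om)" for om
 have Y[measurable]: "Yl : M \<rightarrow>\<^sub>M UC" by simp
 have Vm[measurable]: "V : bmeas M" and Um[measurable]: "U : bmeas M" unfolding V_def[abs_def] U_def[abs_def] by measurable
 have Yi[measurable]: "(%om. indicator {i} (Yl om) :: real) : bmeas M" for i
  by (rule measurable_compose[OF Y]) simp
 have U: "0 <= U om" "U om <= 1" "abs (U om) <= 1" for om using ps by (auto simp: U_def)
 have V: "abs (V om) <= hi" "(V om)^2 <= hi^2" for om using vr_bounds by (auto simp: V_def)
 have iU: "integrable M U" using U by (intro integrable_const_bound[where B = 1]) auto
 have iVU: "integrable M (%om. V om * U om)"
  using U V hi_pos mult_mono[OF V(1) U(3)] by (intro integrable_const_bound[where B = "hi * 1"]) (auto simp: abs_mult)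
 have iV2: "integrable M (%om. (V om)^2 * U om)"
  using U mult_mono[OF V(2) U(2)] by (intro integrable_const_bound[where B = "hi^2 * 1"]) (auto simp: abs_mult)
 have iUi: "integrable M (%om. U om * indicator {i} (Yl om))" for i
  using U by (intro integrable_const_bound[where B = 1]) (auto simp: indicator_def)
 have m: "mblk a j t $ i = EE (%om. U om * indicator {i} (Yl om))" for i
  by (simp add: mblk_def U_def ps_def)
 have "tot (mblk a j t) = EE (%om. SUM i:UNIV. U om * indicator {i} (Yl om))"
  unfolding tot_def m using iUi by (subst Bochner_Integration.integral_sum) auto
 also have "(%om. SUM i:UNIV. U om * indicator {i} (Yl om)) = U"
  by (simp add: fun_eq_iff indicator_def if_distrib cong: if_cong)
 finally have tot: "tot (mblk a j t) = EE U" .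
 have "wtot l (mblk a j t) = EE (%om. SUM i:UNIV. l i * (U om * indicator {i} (Yl om)))"
  unfolding wtot_def m using iUi by (subst Bochner_Integration.integral_sum) auto
 also have "(%om. SUM i:UNIV. l i * (U om * indicator {i} (Yl om))) = (%om. l (Yl om) * U om)"
 proof
  fix om
  have "(SUM i:UNIV. l i * (U om * indicator {i} (Yl om))) = (SUM i:UNIV. if i = Yl om then l (Yl om) * U om else 0)"
  by (intro sum.cong refl) auto
  then show "(SUM i:UNIV. l i * (U om * indicator {i} (Yl om))) = l (Yl om) * U om" by simp
 qed
 also have "EE (%om. l (Yl om) * U om) = EE (%om. V om * U om)"
  using vr_orth[OF psm ps(3), of t] clip(2)[OF t] by (simp add: V_def U_def)
 finally have wtot: "wtot l (mblk a j t) = EE (%om. V om * U om)" .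
 \<comment> \<open>The optimal constant in the variational form of Cauchy-Schwarz. If
   \<open>EE U = 0\<close>, division by zero makes both \<open>c\<close> and \<open>Th\<close>
   vanish.\<close>
 define c where "c = EE (%om. V om * U om) / EE U"
 have "0 <= EE (%om. (V om - c)^2 * U om)" using U by (intro integral_nonneg_AE) auto
 also have "(%om. (V om - c)^2 * U om) = (%om. (V om)^2 * U om - (2 * c) * (V om * U om) + c^2 * U om)"
  by (simp add: fun_eq_iff power2_eq_square algebra_simps)
 also have "EE ... = EE (%om. (V om)^2 * U om) - 2 * c * EE (%om. V om * U om) + c^2 * EE U"
  using iU iVU iV2 by simp
 finally have "2 * c * EE (%om. V om * U om) - c^2 * EE U <= EE (%om. (V om)^2 * U om)" by simp
 moreover have "2 * c * EE (%om. V om * U om) - c^2 * EE U = Th (mblk a j t)"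
  unfolding Th_def tot wtot c_def by (cases "EE U = 0") (auto simp: field_simps power2_eq_square)
 ultimately show ?thesis by (simp add: V_def U_def ps_def)
qed

text \<open>The tents add up to at most one, so block averages never overestimate the energy of the
  limit.\<close>

lemma sum_Th_mblk_le:
 assumes t: "t : {0..T}" and A: "finite A"
 shows "(SUM j:A. Th (mblk a j t)) <= Vt t"
proof -
 have V[measurable]: "(%om. vr t (Xc t om)) : bmeas M" by measurable
 have psm[measurable]: "tent a j : bmeas borel" for j unfolding tent_def[abs_def] hat_def by measurable
 have i: "integrable M (%om. (vr t (Xc t om))^2 * tent a j (Xc t om))" for j
 proof (rule integrable_const_bound[where B = "hi^2 * 1"])
  show "AE om in M. norm ((vr t (Xc t om))^2 * tent a j (Xc t om)) <= hi^2 * 1"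
  using mult_mono[OF vr_bounds(4) tent_bounds(2)] tent_bounds(1) by (auto simp: abs_mult)
 qed simp
 have i2: "integrable M (%om. (vr t (Xc t om))^2)"
  using vr_bounds(4) by (intro integrable_const_bound[where B = "hi^2"]) auto
 have "(SUM j:A. Th (mblk a j t)) <= (SUM j:A. EE (%om. (vr t (Xc t om))^2 * tent a j (Xc t om)))"
  by (intro sum_mono Th_mblk_le t)
 also have "... = EE (%om. SUM j:A. (vr t (Xc t om))^2 * tent a j (Xc t om))"
  using i by (subst Bochner_Integration.integral_sum) auto
 also have "... <= EE (%om. (vr t (Xc t om))^2)"
 proof (rule integral_mono)
  show "(SUM j:A. (vr t (Xc t om))^2 * tent a j (Xc t om)) <= (vr t (Xc t om))^2" for om
  using mult_left_mono[OF hat_sum_le[OF A, of "Xc t om / h a"], of "(vr t (Xc t om))^2"]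
  by (simp add: sum_distrib_left tent_def)
 qed (use i i2 in auto)
 finally show ?thesis using clip(2)[OF t] by (simp add: Vt_def)
qed


text \<open>The one-sided bound that convergence in law alone does not give. Discrete energy is
  compared with block energy, the block energies converge, and their limits lie below the energy of
  \<open>vr\<close>. Early times, distant positions, mollification and convergence each cost at most
  \<open>eps / 4\<close>.\<close>

theorem energy_limit:
 assumes eps: "0 < eps"
 shows "\<forall>\<^sub>F n in sequentially. (SUM k<4 ^ s n. ta (s n) * (SUM x:win (s n). Th (P (s n) k x))) <=
  (LINT t|lborel. indicator {0..<T} t * Vt t) + eps"
proof -
 define dl where "dl = eps / 4"
 have dl: "0 < dl" using eps by (simp add: dl_def)
 have small: "EX m. c * (1 / b) ^ m <= dl" if "1 < b" for c b :: real
 proof -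
  have "(%m. c * (1 / b) ^ m) ---> c * 0" using that by (intro tendsto_intros LIMSEQ_power_zero) auto
  then have "eventually (%m. c * (1 / b) ^ m < dl) sequentially" using dl by (intro order_tendstoD) simp_all
  then show ?thesis by (auto simp: eventually_sequentially intro: less_imp_le)
 qed
 \<comment> \<open>The order of choices matters: the cutoffs \<open>e\<close> and
   \<open>\<rho>\<close> first, because the mollification constant \<open>K\<close> grows with them,
   then \<open>a\<close>, and the level last.\<close>
 obtain e where e: "hi^2 * T * (1 / 4) ^ e <= dl" using small[of 4 "hi^2 * T"] by auto
 define eps' where "eps' = dl / (hi^2 * T)"
 have eps': "0 < eps'" using dl hi_pos T_pos by (simp add: eps'_def)
 obtain R where R: "!!n k. k <= 4 ^ n ==> measure_pmf.prob (plaw n) {om. R < abs (Xd n k om)} <= eps'"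
  using tight_X[OF eps'] by blast
 have Tr: "0 < sqrt (T / r)" using T_pos r_pos by simp
 obtain \<rho> :: nat where \<rho>0: "R / sqrt (T / r) < \<rho>" using reals_Archimedean2 by blast
 then have \<rho>: "R <= real \<rho> * sqrt (T / r)" using Tr by (simp add: divide_less_eq)
 define K where "K = KTh * 4 * T * sqrt (2 * (real \<rho> + 1) * C0 * 2 ^ e)"
 obtain a where a: "K * (1 / 2) ^ a <= dl" using small[of 2 K] by auto
 define J where "J = int (\<rho> * 2 ^ a)"
 define S where "S t = (SUM j=-J..J. Th (mblk a j t))" for t
 define f where "f n k = (SUM j=-J..J. Th (blk a j n k))" for n k
 define I :: "real => real" where "I = indicator {0..<T}"
 have f0: "0 <= f n k" for n k unfolding f_def by (intro sum_nonneg Th_nonneg nonneg_blk)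
 have fb: "f n k <= hi^2" if "k <= 4 ^ n" for n k unfolding f_def by (rule sum_Th_blk_le[OF that]) simp
 have gI: "integrable lborel (%t. I t * f n (kk n t))" for n unfolding I_def by (rule step_integral(1))
 have gm[measurable]: "(%t. I t * f n (kk n t)) : bmeas lborel" for n using gI by auto
 have lim: "(%n. I t * f (s n) (kk (s n) t)) ---> I t * S t" for t
 proof (cases "t : {0..<T}")
  case True
  then have t: "t : {0..T}" by auto
  have "(%n. f (s n) (kk (s n) t)) ---> S t"
  unfolding f_def S_def by (intro tendsto_sum Th_tendsto nonneg_blk nonneg_mblk blk_LIMSEQ[OF t])
  then show ?thesis by (intro tendsto_mult tendsto_const)
 next
  case False
  then show ?thesis by (simp add: I_def)
 qed
 have Sm[measurable]: "(%t. I t * S t) : bmeas lborel"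
  by (rule borel_measurable_LIMSEQ_real[OF lim gm])
 have dom: "AE t in lborel. norm (I t * f (s n) (kk (s n) t)) <= I t * hi^2" for n
 proof (rule AE_I2)
  fix t
  show "norm (I t * f (s n) (kk (s n) t)) <= I t * hi^2"
  proof (cases "t : {0..<T}")
  case True
  then show ?thesis using fb[OF kk_le[of t "s n"]] f0[of "s n"] by (simp add: I_def)
  qed (simp add: I_def)
 qed
 have domI: "integrable lborel (%t. I t * hi^2)" unfolding I_def by (rule integrable_window[where B = "hi^2"]) auto
 have limE: "AE t in lborel. (%n. I t * f (s n) (kk (s n) t)) ---> I t * S t" using lim by (intro AE_I2)
 have SI: "integrable lborel (%t. I t * S t)"
  by (rule integrable_dominated_convergence[OF Sm gm domI limE dom])
 have conv: "(%n. LINT t|lborel. I t * f (s n) (kk (s n) t)) ---> (LINT t|lborel. I t * S t)"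
  by (rule integral_dominated_convergence[OF Sm gm domI limE dom])
 have SV: "(LINT t|lborel. I t * S t) <= (LINT t|lborel. I t * Vt t)"
 proof (rule integral_mono[OF SI])
  show "integrable lborel (%t. I t * Vt t)" unfolding I_def using Vt_bounds by (intro integrable_window[where B = "hi^2"]) auto
  show "I t * S t <= I t * Vt t" for t
  using sum_Th_mblk_le[of t "{-J..J}" a] by (auto simp: I_def S_def indicator_def)
 qed
 have ev: "\<forall>\<^sub>F n in sequentially. (LINT t|lborel. I t * f (s n) (kk (s n) t)) < (LINT t|lborel. I t * S t) + dl"
  using conv dl by (intro order_tendstoD(2)) auto
 have main: "(SUM k<4 ^ N. ta N * (SUM x:win N. Th (P N k x))) <= (LINT t|lborel. I t * f N (kk N t)) + 3 * dl"
  if N: "a <= N" "e <= N" for N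
 proof -
  define E where "E k = (SUM x:win N. Th (P N k x))" for k
  define b where "b = J * 2 ^ (N - a)"
  define A where "A k = (SUM x:{x : win N. abs x <= b}. Th (P N k x))" for k
  define B where "B k = (SUM x:{x : win N. b < abs x}. Th (P N k x))" for k
  \<comment> \<open>The steps before \<open>m\<close> cover the times below
    \<open>T / 4 ^ e\<close>, where no gradient bound is used.\<close>
  define m :: nat where "m = 4 ^ (N - e)"
  have mN: "m <= 4 ^ N" unfolding m_def by (intro power_increasing) auto
  have ta0: "0 <= ta N" using ta_pos[of N] by simp
  have E: "E k <= hi^2" if "k <= 4 ^ N" for k
  using sum_Th_le[OF that order_refl] tot_win[OF that] by (simp only: E_def mult_1_right)
  have EAB: "E k = A k + B k" for k
  proof -
  have w: "win N = {x : win N. abs x <= b} Un {x : win N. b < abs x}" by auto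
  have fin: "finite {x : win N. Q x}" for Q by (rule finite_subset[of _ "win N"]) auto
  show ?thesis unfolding E_def A_def B_def by (subst w, rule sum.union_disjoint[OF fin fin]) auto
  qed
  have hb: "real_of_int b * h N = real \<rho> * sqrt (T / r)"
  proof -
  have "(2::real) ^ N = 2 ^ a * 2 ^ (N - a)" using N by (simp flip: power_add)
  then show ?thesis by (simp add: b_def J_def h_def)
  qed
  have B: "B k <= hi^2 * eps'" if k: "k <= 4 ^ N" for k
  proof -
  have "B k <= hi^2 * (SUM x:{x : win N. b < abs x}. tot (P N k x))"
  unfolding B_def by (rule sum_Th_le[OF k]) auto
  also have "(SUM x:{x : win N. b < abs x}. tot (P N k x)) = measure_pmf.prob (plaw N) {om. b < abs (fst om k)}"
  by (rule tail_tot[OF k])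
  also have "... <= measure_pmf.prob (plaw N) {om. R < abs (Xd N k om)}"
  proof (rule measure_pmf.finite_measure_mono)
  show "{om. b < abs (fst om k)} <= {om. R < abs (Xd N k om)}"
  proof safe
  fix x :: "nat => int" and i :: 'd assume "b < abs (fst (x, i) k)"
  then have "real_of_int b < real_of_int \<bar>x k\<bar>" by (simp only: of_int_less_iff fst_conv)
  then have "real_of_int b * h N < real_of_int \<bar>x k\<bar> * h N" using h_pos[of N] by simp
  then show "R < abs (Xd N k (x, i))" using \<rho> hb h_pos[of N] by (simp add: Xd_def abs_mult mult.commute)
  qed
  qed simp
  also have "... <= eps'" by (rule R[OF k])
  finally show ?thesis by (simp add: mult_left_mono)
  qed
  have sp: "sum g {..<4 ^ N} = sum g {..<m} + sum g {m..<4 ^ N}" for g :: "nat => real"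
  using sum.atLeastLessThan_concat[of 0 m "4 ^ N" g] mN by (simp add: atLeast0LessThan)
  have T4: "ta N * real (4 ^ N) = T" by (simp add: ta_def)
  have s1: "(SUM k<m. ta N * E k) <= dl"
  proof -
  have "(SUM k<m. ta N * E k) <= (SUM k<m. ta N * hi^2)"
  using mN ta0 by (intro sum_mono mult_left_mono E) auto
  also have "... = hi^2 * T * (1 / 4) ^ e"
  proof -
  have "(4::real) ^ N = 4 ^ e * 4 ^ (N - e)" using N by (simp flip: power_add)
  then show ?thesis by (simp add: m_def ta_def power_divide)
  qed
  finally show ?thesis using e by linarith
  qed
  have s2: "(SUM k=m..<4 ^ N. ta N * B k) <= dl"
  proof -
  have "(SUM k=m..<4 ^ N. ta N * B k) <= (SUM k=m..<4 ^ N. ta N * (hi^2 * eps'))"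
  using ta0 by (intro sum_mono mult_left_mono B) auto
  also have "... = real (4 ^ N - m) * (ta N * (hi^2 * eps'))" by simp
  also have "... <= real (4 ^ N) * (ta N * (hi^2 * eps'))" using ta0 eps' by (intro mult_right_mono of_nat_mono) auto
  also have "... = T * (hi^2 * eps')" using T4 by (metis mult.assoc mult.commute)
  also have "... = dl" using T_pos hi_pos by (simp add: eps'_def)
  finally show ?thesis .
  qed
  have "(SUM k=m..<4 ^ N. ta N * A k) <= (SUM k=m..<4 ^ N. ta N * f N k) + K / 2 ^ a"
  unfolding A_def b_def m_def f_def J_def K_def blk_def by (rule mollified_energy[OF N])
  also have "K / 2 ^ a <= dl" using a by (simp add: power_divide)
  also have "(SUM k=m..<4 ^ N. ta N * f N k) <= (SUM k<4 ^ N. ta N * f N k)"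
  using f0 ta0 by (intro sum_mono2) auto
  also have "... = (LINT t|lborel. I t * f N (kk N t))" unfolding I_def by (rule step_integral(2)[symmetric])
  finally have s3: "(SUM k=m..<4 ^ N. ta N * A k) <= (LINT t|lborel. I t * f N (kk N t)) + dl" by simp
  have "(SUM k<4 ^ N. ta N * E k) = (SUM k<m. ta N * E k) + ((SUM k=m..<4 ^ N. ta N * A k) + (SUM k=m..<4 ^ N. ta N * B k))"
  unfolding sp EAB distrib_left sum.distrib by simp
  then show ?thesis using s1 s2 s3 unfolding E_def by linarith
 qed
 show ?thesis
  using ev eventually_ge_at_top[of "max a e"]
 proof eventually_elim
  case (elim n)
  have "(SUM k<4 ^ s n. ta (s n) * (SUM x:win (s n). Th (P (s n) k x))) <= (LINT t|lborel. I t * f (s n) (kk (s n) t)) + 3 * dl"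
  using elim(2) s_ge[of n] by (intro main) auto
  moreover have "eps = 4 * dl" by (simp add: dl_def)
  ultimately show ?case using elim(1) SV unfolding I_def by linarith
 qed
qed

lemma E_square_vr:
 fixes u :: "real => real"
 assumes [measurable]: "u : bmeas borel" and u: "!!x. abs (u x) <= hi"
 shows "EE (%om. (vr t (Xc (clip t) om) - u (Xc (clip t) om))^2) =
  Vt t + EE (%om. (u (Xc (clip t) om))^2 - 2 * (l (Yl om) * u (Xc (clip t) om)))"
proof -
 define V where "V om = vr t (Xc (clip t) om)" for om
 define U where "U om = u (Xc (clip t) om)" for om
 have Y[measurable]: "Yl : M \<rightarrow>\<^sub>M UC" by simp
 have lY[measurable]: "(%om. l (Yl om)) : bmeas M" by (rule measurable_compose[OF Y]) simp
 have [measurable]: "V : bmeas M" "U : bmeas M" unfolding V_def[abs_def] U_def[abs_def] by measurable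
 have b: "abs (V om) <= hi" "abs (U om) <= hi" "abs (l (Yl om)) <= hi" for om
  using vr_bounds u l_pos[of "Yl om"] le_hi[of "Yl om"] by (auto simp: V_def U_def)
 have i: "integrable M (%om. G om * H om)"
  if [measurable]: "G : bmeas M" "H : bmeas M" and "!!om. abs (G om) <= hi" "!!om. abs (H om) <= hi" for G H :: "'b => real"
  using mult_mono[OF that(3,4)] hi_pos by (intro integrable_const_bound[where B = "hi * hi"]) (auto simp: abs_mult)
 have iVV: "integrable M (%om. V om * V om)" and iVU: "integrable M (%om. V om * U om)"
  and iUU: "integrable M (%om. U om * U om)" and ilU: "integrable M (%om. l (Yl om) * U om)"
  using b by (intro i; simp)+
 have o: "EE (%om. V om * U om) = EE (%om. l (Yl om) * U om)"
  unfolding V_def U_def by (rule vr_orth[OF assms])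
 have "EE (%om. (V om - U om)^2) = EE (%om. V om * V om - 2 * (V om * U om) + U om * U om)"
  by (intro Bochner_Integration.integral_cong) (auto simp: power2_eq_square algebra_simps)
 also have "... = EE (%om. V om * V om) - 2 * EE (%om. l (Yl om) * U om) + EE (%om. U om * U om)"
  using iVV iVU iUU o by simp
 also have "... = Vt t + EE (%om. (U om)^2 - 2 * (l (Yl om) * U om))"
  using iUU ilU by (simp add: Vt_def V_def power2_eq_square)
 finally show ?thesis by (simp add: V_def U_def)
qed

text \<open>After expanding the square around a fixed Lipschitz \<open>w\<close>, the energy is
  bounded above in the limit and the remaining terms converge. So the distance from the discrete
  regression functions to \<open>w\<close> is asymptotically at most the distance from
  \<open>vr\<close> to \<open>w\<close>, however irregular \<open>vr\<close> may be.\<close>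

theorem regression_limit:
 fixes w :: "real \<times> real => real"
 assumes L0: "0 <= L" and L: "!!p p'. abs (w p - w p') <= L * dist p p'" and w: "!!p. lo <= w p" "!!p. w p <= hi"
  and eps: "0 < eps"
 shows "\<forall>\<^sub>F n in sequentially.
  (SUM k<4 ^ s n. ta (s n) * EP (s n) (%om. (vd (s n) k (fst om k) - w (ta (s n) * real k, Xd (s n) k om))^2)) <=
  (LINT t|lborel. indicator {0..<T} t * verr w t) + eps"
proof -
 \<comment> \<open>What remains of the square once the energy is split off. It must be Lipschitz in
   time too, because \<open>w\<close> is evaluated at grid times while the limit has the time
   \<open>t\<close>.\<close>
 define ph where "ph t x i = (w (t, x))^2 - 2 * (l i * w (t, x))" for t x i
 define f where "f n k = EP n (%om. ph (ta n * real k) (Xd n k om) (snd om))" for n k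
 define G where "G t = EE (%om. ph t (Xc (clip t) om) (Yl om))" for t
 define I :: "real => real" where "I = indicator {0..<T}"
 have wb: "abs (w p) <= hi" for p using w[of p] lo_pos by linarith
 have lb: "abs (l i) <= hi" for i using l_pos[of i] le_hi[of i] by simp
 have w2: "(w p)^2 <= hi^2" for p using wb[of p] hi_pos by (simp add: power2_le_iff_abs_le)
 have phb: "abs (ph t x i) <= 3 * hi^2" for t x i
 proof -
  have "abs (l i * w (t, x)) <= hi * hi" unfolding abs_mult by (intro mult_mono lb wb) (use hi_pos in auto)
  then show ?thesis using w2[of "(t, x)"] zero_le_power2[of "w (t, x)"] power2_eq_square[of hi]
  unfolding ph_def abs_le_iff by linarith
 qed
 have phL: "abs (ph t x i - ph t' x' i) <= 4 * hi * L * dist (t, x) (t', x')" for t x t' x' i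
 proof -
  have "ph t x i - ph t' x' i = (w (t, x) - w (t', x')) * (w (t, x) + w (t', x') - 2 * l i)"
  by (simp add: ph_def power2_eq_square algebra_simps)
  moreover have "abs (w (t, x) + w (t', x') - 2 * l i) <= 4 * hi"
  using wb[of "(t, x)"] wb[of "(t', x')"] lb[of i] by linarith
  ultimately have "abs (ph t x i - ph t' x' i) <= (L * dist (t, x) (t', x')) * (4 * hi)"
  unfolding abs_mult by (simp only: abs_mult) (intro mult_mono L, use L0 in auto)
  then show ?thesis by (simp add: mult_ac)
 qed
 have phm: "(%x. ph t x i) : bmeas borel" for t i
 proof (rule borel_measurable_continuous_onI)
  have "(4 * hi * L)-lipschitz_on UNIV (%x. ph t x i)"
  using phL[of t _ i t] L0 hi_pos by (auto simp: lipschitz_on_def dist_Pair_Pair dist_norm)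
  then show "continuous_on UNIV (%x. ph t x i)" by (rule lipschitz_on_continuous_on)
 qed
 have lim: "(%n. I t * f (s n) (kk (s n) t)) ---> I t * G t" for t
 proof (cases "t : {0..<T}")
  case True
  then have t: "t : {0..T}" by auto
  define F where "F n = EP (s n) (%om. ph t (Xd (s n) (kk (s n) t) om) (snd om))" for n
  have F: "F ---> EE (%om. ph t (Xc t om) (Yl om))"
  unfolding F_def
  by (rule weak_convergence[where B = "3 * hi^2" and L = "4 * hi * L", OF _ _ t])
  (use phb phL[of t _ _ t] in \<open>auto simp: dist_Pair_Pair dist_norm\<close>)
  have d: "norm (f (s n) (kk (s n) t) - F n) <= 4 * hi * L * abs (qfloor T (s n) t - t)" for n
  proof -
  define A where "A om = ph (qfloor T (s n) t) (Xd (s n) (kk (s n) t) om) (snd om)" for om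
  define B where "B om = ph t (Xd (s n) (kk (s n) t) om) (snd om)" for om
  have "f (s n) (kk (s n) t) - F n = EP (s n) (%om. A om - B om)"
  unfolding f_def F_def ta_kk A_def[symmetric] B_def[symmetric] by (subst Bochner_Integration.integral_diff) auto
  also have "norm ... <= EP (s n) (%om. norm (A om - B om))" by (rule integral_norm_bound)
  also have "... <= EP (s n) (%om. 4 * hi * L * abs (qfloor T (s n) t - t))"
  proof (rule integral_mono)
  show "norm (A om - B om) <= 4 * hi * L * abs (qfloor T (s n) t - t)" for om
  using phL[of "qfloor T (s n) t" "Xd (s n) (kk (s n) t) om" "snd om" t "Xd (s n) (kk (s n) t) om"]
  by (simp add: A_def B_def dist_Pair_Pair dist_norm)
  qed auto
  finally show ?thesis by simp
  qed
  have z: "(%n. 4 * hi * L * abs (qfloor T (s n) t - t)) ---> 4 * hi * L * abs (t - t)"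
  by (intro tendsto_intros qfloor_s_LIMSEQ) (use t in auto)
  then have z: "(%n. 4 * hi * L * abs (qfloor T (s n) t - t)) ---> 0" by simp
  have "(%n. f (s n) (kk (s n) t) - F n) ---> 0"
  by (rule Lim_null_comparison[OF always_eventually z]) (use d in blast)
  from tendsto_add[OF this F] have "(%n. f (s n) (kk (s n) t)) ---> G t"
  using clip(2)[OF t] by (simp add: G_def)
  then show ?thesis by (intro tendsto_mult tendsto_const)
 next
  case False
  then show ?thesis by (simp add: I_def)
 qed
 have gI: "integrable lborel (%t. I t * f n (kk n t))" for n unfolding I_def by (rule step_integral(1))
 have gm[measurable]: "(%t. I t * f n (kk n t)) : bmeas lborel" for n using gI by auto
 have Gm[measurable]: "(%t. I t * G t) : bmeas lborel"
  by (rule borel_measurable_LIMSEQ_real[OF lim gm])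
 have fb: "abs (f n k) <= 3 * hi^2" for n k
 proof -
  have "abs (f n k) <= EP n (%om. abs (ph (ta n * real k) (Xd n k om) (snd om)))" unfolding f_def by (rule integral_abs_bound)
  also have "... <= EP n (%om. 3 * hi^2)" by (intro integral_mono phb) auto
  finally show ?thesis by simp
 qed
 have dom: "AE t in lborel. norm (I t * f (s n) (kk (s n) t)) <= I t * (3 * hi^2)" for n
  using fb by (intro AE_I2) (simp add: I_def indicator_def)
 have domI: "integrable lborel (%t. I t * (3 * hi^2))" unfolding I_def by (rule integrable_window[where B = "3 * hi^2"]) auto
 have limE: "AE t in lborel. (%n. I t * f (s n) (kk (s n) t)) ---> I t * G t" using lim by (intro AE_I2)
 have GI: "integrable lborel (%t. I t * G t)"
  by (rule integrable_dominated_convergence[OF Gm gm domI limE dom])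
 have conv: "(%n. LINT t|lborel. I t * f (s n) (kk (s n) t)) ---> (LINT t|lborel. I t * G t)"
  by (rule integral_dominated_convergence[OF Gm gm domI limE dom])
 have ev: "\<forall>\<^sub>F n in sequentially. (LINT t|lborel. I t * f (s n) (kk (s n) t)) < (LINT t|lborel. I t * G t) + eps / 2"
  using conv eps by (intro order_tendstoD(2)) auto
 have VI: "integrable lborel (%t. I t * Vt t)" unfolding I_def using Vt_bounds by (intro integrable_window[where B = "hi^2"]) auto
 have "I t * verr w t = I t * Vt t + I t * G t" for t
 proof -
  have wm: "(%x. w (t, x)) : bmeas borel"
  proof (rule borel_measurable_continuous_onI)
  have "L-lipschitz_on UNIV (%x. w (t, x))"
  using L[of "(t, _)" "(t, _)"] L0 by (auto simp: lipschitz_on_def dist_Pair_Pair dist_norm)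
  then show "continuous_on UNIV (%x. w (t, x))" by (rule lipschitz_on_continuous_on)
  qed
  show ?thesis unfolding E_square_vr[OF wm wb] G_def ph_def by (rule distrib_left)
 qed
 then have eqI: "(LINT t|lborel. I t * verr w t) =
  (LINT t|lborel. I t * Vt t) + (LINT t|lborel. I t * G t)"
  using VI GI by simp
 have E: "EP n (%om. (vd n k (fst om k) - w (ta n * real k, Xd n k om))^2) = (SUM x:win n. Th (P n k x)) + f n k"
  if k: "k <= 4 ^ n" for n k
 proof -
  have "f n k = EP n (%om. (w (ta n * real k, Xd n k om))^2) - EP n (%om. 2 * (l (snd om) * w (ta n * real k, Xd n k om)))"
  unfolding f_def ph_def by (rule Bochner_Integration.integral_diff) auto
  then show ?thesis
  using E_vd[OF k, of "%x. w (ta n * real k, h n * of_int x)"] by (simp add: Xd_def)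
 qed
 have ev2: "\<forall>\<^sub>F n in sequentially. (SUM k<4 ^ s n. ta (s n) * (SUM x:win (s n). Th (P (s n) k x))) <=
  (LINT t|lborel. indicator {0..<T} t * Vt t) + eps / 2"
  by (rule energy_limit) (use eps in simp)
 show ?thesis
  using ev ev2
 proof eventually_elim
  case (elim n)
  have "(SUM k<4 ^ s n. ta (s n) * EP (s n) (%om. (vd (s n) k (fst om k) - w (ta (s n) * real k, Xd (s n) k om))^2)) =
  (SUM k<4 ^ s n. ta (s n) * (SUM x:win (s n). Th (P (s n) k x))) + (SUM k<4 ^ s n. ta (s n) * f (s n) k)"
  unfolding sum.distrib[symmetric] distrib_left[symmetric] by (intro sum.cong refl arg_cong2[where f = "(*)"] E) auto
  also have "(SUM k<4 ^ s n. ta (s n) * f (s n) k) = (LINT t|lborel. I t * f (s n) (kk (s n) t))"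
  unfolding I_def by (rule step_integral(2)[symmetric])
  finally show ?case using elim eqI unfolding I_def by linarith
 qed
qed

end

section \<open>The stochastic integral\<close>

text \<open>For a coefficient constant on blocks of \<open>B\<close> fine steps, the fine sum up to
  \<open>K\<close> collapses to a coarse elementary integral; stopping at \<open>K\<close> inside a
  block is handled by \<open>min\<close>.\<close>

lemma sum_grid_telescope:
 fixes g W :: "nat => real"
 assumes "0 < B" "K <= m * B"
 shows "(SUM j<K. g (j div B) * (W (Suc j) - W j)) = (SUM k<m. g k * (W (min (Suc k * B) K) - W (min (k * B) K)))"
 using assms(2)
proof (induction K)
 case (Suc K)
 define d where "d = W (Suc K) - W K"
 have k0: "K div B < m" using Suc.prems assms(1) by (simp add: less_mult_imp_div_less)
 have "g k * (W (min (Suc k * B) (Suc K)) - W (min (k * B) (Suc K))) =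
  g k * (W (min (Suc k * B) K) - W (min (k * B) K)) + (if k = K div B then g k * d else 0)" for k
 proof -
  have 1: "W (min z (Suc K)) = W (min z K) + (if K < z then d else 0)" for z
  by (cases "K < z") (auto simp: min_def d_def le_Suc_eq)
  have 2: "k = K div B \<longleftrightarrow> k * B <= K & K < Suc k * B"
  using assms(1) by (metis div_nat_eqI dividend_less_times_div less_eq_div_iff_mult_less_eq order_refl div_less_iff_less_mult lessI mult.commute)
  have 3: "k * B <= Suc k * B" by simp
  show ?thesis unfolding 1 2 using 3 by (auto simp: algebra_simps not_less simp del: mult_Suc)
 qed
 then have "(SUM k<m. g k * (W (min (Suc k * B) (Suc K)) - W (min (k * B) (Suc K)))) =
  (SUM k<m. g k * (W (min (Suc k * B) K) - W (min (k * B) K))) + g (K div B) * d"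
  using k0 by (simp add: sum.distrib)
 then show ?case using Suc by (simp add: d_def)
qed simp

context volatilities
begin

text \<open>A Lipschitz constant of the map from \<open>a\<close> to \<open>sqrt (c / a)\<close> on
  \<open>{lo..}\<close>, for all \<open>c\<close> between \<open>0\<close> and
  \<open>hi\<close>.\<close>

definition ka :: real where "ka = sqrt hi / (2 * lo * sqrt lo)"

lemma ka_pos: "0 < ka" using lo_pos hi_pos by (simp add: ka_def)

lemma sqrt_quotient_lipschitz:
 assumes a: "lo <= a" and b: "lo <= b" and c: "0 <= c" "c <= hi"
 shows "abs (sqrt (c / a) - sqrt (c / b)) <= ka * abs (a - b)"
proof -
 have p: "0 < a" "0 < b" using a b lo_pos by auto
 then have q: "0 < sqrt a" "0 < sqrt b" by auto
 have "(sqrt b - sqrt a) * (sqrt a + sqrt b) = b - a" using p by (simp add: algebra_simps)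
 moreover have "sqrt a + sqrt b ~= 0" using q by linarith
 ultimately have "sqrt b - sqrt a = (b - a) / (sqrt a + sqrt b)" by (intro eq_divide_imp)
 moreover have "sqrt (c / a) - sqrt (c / b) = sqrt c * (sqrt b - sqrt a) / (sqrt a * sqrt b)"
  using q by (simp add: real_sqrt_divide field_simps)
 ultimately have "sqrt (c / a) - sqrt (c / b) = sqrt c * (b - a) / (sqrt a * sqrt b * (sqrt a + sqrt b))" by simp
 then have "abs (sqrt (c / a) - sqrt (c / b)) = sqrt c * abs (b - a) / (sqrt a * sqrt b * (sqrt a + sqrt b))"
  using q c by (simp add: abs_mult abs_divide)
 also have "... <= sqrt hi * abs (b - a) / (lo * (2 * sqrt lo))"
 proof (rule frac_le)
  have s: "sqrt lo <= sqrt a" "sqrt lo <= sqrt b" "0 < sqrt lo" using a b lo_pos by auto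
  have "sqrt lo * sqrt lo <= sqrt a * sqrt b" using s by (intro mult_mono) auto
  then have "lo <= sqrt a * sqrt b" using lo_pos by simp
  moreover have "2 * sqrt lo <= sqrt a + sqrt b" using s by linarith
  ultimately show "lo * (2 * sqrt lo) <= sqrt a * sqrt b * (sqrt a + sqrt b)"
  by (rule mult_mono) (use s lo_pos q in auto)
  show "sqrt c * abs (b - a) <= sqrt hi * abs (b - a)" using c by (intro mult_right_mono) auto
 qed (use lo_pos hi_pos in auto)
 finally show ?thesis by (simp add: ka_def abs_minus_commute mult_ac)
qed

lemma sqrt_quotient_square:
 assumes a: "lo <= a" "lo <= b" "lo <= c'" and c: "0 <= c" "c <= hi" and d: "abs (a - c') <= dl"
 shows "(sqrt (c / a) - sqrt (c / b))^2 <= 2 * ka^2 * (dl^2 + (b - c')^2)"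
proof -
 have "(sqrt (c / a) - sqrt (c / b))^2 <= (ka * abs (a - b))^2"
  using sqrt_quotient_lipschitz[OF a(1,2) c] by (metis abs_ge_zero power2_abs power_mono)
 also have "... = ka^2 * ((a - c') - (b - c'))^2" by (simp add: power_mult_distrib)
 also have "... <= ka^2 * (2 * ((a - c')^2 + (b - c')^2))"
 proof (rule mult_left_mono)
  have "0 <= ((a - c') + (b - c'))^2" by simp
  then show "((a - c') - (b - c'))^2 <= 2 * ((a - c')^2 + (b - c')^2)"
  unfolding power2_sum power2_diff by argo
 qed simp
 also have "... <= ka^2 * (2 * (dl^2 + (b - c')^2))"
  using d by (intro mult_left_mono add_right_mono) (auto intro: power2_le_iff_abs_le[THEN iffD2])
 finally show ?thesis by (simp only: mult.assoc mult.left_commute)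
qed

end

context approx
begin

text \<open>Coefficients are frozen at the start of each coarse cell. By the isometry the error is
  an \<open>L^2\<close> distance of volatilities, and it splits into the motion of \<open>w\<close>
  along the path within a cell, contributing \<open>b^2\<close> from time and
  \<open>hi / lo * b\<close> from space, and the distance of \<open>w\<close> from the discrete
  regression function.\<close>

lemma discrete_ito:
 fixes w :: "real \<times> real => real"
 assumes L0: "0 <= L" and L: "!!p p'. abs (w p - w p') <= L * dist p p'" and w: "!!p. lo <= w p"
  and N: "m <= N" and K: "K <= 4 ^ N"
 defines "B \<equiv> 4 ^ (N - m)" and "b \<equiv> T / 4 ^ m"
 shows "EP N (%om. ((SUM k<4 ^ m. sqrt (l (snd om) / w (quad T m k, Xd N (k * B) om)) *
  (Wd N (min (Suc k * B) K) om - Wd N (min (k * B) K) om)) - (Xd N K om - Xd N 0 om))^2)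
  <= 2 * ka^2 * (L^2 * (T * (b^2 + hi / lo * b)) +
  (SUM k<4 ^ N. ta N * EP N (%om. (vd N k (fst om k) - w (ta N * real k, Xd N k om))^2)))"
proof -
 define g where "g k om = sqrt (l (snd om) / w (quad T m k, Xd N (k * B) om))" for k om
 define e where "e k = EP N (%om. (vd N k (fst om k) - w (ta N * real k, Xd N k om))^2)" for k
 have B: "0 < B" by (simp add: B_def)
 have b0: "0 <= b" using T_pos by (simp add: b_def)
 have BN: "4 ^ m * B = (4::nat) ^ N" using N by (simp add: B_def flip: power_add)
 have taB: "ta N * real B = b"
 proof -
  have "(4::real) ^ N = 4 ^ m * 4 ^ (N - m)" using N by (simp flip: power_add)
  then show ?thesis by (simp add: ta_def b_def B_def)
 qed
 have q: "quad T m k = ta N * real (k * B)" for k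
 proof -
  have "ta N * real (k * B) = b * real k" by (simp add: taB[symmetric])
  then show ?thesis by (simp add: quad_def b_def)
 qed
 have adg: "adapted_at j (g (j div B))" for j
  unfolding g_def Xd_def adapted_at_def by (auto simp: div_times_less_eq_dividend)
 have e0: "0 <= e k" for k unfolding e_def by simp
 have step: "EP N (%om. (g (j div B) om - sgd N j om)^2) <= 2 * ka^2 * (L^2 * (b^2 + hi / lo * b) + e j)"
  if j: "j <= 4 ^ N" for j
 proof -
  define i where "i = (j div B) * B"
  have i: "i <= j" "j - i <= B" unfolding i_def using B by (auto simp: div_times_less_eq_dividend minus_div_mult_eq_mod less_imp_le)
  have dt: "0 <= ta N * real (j - i)" "ta N * real (j - i) <= b"
  unfolding taB[symmetric] using i ta_pos[of N] by auto
  have dt2: "(ta N * real j - ta N * real i)^2 <= b^2"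
  proof -
  have "ta N * real j - ta N * real i = ta N * real (j - i)" using i by (simp add: of_nat_diff right_diff_distrib)
  then show ?thesis using dt by (simp add: power_mono)
  qed
  define E where "E om = (vd N j (fst om j) - w (ta N * real j, Xd N j om))^2" for om
  define D where "D om = (Xd N j om - Xd N i om)^2" for om
  have pt: "(g (j div B) om - sgd N j om)^2 <= 2 * ka^2 * (L^2 * (b^2 + D om) + E om)" if "om : set_pmf (plaw N)" for om
  proof -
  define dl where "dl = L * dist (ta N * real i, Xd N i om) (ta N * real j, Xd N j om)"
  have "(g (j div B) om - sgd N j om)^2 <= 2 * ka^2 * (dl^2 + E om)"
  unfolding g_def sgd_vd[OF that j] q i_def[symmetric] E_def dl_def
  by (rule sqrt_quotient_square) (use w vd_bounds l_pos le_hi L in \<open>auto intro: less_imp_le\<close>)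
  also have "dl^2 <= L^2 * (b^2 + D om)"
  proof -
  have "dl^2 = L^2 * ((ta N * real j - ta N * real i)^2 + D om)"
  unfolding dl_def power_mult_distrib D_def by (simp add: dist_Pair_Pair dist_real_def power2_commute)
  also have "... <= L^2 * (b^2 + D om)" using dt2 by (intro mult_left_mono add_right_mono) auto
  finally show ?thesis .
  qed
  finally show ?thesis using ka_pos by (simp add: mult_left_mono)
  qed
  have "EP N (%om. (g (j div B) om - sgd N j om)^2) <= EP N (%om. 2 * ka^2 * (L^2 * (b^2 + D om) + E om))"
  by (rule integral_mono_AE) (use pt in \<open>auto simp: AE_measure_pmf_iff\<close>)
  also have "... = 2 * ka^2 * (L^2 * (b^2 + EP N D) + EP N E)" by simp
  also have "... <= 2 * ka^2 * (L^2 * (b^2 + hi / lo * b) + EP N E)"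
  proof (intro mult_left_mono add_right_mono add_left_mono)
  have "EP N D <= hi / lo * (ta N * real (j - i))" unfolding D_def by (rule second_X[OF i(1) j])
  also have "... <= hi / lo * b" using dt hilo by (intro mult_left_mono) auto
  finally show "EP N D <= hi / lo * b" .
  qed auto
  finally show ?thesis unfolding e_def E_def[abs_def] .
 qed
 have "(SUM k<4 ^ m. g k om * (Wd N (min (Suc k * B) K) om - Wd N (min (k * B) K) om)) =
  (SUM j=0..<K. g (j div B) om * (Wd N (Suc j) om - Wd N j om))" for om
  unfolding atLeast0LessThan
  by (rule sum_grid_telescope[OF B, symmetric, of K "4 ^ m" "%k. g k om" "%j. Wd N j om"]) (use K BN in simp)
 then have "EP N (%om. ((SUM k<4 ^ m. g k om * (Wd N (min (Suc k * B) K) om - Wd N (min (k * B) K) om)) - (Xd N K om - Xd N 0 om))^2)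
  = (SUM j=0..<K. ta N * EP N (%om. (g (j div B) om - sgd N j om)^2))"
  by (simp only: isometry_X[OF le0 K adg])
 also have "... <= (SUM j=0..<K. ta N * (2 * ka^2 * (L^2 * (b^2 + hi / lo * b) + e j)))"
  using K ta_pos[of N] by (intro sum_mono mult_left_mono step) auto
 also have "... <= (SUM j<4 ^ N. ta N * (2 * ka^2 * (L^2 * (b^2 + hi / lo * b) + e j)))"
 proof (rule sum_mono2)
  have "0 <= b^2 + hi / lo * b" using b0 hilo(1) by (intro add_nonneg_nonneg mult_nonneg_nonneg) auto
  then have "0 <= L^2 * (b^2 + hi / lo * b) + e j" for j
  by (rule add_nonneg_nonneg[OF mult_nonneg_nonneg[OF zero_le_power2] e0])
  then show "0 <= ta N * (2 * ka^2 * (L^2 * (b^2 + hi / lo * b) + e j))" for j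
  using ta_pos[of N] by (intro mult_nonneg_nonneg) auto
 qed (use K in auto)
 also have "... = (SUM j<4 ^ N. 2 * ka^2 * L^2 * (b^2 + hi / lo * b) * ta N + 2 * ka^2 * (ta N * e j))"
  by (intro sum.cong refl) (simp only: distrib_left mult_ac)
 also have "... = 2 * ka^2 * L^2 * (b^2 + hi / lo * b) * (ta N * 4 ^ N) + 2 * ka^2 * (SUM j<4 ^ N. ta N * e j)"
  by (simp add: sum.distrib sum_distrib_left)
 also have "ta N * 4 ^ N = T" by (simp add: ta_def)
 finally show ?thesis unfolding g_def e_def by (simp only: distrib_left mult_ac)
qed

end

context scaling
begin

lemma transfer_bound:
 fixes Ps :: "nat => (nat => int) \<times> 'd => real"
 assumes nn: "!!n om. 0 <= Ps n om" and Z: "Z : bmeas M"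
  and lim: "AE om in M. (%n. Ps n (Om n om)) ---> Z om" and b: "\<forall>\<^sub>F n in sequentially. EP (s n) (Ps n) <= C"
 shows "integrable M Z" "EE Z <= C"
proof -
 have "EE (%om. Ps n (Om n om)) = EP (s n) (Ps n)" for n by (rule E_Om[where F = "Ps n" and n = n])
 then have b': "\<forall>\<^sub>F n in sequentially. EE (%om. Ps n (Om n om)) <= C" using b by (simp only:)
 show "integrable M Z" "EE Z <= C"
  by (rule fatou_bound[OF int_Om nn Z lim b'])+
qed

lemma kk_diff:
 assumes "u : quads T" "t : quads T" "u <= t"
 shows "\<forall>\<^sub>F n in sequentially. ta (s n) * real (kk (s n) t - kk (s n) u) = t - u"
proof -
 obtain mu where mu: "!!n. mu <= n ==> qfloor T n u = u" using qfloor_eventually[OF assms(1)] by blast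
 obtain mt where mt: "!!n. mt <= n ==> qfloor T n t = t" using qfloor_eventually[OF assms(2)] by blast
 show ?thesis unfolding eventually_sequentially
 proof (intro exI[of _ "max mu mt"] allI impI)
  fix n assume n: "max mu mt <= n"
  have mm: "mu <= s n" "mt <= s n" using n s_ge[of n] by auto
  show "ta (s n) * real (kk (s n) t - kk (s n) u) = t - u"
  using mu[OF mm(1)] mt[OF mm(2)] kk_mono[OF assms(3), of "s n"] by (simp add: of_nat_diff right_diff_distrib ta_kk)
 qed
qed

lemma second_quads:
 assumes "u : quads T" "t : quads T" "u <= t"
 shows "integrable M (%om. (Xc t om - Xc u om)^2)" "EE (%om. (Xc t om - Xc u om)^2) <= hi / lo * (t - u)"
proof -
 define Ps where "Ps n om = (Xd (s n) (kk (s n) t) om - Xd (s n) (kk (s n) u) om)^2" for n om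
 have T: "t : {0..T}" using quads_subset[OF T_pos] assms by blast
 have nn: "0 <= Ps n om" for n om by (simp add: Ps_def)
 have m: "(%om. (Xc t om - Xc u om)^2) : bmeas M" by measurable
 have lim: "AE om in M. (%n. Ps n (Om n om)) ---> (Xc t om - Xc u om)^2"
  using AE_conv_c
 proof eventually_elim
  case (elim om)
  then have "(%n. (Xn n t om - Xn n u om)^2) ---> (Xc t om - Xc u om)^2"
  using assms by (intro tendsto_power tendsto_diff) auto
  then show ?case by (simp add: Ps_def Xn_def)
 qed
 have b: "\<forall>\<^sub>F n in sequentially. EP (s n) (Ps n) <= hi / lo * (t - u)"
  using kk_diff[OF assms]
 proof eventually_elim
  case (elim n)
  then show ?case using second_X[OF kk_mono[OF assms(3)] kk_le[OF T], of "s n"] unfolding Ps_def by simp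
 qed
 show "integrable M (%om. (Xc t om - Xc u om)^2)" "EE (%om. (Xc t om - Xc u om)^2) <= hi / lo * (t - u)"
  by (rule transfer_bound[OF nn m lim b])+
qed

lemma second_Xc:
 assumes "u : quads T" "t : {0..T}" "u <= t"
 shows "integrable M (%om. (Xc t om - Xc u om)^2)" "EE (%om. (Xc t om - Xc u om)^2) <= hi / lo * (t - u)"
proof -
 obtain mu where mu: "!!n. mu <= n ==> qfloor T n u = u" using qfloor_eventually[OF assms(1)] by blast
 define f where "f n om = (Xc (qfloor T (mu + n) t) om - Xc u om)^2" for n om
 have u: "u <= qfloor T (mu + n) t" for n using qfloor_mono[OF T_pos assms(3), of "mu + n"] mu[of "mu + n"] by simp
 have i: "integrable M (f n)" for n
  unfolding f_def by (rule second_quads(1)[OF assms(1) qfloor_in[OF T_pos assms(2)] u])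
 have nn: "0 <= f n om" for n om by (simp add: f_def)
 have m: "(%om. (Xc t om - Xc u om)^2) : bmeas M" by measurable
 have lim: "AE om in M. (%n. f n om) ---> (Xc t om - Xc u om)^2"
 proof (rule AE_I2)
  fix om assume om: "om : space M"
  have "(%n. Xc (qfloor T (mu + n) t) om) ---> Xc t om"
  using LIMSEQ_ignore_initial_segment[OF qfloor_c(1)[OF om assms(2)], of mu] by (simp add: add.commute)
  then show "(%n. f n om) ---> (Xc t om - Xc u om)^2" unfolding f_def by (intro tendsto_power tendsto_diff tendsto_const)
 qed
 have b: "\<forall>\<^sub>F n in sequentially. EE (f n) <= hi / lo * (t - u)"
 proof (intro always_eventually allI)
  fix n
  have "EE (f n) <= hi / lo * (qfloor T (mu + n) t - u)"
  unfolding f_def by (rule second_quads(2)[OF assms(1) qfloor_in[OF T_pos assms(2)] u])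
  also have "... <= hi / lo * (t - u)"
  using qfloor_bounds(1)[OF T_pos, of t "mu + n"] assms(2) hilo by (intro mult_left_mono) auto
  finally show "EE (f n) <= hi / lo * (t - u)" .
 qed
 show "integrable M (%om. (Xc t om - Xc u om)^2)" "EE (%om. (Xc t om - Xc u om)^2) <= hi / lo * (t - u)"
  by (rule fatou_bound[OF i nn m lim b])+
qed

text \<open>Evaluation at the left end of each cell makes the coefficients adapted. The Lipschitz
  \<open>w\<close> takes the place of \<open>vr\<close>, so that the coefficients also converge
  along the chains.\<close>

definition grid_process :: "nat => (real \<times> real => real) => 'b elementary" where
 "grid_process m w = map (%k. (quad T m k, quad T m (Suc k),
  %om. sqrt (l (Yl om) / w (quad T m k, Xc (quad T m k) om)))) [0..<4 ^ m]"

lemma grid_value: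
 "elementary_value (grid_process m w) t om = (SUM k<4 ^ m. sqrt (l (Yl om) / w (quad T m k, Xc (quad T m k) om)) *
  indicator {quad T m k<..quad T m (Suc k)} t)"
 unfolding elementary_value_def grid_process_def
 by (simp add: comp_def interv_sum_list_conv_sum_set_nat atLeast0LessThan)

lemma grid_integral:
 "elementary_integral Wc (grid_process m w) t om = (SUM k<4 ^ m. sqrt (l (Yl om) / w (quad T m k, Xc (quad T m k) om)) *
  (Wc (min (quad T m (Suc k)) t) om - Wc (min (quad T m k) t) om))"
 unfolding elementary_integral_def grid_process_def
 by (simp add: comp_def interv_sum_list_conv_sum_set_nat atLeast0LessThan)

lemma Y_measurable_compose:
 assumes "!!i. (%om. ph i om) : bmeas N" "Yl : N \<rightarrow>\<^sub>M UC"
 shows "(%om. ph (Yl om) om :: real) : bmeas N"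
 by (rule measurable_compose_countable[where f = ph, OF assms])

end

section \<open>Elementary integrals with Lipschitz volatility\<close>

locale smooth_volatility = scaling l lo hi al \<mu> T r C0 M s Om
 for l :: "'d::finite => real" and lo hi al \<mu> T r C0 and M :: "'b measure" and s Om +
 fixes w :: "real \<times> real => real" and L :: real
 assumes L_nonneg: "0 <= L" and w_lipschitz: "!!p p'. abs (w p - w p') <= L * dist p p'"
  and w_ge: "!!p. lo <= w p" and w_le: "!!p. w p <= hi"
begin

lemma continuous_w: "continuous_on UNIV w"
proof -
 have "L-lipschitz_on UNIV w" using w_lipschitz L_nonneg by (auto simp: lipschitz_on_def dist_norm)
 then show ?thesis by (rule lipschitz_on_continuous_on)
qed

lemma measurable_w:
 assumes "f : bmeas N" "g : bmeas N"
 shows "(%om. w (f om, g om)) : bmeas N"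
 by (rule measurable_compose[OF borel_measurable_Pair[OF assms] borel_measurable_continuous_onI[OF continuous_w]])

definition gw :: "real => 'b => real" where "gw u om = sqrt (l (Yl om) / w (u, Xc u om))"

lemma gw_bounds: "0 <= gw u om" "gw u om <= sqrt (hi / lo)"
proof -
 have p: "0 < l (Yl om)" "l (Yl om) <= hi" "lo <= w (u, Xc u om)" "0 < w (u, Xc u om)"
  using l_pos le_hi w_ge[of "(u, Xc u om)"] lo_pos by auto
 then show "0 <= gw u om" unfolding gw_def by simp
 have "l (Yl om) / w (u, Xc u om) <= hi / lo" by (rule frac_le) (use p lo_pos in auto)
 then show "gw u om <= sqrt (hi / lo)" unfolding gw_def by (rule real_sqrt_le_mono)
qed

lemma measurable_gw:
 assumes "Xc u : bmeas N" "Yl : N \<rightarrow>\<^sub>M UC"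
 shows "gw u : bmeas N"
proof -
 have 1: "(%om. w (u, Xc u om)) : bmeas N" by (rule measurable_w[OF borel_measurable_const assms(1)])
 have "(%om. sqrt (l i / w (u, Xc u om))) : bmeas N" for i
  by (rule measurable_compose[OF borel_measurable_divide[OF borel_measurable_const 1] borel_measurable_sqrt])
 from Y_measurable_compose[OF this assms(2)] show ?thesis unfolding gw_def[abs_def] .
qed

lemma measurable_gw_M [measurable]: "gw u : bmeas M"
 by (rule measurable_gw) auto

text \<open>The error that remains when the mesh tends to zero: the squared distance from
  \<open>w\<close> to \<open>vr\<close> under the law of \<open>X\<close>, integrated over
  time.\<close>

definition D :: real where
 "D = (LINT t|lborel. indicator {0..<T} t * verr w t)"

definition mesh_error :: "nat => real" where
 "mesh_error m = L^2 * (T * ((T / 4 ^ m)^2 + hi / lo * (T / 4 ^ m)))"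

definition Iw :: "nat => real => 'b => real" where "Iw m = elementary_integral Wc (grid_process m w)"

lemma Iw: "Iw m t om = (SUM k<4 ^ m. gw (quad T m k) om * (Wc (min (quad T m (Suc k)) t) om - Wc (min (quad T m k) t) om))"
 by (simp add: Iw_def grid_integral gw_def)

lemma measurable_Iw [measurable]: "Iw m t : bmeas M"
 unfolding Iw[abs_def] by measurable

lemma quad_mem: "k <= 4 ^ m ==> quad T m k : {0..T}"
 using quadsI quads_subset[OF T_pos] by blast

lemma quad_mono: "k <= k' ==> quad T m k <= quad T m k'"
 using T_pos by (auto simp: quad_def intro!: divide_right_mono)

text \<open>The coarse level \<open>m\<close> is fixed while the chains are refined, so the coarse
  sums converge term by term and the discrete bound passes to the limit by Fatou's lemma;
  \<open>eps\<close> pays for the one-sided regression limit.\<close>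

lemma ito_quads:
 assumes t: "t : quads T" and eps: "0 < eps"
 shows "integrable M (%om. (Iw m t om - (Xc t om - Xc 0 om))^2)"
  "EE (%om. (Iw m t om - (Xc t om - Xc 0 om))^2) <= 2 * ka^2 * (mesh_error m + (D + eps))"
proof -
 define Bn where "Bn n = (4::nat) ^ (s n - m)" for n
 define Ps where "Ps n om = ((SUM k<4 ^ m. sqrt (l (snd om) / w (quad T m k, Xd (s n) (k * Bn n) om)) *
  (Wd (s n) (min (Suc k * Bn n) (kk (s n) t)) om - Wd (s n) (min (k * Bn n) (kk (s n) t)) om)) -
  (Xd (s n) (kk (s n) t) om - Xd (s n) 0 om))^2" for n om
 have tT: "t : {0..T}" using t quads_subset[OF T_pos] by blast
 have nn: "0 <= Ps n om" for n om by (simp add: Ps_def)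
 have m: "(%om. (Iw m t om - (Xc t om - Xc 0 om))^2) : bmeas M" by measurable
 have sm: "\<forall>\<^sub>F n in sequentially. m <= s n"
  using eventually_ge_at_top[of m] by eventually_elim (use s_ge order_trans in blast)
 have q0: "0 : quads T" using quadsI[of 0 0 T] by (simp add: quad_def)
 have mq: "min (quad T m k) t : quads T" if "k <= 4 ^ m" for k
  using t quadsI[OF that] by (simp add: min_def)
 have kkmin: "kk n (min a c) = min (kk n a) (kk n c)" for n a c
  using kk_mono[of a c n] kk_mono[of c a n] by (auto simp: min_def not_le)
 have lim: "AE om in M. (%n. Ps n (Om n om)) ---> (Iw m t om - (Xc t om - Xc 0 om))^2"
  using AE_conv_c
 proof eventually_elim
  case (elim om)
  have gl: "(%n. sqrt (l (Yn n om) / w (quad T m k, Xn n (quad T m k) om))) ---> gw (quad T m k) om" if "k < 4 ^ m" for k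
  proof -
  have X: "(%n. Xn n (quad T m k) om) ---> Xc (quad T m k) om" using elim quadsI[of k m T] that by auto
  have "(%n. w (quad T m k, Xn n (quad T m k) om)) ---> w (quad T m k, Xc (quad T m k) om)"
  by (rule continuous_on_tendsto_compose[OF continuous_w]) (auto intro!: tendsto_Pair X)
  moreover have "w (quad T m k, Xc (quad T m k) om) ~= 0" using w_ge[of "(quad T m k, Xc (quad T m k) om)"] lo_pos by auto
  moreover have "(%n. l (Yn n om)) ---> l (Yl om)"
  proof (rule tendsto_eventually)
  show "\<forall>\<^sub>F n in sequentially. l (Yn n om) = l (Yl om)" using elim by (auto elim: eventually_mono)
  qed
  ultimately show ?thesis unfolding gw_def by (intro tendsto_real_sqrt tendsto_divide)
  qed
  have "(%n. ((SUM k<4 ^ m. sqrt (l (Yn n om) / w (quad T m k, Xn n (quad T m k) om)) *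
  (Wn n (min (quad T m (Suc k)) t) om - Wn n (min (quad T m k) t) om)) - (Xn n t om - Xn n 0 om))^2)
  ---> (Iw m t om - (Xc t om - Xc 0 om))^2"
  unfolding Iw using elim mq t q0 by (intro tendsto_power tendsto_diff tendsto_sum tendsto_mult gl) auto
  moreover have "\<forall>\<^sub>F n in sequentially. ((SUM k<4 ^ m. sqrt (l (Yn n om) / w (quad T m k, Xn n (quad T m k) om)) *
  (Wn n (min (quad T m (Suc k)) t) om - Wn n (min (quad T m k) t) om)) - (Xn n t om - Xn n 0 om))^2 = Ps n (Om n om)"
  using sm
  proof eventually_elim
  case (elim n)
  have k0: "kk (s n) 0 = 0" by (simp add: kk_def)
  show ?case unfolding Ps_def Xn_def Wn_def Yn_def kkmin kk_quad[OF elim] k0 Bn_def by simp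
  qed
  ultimately show ?case by (rule Lim_transform_eventually)
 qed
 have b: "\<forall>\<^sub>F n in sequentially. EP (s n) (Ps n) <= 2 * ka^2 * (mesh_error m + (D + eps))"
  using sm regression_limit[OF L_nonneg w_lipschitz w_ge w_le eps]
 proof eventually_elim
  case (elim n)
  have "EP (s n) (Ps n) <= 2 * ka^2 * (mesh_error m +
  (SUM k<4 ^ s n. ta (s n) * EP (s n) (%om. (vd (s n) k (fst om k) - w (ta (s n) * real k, Xd (s n) k om))^2)))"
  unfolding Ps_def Bn_def mesh_error_def by (rule discrete_ito[OF L_nonneg w_lipschitz w_ge elim(1) kk_le[OF tT]])
  also have "... <= 2 * ka^2 * (mesh_error m + (D + eps))"
  using elim(2) unfolding D_def by (intro mult_left_mono add_left_mono) auto
  finally show ?case .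
 qed
 show "integrable M (%om. (Iw m t om - (Xc t om - Xc 0 om))^2)"
  "EE (%om. (Iw m t om - (Xc t om - Xc 0 om))^2) <= 2 * ka^2 * (mesh_error m + (D + eps))"
  by (rule transfer_bound[OF nn m lim b])+
qed

lemma ito_bound:
 assumes t: "t : {0..T}" and eps: "0 < eps"
 shows "integrable M (%om. (Iw m t om - (Xc t om - Xc 0 om))^2)"
  "EE (%om. (Iw m t om - (Xc t om - Xc 0 om))^2) <= 2 * ka^2 * (mesh_error m + (D + eps))"
proof -
 define f where "f n om = (Iw m (qfloor T n t) om - (Xc (qfloor T n t) om - Xc 0 om))^2" for n om
 have i: "integrable M (f n)" for n unfolding f_def by (rule ito_quads(1)[OF qfloor_in[OF T_pos t] eps])
 have nn: "0 <= f n om" for n om by (simp add: f_def)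
 have mm: "(%om. (Iw m t om - (Xc t om - Xc 0 om))^2) : bmeas M" by measurable
 have lim: "AE om in M. (%n. f n om) ---> (Iw m t om - (Xc t om - Xc 0 om))^2"
 proof (rule AE_I2)
  fix om assume om: "om : space M"
  have W: "(%n. Wc (min c (qfloor T n t)) om) ---> Wc (min c t) om" if c: "c : {0..T}" for c
  proof (rule continuous_on_tendsto_compose[OF continuous_c(2)[OF om]])
  show "(%n. min c (qfloor T n t)) ---> min c t" by (intro tendsto_min tendsto_const qfloor_LIMSEQ[OF T_pos]) (use t in auto)
  show "min c t : {0..T}" using c t by auto
  have "qfloor T n t : {0..T}" for n using qfloor_in[OF T_pos t] quads_subset[OF T_pos] by blast
  then show "\<forall>\<^sub>F n in sequentially. min c (qfloor T n t) : {0..T}" using c by (intro always_eventually) (auto simp: min_def)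
  qed
  show "(%n. f n om) ---> (Iw m t om - (Xc t om - Xc 0 om))^2"
  unfolding f_def Iw by (intro tendsto_power tendsto_diff tendsto_sum tendsto_mult tendsto_const W qfloor_c om t quad_mem) auto
 qed
 have b: "\<forall>\<^sub>F n in sequentially. EE (f n) <= 2 * ka^2 * (mesh_error m + (D + eps))"
  unfolding f_def by (intro always_eventually allI ito_quads(2)[OF qfloor_in[OF T_pos t] eps])
 show "integrable M (%om. (Iw m t om - (Xc t om - Xc 0 om))^2)"
  "EE (%om. (Iw m t om - (Xc t om - Xc 0 om))^2) <= 2 * ka^2 * (mesh_error m + (D + eps))"
  by (rule fatou_bound[OF i nn mm lim b])+
qed

end

section \<open>The integrand of the limit equation\<close>

context scaling
begin

definition Hc :: "real => 'b => real" where "Hc t om = sqrt (l (Yl om) / vr t (Xc t om))"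

lemma Hc_bounds: "0 <= Hc t om" "(Hc t om)^2 <= hi / lo"
proof -
 have p: "0 < l (Yl om)" "l (Yl om) <= hi" "lo <= vr t (Xc t om)" "0 < vr t (Xc t om)"
  using l_pos le_hi vr_bounds(1)[of t "Xc t om"] lo_pos by auto
 then show "0 <= Hc t om" unfolding Hc_def by simp
 have "l (Yl om) / vr t (Xc t om) <= hi / lo" by (rule frac_le) (use p lo_pos in auto)
 then show "(Hc t om)^2 <= hi / lo" using p unfolding Hc_def by simp
qed

lemma progressive_Hc: "progressively_measurable Fc T Hc"
 unfolding progressively_measurable_def
proof
 fix t assume t: "t : {0..T}"
 let ?N = "restrict_space borel {0..t} \<Otimes>\<^sub>M Fc t"
 have X: "(%(u, om). Xc u om) : bmeas ?N"
 proof (rule progressive_of_continuous[where Om = "space M" and T = T])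
  show "Xc u : bmeas (Fc u)" if "u : {0..T}" for u using measurable_Fc that by auto
 qed (use t sets_Fc_mono continuous_c in auto)
 have f: "fst : bmeas ?N"
  by (rule measurable_compose[OF measurable_fst]) (simp add: measurable_restrict_space1)
 have "(%p. (fst p, Xc (fst p) (snd p))) : ?N \<rightarrow>\<^sub>M borel \<Otimes>\<^sub>M borel"
  by (rule measurable_Pair[OF f]) (use X in \<open>simp add: case_prod_beta\<close>)
 from measurable_compose[OF this measurable_vr]
 have v: "(%p. vr (fst p) (Xc (fst p) (snd p))) : bmeas ?N" by simp
 have Y: "(%p. Yl (snd p)) : ?N \<rightarrow>\<^sub>M UC" by (rule measurable_compose[OF measurable_snd measurable_Y])
 have "(%p. sqrt (l i / vr (fst p) (Xc (fst p) (snd p)))) : bmeas ?N" for i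
  by (rule measurable_compose[OF borel_measurable_divide[OF borel_measurable_const v] borel_measurable_sqrt])
 from measurable_compose_countable[where f = "%i p. sqrt (l i / vr (fst p) (Xc (fst p) (snd p)))", OF this Y]
 show "(%(u, om). Hc u om) : bmeas ?N" unfolding Hc_def case_prod_beta .
qed

text \<open>Sets generated by \<open>X\<close> at time \<open>t\<close> are preimages of Borel sets,
  so orthogonality tested with indicators is the characterisation of conditional
  expectation.\<close>

lemma regression_vr: 
 assumes t: "t : {0..T}"
 shows "AE om in M. vr t (Xc t om) = real_cond_exp M (vimage_algebra (space M) (Xc t) borel) (%om. l (Yl om)) om"
proof -
 let ?F = "vimage_algebra (space M) (Xc t) borel"
 have Y[measurable]: "Yl : M \<rightarrow>\<^sub>M UC" by simp
 have lY[measurable]: "(%om. l (Yl om)) : bmeas M" by (rule measurable_compose[OF Y]) simp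
 have sub: "subalgebra M ?F"
  using measurable_sets[OF measurable_c(1)] by (auto simp: subalgebra_def sets_vimage_algebra2)
 interpret finite_measure_subalgebra M ?F using sub by unfold_locales
 have XF: "Xc t : bmeas ?F" by (rule measurable_vimage_algebra1) simp
 have "AE om in M. real_cond_exp M ?F (%om. l (Yl om)) om = vr t (Xc t om)"
 proof (rule real_cond_exp_charact)
  fix A assume "A : sets ?F"
  then obtain B where B[measurable]: "B : sets borel" and A: "A = Xc t -` B Int space M" by (auto simp: sets_vimage_algebra2)
  have i: "set_lebesgue_integral M A f = EE (%om. f om * indicator B (Xc t om))" for f :: "'b => real"
  unfolding set_lebesgue_integral_def A by (intro Bochner_Integration.integral_cong) (auto simp: indicator_def)
  have "EE (%om. vr t (Xc t om) * indicator B (Xc t om)) = EE (%om. l (Yl om) * indicator B (Xc t om))"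
  using vr_orth[of "indicator B" 1 t] clip(2)[OF t] by (simp add: indicator_def)
  then show "set_lebesgue_integral M A (%om. l (Yl om)) = set_lebesgue_integral M A (%om. vr t (Xc t om))"
  unfolding i by simp
 next
  show "integrable M (%om. l (Yl om))"
  using l_pos le_hi by (intro integrable_const_bound[where B = hi]) (auto simp: abs_of_pos)
  show "integrable M (%om. vr t (Xc t om))"
  using vr_bounds by (intro integrable_const_bound[where B = hi]) auto
  show "(%om. vr t (Xc t om)) : bmeas ?F" by (rule measurable_compose[OF XF vr_at])
 qed
 then show ?thesis by eventually_elim simp
qed

text \<open>Density of Lipschitz functions is applied to the law of the pair of time and position, a
  finite measure on the plane. Both functions lie in \<open>{lo..hi}\<close>, so the squared
  difference is at most \<open>hi\<close> times the absolute one, whence the tolerance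
  \<open>eps / hi\<close>.\<close>

lemma smooth_volatility_exists:
 assumes eps: "0 < eps"
 shows "EX w L. smooth_volatility l lo hi al \<mu> T r C0 M s Om w L &
  (LINT t|lborel. indicator {0..<T} t * verr w t) <= eps"
proof -
 define I where "I = (%t::real. ennreal (indicator {0..<T} t))"
 define N1 where "N1 = density lborel I"
 have Im: "I : bmeas lborel" by (simp add: I_def)
 interpret N1: finite_measure N1
 proof
  have "emeasure N1 (space N1) = emeasure lborel {0..<T}"
  unfolding N1_def I_def by (subst emeasure_density) (auto simp: nn_integral_indicator ennreal_indicator)
  then show "emeasure N1 (space N1) ~= \<infinity>" using T_pos by (simp add: emeasure_lborel_Ico)
 qed
 interpret pr: pair_sigma_finite N1 M by unfold_locales
 interpret fm: finite_measure "N1 \<Otimes>\<^sub>M M" by (rule finite_measure_pair_measure) unfold_locales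
 have sN[simp]: "sets N1 = sets borel" by (simp add: N1_def)
 have sets_pr: "sets (N1 \<Otimes>\<^sub>M M) = sets (borel \<Otimes>\<^sub>M M)" by (intro sets_pair_measure_cong) auto
 define \<Xi> where "\<Xi> p = (fst p, Xc (clip (fst p)) (snd p))" for p
 have \<Xi>: "\<Xi> : N1 \<Otimes>\<^sub>M M \<rightarrow>\<^sub>M borel"
 proof -
  have "\<Xi> : borel \<Otimes>\<^sub>M M \<rightarrow>\<^sub>M borel \<Otimes>\<^sub>M borel"
  unfolding \<Xi>_def[abs_def] by (rule measurable_Pair[OF measurable_fst]) (use joint_Xc in \<open>simp add: case_prod_beta\<close>)
  then show ?thesis by (simp add: borel_prod measurable_cong_sets[OF sets_pr refl])
 qed
 define \<nu> where "\<nu> = distr (N1 \<Otimes>\<^sub>M M) borel \<Xi>"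
 define v where "v = (%(t, x). vr t x)"
 have vm: "v : bmeas borel" using measurable_vr by (simp add: v_def borel_prod)
 have fin: "finite_measure \<nu>" unfolding \<nu>_def by (rule fm.finite_measure_distr[OF \<Xi>])
 have s\<nu>: "sets \<nu> = sets borel" by (simp add: \<nu>_def)
 have vlo: "lo <= v x" and vhi: "v x <= hi" for x using vr_bounds by (auto simp: v_def split: prod.split)
 have "0 < eps / hi" using eps hi_pos by simp
 from lipschitz_dense[OF fin s\<nu> vm vlo vhi this]
 obtain w L where L0: "0 <= L" and L: "ALL x y. abs (w x - w y) <= L * dist x y" and w: "ALL x. lo <= w x & w x <= hi"
  and c: "(\<integral>x. abs (v x - w x) \<partial>\<nu>) <= eps / hi"
  by (elim exE conjE) (rule that)
 have sv: "smooth_volatility l lo hi al \<mu> T r C0 M s Om w L"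
  by unfold_locales (use L0 L w in auto)
 then interpret smooth_volatility l lo hi al \<mu> T r C0 M s Om w L .
 have wm: "w : bmeas borel" by (rule borel_measurable_continuous_onI[OF continuous_w])
 have vw: "abs (v x - w x) <= hi" for x
  using vlo[of x] vhi[of x] w_ge[of x] w_le[of x] lo_pos by linarith
 interpret \<nu>: finite_measure \<nu> by (rule fin)
 have m1: "(%x. (v x - w x)^2) : bmeas borel" using vm wm by simp
 have vw2: "(v x - w x)^2 <= hi * abs (v x - w x)" for x
  using mult_right_mono[OF vw[of x] abs_ge_zero[of "v x - w x"]] by (simp add: power2_eq_square flip: abs_mult)
 have i1: "integrable \<nu> (%x. hi * abs (v x - w x))"
  using vw vm wm hi_pos by (intro integrable_mult_right \<nu>.integrable_const_bound[where B = hi]) (auto simp: \<nu>_def)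
 have i2: "integrable \<nu> (%x. (v x - w x)^2)"
  by (rule Bochner_Integration.integrable_bound[OF i1]) (use vw2 m1 hi_pos in \<open>auto simp: \<nu>_def abs_mult intro: AE_I2\<close>)
 have "(LINT t|lborel. indicator {0..<T} t * verr w t) =
  (LINT t|N1. EE (%om. (v (\<Xi> (t, om)) - w (\<Xi> (t, om)))^2))"
 proof -
  have e: "(%t. EE (%om. (v (\<Xi> (t, om)) - w (\<Xi> (t, om)))^2)) : bmeas borel"
  proof -
  have "(%p. (v (\<Xi> p) - w (\<Xi> p))^2) : bmeas (borel \<Otimes>\<^sub>M M)"
  using measurable_compose[OF \<Xi> m1] by (simp add: measurable_cong_sets[OF sets_pr refl])
  then show ?thesis by (intro borel_measurable_lebesgue_integral) (simp add: case_prod_beta)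
  qed
  show ?thesis unfolding N1_def I_def
  by (subst integral_real_density) (use e in \<open>auto simp: \<Xi>_def v_def\<close>)
 qed
 also have "... = (LINT p|(N1 \<Otimes>\<^sub>M M). (v (\<Xi> p) - w (\<Xi> p))^2)"
 proof (rule pr.integral_fst')
  show "integrable (N1 \<Otimes>\<^sub>M M) (%p. (v (\<Xi> p) - w (\<Xi> p))^2)"
  using i2 integrable_distr_eq[OF \<Xi> m1] by (simp add: \<nu>_def)
 qed
 also have "... = (LINT x|\<nu>. (v x - w x)^2)" unfolding \<nu>_def by (rule integral_distr[OF \<Xi> m1, symmetric])
 also have "... <= (LINT x|\<nu>. hi * abs (v x - w x))" by (rule integral_mono[OF i2 i1 vw2])
 also have "... <= eps" using c hi_pos by (simp add: pos_le_divide_eq mult.commute)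
 finally show ?thesis using sv by blast
qed

end

context smooth_volatility
begin

lemma elementary_grid: "elementary_process M Fc T (grid_process m w)"
 unfolding elementary_process_def
proof
 fix p assume "p : set (grid_process m w)"
 then obtain k where k: "k < 4 ^ m" and p: "p = (quad T m k, quad T m (Suc k), gw (quad T m k))"
  unfolding grid_process_def gw_def[abs_def] by auto
 have q: "quad T m k : {0..T}" "quad T m (Suc k) : {0..T}" "quad T m k <= quad T m (Suc k)"
  using k by (intro quad_mem quad_mono; simp)+
 have "gw (quad T m k) : bmeas (Fc (quad T m k))"
  using measurable_Fc(1)[OF q(1) order_refl] measurable_Y by (rule measurable_gw)
 moreover have "bounded (gw (quad T m k) ` space M)"
  using gw_bounds by (intro boundedI[of _ "sqrt (hi / lo)"]) (auto simp: abs_of_nonneg)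
 ultimately show "case p of (a, b, xi) => 0 <= a & a <= b & b <= T & xi : bmeas (Fc a) & bounded (xi ` space M)"
  using q unfolding p by simp
qed

text \<open>Elementary processes use cells open on the left, rounding down uses cells open on the
  right; the two agree off the countable set of grid points.\<close>

lemma grid_value_at:
 assumes t: "t : {0..<T}" "t ~: range (quad T m)"
 shows "elementary_value (grid_process m w) t om = gw (qfloor T m t) om"
proof -
 have q: "quad T m k = ta m * real k" for k by (simp add: quad_def ta_def)
 have ind: "indicator {quad T m k<..quad T m (Suc k)} t = (if k = kk m t then 1 else 0 :: real)" for k
 proof -
  have "t : {quad T m k<..quad T m (Suc k)} \<longleftrightarrow> t : {quad T m k..<quad T m (Suc k)}"
  using t(2) by (auto simp: less_le)
  also have "... \<longleftrightarrow> kk m t = k" unfolding q by (rule cell_iff) (use t in auto)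
  finally show ?thesis by (auto simp: indicator_def)
 qed
 have "elementary_value (grid_process m w) t om = (SUM k<4 ^ m. if k = kk m t then gw (quad T m k) om else 0)"
  unfolding grid_value ind gw_def by (intro sum.cong) auto
 also have "... = gw (quad T m (kk m t)) om" using kk_less[OF t(1), of m] by simp
 finally show ?thesis by (simp add: q ta_kk)
qed

text \<open>Counterpart of the discrete estimate with \<open>vr\<close> in place of the discrete
  regression function: motion of \<open>w\<close> within a cell plus the distance from
  \<open>w\<close> to \<open>vr\<close>.\<close>

lemma value_error:
 assumes t: "t : {0..<T}"
 shows "(\<integral>\<^sup>+om. ennreal ((gw (qfloor T m t) om - Hc t om)^2) \<partial>M) <= ennreal (2 * ka^2 *
  (L^2 * ((T / 4 ^ m)^2 + hi / lo * (T / 4 ^ m)) + verr w t))"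
proof -
 define u where "u = qfloor T m t"
 define b where "b = T / 4 ^ m"
 have tT: "t : {0..T}" using t by auto
 have u: "u <= t" "t - u <= b" unfolding u_def b_def using qfloor_bounds[OF T_pos, of t m] t by auto
 have uq: "u : quads T" unfolding u_def by (rule qfloor_in[OF T_pos tT])
 have ub: "(t - u)^2 <= b^2" using u by (intro power_mono) auto
 define A where "A om = (Xc t om - Xc u om)^2" for om
 define E where "E om = (vr t (Xc t om) - w (t, Xc t om))^2" for om
 have wt: "(%om. w (t, Xc t om)) : bmeas M" by (rule measurable_w) auto
 have iA: "integrable M A" "EE A <= hi / lo * (t - u)"
  unfolding A_def[abs_def] by (rule second_Xc[OF uq tT u(1)])+
 have iE: "integrable M E"
 proof (rule integrable_const_bound[where B = "hi^2"])
  have "abs (vr t (Xc t om) - w (t, Xc t om)) <= hi" for om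
  using vr_bounds[of t "Xc t om"] w_ge[of "(t, Xc t om)"] w_le[of "(t, Xc t om)"] lo_pos by linarith
  then have "(vr t (Xc t om) - w (t, Xc t om))^2 <= hi^2" for om using hi_pos by (simp add: power2_le_iff_abs_le)
  then show "AE om in M. norm (E om) <= hi^2" unfolding E_def by simp
  show "E : bmeas M" unfolding E_def[abs_def] using wt by measurable
 qed
 have pt: "(gw u om - Hc t om)^2 <= 2 * ka^2 * (L^2 * (b^2 + A om) + E om)" for om
 proof -
  define dl where "dl = L * dist (u, Xc u om) (t, Xc t om)"
  have "(gw u om - Hc t om)^2 <= 2 * ka^2 * (dl^2 + E om)"
  unfolding gw_def Hc_def E_def dl_def
  by (rule sqrt_quotient_square) (use w_ge vr_bounds l_pos le_hi w_lipschitz in \<open>auto intro: less_imp_le\<close>)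
  also have "dl^2 <= L^2 * (b^2 + A om)"
  proof -
  have "dl^2 = L^2 * ((t - u)^2 + A om)"
  unfolding dl_def power_mult_distrib A_def by (simp add: dist_Pair_Pair dist_real_def power2_commute)
  also have "... <= L^2 * (b^2 + A om)" using ub by (intro mult_left_mono add_right_mono) auto
  finally show ?thesis .
  qed
  finally show ?thesis using ka_pos by (simp add: mult_left_mono)
 qed
 have "(\<integral>\<^sup>+om. ennreal ((gw u om - Hc t om)^2) \<partial>M) <= (\<integral>\<^sup>+om. ennreal (2 * ka^2 * (L^2 * (b^2 + A om) + E om)) \<partial>M)"
  by (intro nn_integral_mono ennreal_leI pt)
 also have "... = ennreal (EE (%om. 2 * ka^2 * (L^2 * (b^2 + A om) + E om)))"
 proof (rule nn_integral_eq_integral)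
  show "integrable M (%om. 2 * ka^2 * (L^2 * (b^2 + A om) + E om))" using iA(1) iE by simp
  have "0 <= A om" "0 <= E om" for om by (simp_all add: A_def E_def)
  then show "AE om in M. 0 <= 2 * ka^2 * (L^2 * (b^2 + A om) + E om)"
  by (intro AE_I2 mult_nonneg_nonneg add_nonneg_nonneg) auto
 qed
 also have "EE (%om. 2 * ka^2 * (L^2 * (b^2 + A om) + E om)) = 2 * ka^2 * (L^2 * (b^2 + EE A) + EE E)"
  using iA iE by (simp add: prob_space)
 also have "... <= 2 * ka^2 * (L^2 * (b^2 + hi / lo * b) + EE E)"
 proof (intro mult_left_mono add_right_mono add_left_mono)
  have "hi / lo * (t - u) <= hi / lo * b" using u hilo by (intro mult_left_mono) auto
  then show "EE A <= hi / lo * b" using iA by linarith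
 qed auto
 finally show ?thesis unfolding clip(2)[OF tT] unfolding u_def b_def E_def[abs_def]
  by (simp add: ennreal_leI)
qed

lemma integrable_error:
 "integrable lborel (%t. indicator {0..<T} t * verr w t)"
proof (rule integrable_window[where B = "hi^2"])
 have f: "fst : bmeas (borel \<Otimes>\<^sub>M M)" for M :: "'b measure" by simp
 have X: "(%p. Xc (clip (fst p)) (snd p)) : bmeas (borel \<Otimes>\<^sub>M M)" using joint_Xc by (simp add: case_prod_beta)
 have "(%p. (vr (fst p) (Xc (clip (fst p)) (snd p)) - w (fst p, Xc (clip (fst p)) (snd p)))^2) : bmeas (borel \<Otimes>\<^sub>M M)"
  using joint_vr measurable_w[OF f X] by (simp add: case_prod_beta)
 then show "(%t. verr w t) : bmeas borel"
  by (intro borel_measurable_lebesgue_integral) (simp add: case_prod_beta)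
 fix t
 have b: "abs (vr t (Xc (clip t) om) - w (t, Xc (clip t) om)) <= hi" for om
  using vr_bounds[of t "Xc (clip t) om"] w_ge[of "(t, Xc (clip t) om)"] w_le[of "(t, Xc (clip t) om)"] lo_pos by linarith
 have wt: "(%om. w (t, Xc (clip t) om)) : bmeas M" by (rule measurable_w) auto
 have sq: "(vr t (Xc (clip t) om) - w (t, Xc (clip t) om))^2 <= hi^2" for om using b[of om] hi_pos by (simp add: power2_le_iff_abs_le)
 have "verr w t <= EE (%om. hi^2)"
  using sq wt by (intro integral_mono integrable_const_bound[where B = "hi^2"]) auto
 moreover have "0 <= verr w t" by (rule integral_nonneg_AE) simp
 ultimately show "abs (verr w t) <= hi^2" by (simp add: prob_space)
qed

text \<open>Fubini reduces the claim to the estimate at a fixed time; grid points and the end time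
  \<open>T\<close> form a null set.\<close>

lemma process_error:
 fixes m :: nat
 defines "Q \<equiv> %om. \<integral>\<^sup>+t\<in>{0..T}. ennreal ((elementary_value (grid_process m w) t om - Hc t om)^2) \<partial>lborel"
 shows "Q : bmeas M" "(\<integral>\<^sup>+om. Q om \<partial>M) <= ennreal (2 * ka^2 * (mesh_error m + D))"
proof -
 define S where "S p = elementary_value (grid_process m w) (fst p) (snd p)" for p
 define H where "H p = sqrt (l (Yl (snd p)) / vr (fst p) (Xc (clip (fst p)) (snd p)))" for p
 define G where "G p = ennreal ((S p - H p)^2) * indicator {0..T} (fst p)" for p
 have Sm: "S : bmeas (borel \<Otimes>\<^sub>M M)"
  unfolding S_def[abs_def] grid_value gw_def[symmetric] by measurable
 have Hm: "H : bmeas (borel \<Otimes>\<^sub>M M)"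
 proof -
  have Y: "(%p. Yl (snd p)) : borel \<Otimes>\<^sub>M M \<rightarrow>\<^sub>M UC" by (rule measurable_compose[OF measurable_snd]) simp
  have v: "(%p. vr (fst p) (Xc (clip (fst p)) (snd p))) : bmeas (borel \<Otimes>\<^sub>M M)" using joint_vr by (simp add: case_prod_beta)
  have "(%p. sqrt (l i / vr (fst p) (Xc (clip (fst p)) (snd p)))) : bmeas (borel \<Otimes>\<^sub>M M)" for i
  by (rule measurable_compose[OF borel_measurable_divide[OF borel_measurable_const v] borel_measurable_sqrt])
  from measurable_compose_countable[where f = "%i p. sqrt (l i / vr (fst p) (Xc (clip (fst p)) (snd p)))", OF this Y]
  show ?thesis unfolding H_def[abs_def] .
 qed
 have Gm: "G : bmeas (lborel \<Otimes>\<^sub>M M)"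
 proof -
  have "G : bmeas (borel \<Otimes>\<^sub>M M)" unfolding G_def[abs_def] using Sm Hm by measurable
  moreover have ss: "sets (lborel \<Otimes>\<^sub>M M) = sets (borel \<Otimes>\<^sub>M M)" by (intro sets_pair_measure_cong) auto
  ultimately show ?thesis by (simp only: measurable_cong_sets[OF ss refl])
 qed
 have HH: "H (t, om) = Hc t om" if "t : {0..T}" for t om using clip(2)[OF that] by (simp add: H_def Hc_def)
 interpret pr: pair_sigma_finite lborel M by unfold_locales
 have Q: "Q om = (\<integral>\<^sup>+t. G (t, om) \<partial>lborel)" for om
  unfolding Q_def by (intro nn_integral_cong) (auto simp: G_def S_def HH indicator_def)
 have G': "(%(om, t). G (t, om)) : bmeas (M \<Otimes>\<^sub>M lborel)"
  using measurable_compose[OF measurable_pair_swap' Gm] by (simp add: case_prod_beta)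
 show "Q : bmeas M" unfolding Q by (rule lborel.borel_measurable_nn_integral[OF G'])
 have "(\<integral>\<^sup>+om. Q om \<partial>M) = (\<integral>\<^sup>+t. \<integral>\<^sup>+om. G (t, om) \<partial>M \<partial>lborel)"
  unfolding Q by (rule pr.Fubini') (use Gm in \<open>simp add: case_prod_beta\<close>)
 also have "... <= (\<integral>\<^sup>+t. ennreal (indicator {0..<T} t * (2 * ka^2 *
  (L^2 * ((T / 4 ^ m)^2 + hi / lo * (T / 4 ^ m)) + verr w t))) \<partial>lborel)"
 proof (rule nn_integral_mono_AE)
  have "AE t in lborel. t ~: range (quad T m)"
  by (intro AE_not_in countable_imp_null_set_lborel) simp
  moreover have "AE t in lborel. t ~= T" by (rule AE_lborel_singleton)
  ultimately show "AE t in lborel. (\<integral>\<^sup>+om. G (t, om) \<partial>M) <= ennreal (indicator {0..<T} t * (2 * ka^2 *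
  (L^2 * ((T / 4 ^ m)^2 + hi / lo * (T / 4 ^ m)) + verr w t)))"
  proof eventually_elim
  case (elim t)
  show ?case
  proof (cases "t : {0..<T}")
  case True
  then have "G (t, om) = ennreal ((gw (qfloor T m t) om - Hc t om)^2)" for om
  using grid_value_at[OF True elim(1), of om] HH[of t om] by (simp add: G_def S_def)
  then show ?thesis using value_error[OF True, of m] True by simp
  next
  case False
  then have "G (t, om) = 0" for om using elim(2) by (auto simp: G_def indicator_def)
  then show ?thesis by simp
  qed
  qed
 qed
 also have "... = ennreal (LINT t|lborel. indicator {0..<T} t * (2 * ka^2 *
  (L^2 * ((T / 4 ^ m)^2 + hi / lo * (T / 4 ^ m)) + verr w t)))"
  (is "_ = ennreal (LINT t|lborel. indicator {0..<T} t * (2 * ka^2 * (?c + ?e t)))")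
 proof (rule nn_integral_eq_integral)
  have c0: "0 <= ?c" using T_pos hilo(1) by (intro mult_nonneg_nonneg add_nonneg_nonneg) auto
  have i1: "integrable lborel (%t. indicator {0..<T} t * ?c)" by (rule integrable_window[where B = ?c]) (use c0 in auto)
  have "integrable lborel (%t. 2 * ka^2 * (indicator {0..<T} t * ?c + indicator {0..<T} t * ?e t))"
  using i1 integrable_error by (intro integrable_mult_right Bochner_Integration.integrable_add)
  then show "integrable lborel (%t. indicator {0..<T} t * (2 * ka^2 * (?c + ?e t)))"
  by (simp only: distrib_left mult.left_commute)
  show "AE t in lborel. 0 <= indicator {0..<T} t * (2 * ka^2 * (?c + ?e t))"
  by (intro AE_I2 mult_nonneg_nonneg add_nonneg_nonneg[OF c0]) auto
 qed
 also have "(LINT t|lborel. indicator {0..<T} t * (2 * ka^2 * (?c + ?e t))) = 2 * ka^2 * (mesh_error m + D)"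
 proof -
  have c0: "0 <= ?c" using T_pos hilo(1) by (intro mult_nonneg_nonneg add_nonneg_nonneg) auto
  have i1: "integrable lborel (%t. indicator {0..<T} t * ?c)" by (rule integrable_window[where B = ?c]) (use c0 in auto)
  have "(LINT t|lborel. indicator {0..<T} t * (2 * ka^2 * (?c + ?e t))) =
  (LINT t|lborel. 2 * ka^2 * (indicator {0..<T} t * ?c + indicator {0..<T} t * ?e t))"
  by (intro Bochner_Integration.integral_cong) (simp_all only: distrib_left mult.left_commute)
  also have "... = 2 * ka^2 * ((LINT t|lborel. indicator {0..<T} t * ?c) + D)"
  unfolding D_def integral_mult_right_zero by (subst Bochner_Integration.integral_add[OF i1 integrable_error]) simp
  also have "(LINT t|lborel. indicator {0..<T} t * ?c) = T * ?c"
  unfolding integral_mult_left_zero using T_pos by simp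
  also have "T * ?c = mesh_error m" unfolding mesh_error_def by (simp only: mult.left_commute)
  finally show ?thesis .
 qed
 finally show "(\<integral>\<^sup>+om. Q om \<partial>M) <= ennreal (2 * ka^2 * (mesh_error m + D))" .
qed

lemma mesh_error_LIMSEQ: "mesh_error ---> 0"
proof -
 have "(%m. T * (1 / 4) ^ m) ---> T * 0" by (intro tendsto_intros LIMSEQ_power_zero) auto
 then have 1: "(%m. T / 4 ^ m) ---> 0" by (simp add: power_divide)
 have "(%m. L^2 * (T * ((T / 4 ^ m)^2 + hi / lo * (T / 4 ^ m)))) ---> L^2 * (T * (0^2 + hi / lo * 0))"
  by (intro tendsto_intros 1)
 then show ?thesis by (simp add: mesh_error_def[abs_def])
qed

end

lemma ennreal_bound_tail:
 assumes M: "prob_space M" and Q[measurable]: "Q : bmeas M" and b: "(\<integral>\<^sup>+om. Q om \<partial>M) <= ennreal c"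
  and c: "0 <= c" and eps: "0 < eps"
 shows "measure M {om : space M. ennreal eps < Q om} <= c / eps"
proof -
 interpret prob_space M by (rule M)
 have "emeasure M {om : space M. ennreal eps < Q om} <= emeasure M {om : space M. 1 <= ennreal (1 / eps) * Q om}"
 proof (rule emeasure_mono)
  show "{om : space M. ennreal eps < Q om} <= {om : space M. 1 <= ennreal (1 / eps) * Q om}"
  proof safe
  fix om assume "ennreal eps < Q om"
  then have "ennreal (1 / eps) * ennreal eps <= ennreal (1 / eps) * Q om" by (intro mult_left_mono) auto
  moreover have "ennreal (1 / eps) * ennreal eps = 1" using eps by (simp flip: ennreal_mult)
  ultimately show "1 <= ennreal (1 / eps) * Q om" by simp
  qed
 qed measurable
 also have "... <= ennreal (1 / eps) * (\<integral>\<^sup>+ om. Q om * indicator (space M) om \<partial>M)"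
  by (rule nn_integral_Markov_inequality) auto
 also have "(\<integral>\<^sup>+ om. Q om * indicator (space M) om \<partial>M) = (\<integral>\<^sup>+om. Q om \<partial>M)"
  by (intro nn_integral_cong) simp
 also have "ennreal (1 / eps) * (\<integral>\<^sup>+om. Q om \<partial>M) <= ennreal (1 / eps) * ennreal c" using b by (intro mult_left_mono) auto
 also have "... = ennreal (c / eps)" using eps c by (simp flip: ennreal_mult)
 finally show ?thesis using c eps by (simp add: emeasure_eq_measure)
qed

context scaling
begin

text \<open>One and the same elementary process approximates the integrand while its integral
  approximates the increment of \<open>X\<close>, and this identifies the stochastic integral. First
  \<open>w\<close> is chosen to make \<open>D\<close> small, then the mesh.\<close>

lemma elementary_approximation:
 assumes eps: "0 < eps"
 shows "EX S. elementary_process M Fc T S &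
  (%om. \<integral>\<^sup>+t\<in>{0..T}. ennreal ((elementary_value S t om - Hc t om)^2) \<partial>lborel) : bmeas M &
  (\<integral>\<^sup>+om. (\<integral>\<^sup>+t\<in>{0..T}. ennreal ((elementary_value S t om - Hc t om)^2) \<partial>lborel) \<partial>M) <= ennreal eps &
  (ALL t:{0..T}. (%om. elementary_integral Wc S t om - (Xc t om - Xc 0 om)) : bmeas M &
  integrable M (%om. (elementary_integral Wc S t om - (Xc t om - Xc 0 om))^2) &
  EE (%om. (elementary_integral Wc S t om - (Xc t om - Xc 0 om))^2) <= eps)"
proof -
 define dl where "dl = eps / (2 * ka^2) / 3"
 have dl: "0 < dl" "2 * ka^2 * (3 * dl) = eps" using eps ka_pos by (simp_all add: dl_def)
 obtain w L where sv: "smooth_volatility l lo hi al \<mu> T r C0 M s Om w L"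
  and D: "(LINT t|lborel. indicator {0..<T} t * verr w t) <= dl"
  using smooth_volatility_exists[OF dl(1)] by blast
 interpret smooth_volatility l lo hi al \<mu> T r C0 M s Om w L by (rule sv)
 have "eventually (%m. mesh_error m < dl) sequentially" using mesh_error_LIMSEQ dl(1) by (rule order_tendstoD)
 then obtain m where m: "mesh_error m < dl" by (auto simp: eventually_sequentially)
 have D: "D <= dl" using D unfolding D_def .
 have b: "2 * ka^2 * (mesh_error m + (D + dl)) <= eps" unfolding dl(2)[symmetric] using m D by (intro mult_left_mono) auto
 have b': "2 * ka^2 * (mesh_error m + D) <= eps" unfolding dl(2)[symmetric] using m D dl(1) by (intro mult_left_mono) auto
 show ?thesis
 proof (intro exI[of _ "grid_process m w"] conjI ballI)
  show "elementary_process M Fc T (grid_process m w)" by (rule elementary_grid)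
  show "(%om. \<integral>\<^sup>+t\<in>{0..T}. ennreal ((elementary_value (grid_process m w) t om - Hc t om)^2) \<partial>lborel) : bmeas M"
  by (rule process_error(1))
  show "(\<integral>\<^sup>+om. (\<integral>\<^sup>+t\<in>{0..T}. ennreal ((elementary_value (grid_process m w) t om - Hc t om)^2) \<partial>lborel) \<partial>M) <= ennreal eps"
  using process_error(2) ennreal_leI[OF b'] by (rule order_trans)
  fix t assume t: "t : {0..T}"
  show "(%om. elementary_integral Wc (grid_process m w) t om - (Xc t om - Xc 0 om)) : bmeas M"
  unfolding Iw_def[symmetric] by measurable
  show "integrable M (%om. (elementary_integral Wc (grid_process m w) t om - (Xc t om - Xc 0 om))^2)"
  unfolding Iw_def[symmetric] by (rule ito_bound(1)[OF t dl(1)])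
  show "EE (%om. (elementary_integral Wc (grid_process m w) t om - (Xc t om - Xc 0 om))^2) <= eps"
  unfolding Iw_def[symmetric] by (rule order_trans[OF ito_bound(2)[OF t dl(1)] b])
 qed
qed

text \<open>With errors \<open>1 / (n + 1)\<close> in mean, the inequalities of Markov and Chebyshev
  give both convergences in probability. Boundedness of \<open>Hc\<close> settles
  integrability.\<close>

lemma ito_integral: "has_ito_integral M Fc T Wc Hc (%t om. Xc t om - Xc 0 om)"
proof -
 define e where "e n = 1 / real (Suc n)" for n
 have e: "0 < e n" for n by (simp add: e_def)
 have e0: "(%n. c * e n) ---> 0" for c
  using tendsto_mult_left[OF LIMSEQ_inverse_real_of_nat, of c] by (simp add: e_def inverse_eq_divide)
 define Q where "Q S om = (\<integral>\<^sup>+t\<in>{0..T}. ennreal ((elementary_value S t om - Hc t om)^2) \<partial>lborel)" for S om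
 define R where "R S t om = elementary_integral Wc S t om - (Xc t om - Xc 0 om)" for S t om
 have "EX S. elementary_process M Fc T S & Q S : bmeas M & (\<integral>\<^sup>+om. Q S om \<partial>M) <= ennreal (e n) &
  (ALL t:{0..T}. R S t : bmeas M & integrable M (%om. (R S t om)^2) & EE (%om. (R S t om)^2) <= e n)" for n
  using elementary_approximation[OF e[of n]] unfolding Q_def[abs_def] R_def[abs_def] .
 then obtain S where S: "!!n. elementary_process M Fc T (S n)"
  and Qm: "!!n. Q (S n) : bmeas M" and Qe: "!!n. (\<integral>\<^sup>+om. Q (S n) om \<partial>M) <= ennreal (e n)"
  and R: "!!n t. t : {0..T} ==> R (S n) t : bmeas M & integrable M (%om. (R (S n) t om)^2) & EE (%om. (R (S n) t om)^2) <= e n"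
  by metis
 have lim1: "(%n. prob {om : space M. ennreal eps < Q (S n) om}) ---> 0" if "0 < eps" for eps
 proof (rule Lim_null_comparison[OF always_eventually e0[of "1 / eps"]])
  show "ALL n. norm (prob {om : space M. ennreal eps < Q (S n) om}) <= 1 / eps * e n"
  using ennreal_bound_tail[OF prob_space_axioms Qm Qe less_imp_le[OF e] that] by simp
 qed
 have lim2: "(%n. prob {om : space M. eps < abs (R (S n) t om)}) ---> 0" if t: "t : {0..T}" and eps: "0 < eps" for t eps
 proof (rule Lim_null_comparison[OF always_eventually e0[of "1 / eps^2"]])
  show "ALL n. norm (prob {om : space M. eps < abs (R (S n) t om)}) <= 1 / eps^2 * e n"
  proof
  fix n
  have [measurable]: "R (S n) t : bmeas M" using R[OF t] by blast
  have "prob {om : space M. eps < abs (R (S n) t om)} <= prob {om : space M. abs (R (S n) t om) >= eps}"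
  by (rule finite_measure_mono) auto
  also have "... <= EE (%om. (R (S n) t om)^2) / eps^2"
  using R[OF t, of n] eps by (intro second_moment_method) auto
  also have "... <= e n / eps^2" using R[OF t, of n] by (intro divide_right_mono) auto
  finally show "norm (prob {om : space M. eps < abs (R (S n) t om)}) <= 1 / eps^2 * e n" by simp
  qed
 qed
 have fin: "(\<integral>\<^sup>+t\<in>{0..T}. ennreal ((Hc t om)^2) \<partial>lborel) < \<infinity>" for om
 proof -
  have "(\<integral>\<^sup>+t\<in>{0..T}. ennreal ((Hc t om)^2) \<partial>lborel) <= (\<integral>\<^sup>+t\<in>{0..T}. ennreal (hi / lo) \<partial>lborel)"
  using Hc_bounds(2) by (intro nn_integral_mono mult_right_mono ennreal_leI) auto
  also have "... = ennreal (hi / lo) * emeasure lborel {0..T}" by (simp add: nn_integral_cmult_indicator)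
  also have "... < \<infinity>" using T_pos by (simp add: ennreal_mult_less_top)
  finally show ?thesis .
 qed
 have ca: "continuous_adapted M Fc T (%t om. Xc t om - Xc 0 om)"
  unfolding continuous_adapted_def
 proof (intro conjI ballI)
  show "(%om. Xc t om - Xc 0 om) : bmeas (Fc t)" if "t : {0..T}" for t
  using that T_pos by (intro borel_measurable_diff measurable_Fc) auto
  show "continuous_on {0..T} (%t. Xc t om - Xc 0 om)" if "om : space M" for om
  by (intro continuous_on_diff continuous_on_const continuous_c that)
 qed
 show ?thesis
  unfolding has_ito_integral_def
  using progressive_Hc fin ca S lim1 lim2 unfolding Q_def R_def by blast
qed

lemma weak_solution_limit:
 assumes f: "!!i. 0 < f i" "!!i. l i = (f i)^2"
 shows "weak_solution f al \<mu> T M Fc Wc Yl Xc"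
 unfolding weak_solution_def
proof (intro conjI allI exI[of _ vr])
 have l: "l = (%i. (f i)^2)" using f by (simp add: fun_eq_iff)
 show "regression_function f T M Yl Xc vr"
  unfolding regression_function_def using measurable_vr regression_vr by (simp add: l)
 have "Hc = (%t om. f (Yl om) / sqrt (vr t (Xc t om)))"
 proof (intro ext)
  fix t om
  show "Hc t om = f (Yl om) / sqrt (vr t (Xc t om))"
  unfolding Hc_def f(2)[of "Yl om"] using f(1)[of "Yl om"] by (simp add: real_sqrt_divide)
 qed
 then show "has_ito_integral M Fc T Wc (%t om. f (Yl om) / sqrt (vr t (Xc t om))) (%t om. Xc t om - Xc 0 om)"
  using ito_integral by simp
qed (rule filtered_Fc brownian_Wc measurable_Y continuous_adapted_Xc distr_X0 initial_Y independence)+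

text \<open>Both laws have the characteristic function
  \<open>char \<mu> th * exp (- (th^2 / 2 * t))\<close>: one from the limit of the lazy walks, the
  other from independence of \<open>Z\<close> and the Brownian path.\<close>

lemma distr_Xc:
 assumes N: "independent_start_and_bm \<mu> T N Z B" and t: "t : {0..T}"
 shows "distr M borel (Xc t) = distr N borel (%om. Z om + B t om)"
proof -
 obtain G where G: "filtered_prob_space N G" and bm: "brownian_motion N G T B"
  and Z[measurable]: "Z : bmeas N" and dZ: "distr N borel Z = \<mu>"
  and ind: "prob_space.indep_set N (sets (vimage_algebra (space N) Z borel)) (sets (path_algebra N T B))"
  using N unfolding independent_start_and_bm_def by blast
 interpret N: prob_space N using G unfolding filtered_prob_space_def by blast
 have Bm[measurable]: "B u : bmeas N" if "u : {0..T}" for u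
 proof -
  have "subalgebra N (G u)" using G unfolding filtered_prob_space_def by blast
  moreover have "B u : bmeas (G u)" using bm that unfolding brownian_motion_def continuous_adapted_def by blast
  ultimately show ?thesis by (rule measurable_from_subalg)
 qed
 have BP: "B t : bmeas (path_algebra N T B)"
 proof -
  have "(%om. \<lambda>t\<in>{0..T}. B t om) : path_algebra N T B \<rightarrow>\<^sub>M PiM {0..T} (%_. borel)"
  unfolding path_algebra_def by (rule measurable_vimage_algebra1) (auto simp: space_PiM)
  from measurable_compose[OF this measurable_component_singleton[OF t]] show ?thesis using t by simp
 qed
 have B0: "AE om in N. B 0 om = 0" using bm unfolding brownian_motion_def by blast
 have charB: "char (distr N borel (B t)) th = exp (- (th^2 / 2 * t))" for th
 \<comment> \<open>At time \<open>0\<close> there is no Gaussian density to use, only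
   \<open>B 0 = 0\<close> almost surely.\<close>
 proof (cases "t = 0")
  case True
  have "char (distr N borel (B t)) th = (CLINT om|N. iexp (th * B t om))"
  unfolding char_def by (rule integral_distr) (use t in auto)
  also have "... = (CLINT om|N. 1)"
  by (rule integral_cong_AE) (use B0 True t in \<open>auto elim!: eventually_mono\<close>)
  finally show ?thesis using True by (simp add: N.prob_space)
 next
  case False
  then have t0: "0 < t" using t by auto
  have "distributed N lborel (%om. B t om - B 0 om) (normal_density 0 (sqrt (t - 0)))"
  using bm t0 t unfolding brownian_motion_def by (metis atLeastAtMost_iff order_refl)
  then have d: "distr N lborel (%om. B t om - B 0 om) = density lborel (normal_density 0 (sqrt t))"
  by (simp add: distributed_def)
  have "distr N borel (B t) = distr N lborel (%om. B t om - B 0 om)"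
  proof -
  have "distr N borel (B t) = distr N borel (%om. B t om - B 0 om)"
  by (rule distr_cong_AE) (use B0 t T_pos in \<open>auto elim!: eventually_mono\<close>)
  also have "... = distr N lborel (%om. B t om - B 0 om)" by (rule distr_cong) auto
  finally show ?thesis .
  qed
  then have "char (distr N borel (B t)) th = exp (- (th^2 * (sqrt t)^2 / 2))"
  unfolding d using char_normal[of "sqrt t" th] t0 by simp
  then show ?thesis using t0 by simp
 qed
 have "N.indep_var borel Z borel (B t)"
  unfolding N.indep_var_eq
 proof (intro conjI)
  show "N.indep_set (sigma_sets (space N) {Z -` A Int space N |A. A : sets borel})
  (sigma_sets (space N) {B t -` A Int space N |A. A : sets borel})"
  proof (rule N.indep_setI)
  have 1: "sigma_sets (space N) {Z -` A Int space N |A. A : sets borel} = sets (vimage_algebra (space N) Z borel)"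
  by (simp add: sets_vimage_algebra)
  have 2: "sigma_sets (space N) {B t -` A Int space N |A. A : sets borel} <= sets (path_algebra N T B)"
  proof -
  have sp: "space (path_algebra N T B) = space N" by (simp add: path_algebra_def)
  have "{B t -` A Int space N |A. A : sets borel} <= sets (path_algebra N T B)"
  using measurable_sets[OF BP] sp by auto
  then show ?thesis using sets.sigma_sets_subset[of _ "path_algebra N T B"] sp by simp
  qed
  have ev: "sets (vimage_algebra (space N) Z borel) <= N.events" "sets (path_algebra N T B) <= N.events"
  using ind unfolding N.indep_set_def N.indep_sets_def by (auto split: bool.splits)
  show "sigma_sets (space N) {Z -` A Int space N |A. A : sets borel} <= N.events" unfolding 1 by (rule ev(1))
  show "sigma_sets (space N) {B t -` A Int space N |A. A : sets borel} <= N.events" using 2 ev(2) by blast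
  show "N.prob (a Int b) = N.prob a * N.prob b"
  if "a : sigma_sets (space N) {Z -` A Int space N |A. A : sets borel}"
  "b : sigma_sets (space N) {B t -` A Int space N |A. A : sets borel}" for a b
  using N.indep_setD[OF ind] that 2 unfolding 1 by blast
  qed
 qed (use t in auto)
 from N.char_distr_add[OF this]
 have charZ: "char (distr N borel (%om. Z om + B t om)) th = char \<mu> th * exp (- (th^2 / 2 * t))" for th
  by (simp add: dZ charB)
 have charX: "char (distr M borel (Xc t)) th = char \<mu> th * exp (- (th^2 / 2 * t))" for th
 proof -
  have "char (distr M borel (Xc t)) th = (CLINT om|M. iexp (th * Xc t om))"
  unfolding char_def by (rule integral_distr) auto
  also have "... = char \<mu> th * exp (- (th^2 / 2 * t))" by (rule char_Xc[OF t])
  finally show ?thesis .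
 qed
 have "(%om. Z om + B t om) : bmeas N" using t by measurable
 then have "prob_space (distr N borel (%om. Z om + B t om))" by (rule N.prob_space_distr)
 moreover have "prob_space (distr M borel (Xc t))" by (rule prob_space_distr) simp
 ultimately show ?thesis
  using charX charZ by (intro char_eq_imp_distr_eq) (auto simp: fun_eq_iff)
qed

end

theorem theorem2p2:
  fixes f \<alpha> :: "'d::finite \<Rightarrow> real" and T :: real and \<mu> :: "real measure"
  assumes "CARD('d) \<ge> 2"
    and "\<And>i. f i > 0"
    and "\<And>i. \<alpha> i > 0"
    and "(\<Sum>i\<in>UNIV. \<alpha> i) = 1"
    and "T > 0"
    and "prob_space \<mu>" and "sets \<mu> = sets borel"
    and "condition_C (\<lambda>i. (f i)\<^sup>2)"
  shows "\<exists>(M :: ((real \<Rightarrow> real) \<times> (real \<Rightarrow> real) \<times> 'd) measure) F W Y X.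
           weak_solution f \<alpha> \<mu> T M F W Y X \<and>
           (\<forall>(N :: ((real \<Rightarrow> real) \<times> (real \<Rightarrow> real) \<times> 'd) measure) Z B.
              independent_start_and_bm \<mu> T N Z B \<longrightarrow>
              (\<forall>t\<in>{0..T}. distr M borel (X t) = distr N borel (\<lambda>\<omega>. Z \<omega> + B t \<omega>)))"
proof -
 define l where "l i = (f i)^2" for i
 define lo where "lo = Min (range l)"
 define hi where "hi = Max (range l)"
 have "0 < lo" unfolding lo_def by (subst Min_gr_iff) (auto simp: l_def zero_less_power[OF assms(2)] less_imp_neq[OF assms(2), symmetric])
 moreover have "lo <= l i" "l i <= hi" for i unfolding lo_def hi_def by auto
 ultimately interpret volatilities l lo hi by unfold_locales
 have "condition_C l" using assms(8) by (simp add: l_def[abs_def])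
 from scheme_dissipation[OF this] obtain r C0 where r: "0 < r" "r * (hi / lo) <= 1 / 2" "0 < C0"
  and dis: "ALL p M N K L. supp_in M p --> (ALL x. nonneg_vec (p x)) --> (SUM x=-M..M. tot (p x)) = 1 --> 1 <= K -->
  (SUM k=K..<N. SUM x=-L..L. (norm (scheme r p k (x + 1) - scheme r p k x))^2) <= C0 / sqrt (real K)"
  by blast
 interpret approx l lo hi \<alpha> \<mu> T r C0
 proof (intro approx.intro approx_axioms.intro)
  show "(SUM k=K..<N. SUM x=-L..L. (norm (scheme r p k (x + 1) - scheme r p k x))^2) <= C0 / sqrt (real K)"
  if "supp_in M p" "!!x. nonneg_vec (p x)" "(SUM x=-M..M. tot (p x)) = 1" "1 <= K" for p M N K L
  by (rule dis[rule_format, OF that])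
 qed (rule volatilities_axioms assms r)+
 \<comment> \<open>The reals are embedded through constant functions in the first component and
   recovered by evaluation at \<open>0\<close>.\<close>
 define \<iota> :: "real => (real => real) \<times> (real => real) \<times> 'd" where "\<iota> y = (%_. y, %_. 0, undefined)" for y
 have "fst (\<iota> y) 0 = y" for y by (simp add: \<iota>_def)
 from limit_space_exists[of "%p. fst p 0" \<iota>, OF this]
 obtain M :: "((real => real) \<times> (real => real) \<times> 'd) measure" and s Om where M: "prob_space M" and s: "strict_mono s"
  and Om: "!!n. Om n : M \<rightarrow>\<^sub>M UC" "!!n. distr M (count_space UNIV) (Om n) = measure_pmf (plaw (s n))"
  "AE om in M. ALL j. convergent (%n. coord (s n) j (Om n om))"
  by blast
 interpret M: prob_space M by (rule M)
 interpret scaling l lo hi \<alpha> \<mu> T r C0 M s Om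
  by unfold_locales (rule s Om)+
 have "weak_solution f \<alpha> \<mu> T M Fc Wc Yl Xc"
  by (rule weak_solution_limit) (simp_all add: assms l_def)
 then show ?thesis using distr_Xc by blast
qed

end
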